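(* Let $d\in\{2,3\}$, let $\Omega\subseteq\mathbb{R}^d$ be a bounded polygonal/polyhedral Lipschitz domain, $s\in(0,1)$ and $f\in L^2(\Omega)$. There exist constants $C_{\mathrm{eff}},C_{\mathrm{rel}}>0$ and, if $d=2$, a constant $C_{\mathrm{stab}}>0$, depending only on $\Omega$, $s$, $d$ and the $\gamma$-shape regularity of $\mathcal{T}_\ell$, such that the following holds. Let $\mathcal{T}_\ell\in\mathbb{T}$, $\mathcal{M}_\ell\subseteq\mathcal{T}_\ell$, $\mathcal{T}_{\ell+1}:=\operatorname{refine}(\mathcal{T}_\ell,\mathcal{M}_\ell)$ and $\mathcal{T}_m\in\operatorname{refine}(\mathcal{T}_\ell)$, and let $u_\ell,u_{\ell+1},u_m$ be the Galerkin solutions corresponding to $\mathcal{T}_\ell,\mathcal{T}_{\ell+1},\mathcal{T}_m$, respectively. Then: (a) $\tau_\ell(\mathcal{M}_\ell)\le C_{\mathrm{eff}}\,\|u_{\ell+1}-u_\ell\|_a$; (b) $\|u_{\ell+1}-u_\ell\|_a\le C_{\mathrm{rel}}\,\tau_\ell(\mathcal{T}_\ell\setminus\mathcal{T}_{\ell+1})$; (c) if $d=2$, then $\left|\tau_\ell(\mathcal{T}_m\cap\mathcal{T}_\ell)-\tau_m(\mathcal{T}_m\cap\mathcal{T}_\ell)\right|\le C_{\mathrm{stab}}\,\|u_m-u_\ell\|_a$.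
   Context: Weak form. $\widetilde H^s(\Omega):=\{v\in H^s(\mathbb{R}^d): v\equiv 0 \text{ on }\mathbb{R}^d\setminus\overline\Omega\}$. For $v,w\in\widetilde H^s(\Omega)$, $$a(v,w):=\frac{C(d,s)}{2}\int_{\mathbb{R}^d}\int_{\mathbb{R}^d}\frac{(v(x)-v(y))(w(x)-w(y))}{|x-y|^{d+2s}}\,dy\,dx,\qquad C(d,s):=\frac{2^{2s}s\,\Gamma(d/2+s)}{\pi^{d/2}\Gamma(1-s)},$$ and $\|v\|_a:=a(v,v)^{1/2}$ is the energy norm. Meshes. Triangulations $\mathcal{T}$ of $\Omega$ are regular (conforming, no hanging nodes) decompositions of $\Omega$ into open triangles ($d=2$) or tetrahedra ($d=3$); all are assumed $\gamma$-shape regular, i.e. $\max_{T\in\mathcal{T}}\operatorname{diam}(T)/|T|^{1/d}\le\gamma$ with $\gamma>0$ fixed. $\mathcal{N}_{\mathcal{T}}$ is the set of all vertices of elements of $\mathcal{T}$, $\mathcal{N}^*_{\mathcal{T}}$ the subset of those inside $\Omega$ (not on $\partial\Omega$). $\mathcal{S}^1_0(\mathcal{T})$ is the space of continuous functions on $\overline\Omega$, affine on each $T\in\mathcal{T}$, vanishing on $\partial\Omega$ (extended by zero to $\mathbb{R}^d$). The Galerkin solution $u_\ell\in\mathcal{S}^1_0(\mathcal{T}_\ell)$ corresponding to $\mathcal{T}_\ell$ is the unique solution of $a(u_\ell,w)=\int_\Omega fw\,dx$ for all $w\in\mathcal{S}^1_0(\mathcal{T}_\ell)$. Refinement. Meshes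 are refined by newest vertex bisection (NVB). Elements are tagged simplices $(z_0,\dots,z_d)_\beta$, $\beta\in\{0,\dots,d-1\}$ (the refinement type), with refinement edge $\overline{z_0z_d}$; bisection with midpoint $z'=(z_0+z_d)/2$ yields the sons $(z_0,z',z_1,\dots,z_\beta,z_{\beta+1},\dots,z_{d-1})_{(\beta+1)\bmod d}$ and $(z_d,z',z_1,\dots,z_\beta,z_{d-1},\dots,z_{\beta+1})_{(\beta+1)\bmod d}$; for $d=2$ this means that the edge opposite to the newest vertex is halved. For $\mathcal{M}\subseteq\mathcal{T}$ (marked elements): if $d=2$, $\operatorname{refine}(\mathcal{T},\mathcal{M})$ is the coarsest conforming NVB refinement of $\mathcal{T}$ in which all edges of marked elements are bisected (each marked element is bisected three times into four sons). If $d=3$, let $\Lambda(\mathcal{M})$ be the set of all $T'\in\mathcal{T}$ that are in $\mathcal{M}$ or share at least one edge with an element of $\mathcal{M}$; $\operatorname{refine}(\mathcal{T},\mathcal{M})$ is the coarsest conforming NVB refinement of $\mathcal{T}$ in which all faces of elements of $\Lambda(\mathcal{M})$ contain an interior node (each such element is split into 18 sons if $\beta\in\{0,1\}$, 20 sons if $\beta=2$; the 14 nodes of the sons are its 4 vertices, the midpoints of its 6 edges and one interior node on each of its 4 faces). $\operatorname{refine}(\mathcal{T})$ is the set of all triangulations obtained by refining $\mathcal{T}$ finitely many times. $\mathcal{T}_0$ is a fixed initial conforming triangulation, tagged such that these coarsest refinements exist, and $\mathbb{T}:=\operatorname{refine}(\mathcal{T}_0)$. Two-level estimator. Let $\mathcal{T}_{\ell,u}:=\operatorname{refine}(\mathcal{T}_\ell,\mathcal{T}_\ell)$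 be the uniform refinement, and $\{\varphi^{\ell,u}_z: z\in\mathcal{N}^*_{\mathcal{T}_{\ell,u}}\}$ the nodal basis of $\mathcal{S}^1_0(\mathcal{T}_{\ell,u})$ ($\varphi^{\ell,u}_z(z')=\delta_{zz'}$ for all $z'\in\mathcal{N}^*_{\mathcal{T}_{\ell,u}}$). For $T\in\mathcal{T}_\ell$ let $\mathcal{N}^*_{\mathcal{T}_{\ell,u}}(T)$ be the set of all vertices of sons of $T$ in $\mathcal{T}_{\ell,u}$ not lying on $\partial\Omega$, and $$\tau_\ell(T)^2:=\sum_{z\in\mathcal{N}^*_{\mathcal{T}_{\ell,u}}(T)\setminus\mathcal{N}_{\mathcal{T}_\ell}}\tau_\ell(\varphi^{\ell,u}_z)^2,\qquad \tau_\ell(\varphi^{\ell,u}_z):=\frac{\left|\langle f,\varphi^{\ell,u}_z\rangle_{L^2(\Omega)}-a(u_\ell,\varphi^{\ell,u}_z)\right|}{\|\varphi^{\ell,u}_z\|_a}.$$ For $\mathcal{U}\subseteq\mathcal{T}_\ell$ set $\tau_\ell(\mathcal{U}):=\big(\sum_{T\in\mathcal{U}}\tau_\ell(T)^2\big)^{1/2}$. The estimator $\tau_m$ is defined in the same way from $\mathcal{T}_m$ and $u_m$. *)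

theory Defs
  imports "HOL-Analysis.Analysis"
begin

text \<open>Near every boundary point the domain is the strict epigraph, in direction \<open>e\<close>, of a
  Lipschitz function \<open>g\<close> on the hyperplane orthogonal to \<open>e\<close>.\<close>

definition lipschitz_boundary :: "'a::euclidean_space set \<Rightarrow> bool" where
  "lipschitz_boundary \<Omega> \<longleftrightarrow>
     (\<forall>x\<in>frontier \<Omega>. \<exists>e r L g. norm e = 1 \<and> 0 < r \<and> L-lipschitz_on {y. y \<bullet> e = 0} g \<and>
        \<Omega> \<inter> ball x r = {y \<in> ball x r. (g (y - (y \<bullet> e) *\<^sub>R e) :: real) < y \<bullet> e})"

definition polyhedral_lipschitz_domain :: "'a::euclidean_space set \<Rightarrow> bool" where
  "polyhedral_lipschitz_domain \<Omega> \<longleftrightarrow>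
     \<Omega> \<noteq> {} \<and> open \<Omega> \<and> connected \<Omega> \<and> bounded \<Omega> \<and> lipschitz_boundary \<Omega> \<and>
     (\<exists>P. finite P \<and> (\<forall>p\<in>P. polytope p) \<and> closure \<Omega> = \<Union>P)"

definition L2_on :: "'a::euclidean_space set \<Rightarrow> ('a \<Rightarrow> real) \<Rightarrow> bool" where
  "L2_on \<Omega> f \<longleftrightarrow>
     f \<in> borel_measurable (lebesgue_on \<Omega>) \<and> integrable (lebesgue_on \<Omega>) (\<lambda>x. (f x)\<^sup>2)"

definition L2_inner :: "'a::euclidean_space set \<Rightarrow> ('a \<Rightarrow> real) \<Rightarrow> ('a \<Rightarrow> real) \<Rightarrow> real" where
  "L2_inner \<Omega> f g = (\<integral>x. f x * g x \<partial>lebesgue_on \<Omega>)"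

definition frac_const :: "nat \<Rightarrow> real \<Rightarrow> real" where
  "frac_const d s =
     2 powr (2 * s) * s * Gamma (real d / 2 + s) / (pi powr (real d / 2) * Gamma (1 - s))"

text \<open>The integrand is absolutely integrable for \<open>v, w\<close> in the fractional Sobolev space on which
  the form lives; below it is only applied to compactly supported piecewise affine functions.\<close>

definition frac_form ::
    "real \<Rightarrow> ('a::euclidean_space \<Rightarrow> real) \<Rightarrow> ('a \<Rightarrow> real) \<Rightarrow> real" where
  "frac_form s v w = frac_const DIM('a) s / 2 *
     (\<integral>x. (\<integral>y. (v x - v y) * (w x - w y) / norm (x - y) powr (real DIM('a) + 2 * s)
        \<partial>lborel) \<partial>lborel)"

definition energy_norm :: "real \<Rightarrow> ('a::euclidean_space \<Rightarrow> real) \<Rightarrow> real" where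
  "energy_norm s v = sqrt (frac_form s v v)"

text \<open>\<open>([z\<^sub>0, \<dots>, z\<^sub>d], \<beta>)\<close> stands for the simplex with these ordered vertices and refinement
  type \<open>\<beta>\<close>. A mesh is a set of tagged simplices; on meshes with a common NVB ancestor, equal
  elements carry equal tags, because bisection strictly shrinks an element.\<close>

type_synonym 'a tagged = "'a list \<times> nat"

definition vertices :: "'a tagged \<Rightarrow> 'a set" where
  "vertices K = set (fst K)"

definition closed_elem :: "'a::euclidean_space tagged \<Rightarrow> 'a set" where
  "closed_elem K = convex hull (vertices K)"

definition open_elem :: "'a::euclidean_space tagged \<Rightarrow> 'a set" where
  "open_elem K = interior (closed_elem K)"

definition tagged_simplex :: "'a::euclidean_space tagged \<Rightarrow> bool" where
  "tagged_simplex K \<longleftrightarrow>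
     length (fst K) = DIM('a) + 1 \<and> distinct (fst K) \<and> \<not> affine_dependent (vertices K) \<and>
     snd K < DIM('a)"

text \<open>The library predicate \<^const>\<open>triangulation\<close> on the closed elements rules out hanging
  nodes; injectivity makes each element occur with one tag only.\<close>

definition conforming :: "'a::euclidean_space tagged set \<Rightarrow> bool" where
  "conforming \<T> \<longleftrightarrow>
     finite \<T> \<and> (\<forall>K\<in>\<T>. tagged_simplex K) \<and> inj_on closed_elem \<T> \<and>
     triangulation (closed_elem ` \<T>)"

definition tagged_triangulation ::
    "'a::euclidean_space set \<Rightarrow> 'a tagged set \<Rightarrow> bool" where
  "tagged_triangulation \<Omega> \<T> \<longleftrightarrow>
     conforming \<T> \<and> (\<forall>K\<in>\<T>. open_elem K \<subseteq> \<Omega>) \<and> (\<Union>K\<in>\<T>. closed_elem K) = closure \<Omega>"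

definition shape_regular :: "real \<Rightarrow> 'a::euclidean_space tagged set \<Rightarrow> bool" where
  "shape_regular \<gamma> \<T> \<longleftrightarrow>
     (\<forall>K\<in>\<T>. diameter (open_elem K) / measure lebesgue (open_elem K) powr (1 / real DIM('a)) \<le> \<gamma>)"

definition nodes :: "'a tagged set \<Rightarrow> 'a set" where
  "nodes \<T> = (\<Union>K\<in>\<T>. vertices K)"

definition interior_nodes ::
    "'a::euclidean_space set \<Rightarrow> 'a tagged set \<Rightarrow> 'a set" where
  "interior_nodes \<Omega> \<T> = nodes \<T> - frontier \<Omega>"

text \<open>\<open>take \<beta> m\<close> is \<open>z\<^sub>1, \<dots>, z\<^sub>\<beta>\<close> and \<open>drop \<beta> m\<close> is \<open>z\<^sub>\<beta>\<^sub>+\<^sub>1, \<dots>, z\<^sub>d\<^sub>-\<^sub>1\<close>.\<close>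

definition bisection_sons :: "'a::euclidean_space tagged \<Rightarrow> 'a tagged set" where
  "bisection_sons K =
     (let zs = fst K; \<beta> = snd K; z0 = hd zs; zd = last zs; z' = midpoint z0 zd;
          m = butlast (tl zs); \<beta>' = (\<beta> + 1) mod DIM('a)
      in {([z0, z'] @ take \<beta> m @ drop \<beta> m, \<beta>'),
          ([zd, z'] @ take \<beta> m @ rev (drop \<beta> m), \<beta>')})"

definition bisects_to ::
    "'a::euclidean_space tagged set \<Rightarrow> 'a tagged set \<Rightarrow> bool" where
  "bisects_to \<T> \<T>' \<longleftrightarrow> (\<exists>K\<in>\<T>. \<T>' = (\<T> - {K}) \<union> bisection_sons K)"

text \<open>Intermediate meshes need not be conforming.\<close>

definition nvb_refinement ::
    "'a::euclidean_space tagged set \<Rightarrow> 'a tagged set \<Rightarrow> bool" where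
  "nvb_refinement = rtranclp bisects_to"

definition edge_neighbourhood ::
    "'a::euclidean_space tagged set \<Rightarrow> 'a tagged set \<Rightarrow> 'a tagged set" where
  "edge_neighbourhood \<T> \<M> =
     {K\<in>\<T>. K \<in> \<M> \<or>
        (\<exists>K'\<in>\<M>. \<exists>E. E edge_of closed_elem K \<and> E edge_of closed_elem K')}"

definition marking_resolved ::
    "'a::euclidean_space tagged set \<Rightarrow> 'a tagged set \<Rightarrow> 'a tagged set \<Rightarrow> bool" where
  "marking_resolved \<T> \<M> \<T>' \<longleftrightarrow>
     (DIM('a) = 2 \<longrightarrow>
        (\<forall>K\<in>\<M>. \<forall>x\<in>vertices K. \<forall>y\<in>vertices K. x \<noteq> y \<longrightarrow> midpoint x y \<in> nodes \<T>')) \<and>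
     (DIM('a) = 3 \<longrightarrow>
        (\<forall>K\<in>edge_neighbourhood \<T> \<M>. \<forall>F. F facet_of closed_elem K \<longrightarrow>
           (\<exists>z\<in>nodes \<T>'. z \<in> rel_interior F)))"

definition coarsest_refinement ::
    "'a::euclidean_space tagged set \<Rightarrow> 'a tagged set \<Rightarrow> 'a tagged set \<Rightarrow> bool" where
  "coarsest_refinement \<T> \<M> \<T>' \<longleftrightarrow>
     nvb_refinement \<T> \<T>' \<and> conforming \<T>' \<and> marking_resolved \<T> \<M> \<T>' \<and>
     (\<forall>\<T>''. nvb_refinement \<T> \<T>'' \<and> conforming \<T>'' \<and> marking_resolved \<T> \<M> \<T>'' \<longrightarrow>
        nvb_refinement \<T>' \<T>'')"

definition refine ::
    "'a::euclidean_space tagged set \<Rightarrow> 'a tagged set \<Rightarrow> 'a tagged set" where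
  "refine \<T> \<M> = (THE \<T>'. coarsest_refinement \<T> \<M> \<T>')"

abbreviation uniform_refinement :: "'a::euclidean_space tagged set \<Rightarrow> 'a tagged set" where
  "uniform_refinement \<T> \<equiv> refine \<T> \<T>"

definition refinements :: "'a::euclidean_space tagged set \<Rightarrow> 'a tagged set set" where
  "refinements \<T> = {\<T>'. rtranclp (\<lambda>\<A> \<B>. \<exists>\<M>\<subseteq>\<A>. \<B> = refine \<A> \<M>) \<T> \<T>'}"

text \<open>Requirement on the tags of the initial mesh, needed for \<^const>\<open>refine\<close> to be meaningful.\<close>

definition admissibly_tagged :: "'a::euclidean_space tagged set \<Rightarrow> bool" where
  "admissibly_tagged \<T>\<^sub>0 \<longleftrightarrow>
     (\<forall>\<T>\<in>refinements \<T>\<^sub>0. \<forall>\<M>\<subseteq>\<T>. \<exists>\<T>'. coarsest_refinement \<T> \<M> \<T>')"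

definition S10 ::
    "'a::euclidean_space set \<Rightarrow> 'a tagged set \<Rightarrow> ('a \<Rightarrow> real) set" where
  "S10 \<Omega> \<T> =
     {v. continuous_on (closure \<Omega>) v \<and>
         (\<forall>K\<in>\<T>. \<exists>g c. \<forall>x\<in>open_elem K. v x = g \<bullet> x + c) \<and>
         (\<forall>x. x \<notin> \<Omega> \<longrightarrow> v x = 0)}"

definition galerkin_solution ::
    "'a::euclidean_space set \<Rightarrow> real \<Rightarrow> ('a \<Rightarrow> real) \<Rightarrow> 'a tagged set \<Rightarrow> ('a \<Rightarrow> real) \<Rightarrow> bool" where
  "galerkin_solution \<Omega> s f \<T> u \<longleftrightarrow>
     u \<in> S10 \<Omega> \<T> \<and> (\<forall>w\<in>S10 \<Omega> \<T>. frac_form s u w = L2_inner \<Omega> f w)"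

definition hat ::
    "'a::euclidean_space set \<Rightarrow> 'a tagged set \<Rightarrow> 'a \<Rightarrow> 'a \<Rightarrow> real" where
  "hat \<Omega> \<T> z =
     (THE \<phi>. \<phi> \<in> S10 \<Omega> \<T> \<and>
        (\<forall>z'\<in>interior_nodes \<Omega> \<T>. \<phi> z' = (if z' = z then 1 else 0)))"

definition sons_in ::
    "'a::euclidean_space tagged set \<Rightarrow> 'a tagged \<Rightarrow> 'a tagged set" where
  "sons_in \<T>' K = {K'\<in>\<T>'. open_elem K' \<subseteq> open_elem K}"

text \<open>In the following, \<open>u\<close> is to be the Galerkin solution for the mesh \<open>\<T>\<close>.\<close>

definition tau_node ::
    "'a::euclidean_space set \<Rightarrow> real \<Rightarrow> ('a \<Rightarrow> real) \<Rightarrow> 'a tagged set \<Rightarrow> ('a \<Rightarrow> real) \<Rightarrow>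
     'a \<Rightarrow> real" where
  "tau_node \<Omega> s f \<T> u z =
     (let \<phi> = hat \<Omega> (uniform_refinement \<T>) z
      in \<bar>L2_inner \<Omega> f \<phi> - frac_form s u \<phi>\<bar> / energy_norm s \<phi>)"

definition tau_elem ::
    "'a::euclidean_space set \<Rightarrow> real \<Rightarrow> ('a \<Rightarrow> real) \<Rightarrow> 'a tagged set \<Rightarrow> ('a \<Rightarrow> real) \<Rightarrow>
     'a tagged \<Rightarrow> real" where
  "tau_elem \<Omega> s f \<T> u K =
     sqrt (\<Sum>z \<in> interior_nodes \<Omega> (sons_in (uniform_refinement \<T>) K) - nodes \<T>.
             (tau_node \<Omega> s f \<T> u z)\<^sup>2)"

definition tau ::
    "'a::euclidean_space set \<Rightarrow> real \<Rightarrow> ('a \<Rightarrow> real) \<Rightarrow> 'a tagged set \<Rightarrow> ('a \<Rightarrow> real) \<Rightarrow>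
     'a tagged set \<Rightarrow> real" where
  "tau \<Omega> s f \<T> u \<U> = sqrt (\<Sum>K\<in>\<U>. (tau_elem \<Omega> s f \<T> u K)\<^sup>2)"

end

theory Submission
  imports Defs
begin

text \<open>Conformity is used in the form that the barycentric coordinates of neighbouring elements agree
  on their intersection, so that the functions equal to the coordinate of \<open>z\<close> on each element are
  the hat functions. An NVB refinement is a family of binary trees, one for each element. The uniform
  refinement is given by an explicit tree that depends on the dimension and the refinement type only.
  In barycentric coordinates, halving the edge \<open>ab\<close> is the map
  \<open>(v a, v b) \<mapsto> ((v a - v b)\<^sup>+, (v b - v a)\<^sup>+)\<close> with \<open>2 min (v a) (v b)\<close> for the midpoint; on each
  face of an element, the uniform refinement amounts to a sequence of such maps. That neighbours
  perform the same sequence on a common face proves this refinement conforming, hence it is the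
  coarsest one, and \<open>refine \<T> \<M>\<close> lies between \<open>\<T>\<close> and it.

  For the efficiency and the stability, at most \<open>d + 1\<close> hat functions overlap at a point, which gives
  a Bessel inequality for the energy product; the hat functions of new nodes on marked elements
  belong to the refined space, and in dimension 2 those on unrefined elements are not changed.
  For the reliability, \<open>e = u\<^sub>l\<^sub>+\<^sub>1 - u\<^sub>l\<close> minus its nodal interpolant on \<open>\<T>\<^sub>l\<close> is a combination of the
  hat functions of new nodes in refined elements. Its coefficient at \<open>z\<close> is bounded by the
  oscillation of \<open>e\<close> on an element \<open>K\<close> at \<open>z\<close>, and the weighted squares of the oscillations sum up to
  at most a constant times the energy of \<open>e\<close>, because \<open>e\<close> is affine on the descendants of \<open>K\<close>.\<close>

section \<open>Barycentric coordinates\<close>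

text \<open>The energy is nonlocal, so it is no sum over elements. Two one-sided facts replace a
  localisation. From above: at a pair of points at most 2(d + 1) hat functions have a jump, however
  far apart the points are. From below: the integrand of a square is nonnegative, so all pairs may
  be dropped except those inside one element. A hat function has energy at most, and a unit
  oscillation on an element of size h at least, a constant times h^(d - 2s); the powers of h cancel.
  Point values are not controlled by the energy in general. Nodal interpolation works because e is
  discrete and each element has at most 20 descendants. The other obstacle is combinatorial:
  \<open>refine\<close> is a definite description, and the assumption on the tags only says that
  coarsest refinements exist, so the pattern has to be derived. On vertices and edges the tags leave
  no choice. On a facet of a tetrahedron they select the edge cut first, and the order of the next
  two cuts is immaterial. As there are only five pairs of dimension and type, the pattern is
  verified by evaluation.\<close>

definition affine_fun :: "('a::euclidean_space \<Rightarrow> real) \<Rightarrow> bool" where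
  "affine_fun f \<longleftrightarrow> (\<exists>g c. \<forall>x. f x = g \<bullet> x + c)"

lemma affine_funI: "(\<And>x. f x = g \<bullet> x + c) \<Longrightarrow> affine_fun f"
  unfolding affine_fun_def by blast

lemma affine_fun_const [simp]: "affine_fun (\<lambda>x. c)"
  by (rule affine_funI[of _ 0 c]) simp

lemma affine_fun_add: "affine_fun f \<Longrightarrow> affine_fun g \<Longrightarrow> affine_fun (\<lambda>x. f x + g x)"
  unfolding affine_fun_def
proof (elim exE)
  fix a c b d assume "\<forall>x. f x = a \<bullet> x + c" "\<forall>x. g x = b \<bullet> x + d"
  then show "\<exists>h e. \<forall>x. f x + g x = h \<bullet> x + e"
    by (intro exI[of _ "a + b"] exI[of _ "c + d"]) (auto simp: inner_add_left)
qed

lemma affine_fun_cmult: "affine_fun f \<Longrightarrow> affine_fun (\<lambda>x. k * f x)"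
  unfolding affine_fun_def
proof (elim exE)
  fix a c assume "\<forall>x. f x = a \<bullet> x + c"
  then show "\<exists>h e. \<forall>x. k * f x = h \<bullet> x + e"
    by (intro exI[of _ "k *\<^sub>R a"] exI[of _ "k * c"]) (auto simp: algebra_simps)
qed

lemma affine_fun_diff: "affine_fun f \<Longrightarrow> affine_fun g \<Longrightarrow> affine_fun (\<lambda>x. f x - g x)"
  using affine_fun_add[of f "\<lambda>x. (-1) * g x"] affine_fun_cmult[of g "-1"] by simp

lemma affine_fun_sum:
  "(\<And>i. i \<in> I \<Longrightarrow> affine_fun (f i)) \<Longrightarrow> affine_fun (\<lambda>x. \<Sum>i\<in>I. f i x)"
  by (induction I rule: infinite_finite_induct) (auto intro: affine_fun_add)

lemma affine_fun_inner: "affine_fun (\<lambda>x. x \<bullet> b)"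
  by (rule affine_funI[of _ b 0]) (simp add: inner_commute)

lemma affine_fun_comb:
  assumes "affine_fun f" "finite S" "sum u S = 1"
  shows "f (\<Sum>v\<in>S. u v *\<^sub>R v) = (\<Sum>v\<in>S. u v * f v)"
proof -
  obtain g c where f: "\<And>x. f x = g \<bullet> x + c" using assms(1) unfolding affine_fun_def by blast
  have "(\<Sum>v\<in>S. u v * (g \<bullet> v + c)) = (\<Sum>v\<in>S. u v * (g \<bullet> v)) + sum u S * c"
    by (simp add: distrib_left sum.distrib sum_distrib_right)
  then show ?thesis using assms(3) by (simp add: f inner_sum_right)
qed

lemma affine_fun_comb2:
  assumes "affine_fun f"
  shows "f ((1 - t) *\<^sub>R x + t *\<^sub>R y) = (1 - t) * f x + t * f y"
proof -
  obtain g c where f: "\<And>x. f x = g \<bullet> x + c" using assms(1) unfolding affine_fun_def by blast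
  show ?thesis by (simp add: f algebra_simps)
qed

lemma affine_fun_midpoint: "affine_fun f \<Longrightarrow> f (midpoint x y) = (f x + f y) / 2"
  using affine_fun_comb2[of f "1/2" x y] by (simp add: midpoint_def algebra_simps)

lemma affine_fun_continuous: "affine_fun f \<Longrightarrow> continuous_on A f"
proof -
  assume "affine_fun f"
  then obtain g c where f: "f = (\<lambda>x. g \<bullet> x + c)" unfolding affine_fun_def by blast
  show ?thesis unfolding f by (intro continuous_intros)
qed

definition vertex_set :: "'a::euclidean_space set \<Rightarrow> bool" where
  "vertex_set S \<longleftrightarrow> finite S \<and> card S = DIM('a) + 1 \<and> \<not> affine_dependent S"

lemma vertex_set_affine_hull:
  fixes S :: "'a::euclidean_space set"
  assumes "vertex_set S" shows "affine hull S = UNIV"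
proof -
  have "aff_dim S = int (card S) - 1"
    using assms aff_dim_affine_independent[of S] unfolding vertex_set_def by linarith
  then show ?thesis using assms unfolding vertex_set_def by (subst aff_dim_eq_full [symmetric]) auto
qed

text \<open>The differences of the vertices to one of them, \<open>a\<close>, are linearly
  independent, so a linear functional with prescribed values on them exists; its gradient is the
  adjoint applied to 1.\<close>

lemma vertex_set_interpolation:
  fixes S :: "'a::euclidean_space set"
  assumes "vertex_set S"
  shows "\<exists>f. affine_fun f \<and> (\<forall>v\<in>S. f v = h v)"
proof -
  have fin: "finite S" and "S \<noteq> {}" using assms unfolding vertex_set_def by auto
  then obtain a where a: "a \<in> S" by blast
  have S: "insert a (S - {a}) = S" using a by blast
  have "\<not> dependent {x - a |x. x \<in> S - {a}}"
    using assms affine_dependent_iff_dependent[of a "S - {a}"]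
    unfolding S vertex_set_def Setcompr_eq_image by (auto simp: image_def)
  then obtain g where g: "linear g" "\<forall>x\<in>{x - a |x. x \<in> S - {a}}. g x = h (x + a) - h a"
    using linear_independent_extend[of _ "\<lambda>x. h (x + a) - h a"] by blast
  have gx: "g x = adjoint g 1 \<bullet> x" for x
    using adjoint_works[OF g(1), of x 1] by (simp add: inner_commute)
  have "affine_fun (\<lambda>x. g (x - a) + h a)"
    by (rule affine_funI[of _ "adjoint g 1" "h a - adjoint g 1 \<bullet> a"])
      (simp add: gx inner_diff_right)
  moreover have "\<forall>v\<in>S. g (v - a) + h a = h v"
  proof
    fix v assume "v \<in> S"
    show "g (v - a) + h a = h v"
    proof (cases "v = a")
      case True then show ?thesis using g(1) by (simp add: linear_0)
    next
      case False then have "v - a \<in> {x - a |x. x \<in> S - {a}}" using \<open>v \<in> S\<close> by blast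
      then show ?thesis using g(2) by auto
    qed
  qed
  ultimately show ?thesis by blast
qed

lemma vertex_set_affine_fun_eq:
  fixes S :: "'a::euclidean_space set"
  assumes "vertex_set S" "affine_fun f" "affine_fun g" "\<And>v. v \<in> S \<Longrightarrow> f v = g v"
  shows "f x = g x"
proof -
  have fin: "finite S" using assms unfolding vertex_set_def by auto
  have "x \<in> affine hull S" using vertex_set_affine_hull[OF assms(1)] by simp
  then obtain u where u: "sum u S = 1" "(\<Sum>v\<in>S. u v *\<^sub>R v) = x"
    unfolding affine_hull_finite[OF fin] by auto
  show ?thesis
    using affine_fun_comb[OF assms(2) fin u(1)] affine_fun_comb[OF assms(3) fin u(1)] assms(4)
    by (simp add: u(2))
qed

text \<open>The condition also fixes the value for \<open>z \<notin> S\<close>: then \<open>bary S z\<close> vanishes identically.\<close>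

definition bary :: "'a::euclidean_space set \<Rightarrow> 'a \<Rightarrow> 'a \<Rightarrow> real" where
  "bary S z = (SOME f. affine_fun f \<and> (\<forall>v\<in>S. f v = (if v = z then 1 else 0)))"

context
  fixes S :: "'a::euclidean_space set"
  assumes S: "vertex_set S"
begin

lemma bary_props: "affine_fun (bary S z) \<and> (\<forall>v\<in>S. bary S z v = (if v = z then 1 else 0))"
  unfolding bary_def by (rule someI_ex[OF vertex_set_interpolation[OF S]])

lemma affine_fun_bary: "affine_fun (bary S z)" using bary_props by blast

lemma bary_vertex: "v \<in> S \<Longrightarrow> bary S z v = (if v = z then 1 else 0)" using bary_props by blast

lemma bary_unique:
  assumes "affine_fun f" "\<And>v. v \<in> S \<Longrightarrow> f v = (if v = z then 1 else 0)"
  shows "bary S z x = f x"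
  by (rule vertex_set_affine_fun_eq[OF S affine_fun_bary assms(1)]) (simp add: assms(2) bary_vertex)

lemma bary_notin: "z \<notin> S \<Longrightarrow> bary S z x = 0"
  by (rule bary_unique) auto

lemma affine_fun_expand:
  assumes "affine_fun f" shows "f x = (\<Sum>v\<in>S. bary S v x * f v)"
proof (rule vertex_set_affine_fun_eq[OF S assms])
  show "affine_fun (\<lambda>x. \<Sum>v\<in>S. bary S v x * f v)"
    by (rule affine_fun_sum) (simp add: mult.commute affine_fun_cmult affine_fun_bary)
  fix w assume "w \<in> S"
  then show "f w = (\<Sum>v\<in>S. bary S v w * f v)"
    using S by (simp add: bary_vertex vertex_set_def if_distrib[of "\<lambda>t. t * _"] cong: if_cong)
qed

lemma bary_sum: "(\<Sum>v\<in>S. bary S v x) = 1"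
  using affine_fun_expand[of "\<lambda>_. 1" x] by simp

lemma bary_comb: "(\<Sum>v\<in>S. bary S v x *\<^sub>R v) = x"
proof (rule euclidean_eqI)
  fix b :: 'a assume "b \<in> Basis"
  show "(\<Sum>v\<in>S. bary S v x *\<^sub>R v) \<bullet> b = x \<bullet> b"
    using affine_fun_expand[OF affine_fun_inner, of x b] by (simp add: inner_sum_left)
qed

lemma bary_of_comb:
  assumes "sum u S = 1" "(\<Sum>v\<in>S. u v *\<^sub>R v) = x" "z \<in> S"
  shows "bary S z x = u z"
proof -
  have fin: "finite S" using S unfolding vertex_set_def by auto
  show ?thesis using affine_fun_comb[OF affine_fun_bary fin assms(1), of z] assms(2,3) fin
    by (simp add: bary_vertex if_distrib[of "\<lambda>t. _ * t"] cong: if_cong)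
qed

lemma convex_hull_iff_bary: "x \<in> convex hull S \<longleftrightarrow> (\<forall>z. 0 \<le> bary S z x)"
proof -
  have fin: "finite S" using S unfolding vertex_set_def by auto
  show ?thesis
  proof
    assume "x \<in> convex hull S"
    then obtain u where u: "\<forall>z\<in>S. 0 \<le> u z" "sum u S = 1" "(\<Sum>v\<in>S. u v *\<^sub>R v) = x"
      unfolding convex_hull_finite[OF fin] by auto
    show "\<forall>z. 0 \<le> bary S z x"
    proof
      fix z show "0 \<le> bary S z x"
        using u bary_of_comb[OF u(2,3)] bary_notin by (cases "z \<in> S") auto
    qed
  next
    assume "\<forall>z. 0 \<le> bary S z x"
    then show "x \<in> convex hull S"
      unfolding convex_hull_finite[OF fin]
      by (auto intro!: exI[of _ "\<lambda>z. bary S z x"] simp: bary_sum bary_comb)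
  qed
qed

lemma bary_nonneg: "x \<in> convex hull S \<Longrightarrow> 0 \<le> bary S z x"
  using convex_hull_iff_bary by blast

lemma bary_le_1: "x \<in> convex hull S \<Longrightarrow> bary S z x \<le> 1"
proof (cases "z \<in> S")
  case True
  assume x: "x \<in> convex hull S"
  have "bary S z x \<le> (\<Sum>v\<in>S. bary S v x)"
    using S True bary_nonneg[OF x] by (intro member_le_sum) (auto simp: vertex_set_def)
  then show ?thesis by (simp add: bary_sum)
qed (simp add: bary_notin)

lemma bary_add_le_1:
  assumes "x \<in> convex hull S" "v \<noteq> w" shows "bary S v x + bary S w x \<le> 1"
proof (cases "v \<in> S \<and> w \<in> S")
  case True
  have "bary S v x + bary S w x = (\<Sum>v\<in>{v,w}. bary S v x)" using assms by simp
  also have "\<dots> \<le> (\<Sum>v\<in>S. bary S v x)"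
    using S True bary_nonneg[OF assms(1)] by (intro sum_mono2) (auto simp: vertex_set_def)
  finally show ?thesis by (simp add: bary_sum)
next
  case False
  then show ?thesis using bary_le_1[OF assms(1)] by (auto simp: bary_notin)
qed

lemma interior_convex_hull_iff_bary:
  "x \<in> interior (convex hull S) \<longleftrightarrow> (\<forall>z\<in>S. 0 < bary S z x)"
proof -
  have fin: "finite S" using S unfolding vertex_set_def by auto
  have "interior (convex hull S) = {x. \<exists>u. (\<forall>z\<in>S. 0 < u z \<and> u z < 1) \<and> sum u S = 1 \<and> (\<Sum>v\<in>S. u v *\<^sub>R v) = x}"
    using interior_convex_hull_explicit[of S] interior_convex_hull_explicit_minimal[of S] S
    unfolding vertex_set_def by auto
  then have A: "x \<in> interior (convex hull S) \<longleftrightarrow>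
     (\<exists>u. (\<forall>z\<in>S. 0 < u z \<and> u z < 1) \<and> sum u S = 1 \<and> (\<Sum>v\<in>S. u v *\<^sub>R v) = x)" by auto
  show ?thesis
  proof
    assume "x \<in> interior (convex hull S)"
    then show "\<forall>z\<in>S. 0 < bary S z x" unfolding A using bary_of_comb by auto
  next
    assume B: "\<forall>z\<in>S. 0 < bary S z x"
    \<comment> \<open>The library description of the interior also asks for coefficients below 1. A
      second vertex, whose coordinate is positive as well, provides this.\<close>
    have "bary S z x < 1" if z: "z \<in> S" for z
    proof -
      have "card (S - {z}) > 0" using S z by (simp add: vertex_set_def)
      then obtain w where w: "w \<in> S" "w \<noteq> z" by (metis Diff_iff card_gt_0_iff ex_in_conv insertI1)
      have "x \<in> convex hull S" unfolding convex_hull_iff_bary using B bary_notin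
        by (metis less_eq_real_def)
      from bary_add_le_1[OF this w(2)] B w show ?thesis by force
    qed
    then show "x \<in> interior (convex hull S)" unfolding A
      using B by (intro exI[of _ "\<lambda>z. bary S z x"]) (auto simp: bary_sum bary_comb)
  qed
qed

end

section \<open>Bisection trees\<close>

text \<open>Since \<open>b\<close> is twice the midpoint minus \<open>a\<close>, the new set still
  spans the whole space affinely, and with the same number of points it stays independent. The
  midpoint is new because its coordinate at \<open>a\<close> is 1/2, a value that no vertex
  has.\<close>

lemma vertex_set_bisect:
  fixes S :: "'a::euclidean_space set"
  assumes S: "vertex_set S" and ab: "a \<in> S" "b \<in> S" "a \<noteq> b"
  shows "midpoint a b \<notin> S" "vertex_set (insert (midpoint a b) (S - {b}))"
    "card (insert (midpoint a b) (S - {b})) = card S"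
proof -
  let ?m = "midpoint a b"
  let ?S = "insert ?m (S - {b})"
  have fin: "finite S" and card: "card S = DIM('a) + 1" using S by (auto simp: vertex_set_def)
  have "bary S a ?m = 1 / 2"
    using affine_fun_midpoint[OF affine_fun_bary[OF S]] ab by (simp add: bary_vertex[OF S])
  then show m: "?m \<notin> S" by (auto simp: bary_vertex[OF S] split: if_splits)
  have c: "card ?S = card S" using m fin ab(2) card by simp
  then show "card ?S = card S" .
  have aff: "affine (affine hull ?S)" by simp
  have a: "a \<in> affine hull ?S" and mm: "?m \<in> affine hull ?S" using ab by (auto intro: hull_inc)
  have "b = (-1) *\<^sub>R a + 2 *\<^sub>R ?m" by (simp add: midpoint_def algebra_simps)
  also have "\<dots> \<in> affine hull ?S" by (rule mem_affine[OF aff a mm]) simp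
  finally have "S \<subseteq> affine hull ?S" by (auto intro: hull_inc)
  then have "affine hull S \<subseteq> affine hull ?S" by (meson aff hull_minimal)
  then have "affine hull ?S = UNIV" using vertex_set_affine_hull[OF S] by auto
  then have "aff_dim ?S = int DIM('a)" by (simp add: aff_dim_eq_full)
  then have "\<not> affine_dependent ?S" unfolding affine_independent_iff_card
    using fin c card by simp
  then show "vertex_set ?S" unfolding vertex_set_def using fin c card by simp
qed

text \<open>An affine function is determined by its values on \<open>S'\<close>, and at the midpoint
  the old coordinates of \<open>a\<close> and \<open>b\<close> are both 1/2; hence the factor 2 and
  the difference. These formulas are the origin of \<open>vstep\<close>.\<close>

lemma bary_bisect:
  fixes S :: "'a::euclidean_space set"
  assumes S: "vertex_set S" and ab: "a \<in> S" "b \<in> S" "a \<noteq> b"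
  defines "S' \<equiv> insert (midpoint a b) (S - {b})"
  shows "bary S' (midpoint a b) x = 2 * bary S b x"
    "bary S' a x = bary S a x - bary S b x"
    "bary S' b x = 0"
    "\<lbrakk>z \<noteq> a; z \<noteq> b; z \<noteq> midpoint a b\<rbrakk> \<Longrightarrow> bary S' z x = bary S z x"
proof -
  let ?m = "midpoint a b"
  note vb = vertex_set_bisect[OF S ab]
  have S': "vertex_set S'" using vb(2) unfolding S'_def .
  note aff = affine_fun_bary[OF S]
  have mid: "bary S z ?m = (bary S z a + bary S z b) / 2" for z
    using affine_fun_midpoint[OF aff] .
  have vm: "v \<in> S' \<Longrightarrow> v = ?m \<or> v \<in> S \<and> v \<noteq> b" for v unfolding S'_def by auto
  have nm: "?m \<noteq> a" "?m \<noteq> b" using ab(3) by simp_all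
  show "bary S' ?m x = 2 * bary S b x"
    by (rule bary_unique[OF S'])
      (use vb(1) ab in \<open>auto dest!: vm simp: affine_fun_cmult[OF aff] mid bary_vertex[OF S]\<close>)
  show "bary S' a x = bary S a x - bary S b x"
    by (rule bary_unique[OF S'])
      (use vb(1) ab nm in \<open>auto dest!: vm simp: affine_fun_diff[OF aff aff] mid bary_vertex[OF S]\<close>)
  show "bary S' b x = 0"
    by (rule bary_notin[OF S']) (use nm in \<open>auto simp: S'_def simp del: midpoint_eq_endpoint\<close>)
  assume z: "z \<noteq> a" "z \<noteq> b" "z \<noteq> ?m"
  show "bary S' z x = bary S z x"
    by (rule bary_unique[OF S' aff])
      (use vb(1) ab nm z in \<open>auto dest!: vm simp: mid bary_vertex[OF S]\<close>)
qed

text \<open>The cut runs along the hyperplane where the coordinates of \<open>a\<close> and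
  \<open>b\<close> are equal, so the half at \<open>a\<close> is where that of \<open>a\<close>
  dominates. For interiors one direction suffices to keep the two halves disjoint.\<close>

lemma bisect_hull:
  fixes S :: "'a::euclidean_space set"
  assumes S: "vertex_set S" and ab: "a \<in> S" "b \<in> S" "a \<noteq> b"
  defines "S' \<equiv> insert (midpoint a b) (S - {b})"
  shows "x \<in> convex hull S' \<longleftrightarrow> x \<in> convex hull S \<and> bary S b x \<le> bary S a x"
    "x \<in> interior (convex hull S') \<Longrightarrow> x \<in> interior (convex hull S) \<and> bary S b x < bary S a x"
proof -
  let ?m = "midpoint a b"
  note vb = vertex_set_bisect[OF S ab]
  have S': "vertex_set S'" using vb(2) unfolding S'_def .
  have nm: "?m \<noteq> a" "?m \<noteq> b" using ab(3) by simp_all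
  note bb = bary_bisect[OF S ab, folded S'_def]
  show "x \<in> convex hull S' \<longleftrightarrow> x \<in> convex hull S \<and> bary S b x \<le> bary S a x"
    unfolding convex_hull_iff_bary[OF S'] convex_hull_iff_bary[OF S]
  proof
    assume L: "\<forall>z. 0 \<le> bary S' z x"
    have b: "0 \<le> bary S b x" using L[rule_format, of ?m] bb(1) by simp
    have a: "bary S b x \<le> bary S a x" using L[rule_format, of a] bb(2) by simp
    have "0 \<le> bary S z x" for z
    proof (cases "z = a \<or> z = b \<or> z = ?m")
      case True
      then show ?thesis using a b bary_notin[OF S vb(1), of x] by auto
    next
      case False
      then show ?thesis using L[rule_format, of z] bb(4)[of z x] by simp
    qed
    then show "(\<forall>z. 0 \<le> bary S z x) \<and> bary S b x \<le> bary S a x" using a by blast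
  next
    assume R: "(\<forall>z. 0 \<le> bary S z x) \<and> bary S b x \<le> bary S a x"
    show "\<forall>z. 0 \<le> bary S' z x"
    proof
      fix z show "0 \<le> bary S' z x"
      proof (cases "z = a \<or> z = b \<or> z = ?m")
        case True
        then show ?thesis using R bb(1)[of x] bb(2)[of x] bb(3)[of x] by auto
      next
        case False
        then show ?thesis using R bb(4)[of z x] by simp
      qed
    qed
  qed
  assume "x \<in> interior (convex hull S')"
  then have L: "\<forall>z\<in>S'. 0 < bary S' z x" unfolding interior_convex_hull_iff_bary[OF S'] .
  have b: "0 < bary S b x" using L[rule_format, of ?m] bb(1) by (simp add: S'_def)
  have a: "bary S b x < bary S a x" using L[rule_format, of a] bb(2) ab by (simp add: S'_def)
  have "0 < bary S z x" if z: "z \<in> S" for z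
  proof (cases "z = a \<or> z = b")
    case True then show ?thesis using a b by auto
  next
    case False
    then have "z \<noteq> ?m" "z \<in> S'" using z vb(1) by (auto simp: S'_def)
    then show ?thesis using L bb(4)[of z x] False by auto
  qed
  then show "x \<in> interior (convex hull S) \<and> bary S b x < bary S a x"
    using a unfolding interior_convex_hull_iff_bary[OF S] by blast
qed

section \<open>Tagged simplices and their two sons\<close>

definition end1 :: "'a tagged \<Rightarrow> 'a" where "end1 K = hd (fst K)"
definition end2 :: "'a tagged \<Rightarrow> 'a" where "end2 K = last (fst K)"
definition mid_pt :: "'a::euclidean_space tagged \<Rightarrow> 'a" where "mid_pt K = midpoint (end1 K) (end2 K)"

definition son1 :: "'a::euclidean_space tagged \<Rightarrow> 'a tagged" where
  "son1 K = ([end1 K, mid_pt K] @ butlast (tl (fst K)), (snd K + 1) mod DIM('a))"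

definition son2 :: "'a::euclidean_space tagged \<Rightarrow> 'a tagged" where
  "son2 K = ([end2 K, mid_pt K] @ take (snd K) (butlast (tl (fst K)))
       @ rev (drop (snd K) (butlast (tl (fst K)))), (snd K + 1) mod DIM('a))"

lemma bisection_sons_eq: "bisection_sons K = {son1 K, son2 K}"
  unfolding bisection_sons_def son1_def son2_def end1_def end2_def mid_pt_def Let_def by simp

lemma vertex_set_vertices: "tagged_simplex K \<Longrightarrow> vertex_set (vertices K)"
  unfolding tagged_simplex_def vertex_set_def vertices_def by (auto simp: distinct_card)

lemma tagged_simplexI:
  fixes K :: "'a::euclidean_space tagged"
  assumes "vertex_set (vertices K)" "length (fst K) = DIM('a) + 1" "snd K < DIM('a)"
  shows "tagged_simplex K"
  using assms unfolding tagged_simplex_def vertex_set_def vertices_def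
  by (auto intro: card_distinct)

lemma tagged_simplex_list:
  fixes K :: "'a::euclidean_space tagged"
  assumes "tagged_simplex K"
  obtains m where "fst K = end1 K # m @ [end2 K]" "length m = DIM('a) - 1"
    "end1 K \<noteq> end2 K" "end1 K \<notin> set m" "end2 K \<notin> set m" "distinct m"
proof -
  have l: "length (fst K) = DIM('a) + 1" "distinct (fst K)"
    using assms unfolding tagged_simplex_def by auto
  obtain a zs where K: "fst K = a # zs" using l(1) by (cases "fst K") auto
  then have "zs \<noteq> []" using l(1) DIM_positive[where 'a='a] by (cases zs) auto
  then have "fst K = a # butlast zs @ [last zs]" using K by simp
  then obtain m b where "fst K = a # m @ [b]" by blast
  then show thesis using that[of m] l by (auto simp: end1_def end2_def)
qed

lemma end_vertices:
  assumes "tagged_simplex K"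
  shows "end1 K \<in> vertices K" "end2 K \<in> vertices K" "end1 K \<noteq> end2 K"
  using assms by (metis tagged_simplex_list vertices_def list.set_intros(1),
      metis tagged_simplex_list vertices_def last_in_set end2_def list.distinct(1),
      metis tagged_simplex_list)

lemma vertices_sons:
  assumes "tagged_simplex K"
  shows "vertices (son1 K) = insert (mid_pt K) (vertices K - {end2 K})"
    "vertices (son2 K) = insert (mid_pt K) (vertices K - {end1 K})"
proof -
  from assms obtain m where m: "fst K = end1 K # m @ [end2 K]" "end1 K \<noteq> end2 K"
    "end1 K \<notin> set m" "end2 K \<notin> set m" by (rule tagged_simplex_list)
  have bm: "butlast (tl (fst K)) = m" by (subst m(1)) simp
  have v: "vertices K = insert (end1 K) (insert (end2 K) (set m))"
    unfolding vertices_def by (subst m(1)) auto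
  have "set (take (snd K) m) \<union> set (drop (snd K) m) = set m"
    by (metis append_take_drop_id set_append)
  then have "vertices (son2 K) = insert (end2 K) (insert (mid_pt K) (set m))"
    unfolding son2_def vertices_def bm by auto
  then show "vertices (son2 K) = insert (mid_pt K) (vertices K - {end1 K})"
    unfolding v using m by auto
  show "vertices (son1 K) = insert (mid_pt K) (vertices K - {end2 K})"
    unfolding v using m unfolding son1_def vertices_def bm by auto
qed

lemma mid_pt_swap: "mid_pt K = midpoint (end2 K) (end1 K)"
  unfolding mid_pt_def by (rule midpoint_sym)

lemma tagged_simplex_sons:
  assumes "tagged_simplex K"
  shows "tagged_simplex (son1 K)" "tagged_simplex (son2 K)"
proof -
  note vs = vertex_set_vertices[OF assms] and e = end_vertices[OF assms]
  from assms obtain m where m: "fst K = end1 K # m @ [end2 K]" "length m = DIM('a) - 1"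
    by (rule tagged_simplex_list)
  have bm: "butlast (tl (fst K)) = m" by (subst m(1)) simp
  show "tagged_simplex (son1 K)"
  proof (rule tagged_simplexI)
    show "vertex_set (vertices (son1 K))"
      unfolding vertices_sons[OF assms] mid_pt_def by (rule vertex_set_bisect(2)[OF vs e])
  qed (simp_all add: son1_def bm m(2))
  show "tagged_simplex (son2 K)"
  proof (rule tagged_simplexI)
    show "vertex_set (vertices (son2 K))"
      unfolding vertices_sons[OF assms] mid_pt_swap
      by (rule vertex_set_bisect(2)[OF vs e(2,1) e(3)[symmetric]])
    have "snd K < DIM('a)" using assms by (simp add: tagged_simplex_def)
    then show "length (fst (son2 K)) = DIM('a) + 1" using m(2) DIM_positive[where 'a='a]
        append_take_drop_id[of "snd K" m, THEN arg_cong[where f=length]]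
      unfolding son2_def bm by (simp del: append_take_drop_id)
  qed (simp add: son2_def)
qed

abbreviation lam :: "'a::euclidean_space tagged \<Rightarrow> 'a \<Rightarrow> 'a \<Rightarrow> real" where
  "lam K \<equiv> bary (vertices K)"

lemma mid_pt_notin: "tagged_simplex K \<Longrightarrow> mid_pt K \<notin> vertices K"
  unfolding mid_pt_def by (rule vertex_set_bisect(1)[OF vertex_set_vertices end_vertices])

lemma lam_son1:
  assumes "tagged_simplex K"
  shows "lam (son1 K) (mid_pt K) x = 2 * lam K (end2 K) x"
    "lam (son1 K) (end1 K) x = lam K (end1 K) x - lam K (end2 K) x"
    "lam (son1 K) (end2 K) x = 0"
    "\<lbrakk>z \<noteq> end1 K; z \<noteq> end2 K; z \<noteq> mid_pt K\<rbrakk> \<Longrightarrow> lam (son1 K) z x = lam K z x"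
  unfolding vertices_sons[OF assms] mid_pt_def
  using bary_bisect[OF vertex_set_vertices[OF assms] end_vertices[OF assms]] by auto

lemma lam_son2:
  assumes "tagged_simplex K"
  shows "lam (son2 K) (mid_pt K) x = 2 * lam K (end1 K) x"
    "lam (son2 K) (end2 K) x = lam K (end2 K) x - lam K (end1 K) x"
    "lam (son2 K) (end1 K) x = 0"
    "\<lbrakk>z \<noteq> end1 K; z \<noteq> end2 K; z \<noteq> mid_pt K\<rbrakk> \<Longrightarrow> lam (son2 K) z x = lam K z x"
  unfolding vertices_sons[OF assms] mid_pt_swap
  using bary_bisect[OF vertex_set_vertices[OF assms] end_vertices(2,1)[OF assms]
      end_vertices(3)[OF assms, symmetric]] by auto

lemma closed_elem_iff: "tagged_simplex K \<Longrightarrow> x \<in> closed_elem K \<longleftrightarrow> (\<forall>z. 0 \<le> lam K z x)"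
  unfolding closed_elem_def by (rule convex_hull_iff_bary[OF vertex_set_vertices])

lemma open_elem_iff: "tagged_simplex K \<Longrightarrow> x \<in> open_elem K \<longleftrightarrow> (\<forall>z\<in>vertices K. 0 < lam K z x)"
  unfolding open_elem_def closed_elem_def
  by (rule interior_convex_hull_iff_bary[OF vertex_set_vertices])

lemma closed_elem_son1: "tagged_simplex K \<Longrightarrow>
    x \<in> closed_elem (son1 K) \<longleftrightarrow> x \<in> closed_elem K \<and> lam K (end2 K) x \<le> lam K (end1 K) x"
  unfolding closed_elem_def vertices_sons mid_pt_def
  by (rule bisect_hull(1)[OF vertex_set_vertices end_vertices])

lemma closed_elem_son2: "tagged_simplex K \<Longrightarrow>
    x \<in> closed_elem (son2 K) \<longleftrightarrow> x \<in> closed_elem K \<and> lam K (end1 K) x \<le> lam K (end2 K) x"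
  unfolding closed_elem_def vertices_sons mid_pt_swap
  by (rule bisect_hull(1)[OF vertex_set_vertices end_vertices(2,1) end_vertices(3)[symmetric]])

lemma open_elem_son1: "tagged_simplex K \<Longrightarrow> x \<in> open_elem (son1 K) \<Longrightarrow>
    x \<in> open_elem K \<and> lam K (end2 K) x < lam K (end1 K) x"
  unfolding open_elem_def closed_elem_def vertices_sons mid_pt_def
  by (rule bisect_hull(2)[OF vertex_set_vertices end_vertices])

lemma open_elem_son2: "tagged_simplex K \<Longrightarrow> x \<in> open_elem (son2 K) \<Longrightarrow>
    x \<in> open_elem K \<and> lam K (end1 K) x < lam K (end2 K) x"
  unfolding open_elem_def closed_elem_def vertices_sons mid_pt_swap
  by (rule bisect_hull(2)[OF vertex_set_vertices end_vertices(2,1) end_vertices(3)[symmetric]])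

lemma closed_elem_sons:
  "tagged_simplex K \<Longrightarrow> closed_elem K = closed_elem (son1 K) \<union> closed_elem (son2 K)"
  by (auto simp: closed_elem_son1 closed_elem_son2)

lemma open_elem_nonempty:
  fixes K :: "'a::euclidean_space tagged"
  assumes "tagged_simplex K" shows "open_elem K \<noteq> {}"
  using interior_simplex_nonempty
proof -
  have vs: "vertex_set (vertices K)" by (rule vertex_set_vertices[OF assms])
  have "interior (convex hull (vertices K)) \<noteq> {}"
    using vs vertex_set_affine_hull[OF vs] unfolding vertex_set_def
    by (metis affine_hull_convex_hull convex_convex_hull convex_hull_eq_empty empty_iff
        affine_hull_empty UNIV_not_empty rel_interior_eq_empty rel_interior_interior)
  then show ?thesis unfolding open_elem_def closed_elem_def .
qed

section \<open>Binary trees of bisections and their leaves\<close>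

datatype btree = Leaf | Node btree btree

text \<open>A tree only records where to bisect. The tag of a simplex determines its sons, so one
  tree can be run on any tagged simplex, in particular one \<open>utree\<close> on all elements of
  the same type.\<close>

primrec leaves :: "btree \<Rightarrow> 'a::euclidean_space tagged \<Rightarrow> 'a tagged set" where
  "leaves Leaf K = {K}"
| "leaves (Node l r) K = leaves l (son1 K) \<union> leaves r (son2 K)"

lemma finite_leaves [simp]: "finite (leaves t K)"
  by (induction t arbitrary: K) auto

lemma leaves_simplex: "tagged_simplex K \<Longrightarrow> X \<in> leaves t K \<Longrightarrow> tagged_simplex X"
proof (induction t arbitrary: K)
  case (Node l r)
  then show ?case using tagged_simplex_sons[OF Node.prems(1)] by (metis UnE leaves.simps(2))
qed simp

lemma leaves_closed: "tagged_simplex K \<Longrightarrow> (\<Union>X\<in>leaves t K. closed_elem X) = closed_elem K"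
proof (induction t arbitrary: K)
  case (Node l r)
  then show ?case
    using tagged_simplex_sons[OF Node.prems] closed_elem_sons[OF Node.prems] by (simp add: UN_Un)
qed simp

lemma leaves_open: "tagged_simplex K \<Longrightarrow> X \<in> leaves t K \<Longrightarrow> open_elem X \<subseteq> open_elem K"
proof (induction t arbitrary: K)
  case (Node l r)
  then show ?case
    using open_elem_son1[OF Node.prems(1)] open_elem_son2[OF Node.prems(1)]
      tagged_simplex_sons[OF Node.prems(1)] by simp (metis subset_iff)
qed simp

lemma leaves_subset: "tagged_simplex K \<Longrightarrow> X \<in> leaves t K \<Longrightarrow> closed_elem X \<subseteq> closed_elem K"
  using leaves_closed by blast

text \<open>Bisection never loses a vertex: all but \<open>end2 K\<close> pass to the first son, and
  \<open>end2 K\<close> passes to the second. Hence nodes persist under refinement.\<close>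

lemma leaves_vertices: "tagged_simplex K \<Longrightarrow> v \<in> vertices K \<Longrightarrow> \<exists>X\<in>leaves t K. v \<in> vertices X"
proof (induction t arbitrary: K)
  case (Node l r)
  note s = tagged_simplex_sons[OF Node.prems(1)]
  show ?case
  proof (cases "v = end2 K")
    case True
    then have "v \<in> vertices (son2 K)" using Node.prems end_vertices(3)[of K]
      by (simp add: vertices_sons)
    then show ?thesis using Node.IH(2)[OF s(2)] by auto
  next
    case False
    then have "v \<in> vertices (son1 K)" using Node.prems by (simp add: vertices_sons)
    then show ?thesis using Node.IH(1)[OF s(1)] by auto
  qed
qed simp

lemma sons_open_disjoint: "tagged_simplex K \<Longrightarrow> open_elem (son1 K) \<inter> open_elem (son2 K) = {}"
  by (meson disjoint_iff open_elem_son1 open_elem_son2 order_less_asym)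

lemma leaves_sons_disjoint:
  assumes "tagged_simplex K" "X \<in> leaves l (son1 K)" "Y \<in> leaves r (son2 K)"
  shows "open_elem X \<inter> open_elem Y = {}" "X \<noteq> Y"
proof -
  note s = tagged_simplex_sons[OF assms(1)]
  show 1: "open_elem X \<inter> open_elem Y = {}"
    using leaves_open[OF s(1) assms(2)] leaves_open[OF s(2) assms(3)] sons_open_disjoint[OF assms(1)]
    by blast
  show "X \<noteq> Y" using 1 open_elem_nonempty[OF leaves_simplex[OF s(1) assms(2)]] by auto
qed

lemma leaves_disjoint:
  "tagged_simplex K \<Longrightarrow> X \<in> leaves t K \<Longrightarrow> Y \<in> leaves t K \<Longrightarrow> X \<noteq> Y \<Longrightarrow>
    open_elem X \<inter> open_elem Y = {}"
proof (induction t arbitrary: K X Y)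
  case (Node l r)
  note s = tagged_simplex_sons[OF Node.prems(1)]
  show ?case using Node.prems(2,3,4) Node.IH(1)[OF s(1)] Node.IH(2)[OF s(2)]
      leaves_sons_disjoint(1)[OF Node.prems(1)] by (simp; metis inf_commute)
qed simp

text \<open>Inclusion of trees as initial parts. On leaves it is the refinement order, and its
  antisymmetry makes a coarsest refinement unique.\<close>

fun tle :: "btree \<Rightarrow> btree \<Rightarrow> bool" where
  "tle Leaf t = True"
| "tle (Node l r) Leaf = False"
| "tle (Node l r) (Node l' r') = (tle l l' \<and> tle r r')"

lemma tle_refl: "tle t t" by (induction t) auto

lemma tle_trans: "tle s t \<Longrightarrow> tle t u \<Longrightarrow> tle s u"
proof (induction s arbitrary: t u)
  case (Node l r)
  then show ?case by (cases t; cases u) auto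
qed simp

lemma tle_antisym: "tle s t \<Longrightarrow> tle t s \<Longrightarrow> s = t"
proof (induction s arbitrary: t)
  case Leaf then show ?case by (cases t) auto
next
  case (Node l r) then show ?case by (cases t) auto
qed

text \<open>A descendant of one son that equals \<open>K\<close> would contain the other son, whose
  interior is nonempty and disjoint from the first.\<close>

lemma not_both_sons:
  assumes "tagged_simplex K" shows "K \<notin> leaves l (son1 K)" "K \<notin> leaves r (son2 K)"
proof -
  note s = tagged_simplex_sons[OF assms]
  have "open_elem (son1 K) \<subseteq> open_elem K" "open_elem (son2 K) \<subseteq> open_elem K"
    using open_elem_son1[OF assms] open_elem_son2[OF assms] by blast+
  then show "K \<notin> leaves l (son1 K)" "K \<notin> leaves r (son2 K)"
    using leaves_open[OF s(1), of K l] leaves_open[OF s(2), of K r] sons_open_disjoint[OF assms]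
      open_elem_nonempty[OF s(1)] open_elem_nonempty[OF s(2)] by blast+
qed

text \<open>Descendants of the two sons are never equal, so a set of leaves splits in only one way
  into the leaves of the two subtrees.\<close>

lemma leaves_inj: "tagged_simplex K \<Longrightarrow> leaves s K = leaves t K \<Longrightarrow> s = t"
proof (induction s arbitrary: t K)
  case Leaf
  then show ?case using not_both_sons[OF Leaf.prems(1)] by (cases t) auto
next
  case (Node l r)
  note s = tagged_simplex_sons[OF Node.prems(1)]
  show ?case
  proof (cases t)
    case Leaf
    then show ?thesis using not_both_sons[OF Node.prems(1)] Node.prems(2) by auto
  next
    case t: (Node l' r')
    have eq: "leaves l (son1 K) \<union> leaves r (son2 K) = leaves l' (son1 K) \<union> leaves r' (son2 K)"
      using Node.prems(2) t by simp
    have "leaves l (son1 K) = leaves l' (son1 K)" "leaves r (son2 K) = leaves r' (son2 K)"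
      using eq leaves_sons_disjoint(2)[OF Node.prems(1)] by blast+
    then show ?thesis using Node.IH s t by auto
  qed
qed

text \<open>Bisecting a leaf grows the tree at this leaf alone: \<open>X\<close> occurs in only one
  of the two subtrees, so its removal does not touch the other.\<close>

lemma leaves_bisect:
  "tagged_simplex K \<Longrightarrow> X \<in> leaves t K \<Longrightarrow>
    \<exists>t'. tle t t' \<and> leaves t' K = (leaves t K - {X}) \<union> bisection_sons X"
proof (induction t arbitrary: K)
  case Leaf
  then show ?case by (intro exI[of _ "Node Leaf Leaf"]) (auto simp: bisection_sons_eq)
next
  case (Node l r)
  note s = tagged_simplex_sons[OF Node.prems(1)]
  note dj = leaves_sons_disjoint(2)[OF Node.prems(1)]
  show ?case
  proof (cases "X \<in> leaves l (son1 K)")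
    case True
    then obtain t' where "tle l t'" "leaves t' (son1 K) = (leaves l (son1 K) - {X}) \<union> bisection_sons X"
      using Node.IH(1)[OF s(1)] by blast
    moreover have "X \<notin> leaves r (son2 K)" using dj[OF True, of X] by auto
    ultimately show ?thesis by (intro exI[of _ "Node t' r"]) (auto simp: tle_refl)
  next
    case False
    then have X: "X \<in> leaves r (son2 K)" using Node.prems by auto
    then obtain t' where "tle r t'" "leaves t' (son2 K) = (leaves r (son2 K) - {X}) \<union> bisection_sons X"
      using Node.IH(2)[OF s(2)] by blast
    with False show ?thesis by (intro exI[of _ "Node l t'"]) (auto simp: tle_refl)
  qed
qed

section \<open>Meshes, forests and NVB refinements\<close>

definition mesh :: "'a::euclidean_space tagged set \<Rightarrow> bool" where
  "mesh \<T> \<longleftrightarrow> finite \<T> \<and> (\<forall>K\<in>\<T>. tagged_simplex K) \<and>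
     (\<forall>K\<in>\<T>. \<forall>K'\<in>\<T>. K \<noteq> K' \<longrightarrow> open_elem K \<inter> open_elem K' = {})"

definition forest :: "('a::euclidean_space tagged \<Rightarrow> btree) \<Rightarrow> 'a tagged set \<Rightarrow> 'a tagged set" where
  "forest t \<T> = (\<Union>K\<in>\<T>. leaves (t K) K)"

lemma leaves_mesh_disjoint:
  assumes "mesh \<T>" "K \<in> \<T>" "K' \<in> \<T>" "K \<noteq> K'" "X \<in> leaves t K" "Y \<in> leaves t' K'"
  shows "open_elem X \<inter> open_elem Y = {}" "X \<noteq> Y"
proof -
  have k: "tagged_simplex K" "tagged_simplex K'" using assms by (auto simp: mesh_def)
  have "open_elem K \<inter> open_elem K' = {}" using assms(1-4) unfolding mesh_def by blast
  then show 1: "open_elem X \<inter> open_elem Y = {}"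
    using leaves_open[OF k(1) assms(5)] leaves_open[OF k(2) assms(6)] by blast
  show "X \<noteq> Y" using 1 open_elem_nonempty[OF leaves_simplex[OF k(1) assms(5)]] by auto
qed

text \<open>\<open>mesh\<close> admits hanging nodes. Unlike \<open>conforming\<close> it survives
  arbitrary bisections, so it covers the intermediate meshes of a refinement.\<close>

lemma mesh_forest: assumes "mesh \<T>" shows "mesh (forest t \<T>)"
  unfolding mesh_def
proof (intro conjI ballI impI)
  show "finite (forest t \<T>)" using assms unfolding mesh_def forest_def by auto
next
  fix X assume "X \<in> forest t \<T>"
  then show "tagged_simplex X" using assms leaves_simplex unfolding mesh_def forest_def by blast
next
  fix X Y assume "X \<in> forest t \<T>" "Y \<in> forest t \<T>" and ne: "X \<noteq> Y"
  then obtain K K' where K: "K \<in> \<T>" "K' \<in> \<T>" "X \<in> leaves (t K) K" "Y \<in> leaves (t K') K'"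
    unfolding forest_def by blast
  show "open_elem X \<inter> open_elem Y = {}"
  proof (cases "K = K'")
    case True
    then show ?thesis using leaves_disjoint[of K X "t K" Y] K ne assms unfolding mesh_def by auto
  next
    case False then show ?thesis using leaves_mesh_disjoint(1)[OF assms K(1,2)] K by blast
  qed
qed

lemma forest_leaf: "forest (\<lambda>_. Leaf) \<T> = \<T>"
  unfolding forest_def by auto

text \<open>\<open>sons_in\<close> asks for inclusion of open elements. A member of another tree
  fails this test, because its nonempty interior is disjoint from \<open>K\<close>; so the sons in
  the sense of the estimator are the leaves over \<open>K\<close>.\<close>

lemma sons_in_forest:
  assumes "mesh \<T>" "K \<in> \<T>" shows "sons_in (forest t \<T>) K = leaves (t K) K"
proof -
  have K: "tagged_simplex K" using assms by (auto simp: mesh_def)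
  have "X \<in> leaves (t K) K" if X: "X \<in> forest t \<T>" "open_elem X \<subseteq> open_elem K" for X
  proof -
    obtain K' where K': "K' \<in> \<T>" "X \<in> leaves (t K') K'" using X unfolding forest_def by blast
    have k': "tagged_simplex K'" using assms K' by (auto simp: mesh_def)
    have "K' = K"
      using leaves_mesh_disjoint(1)[OF assms(1) K'(1) assms(2) _ K'(2), of K Leaf] X(2)
        open_elem_nonempty[OF leaves_simplex[OF k' K'(2)]] by auto
    then show ?thesis using K' by simp
  qed
  moreover have "X \<in> forest t \<T> \<and> open_elem X \<subseteq> open_elem K" if "X \<in> leaves (t K) K" for X
    using leaves_open[OF K that] that assms(2) unfolding forest_def by blast
  ultimately show ?thesis unfolding sons_in_def by blast
qed

lemma forest_inj:
  assumes "mesh \<T>" "forest s \<T> = forest t \<T>" "K \<in> \<T>" shows "s K = t K"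
proof -
  have "leaves (s K) K = leaves (t K) K"
    using sons_in_forest[OF assms(1,3)] assms(2) by metis
  then show ?thesis using leaves_inj assms unfolding mesh_def by blast
qed

text \<open>A single bisection changes the tree of one element only. Starting from a forest instead
  of \<T> itself, and recording \<open>tle\<close>, turns a chain of refinements into a chain of
  trees over the same elements.\<close>

lemma nvb_forest:
  assumes "mesh \<T>" "nvb_refinement (forest t \<T>) \<T>'"
  shows "\<exists>t'. \<T>' = forest t' \<T> \<and> (\<forall>K. tle (t K) (t' K))"
  using assms(2) unfolding nvb_refinement_def
proof (induction rule: rtranclp_induct)
  case base then show ?case using tle_refl by blast
next
  case (step \<A> \<B>)
  then obtain t' where t': "\<A> = forest t' \<T>" "\<forall>K. tle (t K) (t' K)" by blast
  obtain X where X: "X \<in> \<A>" "\<B> = (\<A> - {X}) \<union> bisection_sons X"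
    using step(2) unfolding bisects_to_def by blast
  then obtain K where K: "K \<in> \<T>" "X \<in> leaves (t' K) K" using t' unfolding forest_def by blast
  have "tagged_simplex K" using K(1) assms(1) by (auto simp: mesh_def)
  from leaves_bisect[OF this K(2)]
  obtain s where s: "tle (t' K) s" "leaves s K = (leaves (t' K) K - {X}) \<union> bisection_sons X"
    by (elim exE conjE)
  have "X \<notin> leaves (t' K') K'" if "K' \<in> \<T>" "K' \<noteq> K" for K'
    using leaves_mesh_disjoint(2)[OF assms(1) K(1) that(1) _ K(2), of X "t' K'"] that by auto
  then have "\<B> = forest (t'(K := s)) \<T>"
    unfolding X(2) t'(1) forest_def using K s by (auto split: if_splits)
  moreover have "tle (t K') ((t'(K := s)) K')" for K'
    using t'(2)[rule_format, of K'] s(1) tle_trans[of "t K" "t' K" s] by (cases "K' = K") simp_all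
  ultimately show ?case by blast
qed

text \<open>The other elements \<C> are carried along because \<open>bisects_to\<close> acts on the
  whole mesh. Disjointness keeps the bisected simplex out of \<C>, so that removing it leaves them
  intact.\<close>

lemma nvb_leaves:
  "tagged_simplex K \<Longrightarrow> (\<And>X. X \<in> \<C> \<Longrightarrow> tagged_simplex X \<and> open_elem X \<inter> open_elem K = {}) \<Longrightarrow>
    nvb_refinement (insert K \<C>) (leaves t K \<union> \<C>)"
proof (induction t arbitrary: K \<C>)
  case Leaf
  then show ?case by (simp add: nvb_refinement_def)
next
  case (Node l r)
  note s = tagged_simplex_sons[OF Node.prems(1)]
  have sub: "open_elem (son1 K) \<subseteq> open_elem K" "open_elem (son2 K) \<subseteq> open_elem K"
    using open_elem_son1[OF Node.prems(1)] open_elem_son2[OF Node.prems(1)] by blast+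
  have "K \<notin> \<C>" using Node.prems(2)[of K] open_elem_nonempty[OF Node.prems(1)] by auto
  then have "bisects_to (insert K \<C>) (insert (son1 K) (insert (son2 K) \<C>))"
    unfolding bisects_to_def by (intro bexI[of _ K]) (auto simp: bisection_sons_eq)
  then have 1: "nvb_refinement (insert K \<C>) (insert (son1 K) (insert (son2 K) \<C>))"
    by (simp add: nvb_refinement_def)
  have 2: "nvb_refinement (insert (son1 K) (insert (son2 K) \<C>)) (leaves l (son1 K) \<union> insert (son2 K) \<C>)"
    by (rule Node.IH(1)[OF s(1)]) (use Node.prems s sub sons_open_disjoint[of K] in blast)
  have 3: "nvb_refinement (insert (son2 K) (leaves l (son1 K) \<union> \<C>)) (leaves r (son2 K) \<union> (leaves l (son1 K) \<union> \<C>))"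
  proof (rule Node.IH(2)[OF s(2)])
    fix X assume "X \<in> leaves l (son1 K) \<union> \<C>"
    then show "tagged_simplex X \<and> open_elem X \<inter> open_elem (son2 K) = {}"
    proof
      assume "X \<in> leaves l (son1 K)"
      then show ?thesis using leaves_simplex[OF s(1)]
          leaves_sons_disjoint(1)[OF Node.prems(1), of X l "son2 K" Leaf] by simp
    next
      assume "X \<in> \<C>"
      then show ?thesis using Node.prems(2)[of X] sub by blast
    qed
  qed
  have "leaves l (son1 K) \<union> insert (son2 K) \<C> = insert (son2 K) (leaves l (son1 K) \<union> \<C>)"
    "leaves r (son2 K) \<union> (leaves l (son1 K) \<union> \<C>) = leaves (Node l r) K \<union> \<C>" by auto
  with 1 2 3 show ?case unfolding nvb_refinement_def by (metis rtranclp_trans)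
qed

lemma forest_nvb:
  assumes "mesh \<T>" shows "nvb_refinement \<T> (forest t \<T>)"
proof -
  have fin: "finite \<T>" using assms by (simp add: mesh_def)
  \<comment> \<open>The set \<A> collects the elements whose trees have already been carried
    out.\<close>
  have "nvb_refinement \<T> (forest t \<A> \<union> (\<T> - \<A>))" if "finite \<A>" "\<A> \<subseteq> \<T>" for \<A>
    using that
  proof (induction \<A> rule: finite_induct)
    case empty then show ?case by (simp add: nvb_refinement_def forest_def)
  next
    case (insert K \<A>)
    let ?\<C> = "forest t \<A> \<union> (\<T> - insert K \<A>)"
    have K: "K \<in> \<T>" "tagged_simplex K" using insert.prems assms by (auto simp: mesh_def)
    have "nvb_refinement (insert K ?\<C>) (leaves (t K) K \<union> ?\<C>)"
    proof (rule nvb_leaves[OF K(2)])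
      fix X assume "X \<in> ?\<C>"
      then consider K' where "K' \<in> \<A>" "X \<in> leaves (t K') K'" | "X \<in> \<T>" "X \<noteq> K"
        unfolding forest_def by blast
      then show "tagged_simplex X \<and> open_elem X \<inter> open_elem K = {}"
      proof cases
        case 1
        then have k': "K' \<in> \<T>" "K' \<noteq> K" using insert by auto
        then have "open_elem X \<inter> open_elem K = {}"
          using leaves_mesh_disjoint(1)[OF assms k'(1) K(1) k'(2) 1(2), of K Leaf] by simp
        moreover have "tagged_simplex X" using leaves_simplex[OF _ 1(2)] k' assms by (auto simp: mesh_def)
        ultimately show ?thesis by blast
      next
        case 2 then show ?thesis using assms K unfolding mesh_def by blast
      qed
    qed
    moreover have "insert K ?\<C> = forest t \<A> \<union> (\<T> - \<A>)" using insert K by auto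
    moreover have "leaves (t K) K \<union> ?\<C> = forest t (insert K \<A>) \<union> (\<T> - insert K \<A>)"
      unfolding forest_def by auto
    ultimately show ?case using insert unfolding nvb_refinement_def by (metis rtranclp_trans insert_subset)
  qed
  from this[OF fin] show ?thesis by simp
qed

lemma nvb_refinement_iff_forest:
  "mesh \<T> \<Longrightarrow> nvb_refinement \<T> \<T>' \<longleftrightarrow> (\<exists>t. \<T>' = forest t \<T>)"
  using nvb_forest[of \<T> "\<lambda>_. Leaf"] forest_nvb forest_leaf by metis

text \<open>Over each element the trees satisfy t <= t' <= t'', and t = t'' because they have the
  same leaves. This is the uniqueness behind the definite description in
  \<open>refine\<close>.\<close>

lemma nvb_antisym:
  assumes "mesh \<T>" "nvb_refinement \<T> \<A>" "nvb_refinement \<A> \<B>" "nvb_refinement \<B> \<A>"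
  shows "\<A> = \<B>"
proof -
  obtain t where t: "\<A> = forest t \<T>" using nvb_refinement_iff_forest assms by blast
  obtain t' where t': "\<B> = forest t' \<T>" "\<And>K. tle (t K) (t' K)" using nvb_forest assms t by blast
  obtain t'' where t'': "\<A> = forest t'' \<T>" "\<And>K. tle (t' K) (t'' K)" using nvb_forest assms t' by blast
  have "t' K = t K" if "K \<in> \<T>" for K
    using forest_inj[OF assms(1), of t t'' K] t t'' t'(2) that tle_antisym by metis
  then show ?thesis unfolding t t' forest_def by auto
qed

section \<open>Conformity in terms of barycentric coordinates\<close>

text \<open>A vertex of \<open>K\<close> that \<open>K'\<close> lacks has coordinate 0 with respect
  to \<open>K'\<close>, by the convention for \<open>bary\<close>. So the equation also forces a
  common point onto the face spanned by the common vertices.\<close>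

definition compatible :: "'a::euclidean_space tagged set \<Rightarrow> bool" where
  "compatible \<T> \<longleftrightarrow> (\<forall>K\<in>\<T>. \<forall>K'\<in>\<T>. \<forall>x\<in>closed_elem K \<inter> closed_elem K'. \<forall>z. lam K z x = lam K' z x)"

lemma bary_convex_hull_subset:
  assumes "vertex_set S" "C \<subseteq> S" "finite C" "\<forall>x\<in>C. 0 \<le> u x" "sum u C = 1" "(\<Sum>v\<in>C. u v *\<^sub>R v) = x"
  shows "bary S z x = (if z \<in> C then u z else 0)"
proof -
  have fin: "finite S" using assms by (simp add: vertex_set_def)
  let ?u = "\<lambda>v. if v \<in> C then u v else 0"
  have "sum ?u S = 1" "(\<Sum>v\<in>S. ?u v *\<^sub>R v) = x"
    using fin assms by (auto simp: sum.inter_restrict[symmetric] Int_absorb1 if_distrib[of "\<lambda>t. t *\<^sub>R _"] cong: if_cong)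
  then show ?thesis using bary_of_comb[OF assms(1), of ?u x z] bary_notin[OF assms(1), of z x] assms(2)
    by (cases "z \<in> S") auto
qed

text \<open>The intersection of two elements is a face of both, hence the hull of a subset of either
  vertex set. The two subsets are the extreme points of the same set and coincide, so both elements
  assign the same coordinates there.\<close>

lemma conforming_mesh_compatible:
  assumes "conforming \<T>" shows "mesh \<T> \<and> compatible \<T>"
proof
  have ts: "\<And>K. K \<in> \<T> \<Longrightarrow> tagged_simplex K" and tr: "triangulation (closed_elem ` \<T>)"
    and inj: "inj_on closed_elem \<T>" and fin: "finite \<T>"
    using assms by (auto simp: conforming_def)
  have face: "(closed_elem K \<inter> closed_elem K') face_of closed_elem K \<and> (closed_elem K \<inter> closed_elem K') face_of closed_elem K'"
    if "K \<in> \<T>" "K' \<in> \<T>" for K K'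
  proof -
    have "\<And>A B. A \<in> closed_elem ` \<T> \<Longrightarrow> B \<in> closed_elem ` \<T> \<Longrightarrow> (A \<inter> B) face_of A"
      using tr unfolding triangulation_def by simp
    then show ?thesis using that by (metis imageI inf_commute)
  qed
  show "mesh \<T>" unfolding mesh_def
  proof (intro conjI ballI impI)
    fix K K' assume K: "K \<in> \<T>" "K' \<in> \<T>" "K \<noteq> K'"
    show "open_elem K \<inter> open_elem K' = {}"
    proof (rule ccontr)
      let ?I = "closed_elem K \<inter> closed_elem K'"
      assume "open_elem K \<inter> open_elem K' \<noteq> {}"
      then have "?I \<inter> interior (closed_elem K) \<noteq> {}" "?I \<inter> interior (closed_elem K') \<noteq> {}"
        using interior_subset unfolding open_elem_def by blast+
      \<comment> \<open>A face that meets the interior is the whole set; two different elements with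
        the same closure are excluded by \<open>inj_on\<close>.\<close>
      then have "?I = closed_elem K" "?I = closed_elem K'"
        using face[OF K(1,2)] face_of_disjoint_interior by blast+
      then show False using inj K unfolding inj_on_def by blast
    qed
  qed (use ts fin in auto)
  show "compatible \<T>" unfolding compatible_def
  proof (intro ballI allI)
    fix K K' x z assume K: "K \<in> \<T>" "K' \<in> \<T>" and x: "x \<in> closed_elem K \<inter> closed_elem K'"
    let ?I = "closed_elem K \<inter> closed_elem K'"
    note vs = vertex_set_vertices[OF ts[OF K(1)]] vertex_set_vertices[OF ts[OF K(2)]]
    have ind: "\<not> affine_dependent (vertices K)" "\<not> affine_dependent (vertices K')"
      using vs unfolding vertex_set_def by auto
    obtain C where C: "C \<subseteq> vertices K" "?I = convex hull C"
      using face[OF K] face_of_convex_hull_affine_independent[OF ind(1)] unfolding closed_elem_def by blast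
    obtain C' where C': "C' \<subseteq> vertices K'" "?I = convex hull C'"
      using face[OF K] face_of_convex_hull_affine_independent[OF ind(2)] unfolding closed_elem_def by blast
    have "\<not> affine_dependent C" "\<not> affine_dependent C'"
      using ind C C' affine_dependent_subset by blast+
    then have "x \<in> C \<longleftrightarrow> x \<in> C'" for x
      using extreme_point_of_convex_hull_affine_independent C(2) C'(2) by metis
    then have "C = C'" by blast
    have fin: "finite C" using C(1) vs(1) finite_subset unfolding vertex_set_def by blast
    then obtain u where u: "\<forall>v\<in>C. 0 \<le> u v" "sum u C = 1" "(\<Sum>v\<in>C. u v *\<^sub>R v) = x"
      using x unfolding C(2) convex_hull_finite[OF fin] by blast
    show "lam K z x = lam K' z x"
      using bary_convex_hull_subset[OF vs(1) C(1) fin u] bary_convex_hull_subset[OF vs(2) _ fin u]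
        C'(1) \<open>C = C'\<close> by simp
  qed
qed

lemma compatible_Int:
  assumes "mesh \<T>" "compatible \<T>" "K \<in> \<T>" "K' \<in> \<T>"
  shows "closed_elem K \<inter> closed_elem K' = convex hull (vertices K \<inter> vertices K')"
proof
  have ts: "tagged_simplex K" "tagged_simplex K'" using assms by (auto simp: mesh_def)
  note vs = vertex_set_vertices[OF ts(1)] vertex_set_vertices[OF ts(2)]
  show "convex hull (vertices K \<inter> vertices K') \<subseteq> closed_elem K \<inter> closed_elem K'"
    unfolding closed_elem_def by (simp add: hull_mono)
  show "closed_elem K \<inter> closed_elem K' \<subseteq> convex hull (vertices K \<inter> vertices K')"
  proof
    fix x assume x: "x \<in> closed_elem K \<inter> closed_elem K'"
    have eq: "lam K z x = lam K' z x" for z using assms x unfolding compatible_def by blast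
    have fin: "finite (vertices K)" by (simp add: vertices_def)
    have z: "lam K z x = 0" if "z \<in> vertices K - vertices K \<inter> vertices K'" for z
      using that eq[of z] bary_notin[OF vs(2), of z x] by auto
    have "(\<Sum>z\<in>vertices K \<inter> vertices K'. lam K z x) = 1"
      "(\<Sum>z\<in>vertices K \<inter> vertices K'. lam K z x *\<^sub>R z) = x"
      using bary_sum[OF vs(1), of x] bary_comb[OF vs(1), of x] z
      by (subst sum.mono_neutral_left[OF fin]; auto)+
    moreover have "0 \<le> lam K z x" for z using x closed_elem_iff[OF ts(1)] by auto
    ultimately show "x \<in> convex hull (vertices K \<inter> vertices K')"
      using fin by (subst convex_hull_finite) (auto intro!: exI[of _ "\<lambda>z. lam K z x"])
  qed
qed

lemma mesh_compatible_conforming: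
  fixes \<T> :: "'a::euclidean_space tagged set"
  assumes "mesh \<T>" "compatible \<T>" shows "conforming \<T>"
  unfolding conforming_def triangulation_def
proof (intro conjI ballI allI impI)
  have ts: "\<And>K. K \<in> \<T> \<Longrightarrow> tagged_simplex K" using assms by (auto simp: mesh_def)
  show "inj_on closed_elem \<T>"
  proof (rule inj_onI, rule ccontr)
    fix K K' assume K: "K \<in> \<T>" "K' \<in> \<T>" "closed_elem K = closed_elem K'" "K \<noteq> K'"
    then have "open_elem K \<inter> open_elem K = {}" using assms(1) unfolding mesh_def open_elem_def by metis
    then show False using open_elem_nonempty[OF ts[OF K(1)]] by simp
  qed
  fix A assume "A \<in> closed_elem ` \<T>"
  then obtain K where K: "K \<in> \<T>" "A = closed_elem K" by blast
  then show "\<exists>n. n simplex A"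
    using ts[OF K(1)] unfolding simplex K(2) closed_elem_def tagged_simplex_def
    by (intro exI[of _ "int (card (vertices K)) - 1"] exI[of _ "vertices K"]) (auto simp: vertices_def)
next
  fix A B assume "A \<in> closed_elem ` \<T> \<and> B \<in> closed_elem ` \<T>"
  then obtain K K' where K: "K \<in> \<T>" "A = closed_elem K" "K' \<in> \<T>" "B = closed_elem K'" by blast
  have "\<not> affine_dependent (vertices K)" "\<not> affine_dependent (vertices K')"
    using assms(1) K unfolding mesh_def tagged_simplex_def by auto
  then show "A \<inter> B face_of A"
    using compatible_Int[OF assms K(1,3)] face_of_convex_hull_affine_independent K
    unfolding closed_elem_def by (metis inf_le1)
qed (use assms in \<open>auto simp: mesh_def\<close>)

text \<open>The coordinate of \<open>z\<close> at \<open>z\<close> is 1 in the element that has it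
  as a vertex, hence also in \<open>K\<close>, and only vertices have nonzero coordinates. In this
  form hanging nodes are excluded throughout.\<close>

lemma node_in_closed_elem:
  assumes "mesh \<T>" "compatible \<T>" "K \<in> \<T>" "z \<in> nodes \<T>" "z \<in> closed_elem K"
  shows "z \<in> vertices K"
proof -
  obtain K' where K': "K' \<in> \<T>" "z \<in> vertices K'" using assms(4) unfolding nodes_def by blast
  have ts: "tagged_simplex K" "tagged_simplex K'" using assms K' by (auto simp: mesh_def)
  note vs = vertex_set_vertices[OF ts(1)] vertex_set_vertices[OF ts(2)]
  have "z \<in> closed_elem K'" using K'(2) unfolding closed_elem_def by (simp add: hull_inc)
  then have "lam K z z = lam K' z z" using assms K' unfolding compatible_def by blast
  also have "\<dots> = 1" using K' bary_vertex[OF vs(2)] by simp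
  finally show ?thesis using bary_notin[OF vs(1), of z z] by auto
qed

lemma nodes_forest: "mesh \<T> \<Longrightarrow> nodes \<T> \<subseteq> nodes (forest t \<T>)"
  unfolding nodes_def forest_def mesh_def using leaves_vertices by fastforce

section \<open>Bisections acting on coordinates\<close>

text \<open>With \<open>t\<close> the smaller value, \<open>v a - t\<close> and
  \<open>v b - t\<close> are the positive parts of the two differences. The value at the midpoint is
  increased, not set, so that the step is the identity when \<open>t\<close> is 0.\<close>

fun vstep :: "'a::euclidean_space \<times> 'a \<Rightarrow> ('a \<Rightarrow> real) \<Rightarrow> 'a \<Rightarrow> real" where
  "vstep (a, b) v = (let t = min (v a) (v b) in
     v(a := v a - t, b := v b - t, midpoint a b := v (midpoint a b) + 2 * t))"

definition vrun :: "('a::euclidean_space \<times> 'a) list \<Rightarrow> ('a \<Rightarrow> real) \<Rightarrow> 'a \<Rightarrow> real" where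
  "vrun P v = fold vstep P v"

lemma vrun_simps [simp]: "vrun [] v = v" "vrun (e # P) v = vrun P (vstep e v)"
  by (simp_all add: vrun_def)

lemma vstep_sym: "vstep (a, b) v = vstep (b, a) v"
  by (auto simp: Let_def fun_eq_iff min.commute midpoint_sym)

lemma vstep_id: "min (v a) (v b) = 0 \<Longrightarrow> vstep (a, b) v = v"
  by (auto simp: Let_def)

lemma vstep_nonneg: "\<forall>z. 0 \<le> v z \<Longrightarrow> 0 \<le> vstep e v z"
  by (cases e) (auto simp: Let_def add_nonneg_nonneg)

text \<open>The son that contains \<open>x\<close> is the one at the endpoint with the larger
  coordinate, and the minimum in \<open>vstep\<close> makes the same distinction; so one formula
  serves both sons.\<close>

lemma vstep_bisect:
  assumes K: "tagged_simplex K" and x: "x \<in> closed_elem Y" and Y: "Y \<in> {son1 K, son2 K}"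
    and e: "e = (end1 K, end2 K) \<or> e = (end2 K, end1 K)"
  shows "vstep e (\<lambda>z. lam K z x) = (\<lambda>z. lam Y z x)"
proof -
  let ?v = "\<lambda>z. lam K z x"
  have e': "vstep e ?v = vstep (end1 K, end2 K) ?v" using e vstep_sym by metis
  have m: "midpoint (end1 K) (end2 K) = mid_pt K" by (simp add: mid_pt_def)
  have ne: "end1 K \<noteq> end2 K" "mid_pt K \<noteq> end1 K" "mid_pt K \<noteq> end2 K"
    using end_vertices[OF K] mid_pt_notin[OF K] by metis+
  have m0: "lam K (mid_pt K) x = 0"
    using bary_notin[OF vertex_set_vertices[OF K] mid_pt_notin[OF K]] .
  show ?thesis
  proof
    fix z
    show "vstep e ?v z = lam Y z x"
    proof (cases "Y = son1 K")
      case True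
      then have "lam K (end2 K) x \<le> lam K (end1 K) x" using x closed_elem_son1[OF K] by simp
      then show ?thesis unfolding e' True using ne m0 lam_son1[OF K, where x=x]
        by (auto simp: Let_def m)
    next
      case False
      then have Y2: "Y = son2 K" using Y by simp
      then have "lam K (end1 K) x \<le> lam K (end2 K) x" using x closed_elem_son2[OF K] by simp
      then show ?thesis unfolding e' Y2 using ne m0 lam_son2[OF K, where x=x]
        by (auto simp: Let_def m)
    qed
  qed
qed

text \<open>An element without one of the endpoints has coordinate 0 there, so a step meant for
  other elements leaves it alone. This permits one list of edges for all branches of a tree.\<close>

lemma vstep_skip:
  assumes K: "tagged_simplex K" and x: "x \<in> closed_elem K" and "\<not> (a \<in> vertices K \<and> b \<in> vertices K)"
  shows "vstep (a, b) (\<lambda>z. lam K z x) = (\<lambda>z. lam K z x)"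
proof (rule vstep_id)
  have "0 \<le> lam K a x" "0 \<le> lam K b x" using x closed_elem_iff[OF K] by auto
  moreover have "lam K a x = 0 \<or> lam K b x = 0"
    using assms(3) bary_notin[OF vertex_set_vertices[OF K]] by blast
  ultimately show "min (lam K a x) (lam K b x) = 0" by auto
qed

text \<open>\<open>A\<close> stands for the affine hull of a face. A point of the face has no
  coordinates outside \<open>A\<close>; a step with an endpoint outside does nothing, and closure
  under midpoints keeps the others inside.\<close>

lemma vrun_filter:
  assumes "\<forall>(a, b)\<in>set P. a \<in> A \<and> b \<in> A \<longrightarrow> midpoint a b \<in> A"
    "\<forall>z. 0 \<le> v z" "\<forall>z. z \<notin> A \<longrightarrow> v z = 0"
  shows "vrun P v = vrun (filter (\<lambda>(a, b). a \<in> A \<and> b \<in> A) P) v"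
  using assms
proof (induction P arbitrary: v)
  case (Cons e P)
  obtain a b where e: "e = (a, b)" by (cases e)
  show ?case
  proof (cases "a \<in> A \<and> b \<in> A")
    case True
    have "vrun P (vstep e v) = vrun (filter (\<lambda>(a, b). a \<in> A \<and> b \<in> A) P) (vstep e v)"
    proof (rule Cons.IH)
      show "\<forall>z. z \<notin> A \<longrightarrow> vstep e v z = 0"
        using Cons.prems True unfolding e by (auto simp: Let_def)
      show "\<forall>z. 0 \<le> vstep e v z" using vstep_nonneg[OF Cons.prems(2)] by blast
    qed (use Cons.prems(1) in simp)
    then show ?thesis using True e by simp
  next
    case False
    then have "min (v a) (v b) = 0" using Cons.prems(2,3) by (metis min_def order_antisym)
    then have "vstep e v = v" unfolding e by (rule vstep_id)
    then show ?thesis using Cons False e by simp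
  qed
qed simp

definition same_edge :: "'b \<times> 'b \<Rightarrow> 'b \<times> 'b \<Rightarrow> bool" where
  "same_edge e f \<longleftrightarrow> e = f \<or> (fst e = snd f \<and> snd e = fst f)"

lemma vrun_same_edges: "list_all2 same_edge P Q \<Longrightarrow> vrun P v = vrun Q v"
proof (induction P Q arbitrary: v rule: list_all2_induct)
  case (Cons e P f Q)
  have "vstep e v = vstep f v"
    using Cons(1) vstep_sym unfolding same_edge_def by (metis prod.collapse)
  then show ?case using Cons by simp
qed simp

text \<open>The bisections of a facet \<open>pqr\<close> of a tetrahedron under uniform refinement, with first edge \<open>pq\<close>.\<close>

definition facet_prog :: "'a::euclidean_space \<Rightarrow> 'a \<Rightarrow> 'a \<Rightarrow> ('a \<times> 'a) list" where
  "facet_prog p q r = [(p, q), (p, r), (q, r), (midpoint p q, r)]"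

text \<open>After the cut of \<open>pq\<close> the coordinate of \<open>p\<close> or of
  \<open>q\<close> is 0, and then one of the cuts of \<open>pr\<close> and \<open>qr\<close> does
  nothing; so these two commute. The last two assumptions keep the remaining cut from refilling the
  vanished coordinate.\<close>

lemma facet_prog_swap:
  assumes "\<forall>z. 0 \<le> v z" "p \<noteq> q" "p \<noteq> r" "q \<noteq> r" "p \<noteq> midpoint q r" "q \<noteq> midpoint p r"
  shows "vrun (facet_prog p q r) v = vrun [(p, q), (q, r), (p, r), (midpoint p q, r)] v"
proof -
  define w where "w = vstep (p, q) v"
  have w: "0 \<le> w z" for z unfolding w_def using vstep_nonneg assms(1) by blast
  have m: "midpoint p q \<noteq> p" "midpoint p q \<noteq> q" "p \<noteq> midpoint p q" "q \<noteq> midpoint p q"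
    using assms(2) midpoint_eq_endpoint by metis+
  have "w p = 0 \<or> w q = 0" unfolding w_def using assms(2) m by (auto simp: Let_def min_def)
  then have "vstep (q, r) (vstep (p, r) w) = vstep (p, r) (vstep (q, r) w)"
  proof
    assume "w p = 0"
    then have 1: "min (w p) (w r) = 0" using w by simp
    have "vstep (q, r) w p = 0" using \<open>w p = 0\<close> assms by (simp add: Let_def)
    then have 2: "min (vstep (q, r) w p) (vstep (q, r) w r) = 0" using vstep_nonneg[of w] w by (simp del: vstep.simps)
    show ?thesis unfolding vstep_id[of w, OF 1] vstep_id[of "vstep (q, r) w", OF 2] ..
  next
    assume "w q = 0"
    then have 1: "min (w q) (w r) = 0" using w by simp
    have "vstep (p, r) w q = 0" using \<open>w q = 0\<close> assms by (simp add: Let_def)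
    then have 2: "min (vstep (p, r) w q) (vstep (p, r) w r) = 0" using vstep_nonneg[of w] w by (simp del: vstep.simps)
    show ?thesis unfolding vstep_id[of w, OF 1] vstep_id[of "vstep (p, r) w", OF 2] ..
  qed
  then show ?thesis unfolding facet_prog_def w_def by (simp del: vstep.simps)
qed

lemma facet_prog_commute:
  assumes "\<forall>z. 0 \<le> v z" "p \<noteq> q" "p \<noteq> r" "q \<noteq> r" "p \<noteq> midpoint q r" "q \<noteq> midpoint p r"
  shows "vrun (facet_prog p q r) v = vrun (facet_prog q p r) v"
  unfolding facet_prog_swap[OF assms] unfolding facet_prog_def
  by (rule vrun_same_edges) (auto simp: same_edge_def midpoint_sym)

text \<open>The nodes of a refined simplex are encoded by their barycentric coordinates, scaled by 4;
  this is enough for two nested midpoints. Type, vertex order and bisections carry over; the prefix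
  \<open>s\<close> stands for symbolic.\<close>

type_synonym snode = "nat list"
type_synonym ssimplex = "nat list list \<times> nat"

definition smid :: "snode \<Rightarrow> snode \<Rightarrow> snode" where
  "smid a b = map2 (\<lambda>x y. (x + y) div 2) a b"

definition sson1 :: "nat \<Rightarrow> ssimplex \<Rightarrow> ssimplex" where
  "sson1 d X = ([hd (fst X), smid (hd (fst X)) (last (fst X))] @ butlast (tl (fst X)), (snd X + 1) mod d)"

definition sson2 :: "nat \<Rightarrow> ssimplex \<Rightarrow> ssimplex" where
  "sson2 d X = ([last (fst X), smid (hd (fst X)) (last (fst X))] @ take (snd X) (butlast (tl (fst X)))
     @ rev (drop (snd X) (butlast (tl (fst X)))), (snd X + 1) mod d)"

definition snode_ok :: "nat \<Rightarrow> snode \<Rightarrow> bool" where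
  "snode_ok d c \<longleftrightarrow> length c = d + 1 \<and> sum_list c = 4"

definition ssimplex_ok :: "nat \<Rightarrow> ssimplex \<Rightarrow> bool" where
  "ssimplex_ok d X \<longleftrightarrow> list_all (snode_ok d) (fst X) \<and> 2 \<le> length (fst X)"

text \<open>Guards the truncating \<open>div\<close> in \<open>smid\<close>: for entries of equal
  parity the symbolic midpoint is exact.\<close>

definition even_edge :: "snode \<Rightarrow> snode \<Rightarrow> bool" where
  "even_edge a b \<longleftrightarrow> list_all even (map2 (+) a b)"

primrec sleaves :: "nat \<Rightarrow> btree \<Rightarrow> ssimplex \<Rightarrow> ssimplex list" where
  "sleaves d Leaf X = [X]"
| "sleaves d (Node l r) X = sleaves d l (sson1 d X) @ sleaves d r (sson2 d X)"

primrec tree_ok :: "nat \<Rightarrow> btree \<Rightarrow> ssimplex \<Rightarrow> bool" where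
  "tree_ok d Leaf X = ssimplex_ok d X"
| "tree_ok d (Node l r) X = (ssimplex_ok d X \<and> even_edge (hd (fst X)) (last (fst X)) \<and>
     tree_ok d l (sson1 d X) \<and> tree_ok d r (sson2 d X))"

definition sstep :: "nat \<Rightarrow> snode \<times> snode \<Rightarrow> ssimplex list \<Rightarrow> ssimplex list" where
  "sstep d e Xs = concat (map (\<lambda>X. if fst e \<in> set (fst X) \<and> snd e \<in> set (fst X)
     then [sson1 d X, sson2 d X] else [X]) Xs)"

text \<open>The essential condition is that every current simplex with both endpoints has them as
  its refinement edge. Then cutting the edge wherever it occurs consists of NVB bisections
  only.\<close>

fun step_ok :: "nat \<Rightarrow> snode \<times> snode \<Rightarrow> ssimplex list \<Rightarrow> bool" where
  "step_ok d (a, b) Xs \<longleftrightarrow> snode_ok d a \<and> snode_ok d b \<and> even_edge a b \<and>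
     list_all (\<lambda>X. ssimplex_ok d X \<and> (a \<in> set (fst X) \<and> b \<in> set (fst X) \<longrightarrow>
       (hd (fst X) = a \<and> last (fst X) = b \<or> hd (fst X) = b \<and> last (fst X) = a))) Xs"

primrec prog_ok :: "nat \<Rightarrow> (snode \<times> snode) list \<Rightarrow> ssimplex list \<Rightarrow> bool" where
  "prog_ok d [] Xs = True"
| "prog_ok d (e # P) Xs = (step_ok d e Xs \<and> prog_ok d P (sstep d e Xs))"

definition srun :: "nat \<Rightarrow> (snode \<times> snode) list \<Rightarrow> ssimplex list \<Rightarrow> ssimplex list" where
  "srun d P Xs = fold (sstep d) P Xs"

definition sunit :: "nat \<Rightarrow> nat \<Rightarrow> snode" where
  "sunit d i = map (\<lambda>j. if j = i then 4 else 0) [0..<d+1]"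

definition sroot :: "nat \<Rightarrow> nat \<Rightarrow> ssimplex" where
  "sroot d \<beta> = (map (sunit d) [0..<d+1], \<beta>)"

section \<open>Realisation of symbolic simplices in a tagged element\<close>

definition pt :: "'a::euclidean_space tagged \<Rightarrow> snode \<Rightarrow> 'a" where
  "pt K c = (\<Sum>i<length (fst K). (real (c ! i) / 4) *\<^sub>R (fst K ! i))"

definition rl :: "'a::euclidean_space tagged \<Rightarrow> ssimplex \<Rightarrow> 'a tagged" where
  "rl K X = (map (pt K) (fst X), snd X)"

abbreviation ptp :: "'a::euclidean_space tagged \<Rightarrow> snode \<times> snode \<Rightarrow> 'a \<times> 'a" where
  "ptp K \<equiv> map_prod (pt K) (pt K)"

context
  fixes K :: "'a::euclidean_space tagged"
  assumes K: "tagged_simplex K"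
begin

lemma len_K: "length (fst K) = DIM('a) + 1" using K by (simp add: tagged_simplex_def)

lemma nth_K: "i < DIM('a) + 1 \<Longrightarrow> fst K ! i \<in> vertices K"
  using len_K by (simp add: vertices_def)

lemma sum_vertices: "(\<Sum>v\<in>vertices K. f v) = (\<Sum>i<length (fst K). f (fst K ! i))"
proof -
  have "bij_betw ((!) (fst K)) {..<length (fst K)} (vertices K)"
    unfolding vertices_def using K by (intro bij_betw_nth) (auto simp: tagged_simplex_def)
  then show ?thesis by (rule sum.reindex_bij_betw[symmetric])
qed

lemma lam_pt:
  assumes "snode_ok DIM('a) c" "i < DIM('a) + 1"
  shows "lam K (fst K ! i) (pt K c) = real (c ! i) / 4"
proof -
  have dist: "distinct (fst K)" using K by (simp add: tagged_simplex_def)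
  define idx where "idx = the_inv_into {..<length (fst K)} ((!) (fst K))"
  have inj: "inj_on ((!) (fst K)) {..<length (fst K)}" using dist by (simp add: inj_on_nth)
  have idx: "idx (fst K ! j) = j" if "j < length (fst K)" for j
    unfolding idx_def using the_inv_into_f_f[OF inj, of j] that by simp
  let ?u = "\<lambda>v. real (c ! idx v) / 4"
  have "sum_list c = (\<Sum>j<length (fst K). c ! j)"
    using assms(1) len_K by (simp add: snode_ok_def sum_list_sum_nth atLeast0LessThan)
  then have "(\<Sum>j<length (fst K). real (c ! j)) = 4" using assms(1) unfolding snode_ok_def by (metis of_nat_numeral of_nat_sum)
  then have "sum ?u (vertices K) = 1"
    unfolding sum_vertices using idx by (simp add: sum_divide_distrib[symmetric])
  moreover have "(\<Sum>v\<in>vertices K. ?u v *\<^sub>R v) = pt K c"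
    unfolding sum_vertices pt_def using idx by simp
  ultimately show ?thesis
    using bary_of_comb[OF vertex_set_vertices[OF K], of ?u "pt K c" "fst K ! i"] nth_K assms(2) idx[of i] len_K
    by simp
qed

lemma pt_inj:
  assumes "snode_ok DIM('a) a" "snode_ok DIM('a) b" "pt K a = pt K b" shows "a = b"
proof (rule nth_equalityI)
  show "length a = length b" using assms by (simp add: snode_ok_def)
  fix i assume "i < length a"
  then have i: "i < DIM('a) + 1" using assms by (simp add: snode_ok_def)
  show "a ! i = b ! i" using lam_pt[OF assms(1) i] lam_pt[OF assms(2) i] assms(3) by simp
qed

lemma pt_smid:
  assumes "snode_ok DIM('a) a" "snode_ok DIM('a) b" "even_edge a b"
  shows "pt K (smid a b) = midpoint (pt K a) (pt K b)"
proof -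
  have l: "length a = length (fst K)" "length b = length (fst K)"
    using assms len_K by (auto simp: snode_ok_def)
  have "real (smid a b ! i) / 4 = (real (a ! i) / 4 + real (b ! i) / 4) / 2" if "i < length (fst K)" for i
  proof -
    have "even (a ! i + b ! i)" using assms(3) l that unfolding even_edge_def
      by (simp add: list_all_length)
    then have "real ((a ! i + b ! i) div 2) = (real (a ! i) + real (b ! i)) / 2"
      by (simp add: real_of_nat_div)
    then show ?thesis using l that unfolding smid_def by (simp add: field_simps)
  qed
  then have "pt K (smid a b) =
      (\<Sum>i<length (fst K). (1 / 2) *\<^sub>R ((real (a ! i) / 4) *\<^sub>R (fst K ! i) + (real (b ! i) / 4) *\<^sub>R (fst K ! i)))"
    unfolding pt_def by (intro sum.cong refl) (simp add: scaleR_add_left[symmetric])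
  then show ?thesis unfolding pt_def midpoint_def
    by (simp only: scaleR_sum_right[symmetric] sum.distrib inverse_eq_divide)
qed

lemma rl_root: "rl K (sroot DIM('a) (snd K)) = K"
proof -
  have "pt K (sunit DIM('a) i) = fst K ! i" if "i < DIM('a) + 1" for i
  proof -
    have "pt K (sunit DIM('a) i) = (\<Sum>j<length (fst K). (if j = i then fst K ! j else 0))"
      unfolding pt_def sunit_def len_K
      by (intro sum.cong) (auto simp del: upt_Suc simp: nth_map_upt)
    then show ?thesis using that len_K by (simp add: sum.delta)
  qed
  then have "map (pt K) (map (sunit DIM('a)) [0..<DIM('a)+1]) = fst K"
    by (intro nth_equalityI) (auto simp: len_K simp del: upt_Suc)
  then show ?thesis unfolding rl_def sroot_def by (metis fst_conv prod.collapse snd_conv)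
qed

lemma rl_sons:
  assumes "ssimplex_ok DIM('a) X" "even_edge (hd (fst X)) (last (fst X))"
  shows "son1 (rl K X) = rl K (sson1 DIM('a) X)" "son2 (rl K X) = rl K (sson2 DIM('a) X)"
    "mid_pt (rl K X) = pt K (smid (hd (fst X)) (last (fst X)))"
    "end1 (rl K X) = pt K (hd (fst X))" "end2 (rl K X) = pt K (last (fst X))"
proof -
  have ne: "fst X \<noteq> []" using assms by (auto simp: ssimplex_ok_def)
  show e: "end1 (rl K X) = pt K (hd (fst X))" "end2 (rl K X) = pt K (last (fst X))"
    using ne by (simp_all add: end1_def end2_def rl_def hd_map last_map)
  have "snode_ok DIM('a) (hd (fst X))" "snode_ok DIM('a) (last (fst X))"
    using assms ne by (auto simp: ssimplex_ok_def list_all_iff)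
  then show m: "mid_pt (rl K X) = pt K (smid (hd (fst X)) (last (fst X)))"
    unfolding mid_pt_def e using pt_smid assms(2) by simp
  show "son1 (rl K X) = rl K (sson1 DIM('a) X)" "son2 (rl K X) = rl K (sson2 DIM('a) X)"
    unfolding son1_def son2_def m e unfolding rl_def sson1_def sson2_def
    by (simp_all only: map_tl map_butlast take_map[symmetric] drop_map[symmetric] rev_map[symmetric]
        map_append list.map fst_conv snd_conv)
qed

lemma leaves_rl:
  "tree_ok DIM('a) t X \<Longrightarrow> leaves t (rl K X) = rl K ` set (sleaves DIM('a) t X)"
proof (induction t arbitrary: X)
  case (Node l r)
  then show ?case using rl_sons by (auto simp: image_Un)
qed simp

lemma vertices_rl: "vertices (rl K X) = pt K ` set (fst X)"
  by (simp add: vertices_def rl_def)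

lemma pt_in_vertices_rl:
  "ssimplex_ok DIM('a) X \<Longrightarrow> snode_ok DIM('a) c \<Longrightarrow> pt K c \<in> vertices (rl K X) \<longleftrightarrow> c \<in> set (fst X)"
  using pt_inj unfolding vertices_rl ssimplex_ok_def list_all_iff by blast

text \<open>Invariant of the run: all current simplices that contain \<open>x\<close> assign the
  same coordinates \<open>v\<close> to it. Bisected simplices follow \<open>vstep_bisect\<close>,
  the others \<open>vstep_skip\<close>, and both lead to the same new function.\<close>

lemma step_rl:
  assumes "step_ok DIM('a) e Xs" "\<forall>X\<in>set Xs. tagged_simplex (rl K X)"
    "\<forall>X\<in>set Xs. x \<in> closed_elem (rl K X) \<longrightarrow> (\<lambda>z. lam (rl K X) z x) = v"
    "Y \<in> set (sstep DIM('a) e Xs)"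
  shows "tagged_simplex (rl K Y) \<and> (x \<in> closed_elem (rl K Y) \<longrightarrow> (\<lambda>z. lam (rl K Y) z x) = vstep (ptp K e) v)"
proof -
  obtain a b where e: "e = (a, b)" by (cases e)
  obtain X where X: "X \<in> set Xs" "Y \<in> set (if a \<in> set (fst X) \<and> b \<in> set (fst X)
     then [sson1 DIM('a) X, sson2 DIM('a) X] else [X])"
    using assms(4) unfolding sstep_def e set_concat set_map image_image fst_conv snd_conv by (elim UN_E)
  have ab: "snode_ok DIM('a) a" "snode_ok DIM('a) b" "even_edge a b" using assms(1) e by auto
  have ok: "ssimplex_ok DIM('a) X" "a \<in> set (fst X) \<and> b \<in> set (fst X) \<longrightarrow>
       (hd (fst X) = a \<and> last (fst X) = b \<or> hd (fst X) = b \<and> last (fst X) = a)"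
    using assms(1) X(1) unfolding e by (auto simp: list_all_iff)
  have ts: "tagged_simplex (rl K X)" using assms(2) X by blast
  show ?thesis
  proof (cases "a \<in> set (fst X) \<and> b \<in> set (fst X)")
    case True
    have ab2: "hd (fst X) = a \<and> last (fst X) = b \<or> hd (fst X) = b \<and> last (fst X) = a"
      using ok(2) True by blast
    have "even_edge (hd (fst X)) (last (fst X))"
      using ab2
    proof
      assume "hd (fst X) = b \<and> last (fst X) = a"
      moreover have "map2 (+) b a = map2 (+) a b"
        using ab by (auto simp: snode_ok_def list_eq_iff_nth_eq)
      ultimately show ?thesis using ab(3) unfolding even_edge_def by metis
    qed (use ab in simp)
    note r = rl_sons[OF ok(1) this]
    have Y: "rl K Y \<in> {son1 (rl K X), son2 (rl K X)}" using X(2) True r by auto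
    have "ptp K e = (end1 (rl K X), end2 (rl K X)) \<or> ptp K e = (end2 (rl K X), end1 (rl K X))"
      unfolding r e using ab2 by auto
    note vb = vstep_bisect[OF ts _ Y this]
    have "tagged_simplex (rl K Y)" using Y tagged_simplex_sons[OF ts] by auto
    moreover have "x \<in> closed_elem (rl K X)" if "x \<in> closed_elem (rl K Y)"
    proof -
      from Y have "rl K Y = son1 (rl K X) \<or> rl K Y = son2 (rl K X)" by simp
      then have "x \<in> closed_elem (son1 (rl K X)) \<or> x \<in> closed_elem (son2 (rl K X))"
        using that by (elim disjE) (simp_all only: disjI1 disjI2)
      then show ?thesis unfolding closed_elem_sons[OF ts, THEN eqset_imp_iff] by simp
    qed
    moreover have "(\<lambda>z. lam (rl K X) z x) = v" if "x \<in> closed_elem (rl K X)"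
      using assms(3) X(1) that by blast
    ultimately show ?thesis using vb[of x] by simp
  next
    case False
    then have Y: "Y = X" using X(2) by (simp split: if_splits)
    have "\<not> (pt K a \<in> vertices (rl K X) \<and> pt K b \<in> vertices (rl K X))"
      using False pt_in_vertices_rl[OF ok(1)] ab by blast
    then have "vstep (ptp K e) (\<lambda>z. lam (rl K X) z x) = (\<lambda>z. lam (rl K X) z x)" if "x \<in> closed_elem (rl K X)"
      using vstep_skip[OF ts that] e by simp
    moreover have "(\<lambda>z. lam (rl K X) z x) = v" if "x \<in> closed_elem (rl K X)"
      using assms(3) X(1) that by blast
    ultimately show ?thesis using ts unfolding Y by simp
  qed
qed

lemma run_rl:
  assumes "prog_ok DIM('a) P Xs" "\<forall>X\<in>set Xs. tagged_simplex (rl K X)"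
    "\<forall>X\<in>set Xs. x \<in> closed_elem (rl K X) \<longrightarrow> (\<lambda>z. lam (rl K X) z x) = v"
    "Y \<in> set (srun DIM('a) P Xs)" "x \<in> closed_elem (rl K Y)"
  shows "(\<lambda>z. lam (rl K Y) z x) = vrun (map (ptp K) P) v"
  using assms
proof (induction P arbitrary: Xs v)
  case Nil
  then show ?case by (auto simp: srun_def)
next
  case (Cons e P)
  have "(\<lambda>z. lam (rl K Y) z x) = vrun (map (ptp K) P) (vstep (ptp K e) v)"
  proof (rule Cons.IH)
    show "prog_ok DIM('a) P (sstep DIM('a) e Xs)" using Cons.prems(1) by simp
    show "Y \<in> set (srun DIM('a) P (sstep DIM('a) e Xs))" using Cons.prems(4) by (simp add: srun_def)
    have "step_ok DIM('a) e Xs" using Cons.prems(1) by simp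
    note s = step_rl[OF this Cons.prems(2,3)]
    show "\<forall>X\<in>set (sstep DIM('a) e Xs). tagged_simplex (rl K X)" using s by blast
    show "\<forall>X\<in>set (sstep DIM('a) e Xs). x \<in> closed_elem (rl K X) \<longrightarrow> (\<lambda>z. lam (rl K X) z x) = vstep (ptp K e) v"
      using s by blast
  qed (rule Cons.prems(5))
  then show ?case by simp
qed

end

text \<open>The result of uniform refinement, and the bisected edges in an order that serves all branches
  of the tree simultaneously. The case \<open>\<beta> = 2\<close> has 20 sons, the other tetrahedra have 18.\<close>

definition utree :: "nat \<Rightarrow> nat \<Rightarrow> btree" where
  "utree d \<beta> = (let N = Node Leaf Leaf; A = Node Leaf (Node N Leaf) in
     if d = 2 then Node N N
     else if \<beta> = 2 then Node (Node A (Node (Node Leaf N) (Node Leaf N))) (Node A (Node (Node Leaf N) (Node Leaf N)))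
     else Node (Node A (Node N (Node N Leaf))) (Node A (Node N (Node N Leaf))))"

definition uprog :: "nat \<Rightarrow> nat \<Rightarrow> (snode \<times> snode) list" where
  "uprog d \<beta> =
     (if d = 2 then [([4,0,0], [0,0,4]), ([4,0,0], [0,4,0]), ([0,0,4], [0,4,0])]
      else if \<beta> = 0 then
       [([4,0,0,0], [0,0,0,4]), ([4,0,0,0], [0,0,4,0]), ([4,0,0,0], [0,4,0,0]),
        ([0,0,0,4], [0,4,0,0]), ([0,0,4,0], [0,4,0,0]), ([0,4,0,0], [2,0,0,2]), ([0,4,0,0], [2,0,2,0]),
        ([0,0,0,4], [0,0,4,0]), ([0,0,4,0], [2,0,0,2]), ([0,0,4,0], [0,2,0,2])]
      else if \<beta> = 1 then
       [([4,0,0,0], [0,0,0,4]), ([4,0,0,0], [0,0,4,0]), ([4,0,0,0], [0,4,0,0]),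
        ([0,0,0,4], [0,0,4,0]), ([0,0,4,0], [0,4,0,0]), ([0,4,0,0], [2,0,2,0]), ([0,0,4,0], [2,0,0,2]),
        ([0,0,0,4], [0,4,0,0]), ([0,4,0,0], [0,0,2,2]), ([0,4,0,0], [2,0,0,2])]
      else
       [([4,0,0,0], [0,0,0,4]), ([4,0,0,0], [0,0,4,0]), ([4,0,0,0], [0,4,0,0]),
        ([0,0,0,4], [0,0,4,0]), ([0,0,4,0], [2,0,0,2]), ([0,0,4,0], [0,4,0,0]), ([0,0,0,4], [0,4,0,0]),
        ([0,4,0,0], [2,0,0,2]), ([0,4,0,0], [2,0,2,0]), ([0,4,0,0], [0,0,2,2])])"

text \<open>\<open>Z\<close> lists the indices whose coordinates vanish, so the face is spanned by
  the remaining vertices. The filter is the symbolic form of the one in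
  \<open>vrun_filter\<close>.\<close>

definition sface :: "nat \<Rightarrow> nat \<Rightarrow> nat list \<Rightarrow> (snode \<times> snode) list" where
  "sface d \<beta> Z = filter (\<lambda>(a, b). list_all (\<lambda>i. a ! i = 0) Z \<and> list_all (\<lambda>i. b ! i = 0) Z) (uprog d \<beta>)"

definition scompl :: "nat \<Rightarrow> nat list \<Rightarrow> nat list" where
  "scompl d Z = filter (\<lambda>i. i \<notin> set Z) [0..<d+1]"

text \<open>First edge of the facet opposite to vertex \<open>i\<close> of a tetrahedron that is bisected.\<close>

definition smark :: "nat \<Rightarrow> nat \<Rightarrow> snode \<times> snode" where
  "smark \<beta> i = (let X = (if i = 3 then sson1 3 (sroot 3 \<beta>) else if i = 0 then sson2 3 (sroot 3 \<beta>)
     else sroot 3 \<beta>) in (hd (fst X), last (fst X)))"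

definition sfacet_ok :: "nat \<Rightarrow> nat \<Rightarrow> bool" where
  "sfacet_ok \<beta> i = (let (p, q) = smark \<beta> i; r = hd (filter (\<lambda>c. c \<noteq> p \<and> c \<noteq> q) (map (sunit 3) (scompl 3 [i]))) in
     p \<noteq> q \<and> even_edge p q \<and> set [p, q, r] = set (map (sunit 3) (scompl 3 [i])) \<and>
     (list_all2 same_edge (sface 3 \<beta> [i]) [(p, q), (p, r), (q, r), (smid p q, r)] \<or>
      list_all2 same_edge (sface 3 \<beta> [i]) [(p, q), (q, r), (p, r), (smid p q, r)]))"

text \<open>With \<open>d\<close> vanishing coordinates the face is a vertex, with
  \<open>d - 1\<close> an edge: a vertex is never touched and an edge is cut exactly once, whatever
  the type.\<close>

definition slow_face_ok :: "nat \<Rightarrow> nat \<Rightarrow> nat list \<Rightarrow> bool" where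
  "slow_face_ok d \<beta> Z \<longleftrightarrow> (length Z = d \<longrightarrow> sface d \<beta> Z = []) \<and>
     (length Z = d - 1 \<longrightarrow> list_all2 same_edge (sface d \<beta> Z)
       [(sunit d (scompl d Z ! 0), sunit d (scompl d Z ! 1))])"

text \<open>The last cut in a facet joins the midpoint of its first edge to the third vertex, so the
  interior node has weights 1/4, 1/4 and 1/2.\<close>

definition sfacet_node :: "nat \<Rightarrow> nat \<Rightarrow> snode" where
  "sfacet_node \<beta> i = (let (p, q) = smark \<beta> i; r = hd (filter (\<lambda>c. c \<noteq> p \<and> c \<noteq> q) (map (sunit 3) (scompl 3 [i])))
     in smid (smid p q) r)"

definition sforcing :: "nat \<Rightarrow> nat \<Rightarrow> snode list" where
  "sforcing d \<beta> = (if d = 2 then [[2,2,0], [2,0,2], [0,2,2]] else map (sfacet_node \<beta>) [0..<4])"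

definition snodes :: "nat \<Rightarrow> btree \<Rightarrow> ssimplex \<Rightarrow> snode list" where
  "snodes d t X = concat (map fst (sleaves d t X))"

text \<open>Each branching of the tree is needed for one of the nodes \<open>N\<close>; hence a compatible mesh that
  has these nodes splits the root at least by the whole tree.\<close>

primrec forced :: "nat \<Rightarrow> snode list \<Rightarrow> btree \<Rightarrow> ssimplex \<Rightarrow> bool" where
  "forced d N Leaf X = True"
| "forced d N (Node l r) X = (list_ex (\<lambda>n. n \<in> set (snodes d (Node l r) X) \<and> n \<notin> set (fst X)) N \<and>
     forced d N l (sson1 d X) \<and> forced d N r (sson2 d X))"

text \<open>The finite content of the refinement pattern, on which the later sections rely. The last
  clause says that each facet has just one interior node under uniform refinement; it is needed
  because a resolved marking only provides some interior node.\<close>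

definition ucheck :: "nat \<Rightarrow> nat \<Rightarrow> bool" where
  "ucheck d \<beta> \<longleftrightarrow> tree_ok d (utree d \<beta>) (sroot d \<beta>) \<and> prog_ok d (uprog d \<beta>) [sroot d \<beta>] \<and>
     list_all (\<lambda>X. X \<in> set (srun d (uprog d \<beta>) [sroot d \<beta>])) (sleaves d (utree d \<beta>) (sroot d \<beta>)) \<and>
     list_all (slow_face_ok d \<beta>) (subseqs [0..<d+1]) \<and>
     (d = 3 \<longrightarrow> list_all (sfacet_ok \<beta>) [0..<4]) \<and>
     list_all (snode_ok d) (sforcing d \<beta>) \<and>
     list_all (\<lambda>c. c \<in> set (snodes d (utree d \<beta>) (sroot d \<beta>))) (sforcing d \<beta>) \<and>
     forced d (sforcing d \<beta>) (utree d \<beta>) (sroot d \<beta>) \<and>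
     (d = 3 \<longrightarrow> list_all (\<lambda>i. list_all (\<lambda>c. c ! i = 0 \<and> list_all (\<lambda>j. c ! j \<noteq> 0) (scompl 3 [i]) \<longleftrightarrow>
         c = sfacet_node \<beta> i) (snodes d (utree d \<beta>) (sroot d \<beta>))) [0..<4])"

lemma ucheck_2: "ucheck 2 0" "ucheck 2 1" by code_simp+

lemma ucheck_3: "ucheck 3 0" "ucheck 3 1" "ucheck 3 2" by code_simp+

section \<open>Uniform refinement on faces\<close>

lemma prog_ok_nodes: "prog_ok d P Xs \<Longrightarrow> (a, b) \<in> set P \<Longrightarrow> snode_ok d a \<and> snode_ok d b \<and> even_edge a b"
  by (induction P arbitrary: Xs) auto

lemma filter_in_subseqs: "filter P xs \<in> set (subseqs xs)"
  by (induction xs) (auto simp: Let_def)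

abbreviation ut :: "'a::euclidean_space tagged \<Rightarrow> btree" where
  "ut K \<equiv> utree DIM('a) (snd K)"

definition up :: "'a::euclidean_space tagged \<Rightarrow> ('a \<times> 'a) list" where
  "up K = map (ptp K) (uprog DIM('a) (snd K))"

text \<open>If \<open>w\<close> is an end of the refinement edge, the bisection of \<open>K\<close>
  leaves the opposite facet intact and passes it to the son at the other end, so the facet is first
  cut along the refinement edge of that son. Otherwise the refinement edge of \<open>K\<close> lies
  in the facet.\<close>

definition mark :: "'a::euclidean_space tagged \<Rightarrow> 'a \<Rightarrow> 'a \<times> 'a" where
  "mark K w = (let S = (if w = end2 K then son1 K else if w = end1 K then son2 K else K)
     in (end1 S, end2 S))"

lemma sunit_ok: "i < d + 1 \<Longrightarrow> snode_ok d (sunit d i)"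
proof -
  assume i: "i < d + 1"
  have "sum_list (sunit d i) = (\<Sum>j<d+1. if j = i then 4 else 0)"
    unfolding sunit_def by (simp add: sum_list_sum_nth atLeast0LessThan del: upt_Suc)
  then show ?thesis using i by (simp add: snode_ok_def sunit_def)
qed

context
  fixes K :: "'a::euclidean_space tagged"
  assumes K: "tagged_simplex K" and dim: "DIM('a) = 2 \<or> DIM('a) = 3"
begin

lemma ucheck_K: "ucheck DIM('a) (snd K)"
proof -
  have lt: "snd K < DIM('a)" using K by (simp add: tagged_simplex_def)
  from dim show ?thesis
  proof
    assume "DIM('a) = 2"
    with lt have "snd K = 0 \<or> snd K = 1" by auto
    then show ?thesis using \<open>DIM('a) = 2\<close> ucheck_2 by auto
  next
    assume "DIM('a) = 3"
    with lt have "snd K = 0 \<or> snd K = 1 \<or> snd K = 2" by auto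
    then show ?thesis using \<open>DIM('a) = 3\<close> ucheck_3 by auto
  qed
qed

lemma pt_sunit: "i < DIM('a) + 1 \<Longrightarrow> pt K (sunit DIM('a) i) = fst K ! i"
proof -
  assume i: "i < DIM('a) + 1"
  have "fst (rl K (sroot DIM('a) (snd K))) ! i = fst K ! i" using rl_root[OF K] by simp
  then show ?thesis using i by (simp add: rl_def sroot_def del: upt_Suc)
qed

lemma leaves_ut: "leaves (ut K) K = rl K ` set (sleaves DIM('a) (ut K) (sroot DIM('a) (snd K)))"
  using leaves_rl[OF K, of "ut K" "sroot DIM('a) (snd K)"] ucheck_K
  by (simp add: ucheck_def rl_root[OF K])

lemma lam_leaf:
  assumes "Y \<in> leaves (ut K) K" "x \<in> closed_elem Y"
  shows "(\<lambda>z. lam Y z x) = vrun (up K) (\<lambda>z. lam K z x)"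
proof -
  let ?d = "DIM('a)" and ?r = "sroot DIM('a) (snd K)"
  obtain X where X: "X \<in> set (sleaves ?d (ut K) ?r)" "Y = rl K X"
    using assms(1) unfolding leaves_ut by auto
  have c: "prog_ok ?d (uprog ?d (snd K)) [?r]" "X \<in> set (srun ?d (uprog ?d (snd K)) [?r])"
    using ucheck_K X(1) by (auto simp: ucheck_def list_all_iff)
  show ?thesis unfolding up_def X(2)
    by (rule run_rl[OF K c(1) _ _ c(2)]) (use K rl_root[OF K] assms(2) X(2) in auto)
qed

lemma vrun_face:
  assumes x: "x \<in> closed_elem K" and Z: "set Z \<subseteq> {..<DIM('a) + 1}" "\<forall>i\<in>set Z. lam K (fst K ! i) x = 0"
  shows "vrun (up K) (\<lambda>z. lam K z x) = vrun (map (ptp K) (sface DIM('a) (snd K) Z)) (\<lambda>z. lam K z x)"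
proof -
  note vs = vertex_set_vertices[OF K]
  define A where "A = {y. \<forall>i\<in>set Z. lam K (fst K ! i) y = 0}"
  have ok: "snode_ok DIM('a) a \<and> snode_ok DIM('a) b" if "(a, b) \<in> set (uprog DIM('a) (snd K))" for a b
    using prog_ok_nodes[OF _ that] ucheck_K unfolding ucheck_def by blast
  have A: "pt K a \<in> A \<longleftrightarrow> list_all (\<lambda>i. a ! i = 0) Z" if "snode_ok DIM('a) a" for a
  proof -
    have "lam K (fst K ! i) (pt K a) = 0 \<longleftrightarrow> a ! i = 0" if "i \<in> set Z" for i
      using lam_pt[OF K \<open>snode_ok DIM('a) a\<close>, of i] Z(1) that by auto
    then show ?thesis unfolding A_def list_all_iff by auto
  qed
  have "vrun (up K) (\<lambda>z. lam K z x) = vrun (filter (\<lambda>(a, b). a \<in> A \<and> b \<in> A) (up K)) (\<lambda>z. lam K z x)"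
  proof (rule vrun_filter)
    show "\<forall>(a, b)\<in>set (up K). a \<in> A \<and> b \<in> A \<longrightarrow> midpoint a b \<in> A"
      unfolding A_def by (auto simp: affine_fun_midpoint[OF affine_fun_bary[OF vs]])
    show "\<forall>z. 0 \<le> lam K z x" using x closed_elem_iff[OF K] by blast
    show "\<forall>z. z \<notin> A \<longrightarrow> lam K z x = 0"
    proof (intro allI impI)
      fix z assume "z \<notin> A"
      then obtain i where i: "i \<in> set Z" "lam K (fst K ! i) z \<noteq> 0" unfolding A_def by blast
      show "lam K z x = 0"
      proof (cases "z \<in> vertices K")
        case True
        then have "z = fst K ! i" using i(2) bary_vertex[OF vs True] by (simp split: if_splits)
        then show ?thesis using Z(2) i(1) by blast
      qed (simp add: bary_notin[OF vs])
    qed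
  qed
  also have "filter (\<lambda>(a, b). a \<in> A \<and> b \<in> A) (up K) = map (ptp K) (sface DIM('a) (snd K) Z)"
    unfolding up_def sface_def filter_map
    by (rule arg_cong[of _ _ "map (ptp K)"], rule filter_cong[OF refl])
      (use ok A in \<open>auto simp: comp_def\<close>)
  finally show ?thesis .
qed

lemma zero_indices:
  assumes "Z = filter (\<lambda>i. fst K ! i \<notin> C) [0..<DIM('a) + 1]" "C \<subseteq> vertices K"
  shows "Z \<in> set (subseqs [0..<DIM('a) + 1])" "length Z + card C = DIM('a) + 1"
    "(!) (fst K) ` set (scompl DIM('a) Z) = C" "set Z \<subseteq> {..<DIM('a) + 1}"
    "length (scompl DIM('a) Z) = card C" "distinct (scompl DIM('a) Z)"
    "set (scompl DIM('a) Z) \<subseteq> {..<DIM('a) + 1}"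
proof -
  have l: "length (fst K) = DIM('a) + 1" and dist: "distinct (fst K)"
    using K by (auto simp: tagged_simplex_def)
  show "Z \<in> set (subseqs [0..<DIM('a) + 1])" unfolding assms(1) by (rule filter_in_subseqs)
  have sc: "scompl DIM('a) Z = filter (\<lambda>i. fst K ! i \<in> C) [0..<DIM('a) + 1]"
    unfolding scompl_def assms(1) by (rule filter_cong) auto
  have "C = (!) (fst K) ` {i. i < DIM('a) + 1 \<and> fst K ! i \<in> C}"
    using assms(2) l unfolding vertices_def set_conv_nth by auto
  then show im: "(!) (fst K) ` set (scompl DIM('a) Z) = C"
    unfolding sc by (simp del: upt_Suc)
  show d: "distinct (scompl DIM('a) Z)" unfolding sc by simp
  show sub: "set (scompl DIM('a) Z) \<subseteq> {..<DIM('a) + 1}" unfolding sc by auto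
  show "set Z \<subseteq> {..<DIM('a) + 1}" unfolding assms(1) by auto
  have "inj_on ((!) (fst K)) (set (scompl DIM('a) Z))"
    using dist l sub by (intro inj_on_nth) auto
  then show c: "length (scompl DIM('a) Z) = card C"
    using im d card_image distinct_card by metis
  show "length Z + card C = DIM('a) + 1"
    using sum_length_filter_compl[of "\<lambda>i. fst K ! i \<in> C" "[0..<DIM('a) + 1]"]
    unfolding c[symmetric] sc unfolding assms(1) by (simp del: upt_Suc)
qed

text \<open>On vertices and edges the result depends neither on the type nor on the order of the
  vertices. So agreement of neighbours is an issue on facets of tetrahedra only.\<close>

lemma up_small_face:
  assumes x: "x \<in> closed_elem K" and C: "C \<subseteq> vertices K" "\<forall>z. z \<notin> C \<longrightarrow> lam K z x = 0"
  shows "card C = 1 \<Longrightarrow> vrun (up K) (\<lambda>z. lam K z x) = (\<lambda>z. lam K z x)"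
    "card C = 2 \<Longrightarrow> \<exists>p q. C = {p, q} \<and> vrun (up K) (\<lambda>z. lam K z x) = vstep (p, q) (\<lambda>z. lam K z x)"
proof -
  define Z where "Z = filter (\<lambda>i. fst K ! i \<notin> C) [0..<DIM('a) + 1]"
  note z = zero_indices[OF Z_def C(1)]
  have "\<forall>i\<in>set Z. lam K (fst K ! i) x = 0" using C(2) unfolding Z_def by simp
  note f = vrun_face[OF x z(4) this]
  have ok: "slow_face_ok DIM('a) (snd K) Z"
    using ucheck_K z(1) unfolding ucheck_def list_all_iff by blast
  show "vrun (up K) (\<lambda>z. lam K z x) = (\<lambda>z. lam K z x)" if "card C = 1"
    using ok z(2) that f unfolding slow_face_ok_def by simp
  assume c: "card C = 2"
  let ?k = "scompl DIM('a) Z ! 0" and ?l = "scompl DIM('a) Z ! 1"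
  have s: "scompl DIM('a) Z = [?k, ?l]" using z(5) c by (cases "scompl DIM('a) Z"; cases "tl (scompl DIM('a) Z)") auto
  have kl: "?k < DIM('a) + 1" "?l < DIM('a) + 1" using z(7) s by (metis insert_subset lessThan_iff list.set(2))+
  have "list_all2 same_edge (sface DIM('a) (snd K) Z) [(sunit DIM('a) ?k, sunit DIM('a) ?l)]"
    using ok z(2) c unfolding slow_face_ok_def by simp
  then have "list_all2 same_edge (map (ptp K) (sface DIM('a) (snd K) Z)) [(fst K ! ?k, fst K ! ?l)]"
    using pt_sunit kl by (auto simp: list_all2_Cons2 same_edge_def)
  from vrun_same_edges[OF this] f
  have "vrun (up K) (\<lambda>z. lam K z x) = vstep (fst K ! ?k, fst K ! ?l) (\<lambda>z. lam K z x)"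
    by (simp del: vstep.simps)
  moreover have "C = {fst K ! ?k, fst K ! ?l}"
    using z(3) by (subst (asm) s) auto
  ultimately show "\<exists>p q. C = {p, q} \<and> vrun (up K) (\<lambda>z. lam K z x) = vstep (p, q) (\<lambda>z. lam K z x)" by blast
qed

lemma ends_rl: "fst X \<noteq> [] \<Longrightarrow> (end1 (rl K X), end2 (rl K X)) = (pt K (hd (fst X)), pt K (last (fst X)))"
  by (simp add: end1_def end2_def rl_def hd_map last_map)

lemma root_facts:
  "ssimplex_ok DIM('a) (sroot DIM('a) (snd K))"
  "even_edge (hd (fst (sroot DIM('a) (snd K)))) (last (fst (sroot DIM('a) (snd K))))"
  "son1 K = rl K (sson1 DIM('a) (sroot DIM('a) (snd K)))"
  "son2 K = rl K (sson2 DIM('a) (sroot DIM('a) (snd K)))"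
proof -
  have t: "tree_ok DIM('a) (ut K) (sroot DIM('a) (snd K))" using ucheck_K by (simp add: ucheck_def)
  moreover have "\<exists>l r. ut K = Node l r" using dim by (auto simp: utree_def Let_def)
  ultimately show 1: "ssimplex_ok DIM('a) (sroot DIM('a) (snd K))"
    "even_edge (hd (fst (sroot DIM('a) (snd K)))) (last (fst (sroot DIM('a) (snd K))))" by auto
  show "son1 K = rl K (sson1 DIM('a) (sroot DIM('a) (snd K)))"
    "son2 K = rl K (sson2 DIM('a) (sroot DIM('a) (snd K)))"
    using rl_sons[OF K 1] rl_root[OF K] by simp_all
qed

lemma mark_rl:
  assumes "DIM('a) = 3" "i < 4" shows "mark K (fst K ! i) = ptp K (smark (snd K) i)"
proof -
  have l: "length (fst K) = 4" and dist: "distinct (fst K)"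
    using K assms by (auto simp: tagged_simplex_def)
  have e: "end1 K = fst K ! 0" "end2 K = fst K ! 3"
    using l hd_conv_nth[of "fst K"] last_conv_nth[of "fst K"]
    by (cases "fst K = []"; simp add: end1_def end2_def)+
  have ne: "fst (sson1 3 X) \<noteq> []" "fst (sson2 3 X) \<noteq> []" "fst (sroot 3 X') \<noteq> []" for X X'
    by (auto simp: sson1_def sson2_def sroot_def)
  have iff: "fst K ! i = end2 K \<longleftrightarrow> i = 3" "fst K ! i = end1 K \<longleftrightarrow> i = 0"
    unfolding e using l dist assms by (auto simp: nth_eq_iff_index_eq)
  have "(end1 K, end2 K) = (end1 (rl K (sroot 3 (snd K))), end2 (rl K (sroot 3 (snd K))))"
    using rl_root[OF K] assms by simp
  then show ?thesis
    unfolding mark_def smark_def iff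
    using ends_rl[OF ne(1)] ends_rl[OF ne(2)] ends_rl[OF ne(3)] root_facts(3,4) assms(1)
    by (auto simp: Let_def)
qed

lemma up_facet:
  assumes "DIM('a) = 3" and x: "x \<in> closed_elem K" and i: "i < 4" and zero: "lam K (fst K ! i) x = 0"
    and pq: "mark K (fst K ! i) = (p, q)"
  shows "\<exists>r. vertices K - {fst K ! i} = {p, q, r} \<and> p \<noteq> q \<and> p \<noteq> r \<and> q \<noteq> r \<and>
    vrun (up K) (\<lambda>z. lam K z x) = vrun (facet_prog p q r) (\<lambda>z. lam K z x)"
proof -
  let ?v = "\<lambda>z. lam K z x"
  have l: "length (fst K) = 4" and dist: "distinct (fst K)"
    using K assms by (auto simp: tagged_simplex_def)
  have sfo: "sfacet_ok (snd K) i"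
    using ucheck_K assms(1) i by (auto simp: ucheck_def list_all_iff)
  obtain a b where ab: "smark (snd K) i = (a, b)" by (cases "smark (snd K) i")
  define c where "c = hd (filter (\<lambda>c. c \<noteq> a \<and> c \<noteq> b) (map (sunit 3) (scompl 3 [i])))"
  have s: "a \<noteq> b" "even_edge a b" "{a, b, c} = sunit 3 ` set (scompl 3 [i])"
     "list_all2 same_edge (sface 3 (snd K) [i]) [(a, b), (a, c), (b, c), (smid a b, c)] \<or>
      list_all2 same_edge (sface 3 (snd K) [i]) [(a, b), (b, c), (a, c), (smid a b, c)]"
    using sfo unfolding sfacet_ok_def ab c_def by (auto simp: Let_def)
  have sc: "set (scompl 3 [i]) = {..<4} - {i}" unfolding scompl_def by auto
  have units: "snode_ok 3 (sunit 3 j)" if "j < 4" for j using that sunit_ok[of j 3] by simp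
  have "{a, b, c} \<subseteq> {u. snode_ok 3 u}" unfolding s(3) sc using units by auto
  then have ok: "snode_ok 3 a" "snode_ok 3 b" "snode_ok 3 c" by auto
  have im: "{pt K a, pt K b, pt K c} = vertices K - {fst K ! i}"
  proof -
    have "{pt K a, pt K b, pt K c} = pt K ` {a, b, c}" by simp
    also have "\<dots> = (\<lambda>j. fst K ! j) ` ({..<4} - {i})"
      unfolding s(3) sc image_image using pt_sunit assms(1) by (intro image_cong) auto
    also have "\<dots> = vertices K - {fst K ! i}"
      unfolding vertices_def set_conv_nth l using l dist i by (auto simp: nth_eq_iff_index_eq)
    finally show ?thesis .
  qed
  have p: "pt K a = p" "pt K b = q" using pq mark_rl[OF assms(1) i] ab by auto
  define r where "r = pt K c"
  have "card {p, q, r} = 3"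
    using im l dist i unfolding p r_def[symmetric] vertices_def by (simp add: distinct_card)
  then have ne: "p \<noteq> q" "p \<noteq> r" "q \<noteq> r" by (auto simp: card_insert_if split: if_splits)
  have sm: "pt K (smid a b) = midpoint p q" using pt_smid[OF K] ok s(2) assms(1) p by simp
  have f: "vrun (up K) ?v = vrun (map (ptp K) (sface 3 (snd K) [i])) ?v"
    using vrun_face[OF x, of "[i]"] zero i assms(1) by simp
  have map2: "list_all2 same_edge (map (ptp K) P) (map (ptp K) Q)" if "list_all2 same_edge P Q" for P Q :: "(snode \<times> snode) list"
    using that unfolding list_all2_map1 list_all2_map2 by (rule list_all2_mono) (auto simp: same_edge_def)
  have im': "{p, q, r} = vertices K - {fst K ! i}" using im p r_def by simp
  note vs = vertex_set_vertices[OF K]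
  have pqr: "p \<noteq> midpoint q r" "q \<noteq> midpoint p r"
    using vertex_set_bisect(1)[OF vs, of q r] vertex_set_bisect(1)[OF vs, of p r] im' ne by blast+
  have nn: "\<forall>z. 0 \<le> ?v z" using x closed_elem_iff[OF K] by blast
  have sw: "vrun (facet_prog p q r) ?v = vrun [(p, q), (q, r), (p, r), (midpoint p q, r)] ?v"
    by (rule facet_prog_swap[OF nn ne pqr])
  have "vrun (up K) ?v = vrun (facet_prog p q r) ?v"
    using s(4)
  proof
    assume "list_all2 same_edge (sface 3 (snd K) [i]) [(a, b), (a, c), (b, c), (smid a b, c)]"
    from vrun_same_edges[OF map2[OF this]] show ?thesis
      unfolding f facet_prog_def list.map map_prod_simp p r_def[symmetric] sm by blast
  next
    assume "list_all2 same_edge (sface 3 (snd K) [i]) [(a, b), (b, c), (a, c), (smid a b, c)]"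
    from vrun_same_edges[OF map2[OF this]] show ?thesis
      unfolding sw unfolding f list.map map_prod_simp p r_def[symmetric] sm by blast
  qed
  then show ?thesis using im' ne by blast
qed

text \<open>In dimension at least 2 the new midpoint is second and never last in the list of a son,
  so the next bisection cuts an edge between old vertices.\<close>

lemma middle_vertex:
  assumes "2 \<le> DIM('a)"
  shows "end1 (son1 K) = end1 K" "end2 (son1 K) \<in> vertices K" "end1 (son2 K) = end2 K" "end2 (son2 K) \<in> vertices K"
proof -
  from K obtain m where m: "fst K = end1 K # m @ [end2 K]" "length m = DIM('a) - 1" by (rule tagged_simplex_list)
  have bm: "butlast (tl (fst K)) = m" by (subst m(1)) simp
  have "m \<noteq> []" using m(2) assms by auto
  have sub: "set m \<subseteq> vertices K" unfolding vertices_def by (subst m(1)) auto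
  show "end1 (son1 K) = end1 K" "end1 (son2 K) = end2 K"
    by (simp_all add: son1_def son2_def end1_def)
  have "end2 (son1 K) = last m" using \<open>m \<noteq> []\<close> by (simp add: son1_def end2_def bm)
  then show "end2 (son1 K) \<in> vertices K" using \<open>m \<noteq> []\<close> sub by auto
  let ?n = "take (snd K) m @ rev (drop (snd K) m)"
  have "set ?n = set m" by (metis append_take_drop_id set_append set_rev)
  then have ne: "?n \<noteq> []" using \<open>m \<noteq> []\<close> by (metis set_empty)
  have "end2 (son2 K) = last ([end2 K, mid_pt K] @ ?n)"
    unfolding son2_def end2_def[of "(_, _)"] bm fst_conv ..
  then have "end2 (son2 K) = last ?n" unfolding last_appendR[OF ne] .
  then show "end2 (son2 K) \<in> vertices K" using last_in_set[OF ne] \<open>set ?n = set m\<close> sub by auto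
qed

text \<open>The point \<open>g\<close>, interior to the facet opposite to \<open>w\<close>, forces
  \<open>X\<close> into a subtree that owns part of the facet. As no leaf keeps the whole facet, its
  first edge \<open>pq\<close> was cut on the way to \<open>X\<close>; this leaves the part of
  \<open>X\<close> in the facet on one side of the median.\<close>

lemma mark_side:
  assumes "DIM('a) = 3" and X: "X \<in> leaves t K" "g \<in> closed_elem X"
    and w: "w \<in> vertices K" "lam K w g = 0" "\<forall>v\<in>vertices K - {w}. 0 < lam K v g"
    and nf: "\<forall>Y\<in>leaves t K. \<not> vertices K - {w} \<subseteq> vertices Y"
    and pq: "mark K w = (p, q)"
  shows "(\<forall>x\<in>closed_elem X. lam K w x = 0 \<longrightarrow> lam K q x \<le> lam K p x) \<or>
     (\<forall>x\<in>closed_elem X. lam K w x = 0 \<longrightarrow> lam K p x \<le> lam K q x)"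
proof -
  note s = tagged_simplex_sons[OF K]
  have "2 \<le> DIM('a)" using assms(1) by simp
  note mv = middle_vertex[OF this]
  have mid: "mid_pt K \<notin> vertices K" by (rule mid_pt_notin[OF K])
  obtain l r where t: "t = Node l r" using nf by (cases t) auto
  have X1: "closed_elem X \<subseteq> closed_elem (son1 K)" if "X \<in> leaves l (son1 K)"
    using leaves_subset[OF s(1) that] .
  have X2: "closed_elem X \<subseteq> closed_elem (son2 K)" if "X \<in> leaves r (son2 K)"
    using leaves_subset[OF s(2) that] .
  consider "w = end2 K" | "w = end1 K" "w \<noteq> end2 K" | "w \<noteq> end1 K" "w \<noteq> end2 K" by blast
  then show ?thesis
  proof cases
    case 1
    have "X \<notin> leaves r (son2 K)"
    proof
      assume "X \<in> leaves r (son2 K)"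
      then have "g \<in> closed_elem (son2 K)" using X2 X by blast
      then have "lam K (end1 K) g \<le> 0" using closed_elem_son2[OF K] w(2) 1 by simp
      moreover have "0 < lam K (end1 K) g" using w(3) end_vertices(1,3)[OF K] 1 by simp
      ultimately show False by simp
    qed
    then have X': "X \<in> leaves l (son1 K)" using X t by simp
    have "vertices K - {w} \<subseteq> vertices (son1 K)" unfolding vertices_sons[OF K] 1 by blast
    \<comment> \<open>Without a further bisection this son would keep the whole facet.\<close>
    then obtain l1 l2 where l: "l = Node l1 l2" using nf t by (cases l) auto
    note ss = tagged_simplex_sons[OF s(1)]
    have eq: "lam (son1 K) v x = lam K v x" if "lam K w x = 0" "v \<in> vertices K" for v x
      using that lam_son1[OF K, of x] lam_son1(4)[OF K, of v x] mid unfolding 1 by (metis diff_zero)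
    have pq': "p = end1 (son1 K)" "q = end2 (son1 K)" using pq unfolding mark_def 1 by (auto simp: Let_def)
    have v: "p \<in> vertices K" "q \<in> vertices K" using pq' mv end_vertices[OF K] by auto
    from X' l consider "X \<in> leaves l1 (son1 (son1 K))" | "X \<in> leaves l2 (son2 (son1 K))" by auto
    then show ?thesis
    proof cases
      case 1
      then have "closed_elem X \<subseteq> closed_elem (son1 (son1 K))" using leaves_subset[OF ss(1)] by blast
      then have "lam (son1 K) q x \<le> lam (son1 K) p x" if "x \<in> closed_elem X" for x
        using that closed_elem_son1[OF s(1)] pq' by blast
      then show ?thesis using eq v by metis
    next
      case 2
      then have "closed_elem X \<subseteq> closed_elem (son2 (son1 K))" using leaves_subset[OF ss(2)] by blast
      then have "lam (son1 K) p x \<le> lam (son1 K) q x" if "x \<in> closed_elem X" for x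
        using that closed_elem_son2[OF s(1)] pq' by blast
      then show ?thesis using eq v by metis
    qed
  next
    case 2
    have "X \<notin> leaves l (son1 K)"
    proof
      assume "X \<in> leaves l (son1 K)"
      then have "g \<in> closed_elem (son1 K)" using X1 X by blast
      then have "lam K (end2 K) g \<le> 0" using closed_elem_son1[OF K] w(2) 2 by simp
      moreover have "0 < lam K (end2 K) g" using w(3) end_vertices(2)[OF K] 2(2) by simp
      ultimately show False by simp
    qed
    then have X': "X \<in> leaves r (son2 K)" using X t by simp
    have "vertices K - {w} \<subseteq> vertices (son2 K)" unfolding vertices_sons[OF K] 2(1) by blast
    then obtain r1 r2 where l: "r = Node r1 r2" using nf t by (cases r) auto
    note ss = tagged_simplex_sons[OF s(2)]
    have eq: "lam (son2 K) v x = lam K v x" if "lam K w x = 0" "v \<in> vertices K" for v x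
      using that lam_son2[OF K, of x] lam_son2(4)[OF K, of v x] mid unfolding 2(1) by (metis diff_zero)
    have pq': "p = end1 (son2 K)" "q = end2 (son2 K)" using pq 2 unfolding mark_def by (auto simp: Let_def)
    have v: "p \<in> vertices K" "q \<in> vertices K" using pq' mv end_vertices[OF K] by auto
    from X' l consider "X \<in> leaves r1 (son1 (son2 K))" | "X \<in> leaves r2 (son2 (son2 K))" by auto
    then show ?thesis
    proof cases
      case 1
      then have "closed_elem X \<subseteq> closed_elem (son1 (son2 K))" using leaves_subset[OF ss(1)] by blast
      then have "lam (son2 K) q x \<le> lam (son2 K) p x" if "x \<in> closed_elem X" for x
        using that closed_elem_son1[OF s(2)] pq' by blast
      then show ?thesis using eq v by metis
    next
      case 2
      then have "closed_elem X \<subseteq> closed_elem (son2 (son2 K))" using leaves_subset[OF ss(2)] by blast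
      then have "lam (son2 K) p x \<le> lam (son2 K) q x" if "x \<in> closed_elem X" for x
        using that closed_elem_son2[OF s(2)] pq' by blast
      then show ?thesis using eq v by metis
    qed
  next
    case 3
    then have pq': "p = end1 K" "q = end2 K" using pq unfolding mark_def by auto
    from X t consider "X \<in> leaves l (son1 K)" | "X \<in> leaves r (son2 K)" by auto
    then show ?thesis
    proof cases
      case 1
      then show ?thesis using X1 closed_elem_son1[OF K] pq' by blast
    next
      case 2
      then show ?thesis using X2 closed_elem_son2[OF K] pq' by blast
    qed
  qed
qed

end

section \<open>Dyadic coordinates and the first edge of a common facet\<close>

definition dyadic :: "real \<Rightarrow> bool" where
  "dyadic x \<longleftrightarrow> (\<exists>(m::int) (n::nat). x * 2 ^ n = of_int m)"

lemma dyadic_average: assumes "dyadic x" "dyadic y" shows "dyadic ((x + y) / 2)"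
proof -
  obtain m n m' n' where "x * 2 ^ n = of_int m" "y * 2 ^ n' = of_int m'" using assms unfolding dyadic_def by blast
  then have "(x + y) / 2 * 2 ^ (Suc (n + n')) = of_int (m * 2 ^ n' + m' * 2 ^ n)"
    by (simp add: power_add algebra_simps)
  then show ?thesis unfolding dyadic_def by blast
qed

lemma not_dyadic_third: "\<not> dyadic (1 / 3)"
proof
  assume "dyadic (1 / 3)"
  then obtain m :: int and n where "(1 / 3) * 2 ^ n = real_of_int m" unfolding dyadic_def by blast
  then have "real_of_int (2 ^ n) = real_of_int (3 * m)" by simp
  then have "(2::int) ^ n = 3 * m" by linarith
  then have "(3::int) dvd 2 ^ n" by simp
  moreover have "coprime (3::int) (2 ^ n)" by simp
  ultimately show False by (metis coprime_absorb_left one_dvd abs_numeral numeral_eq_one_iff semiring_norm(84) zdvd1_eq coprime_common_divisor dvd_refl)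
qed

lemma leaves_dyadic:
  assumes "affine_fun f"
  shows "tagged_simplex K \<Longrightarrow> \<forall>v\<in>vertices K. dyadic (f v) \<Longrightarrow> X \<in> leaves t K \<Longrightarrow> \<forall>v\<in>vertices X. dyadic (f v)"
proof (induction t arbitrary: K)
  case (Node l r)
  note s = tagged_simplex_sons[OF Node.prems(1)]
  have "dyadic (f (mid_pt K))"
    unfolding mid_pt_def affine_fun_midpoint[OF assms]
    using dyadic_average Node.prems(2) end_vertices[OF Node.prems(1)] by blast
  then have "\<forall>v\<in>vertices (son1 K). dyadic (f v)" "\<forall>v\<in>vertices (son2 K). dyadic (f v)"
    using Node.prems(2) unfolding vertices_sons[OF Node.prems(1)] by auto
  then show ?case using Node.IH s Node.prems(3) by (metis UnE leaves.simps(2))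
qed simp

text \<open>If the first edges of a common facet differed, the centroid of the facet would have to be a
  node, but nodes have dyadic barycentric coordinates.\<close>

lemma mark_agree:
  fixes K :: "'a::euclidean_space tagged"
  assumes d3: "DIM('a) = 3" and m: "mesh \<T>" "compatible \<T>" and c': "compatible (forest t \<T>)"
    and KK: "K \<in> \<T>" "K' \<in> \<T>" and C: "C = vertices K - {w}" "w \<in> vertices K" "C = vertices K' - {w'}" "w' \<in> vertices K'"
    and n: "n \<in> nodes (forest t \<T>)" "lam K w n = 0" "\<forall>v\<in>C. 0 < lam K v n"
    and pq: "mark K w = (p, q)" "mark K' w' = (p', q')"
      "{p, q} \<subseteq> C" "p \<noteq> q" "{p', q'} \<subseteq> C" "p' \<noteq> q'"
  shows "{p, q} = {p', q'}"
proof (rule ccontr)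
  assume ne: "{p, q} \<noteq> {p', q'}"
  have d: "DIM('a) = 2 \<or> DIM('a) = 3" using d3 by simp
  have ts: "tagged_simplex K" "tagged_simplex K'" using m(1) KK by (auto simp: mesh_def)
  note vs = vertex_set_vertices[OF ts(1)] vertex_set_vertices[OF ts(2)]
  have mf: "mesh (forest t \<T>)" by (rule mesh_forest[OF m(1)])
  have fC: "finite C" and cC: "card C = 3" using C(1,2) vs(1) d3 by (auto simp: vertex_set_def)
  define g where "g = (\<Sum>v\<in>C. (1/3::real) *\<^sub>R v)"
  have u: "\<forall>x\<in>C. 0 \<le> (1/3::real)" "(\<Sum>v\<in>C. (1/3::real)) = 1" "(\<Sum>v\<in>C. (1/3::real) *\<^sub>R v) = g"
    using cC by (auto simp: g_def)
  have sub: "C \<subseteq> vertices K" "C \<subseteq> vertices K'" using C by auto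
  have lg: "lam K z g = (if z \<in> C then 1/3 else 0)" "lam K' z g = (if z \<in> C then 1/3 else 0)" for z
    using bary_convex_hull_subset[OF vs(1) sub(1) fC u] bary_convex_hull_subset[OF vs(2) sub(2) fC u] by auto
  have gK: "g \<in> closed_elem K" "g \<in> closed_elem K'"
    unfolding closed_elem_iff[OF ts(1)] closed_elem_iff[OF ts(2)] lg by auto
  obtain X where X: "X \<in> leaves (t K) K" "g \<in> closed_elem X" using gK(1) leaves_closed[OF ts(1), of "t K"] by blast
  obtain X' where X': "X' \<in> leaves (t K') K'" "g \<in> closed_elem X'" using gK(2) leaves_closed[OF ts(2), of "t K'"] by blast
  have inf: "Y \<in> forest t \<T>" if "Y \<in> leaves (t K) K \<or> Y \<in> leaves (t K') K'" for Y
    using that KK unfolding forest_def by blast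
  have nC: "(\<Sum>v\<in>C. lam K v n) = 1" "(\<Sum>v\<in>C. lam K v n *\<^sub>R v) = n"
    using bary_sum[OF vs(1), of n] bary_comb[OF vs(1), of n] n(2) vs(1) C(1,2)
    by (auto simp: vertex_set_def sum.remove[of _ w])
  have "n \<notin> C"
  proof
    assume "n \<in> C"
    have "card (C - {n}) > 0" using cC \<open>n \<in> C\<close> fC by simp
    then obtain v where "v \<in> C" "v \<noteq> n" by (metis Diff_iff card_gt_0_iff ex_in_conv insertI1)
    then show False using n(3) bary_vertex[OF vs(1), of n v] sub(1) \<open>n \<in> C\<close> by fastforce
  qed
  \<comment> \<open>In an element that keeps the facet, the node \<open>n\<close> inside the facet
    would be hanging.\<close>
  have nf: "\<not> C \<subseteq> vertices Y" if Y: "Y \<in> forest t \<T>" for Y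
  proof
    assume CY: "C \<subseteq> vertices Y"
    have tY: "tagged_simplex Y" using mf Y by (simp add: mesh_def)
    note vY = vertex_set_vertices[OF tY]
    have l: "lam Y z n = (if z \<in> C then lam K z n else 0)" for z
      using bary_convex_hull_subset[OF vY CY fC _ nC] n(3) by (simp add: less_imp_le)
    have "n \<in> closed_elem Y" unfolding closed_elem_iff[OF tY] l using n(3) by (simp add: less_imp_le)
    then have "n \<in> vertices Y" using node_in_closed_elem[OF mf c' Y n(1)] by blast
    then have "lam Y n n = 1" using bary_vertex[OF vY] by simp
    then show False using l[of n] \<open>n \<notin> C\<close> by simp
  qed
  have tX: "tagged_simplex X" "tagged_simplex X'" using leaves_simplex ts X X' by blast+
  note vX = vertex_set_vertices[OF tX(1)] vertex_set_vertices[OF tX(2)]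
  have eqX: "lam X z g = lam X' z g" for z using c' inf X X' unfolding compatible_def by blast
  \<comment> \<open>The centroid \<open>g\<close> is a convex combination of vertices of
    \<open>X\<close>. An affine function that is 0 at \<open>g\<close> and nonnegative at the
    vertices with positive weight is 0 at all of these.\<close>
  have zero: "f z = 0" if f: "affine_fun f" "f g = 0" "\<forall>z\<in>vertices X. 0 < lam X z g \<longrightarrow> 0 \<le> f z" and z: "0 < lam X z g" for f z
  proof -
    have zX: "z \<in> vertices X" using z bary_notin[OF vX(1)] by fastforce
    have "(\<Sum>v\<in>vertices X. lam X v g * f v) = 0" using affine_fun_expand[OF vX(1) f(1), of g] f(2) by simp
    moreover have nn: "0 \<le> lam X v g * f v" if "v \<in> vertices X" for v
    proof (cases "lam X v g = 0")
      case False
      then have "0 < lam X v g" using X(2) closed_elem_iff[OF tX(1)] by (metis order_le_less)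
      then show ?thesis using f(3) that by simp
    qed simp
    ultimately have "lam X z g * f z = 0"
      using sum_nonneg_eq_0_iff[of "vertices X" "\<lambda>v. lam X v g * f v"] zX vX(1) by (auto simp: vertex_set_def)
    then show ?thesis using z by simp
  qed
  have clX: "z \<in> closed_elem X" "z \<in> closed_elem X'" if "0 < lam X z g" for z
  proof -
    have "z \<in> vertices X" "z \<in> vertices X'"
      using that bary_notin[OF vX(1), of z g] bary_notin[OF vX(2), of z g] eqX by fastforce+
    then show "z \<in> closed_elem X" "z \<in> closed_elem X'" unfolding closed_elem_def by (auto intro: hull_inc)
  qed
  have clK: "z \<in> closed_elem K \<and> z \<in> closed_elem K'" if "0 < lam X z g" for z
    using clX[OF that] leaves_subset[OF ts(1) X(1)] leaves_subset[OF ts(2) X'(1)] by blast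
  have eqK: "lam K v z = lam K' v z" if "0 < lam X z g" for v z
    using m(2) KK clK[OF that] unfolding compatible_def by blast
  have w0: "lam K w z = 0" if "0 < lam X z g" for z
    by (rule zero[OF affine_fun_bary[OF vs(1)] _ _ that])
      (use lg C clK closed_elem_iff[OF ts(1)] in auto)
  have w0': "lam K' w' z = 0" if "0 < lam X z g" for z
    by (rule zero[OF affine_fun_bary[OF vs(2)] _ _ that])
      (use lg C clK closed_elem_iff[OF ts(2)] in auto)
  \<comment> \<open>\<open>X\<close> lies on one side of the median through \<open>g\<close>, so the
    vertices of \<open>X\<close> that carry \<open>g\<close> lie on the median itself.\<close>
  have e1: "lam K p z = lam K q z" if z: "0 < lam X z g" for z
  proof -
    have "(\<forall>x\<in>closed_elem X. lam K w x = 0 \<longrightarrow> lam K q x \<le> lam K p x) \<or>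
     (\<forall>x\<in>closed_elem X. lam K w x = 0 \<longrightarrow> lam K p x \<le> lam K q x)"
      by (rule mark_side[OF ts(1) d d3 X C(2) _ _ _ pq(1)])
        (use lg C nf inf in auto)
    then show ?thesis
    proof
      assume "\<forall>x\<in>closed_elem X. lam K w x = 0 \<longrightarrow> lam K q x \<le> lam K p x"
      then show ?thesis
        using zero[of "\<lambda>x. lam K p x - lam K q x", OF _ _ _ z] affine_fun_diff[OF affine_fun_bary affine_fun_bary, OF vs(1) vs(1)]
          lg pq(3) clX w0 by auto
    next
      assume "\<forall>x\<in>closed_elem X. lam K w x = 0 \<longrightarrow> lam K p x \<le> lam K q x"
      then show ?thesis
        using zero[of "\<lambda>x. lam K q x - lam K p x", OF _ _ _ z] affine_fun_diff[OF affine_fun_bary affine_fun_bary, OF vs(1) vs(1)]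
          lg pq(3) clX w0 by auto
    qed
  qed
  have e2: "lam K p' z = lam K q' z" if z: "0 < lam X z g" for z
  proof -
    have "(\<forall>x\<in>closed_elem X'. lam K' w' x = 0 \<longrightarrow> lam K' q' x \<le> lam K' p' x) \<or>
     (\<forall>x\<in>closed_elem X'. lam K' w' x = 0 \<longrightarrow> lam K' p' x \<le> lam K' q' x)"
      by (rule mark_side[OF ts(2) d d3 X' C(4) _ _ _ pq(2)])
        (use lg C nf inf in auto)
    then have "lam K' p' z = lam K' q' z"
    proof
      assume "\<forall>x\<in>closed_elem X'. lam K' w' x = 0 \<longrightarrow> lam K' q' x \<le> lam K' p' x"
      then show ?thesis
        using zero[of "\<lambda>x. lam K' p' x - lam K' q' x", OF _ _ _ z] affine_fun_diff[OF affine_fun_bary affine_fun_bary, OF vs(2) vs(2)]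
          lg pq(5) clX w0' by auto
    next
      assume "\<forall>x\<in>closed_elem X'. lam K' w' x = 0 \<longrightarrow> lam K' p' x \<le> lam K' q' x"
      then show ?thesis
        using zero[of "\<lambda>x. lam K' q' x - lam K' p' x", OF _ _ _ z] affine_fun_diff[OF affine_fun_bary affine_fun_bary, OF vs(2) vs(2)]
          lg pq(5) clX w0' by auto
    qed
    then show ?thesis using eqK[OF z] by simp
  qed
  have "\<exists>z. 0 < lam X z g"
  proof (rule ccontr)
    assume "\<nexists>z. 0 < lam X z g"
    then have "lam X z g = 0" for z using X(2) closed_elem_iff[OF tX(1)] by (metis order_le_less)
    then show False using bary_sum[OF vX(1), of g] by simp
  qed
  then obtain z where z: "0 < lam X z g" by blast
  obtain r where r: "C = {p, q, r}" "r \<noteq> p" "r \<noteq> q"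
  proof -
    have "card (C - {p, q}) = 1" using cC fC pq(3,4) by (simp add: card_Diff_subset)
    then obtain r where "C - {p, q} = {r}" using card_1_singletonE by blast
    then show thesis using that[of r] pq(3) by blast
  qed
  \<comment> \<open>Different first edges would give two different medians of the triangle through
    \<open>z\<close>, and these meet in the centroid only.\<close>
  have pr: "lam K p z = lam K r z"
  proof -
    have "r \<in> {p', q'}"
    proof (rule ccontr)
      assume "r \<notin> {p', q'}"
      then have "{p', q'} \<subseteq> {p, q}" using pq(5) r(1) by blast
      then show False using ne pq(4,6) by auto
    qed
    then show ?thesis using e1[OF z] e2[OF z] pq(5,6) r by auto
  qed
  have "(\<Sum>v\<in>C. lam K v z) = 1"
    using bary_sum[OF vs(1), of z] w0[OF z] vs(1) C(1,2) by (auto simp: vertex_set_def sum.remove[of _ w])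
  then have "lam K p z + lam K q z + lam K r z = 1" using r pq(4) by (simp add: add.assoc)
  then have third: "lam K p z = 1 / 3" using pr e1[OF z] by simp
  have "dyadic 0" "dyadic 1" unfolding dyadic_def by (rule exI[of _ 0], simp, rule exI[of _ 1], rule exI[of _ 0], simp)
  then have "\<forall>v\<in>vertices K. dyadic (lam K p v)" by (simp add: bary_vertex[OF vs(1)])
  then have "\<forall>v\<in>vertices X. dyadic (lam K p v)"
    using leaves_dyadic[OF affine_fun_bary[OF vs(1)] ts(1) _ X(1)] by blast
  moreover have "z \<in> vertices X" using z bary_notin[OF vX(1)] by fastforce
  ultimately show False using third not_dyadic_third by metis
qed

section \<open>Uniform refinement and the coarsest refinement\<close>

lemma compatibleD:
  "\<lbrakk>compatible \<T>; K \<in> \<T>; K' \<in> \<T>; x \<in> closed_elem K; x \<in> closed_elem K'\<rbrakk> \<Longrightarrow> lam K z x = lam K' z x"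
  unfolding compatible_def by blast

lemma rel_interior_facet_iff:
  fixes S :: "'a::euclidean_space set"
  assumes S: "vertex_set S" and w: "w \<in> S"
  shows "y \<in> rel_interior (convex hull (S - {w})) \<longleftrightarrow> bary S w y = 0 \<and> (\<forall>v\<in>S - {w}. 0 < bary S v y)"
proof -
  have fin: "finite (S - {w})" using S by (simp add: vertex_set_def)
  have ind: "\<not> affine_dependent (S - {w})" using S affine_dependent_subset by (auto simp: vertex_set_def)
  show ?thesis unfolding rel_interior_convex_hull_explicit[OF ind]
  proof
    assume "y \<in> {y. \<exists>u. (\<forall>x\<in>S - {w}. 0 < u x) \<and> sum u (S - {w}) = 1 \<and> (\<Sum>x\<in>S - {w}. u x *\<^sub>R x) = y}"
    then obtain u where u: "\<forall>x\<in>S - {w}. 0 < u x" "sum u (S - {w}) = 1" "(\<Sum>x\<in>S - {w}. u x *\<^sub>R x) = y" by blast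
    have "bary S z y = (if z \<in> S - {w} then u z else 0)" for z
      by (rule bary_convex_hull_subset[OF S _ fin _ u(2,3)]) (use u(1) in \<open>auto simp: less_imp_le\<close>)
    then show "bary S w y = 0 \<and> (\<forall>v\<in>S - {w}. 0 < bary S v y)" using u(1) by auto
  next
    assume a: "bary S w y = 0 \<and> (\<forall>v\<in>S - {w}. 0 < bary S v y)"
    have "(\<Sum>v\<in>S - {w}. bary S v y) = 1" "(\<Sum>v\<in>S - {w}. bary S v y *\<^sub>R v) = y"
      using bary_sum[OF S, of y] bary_comb[OF S, of y] a S w by (auto simp: vertex_set_def sum.remove[of _ w])
    then show "y \<in> {y. \<exists>u. (\<forall>x\<in>S - {w}. 0 < u x) \<and> sum u (S - {w}) = 1 \<and> (\<Sum>x\<in>S - {w}. u x *\<^sub>R x) = y}"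
      using a by (intro CollectI exI[of _ "\<lambda>v. bary S v y"]) simp
  qed
qed

lemma facet_of_closed_elem_iff:
  fixes K :: "'a::euclidean_space tagged"
  assumes K: "tagged_simplex K"
  shows "F facet_of closed_elem K \<longleftrightarrow> (\<exists>w\<in>vertices K. F = convex hull (vertices K - {w}))"
proof -
  have "convex hull (vertices K - {w}) \<noteq> {}" if "w \<in> vertices K" for w
  proof -
    have "card (vertices K - {w}) > 0"
      using vertex_set_vertices[OF K] that by (simp add: vertex_set_def)
    then show ?thesis by (metis card.empty convex_hull_eq_empty less_irrefl)
  qed
  then show ?thesis
    using facet_of_convex_hull_affine_independent[of "vertices K" F] vertex_set_vertices[OF K]
    unfolding closed_elem_def vertex_set_def by blast
qed

lemma edge_neighbourhood_self: "edge_neighbourhood \<T> \<T> = \<T>"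
  unfolding edge_neighbourhood_def by auto

lemma marking_resolved_facet_node:
  fixes \<T> :: "'a::euclidean_space tagged set"
  assumes "DIM('a) = 3" "marking_resolved \<T> \<M> \<T>'" "K \<in> edge_neighbourhood \<T> \<M>"
    "tagged_simplex K" "w \<in> vertices K"
  obtains n where "n \<in> nodes \<T>'" "lam K w n = 0" "\<forall>v\<in>vertices K - {w}. 0 < lam K v n"
proof -
  have "convex hull (vertices K - {w}) facet_of closed_elem K"
    unfolding facet_of_closed_elem_iff[OF assms(4)] using assms(5) by blast
  then obtain n where "n \<in> nodes \<T>'" "n \<in> rel_interior (convex hull (vertices K - {w}))"
    using assms(1,2,3) unfolding marking_resolved_def by blast
  then show thesis using that rel_interior_facet_iff[OF vertex_set_vertices[OF assms(4)] assms(5)] by blast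
qed

definition unif :: "'a::euclidean_space tagged set \<Rightarrow> 'a tagged set" where
  "unif \<T> = forest ut \<T>"

text \<open>In dimension 3 arbitrary tags may force neighbours to bisect a common facet differently; the
  existence of some refinement that resolves all marks excludes this.\<close>

definition facet_matching :: "'a::euclidean_space tagged set \<Rightarrow> bool" where
  "facet_matching \<T> \<longleftrightarrow> (DIM('a) = 3 \<longrightarrow>
     (\<exists>\<T>'. nvb_refinement \<T> \<T>' \<and> conforming \<T>' \<and> marking_resolved \<T> \<T> \<T>'))"

lemma ex_nth_vertex: "w \<in> vertices K \<Longrightarrow> \<exists>i<length (fst K). w = fst K ! i"
  unfolding vertices_def by (metis in_set_conv_nth)

lemma mark_in:
  fixes K :: "'a::euclidean_space tagged"
  assumes K: "tagged_simplex K" and d: "DIM('a) = 3" and x: "x \<in> closed_elem K"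
    and w: "w \<in> vertices K" "lam K w x = 0" and pq: "mark K w = (p, q)"
  shows "\<exists>r. vertices K - {w} = {p, q, r} \<and> p \<noteq> q \<and> p \<noteq> r \<and> q \<noteq> r \<and>
    vrun (up K) (\<lambda>z. lam K z x) = vrun (facet_prog p q r) (\<lambda>z. lam K z x)"
proof -
  have d': "DIM('a) = 2 \<or> DIM('a) = 3" using d by simp
  obtain i where i: "i < length (fst K)" "w = fst K ! i" using ex_nth_vertex[OF w(1)] by blast
  have "i < 4" using i K d by (simp add: tagged_simplex_def)
  then show ?thesis using up_facet[OF K d' d x _ _ ] w(2) pq unfolding i(2) by blast
qed

text \<open>By \<open>lam_leaf\<close> both descendants obtain their coordinates from the same
  function \<open>v\<close> by running the edge lists of their elements. As \<open>v\<close> is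
  supported by the common vertices, the lists need only agree on a face with one, two or three
  vertices.\<close>

lemma compatible_unif:
  fixes \<T> :: "'a::euclidean_space tagged set"
  assumes d: "DIM('a) = 2 \<or> DIM('a) = 3" and m: "mesh \<T>" "compatible \<T>" and fm: "facet_matching \<T>"
  shows "compatible (unif \<T>)"
  unfolding compatible_def
proof (intro ballI allI)
  fix X X' x z assume XX: "X \<in> unif \<T>" "X' \<in> unif \<T>" "x \<in> closed_elem X \<inter> closed_elem X'"
  obtain K where K: "K \<in> \<T>" "X \<in> leaves (ut K) K" using XX(1) unfolding unif_def forest_def by blast
  obtain K' where K': "K' \<in> \<T>" "X' \<in> leaves (ut K') K'" using XX(2) unfolding unif_def forest_def by blast
  have ts: "tagged_simplex K" "tagged_simplex K'" using m(1) K K' by (auto simp: mesh_def)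
  note vs = vertex_set_vertices[OF ts(1)] vertex_set_vertices[OF ts(2)]
  have x: "x \<in> closed_elem X" "x \<in> closed_elem X'" using XX(3) by auto
  have xK: "x \<in> closed_elem K" "x \<in> closed_elem K'"
    using x leaves_subset[OF ts(1) K(2)] leaves_subset[OF ts(2) K'(2)] by auto
  define v where "v = (\<lambda>z. lam K z x)"
  have v': "(\<lambda>z. lam K' z x) = v" unfolding v_def
    using compatibleD[OF m(2) K'(1) K(1) xK(2,1)] by (rule ext)
  have l: "(\<lambda>z. lam X z x) = vrun (up K) v" "(\<lambda>z. lam X' z x) = vrun (up K') v"
    using lam_leaf[OF ts(1) d K(2) x(1)] lam_leaf[OF ts(2) d K'(2) x(2)] v' unfolding v_def by auto
  have "vrun (up K) v = vrun (up K') v"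
  proof (cases "K = K'")
    case False
    define C where "C = vertices K \<inter> vertices K'"
    have vC: "\<forall>z. z \<notin> C \<longrightarrow> v z = 0"
    proof (intro allI impI)
      fix z assume "z \<notin> C"
      then have "z \<notin> vertices K \<or> z \<notin> vertices K'" unfolding C_def by blast
      then show "v z = 0" using bary_notin[OF vs(1), of z x] bary_notin[OF vs(2), of z x] v'
        unfolding v_def by metis
    qed
    have cK: "card (vertices K) = DIM('a) + 1" "card (vertices K') = DIM('a) + 1"
      "finite (vertices K)" "finite (vertices K')" using vs by (auto simp: vertex_set_def)
    have "\<not> vertices K \<subseteq> vertices K'"
    proof
      assume "vertices K \<subseteq> vertices K'"
      then have "vertices K = vertices K'" using cK card_subset_eq by metis
      then have "open_elem K = open_elem K'" unfolding open_elem_def closed_elem_def by simp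
      moreover have "open_elem K \<inter> open_elem K' = {}"
        using m(1) K(1) K'(1) False unfolding mesh_def by blast
      ultimately show False using open_elem_nonempty[OF ts(1)] by simp
    qed
    then have "C \<subset> vertices K" unfolding C_def by blast
    then have c: "card C \<le> DIM('a)" using psubset_card_mono[OF cK(3), of C] cK(1) by linarith
    have "C \<noteq> {}" using compatible_Int[OF m K(1) K'(1)] xK unfolding C_def by auto
    moreover have fC: "finite C" using cK(3) unfolding C_def by simp
    ultimately have c1: "card C \<ge> 1" by (simp add: Suc_leI card_gt_0_iff)
    have sub: "C \<subseteq> vertices K" "C \<subseteq> vertices K'" unfolding C_def by auto
    have vC': "\<forall>z. z \<notin> C \<longrightarrow> lam K z x = 0" "\<forall>z. z \<notin> C \<longrightarrow> lam K' z x = 0"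
      using vC fun_cong[OF v'] unfolding v_def by simp_all
    note small = up_small_face[OF ts(1) d xK(1) sub(1) vC'(1), folded v_def]
      up_small_face[OF ts(2) d xK(2) sub(2) vC'(2), unfolded v']
    consider "card C = 1" | "card C = 2" | "card C = 3" "DIM('a) = 3" using c c1 d by linarith
    then show ?thesis
    proof cases
      case 1
      then show ?thesis using small(1,3) by simp
    next
      case 2
      obtain p q where pq: "C = {p, q}" "vrun (up K) v = vstep (p, q) v" using small(2)[OF 2] by blast
      obtain p' q' where pq': "C = {p', q'}" "vrun (up K') v = vstep (p', q') v" using small(4)[OF 2] by blast
      have "(p = p' \<and> q = q') \<or> (p = q' \<and> q = p')" using pq(1) pq'(1) by (metis doubleton_eq_iff)
      then show ?thesis unfolding pq(2) pq'(2) using vstep_sym by metis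
    next
      case 3
      have "card (vertices K - C) = 1" "card (vertices K' - C) = 1"
        using cK sub fC 3 by (simp_all add: card_Diff_subset)
      then obtain w w' where w: "vertices K - C = {w}" "vertices K' - C = {w'}" by (meson card_1_singletonE)
      have C: "C = vertices K - {w}" "w \<in> vertices K" "C = vertices K' - {w'}" "w' \<in> vertices K'"
        using w sub by auto
      have w0: "lam K w x = 0" "lam K' w' x = 0" using vC' C by auto
      obtain p q where pq: "mark K w = (p, q)" by (cases "mark K w")
      obtain p' q' where pq': "mark K' w' = (p', q')" by (cases "mark K' w'")
      obtain r where r: "C = {p, q, r}" "p \<noteq> q" "p \<noteq> r" "q \<noteq> r" "vrun (up K) v = vrun (facet_prog p q r) v"
        using mark_in[OF ts(1) 3(2) xK(1) C(2) w0(1) pq] unfolding v_def C(1) by blast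
      obtain r' where r': "C = {p', q', r'}" "p' \<noteq> q'" "p' \<noteq> r'" "q' \<noteq> r'" "vrun (up K') v = vrun (facet_prog p' q' r') v"
        using mark_in[OF ts(2) 3(2) xK(2) C(4) w0(2) pq'] unfolding v' C(3) by blast
      \<comment> \<open>A refinement with interior nodes on all facets is at hand, so
        \<open>mark_agree\<close> yields the same first edge on both sides. Its orientation may
        differ, which \<open>facet_prog_commute\<close> absorbs.\<close>
      obtain \<T>' where T': "nvb_refinement \<T> \<T>'" "conforming \<T>'" "marking_resolved \<T> \<T> \<T>'"
        using fm 3(2) unfolding facet_matching_def by blast
      obtain t where t: "\<T>' = forest t \<T>" using T'(1) nvb_refinement_iff_forest[OF m(1)] by blast
      have ct: "compatible (forest t \<T>)" using conforming_mesh_compatible T'(2) t by blast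
      obtain n where n: "n \<in> nodes \<T>'" "lam K w n = 0" "\<forall>v\<in>vertices K - {w}. 0 < lam K v n"
        using marking_resolved_facet_node[OF 3(2) T'(3) _ ts(1) C(2)] K(1) edge_neighbourhood_self by blast
      have eq: "{p, q} = {p', q'}"
        by (rule mark_agree[OF 3(2) m ct K(1) K'(1) C n(1)[unfolded t] n(2) _ pq pq'])
          (use n(3) C(1) r(1,2) r'(1,2) in auto)
      have "r \<notin> {p, q}" "r' \<notin> {p', q'}" using r(3,4) r'(3,4) by auto
      then have rr: "r = r'" using r(1) r'(1) eq by blast
      have "(p = p' \<and> q = q') \<or> (p = q' \<and> q = p')" using eq by (simp add: doubleton_eq_iff)
      then show ?thesis
      proof
        assume "p = q' \<and> q = p'"
        moreover have "vrun (facet_prog p q r) v = vrun (facet_prog q p r) v"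
        proof (rule facet_prog_commute)
          show "\<forall>z. 0 \<le> v z" using xK(1) closed_elem_iff[OF ts(1)] unfolding v_def by blast
          show "p \<noteq> midpoint q r" "q \<noteq> midpoint p r"
            using vertex_set_bisect(1)[OF vs(1), of q r] vertex_set_bisect(1)[OF vs(1), of p r] r sub(1)
            by auto
        qed (use r in auto)
        ultimately show ?thesis using r(5) r'(5) rr by simp
      qed (use r(5) r'(5) rr in simp)
    qed
  qed simp
  then show "lam X z x = lam X' z x" using l fun_cong by metis
qed

lemma leaf_node: "K \<in> \<T> \<Longrightarrow> X \<in> leaves (t K) K \<Longrightarrow> v \<in> vertices X \<Longrightarrow> v \<in> nodes (forest t \<T>)"
  unfolding nodes_def forest_def by blast

lemma snode_leaf:
  fixes K :: "'a::euclidean_space tagged"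
  assumes K: "tagged_simplex K" and t: "tree_ok DIM('a) t X" and c: "c \<in> set (snodes DIM('a) t X)"
  shows "\<exists>Y\<in>leaves t (rl K X). pt K c \<in> vertices Y"
proof -
  obtain S where "S \<in> set (sleaves DIM('a) t X)" "c \<in> set (fst S)" using c unfolding snodes_def by auto
  then show ?thesis unfolding leaves_rl[OF K t] by (intro bexI[of _ "rl K S"]) (auto simp: vertices_rl[OF K])
qed

text \<open>Where \<open>t\<close> branches and \<open>s\<close> stops, one of the prescribed nodes
  would lie in an element of the mesh without being its vertex, which compatibility excludes; so
  \<open>s\<close> branches as well.\<close>

lemma forced_tree:
  fixes \<T>' :: "'a::euclidean_space tagged set"
  assumes K: "tagged_simplex K" and m: "mesh \<T>'" "compatible \<T>'"
    and N: "\<forall>n\<in>set N. snode_ok DIM('a) n \<and> pt K n \<in> nodes \<T>'"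
  shows "tagged_simplex (rl K X) \<Longrightarrow> leaves s (rl K X) \<subseteq> \<T>' \<Longrightarrow> tle s t \<Longrightarrow> tree_ok DIM('a) t X \<Longrightarrow>
    forced DIM('a) N t X \<Longrightarrow> s = t"
proof (induction t arbitrary: s X)
  case Leaf
  then show ?case by (cases s) auto
next
  case (Node l r)
  let ?d = "DIM('a)"
  obtain n where n: "n \<in> set N" "n \<in> set (snodes ?d (Node l r) X)" "n \<notin> set (fst X)"
    using Node.prems(5) by (auto simp: list_ex_iff)
  have ok: "ssimplex_ok ?d X" "even_edge (hd (fst X)) (last (fst X))" using Node.prems(4) by auto
  have "s \<noteq> Leaf"
  proof
    assume "s = Leaf"
    then have X: "rl K X \<in> \<T>'" using Node.prems(2) by simp
    obtain Y where Y: "Y \<in> leaves (Node l r) (rl K X)" "pt K n \<in> vertices Y"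
      using snode_leaf[OF K Node.prems(4) n(2)] by blast
    have "pt K n \<in> closed_elem Y" using Y(2) unfolding closed_elem_def by (simp add: hull_inc)
    then have "pt K n \<in> closed_elem (rl K X)" using leaves_subset[OF Node.prems(1) Y(1)] by blast
    then have "pt K n \<in> vertices (rl K X)" using node_in_closed_elem[OF m X] N n(1) by blast
    then show False using pt_in_vertices_rl[OF K ok(1)] N n(1,3) by blast
  qed
  then obtain s1 s2 where s: "s = Node s1 s2" by (cases s) auto
  note r = rl_sons[OF K ok]
  note ts = tagged_simplex_sons[OF Node.prems(1)]
  have "s1 = l" by (rule Node.IH(1)[of "sson1 ?d X"]) (use Node.prems s r ts in auto)
  moreover have "s2 = r" by (rule Node.IH(2)[of "sson2 ?d X"]) (use Node.prems s rl_sons[OF K ok] ts in auto)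
  ultimately show ?case using s by simp
qed

lemma unif_node:
  fixes \<T> :: "'a::euclidean_space tagged set"
  assumes d: "DIM('a) = 2 \<or> DIM('a) = 3" and m: "mesh \<T>" and K: "K \<in> \<T>"
    and c: "c \<in> set (sforcing DIM('a) (snd K))"
  shows "pt K c \<in> nodes (unif \<T>)" "snode_ok DIM('a) c"
proof -
  have ts: "tagged_simplex K" using m K by (auto simp: mesh_def)
  note u = ucheck_K[OF ts d]
  have "c \<in> set (snodes DIM('a) (ut K) (sroot DIM('a) (snd K)))" "tree_ok DIM('a) (ut K) (sroot DIM('a) (snd K))"
    and ok: "snode_ok DIM('a) c"
    using u c unfolding ucheck_def list_all_iff by auto
  then obtain Y where "Y \<in> leaves (ut K) K" "pt K c \<in> vertices Y"
    using snode_leaf[OF ts] rl_root[OF ts] by metis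
  then show "pt K c \<in> nodes (unif \<T>)" unfolding unif_def by (intro leaf_node[OF K])
  show "snode_ok DIM('a) c" by (rule ok)
qed

lemma sleaves_ok: "S \<in> set (sleaves d t X) \<Longrightarrow> tree_ok d t X \<Longrightarrow> ssimplex_ok d S"
proof (induction t arbitrary: X)
  case (Node l r)
  then show ?case by (simp del: split_paired_All) blast
qed simp

lemma sunit_2: "sunit 2 0 = [4, 0, 0]" "sunit 2 (Suc 0) = [0, 4, 0]" "sunit 2 2 = [0, 0, 4]"
  by code_simp+

lemma midpoint_snode:
  fixes K :: "'a::euclidean_space tagged"
  assumes K: "tagged_simplex K" and d: "DIM('a) = 2" and xy: "x \<in> vertices K" "y \<in> vertices K" "x \<noteq> y"
  shows "\<exists>c\<in>set (sforcing DIM('a) (snd K)). midpoint x y = pt K c"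
proof -
  have d': "DIM('a) = 2 \<or> DIM('a) = 3" using d by simp
  have l: "length (fst K) = 3" using K d by (simp add: tagged_simplex_def)
  obtain i j where ij: "i < 3" "j < 3" "x = fst K ! i" "y = fst K ! j"
    using ex_nth_vertex xy(1,2) l by metis
  have "i \<noteq> j" using ij xy(3) by auto
  have "i = 0 \<or> i = 1 \<or> i = 2" "j = 0 \<or> j = 1 \<or> j = 2" using ij by auto
  then have "even_edge (sunit 2 i) (sunit 2 j) \<and> smid (sunit 2 i) (sunit 2 j) \<in> set [[2,2,0], [2,0,2], [0,2,2]]"
    using \<open>i \<noteq> j\<close> by (elim disjE) (simp_all add: sunit_2 smid_def even_edge_def)
  moreover have "pt K (smid (sunit 2 i) (sunit 2 j)) = midpoint x y"
    if "even_edge (sunit 2 i) (sunit 2 j)"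
    using pt_smid[OF K, of "sunit 2 i" "sunit 2 j"] sunit_ok[of i 2] sunit_ok[of j 2] that
      pt_sunit[OF K d', of i] pt_sunit[OF K d', of j] ij d by simp
  ultimately show ?thesis using d unfolding sforcing_def by (intro bexI[of _ "smid (sunit 2 i) (sunit 2 j)"]) auto
qed

lemma sfacet_node_lam:
  fixes K :: "'a::euclidean_space tagged"
  assumes K: "tagged_simplex K" and d: "DIM('a) = 3" and i: "i < 4"
    and c: "c \<in> set (snodes 3 (ut K) (sroot 3 (snd K)))" "snode_ok 3 c"
  shows "(lam K (fst K ! i) (pt K c) = 0 \<and> (\<forall>v\<in>vertices K - {fst K ! i}. 0 < lam K v (pt K c)))
    \<longleftrightarrow> c = sfacet_node (snd K) i"
proof -
  have d': "DIM('a) = 2 \<or> DIM('a) = 3" using d by simp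
  have l: "length (fst K) = 4" and dist: "distinct (fst K)" using K d by (auto simp: tagged_simplex_def)
  have lc: "lam K (fst K ! j) (pt K c) = real (c ! j) / 4" if "j < 4" for j
    using lam_pt[OF K, of c j] c(2) d that by simp
  have v: "vertices K - {fst K ! i} = (\<lambda>j. fst K ! j) ` ({..<4} - {i})"
    unfolding vertices_def set_conv_nth l using l dist i by (auto simp: nth_eq_iff_index_eq)
  have sc: "set (scompl 3 [i]) = {..<4} - {i}" unfolding scompl_def by auto
  have "(lam K (fst K ! i) (pt K c) = 0 \<and> (\<forall>v\<in>vertices K - {fst K ! i}. 0 < lam K v (pt K c)))
    \<longleftrightarrow> c ! i = 0 \<and> list_all (\<lambda>j. c ! j \<noteq> 0) (scompl 3 [i])"
  proof -
    have "lam K (fst K ! j) (pt K c) = 0 \<longleftrightarrow> c ! j = 0" "0 < lam K (fst K ! j) (pt K c) \<longleftrightarrow> c ! j \<noteq> 0"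
      if "j < 4" for j using lc[OF that] by auto
    then show ?thesis unfolding v list_all_iff sc using i by auto
  qed
  also have "\<dots> \<longleftrightarrow> c = sfacet_node (snd K) i"
    using ucheck_K[OF K d'] c(1) d i by (auto simp: ucheck_def list_all_iff)
  finally show ?thesis .
qed

lemma sforcing_3: "set (sforcing 3 \<beta>) = sfacet_node \<beta> ` {..<4}"
  unfolding sforcing_def by (auto simp: atLeast0LessThan)

lemma unif_marking_resolved:
  fixes \<T> :: "'a::euclidean_space tagged set"
  assumes d: "DIM('a) = 2 \<or> DIM('a) = 3" and m: "mesh \<T>" and M: "\<M> \<subseteq> \<T>"
  shows "marking_resolved \<T> \<M> (unif \<T>)"
  unfolding marking_resolved_def
proof (intro conjI impI ballI allI)
  fix K x y assume "DIM('a) = 2" "K \<in> \<M>" "x \<in> vertices K" "y \<in> vertices K" "x \<noteq> y"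
  then show "midpoint x y \<in> nodes (unif \<T>)"
    using midpoint_snode[of K x y] unif_node(1)[OF d m, of K] M m unfolding mesh_def by (metis subsetD)
next
  fix K F assume d3: "DIM('a) = 3" and K: "K \<in> edge_neighbourhood \<T> \<M>" and F: "F facet_of closed_elem K"
  have KT: "K \<in> \<T>" using K unfolding edge_neighbourhood_def by blast
  then have ts: "tagged_simplex K" using m by (auto simp: mesh_def)
  obtain w where w: "w \<in> vertices K" "F = convex hull (vertices K - {w})"
    using F facet_of_closed_elem_iff[OF ts] by blast
  obtain i where i: "i < 4" "w = fst K ! i" using ex_nth_vertex[OF w(1)] ts d3 by (auto simp: tagged_simplex_def)
  let ?c = "sfacet_node (snd K) i"
  have c: "?c \<in> set (sforcing DIM('a) (snd K))" unfolding d3 sforcing_3 using i by blast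
  have cn: "?c \<in> set (snodes 3 (ut K) (sroot 3 (snd K)))"
    using ucheck_K[OF ts d] c d3 unfolding ucheck_def list_all_iff by auto
  have "pt K ?c \<in> rel_interior F"
    unfolding w(2) rel_interior_facet_iff[OF vertex_set_vertices[OF ts] w(1)]
    using sfacet_node_lam[OF ts d3 i(1) cn] unif_node(2)[OF d m KT c] d3 i(2) by simp
  then show "\<exists>z\<in>nodes (unif \<T>). z \<in> rel_interior F" using unif_node(1)[OF d m KT c] by blast
qed

section \<open>Meshes on which \<open>refine\<close> is well defined\<close>

locale refinable_mesh =
  fixes \<T> :: "'a::euclidean_space tagged set"
  assumes dim: "DIM('a) = 2 \<or> DIM('a) = 3"
    and conforming: "conforming \<T>"
    and refinable: "\<And>\<M>. \<M> \<subseteq> \<T> \<Longrightarrow> \<exists>\<T>'. coarsest_refinement \<T> \<M> \<T>'"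
begin

lemma mesh: "mesh \<T>" and compatible: "compatible \<T>"
  using conforming_mesh_compatible[OF conforming] by auto

lemma simplex: "K \<in> \<T> \<Longrightarrow> tagged_simplex K" using mesh by (simp add: mesh_def)

lemma facet_matching: "facet_matching \<T>"
  using refinable[of \<T>] unfolding facet_matching_def coarsest_refinement_def by blast

lemma unif_compatible: "compatible (unif \<T>)"
  by (rule compatible_unif[OF dim mesh compatible facet_matching])

lemma unif_mesh: "mesh (unif \<T>)" unfolding unif_def by (rule mesh_forest[OF mesh])

lemma unif_conforming: "conforming (unif \<T>)"
  by (rule mesh_compatible_conforming[OF unif_mesh unif_compatible])

text \<open>The uniform refinement is conforming and resolves every marking, so a coarsest
  refinement cannot go beyond it. This bounds all trees by \<open>utree\<close>.\<close>

lemma coarsest_below_unif: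
  assumes "coarsest_refinement \<T> \<M> \<T>'" "\<M> \<subseteq> \<T>"
  obtains t where "\<T>' = forest t \<T>" "\<And>K. K \<in> \<T> \<Longrightarrow> tle (t K) (ut K)" "nvb_refinement \<T>' (unif \<T>)"
proof -
  have "nvb_refinement \<T> (unif \<T>)" unfolding unif_def by (rule forest_nvb[OF mesh])
  then have le: "nvb_refinement \<T>' (unif \<T>)"
    using assms unif_conforming unif_marking_resolved[OF dim mesh assms(2)]
    unfolding coarsest_refinement_def by blast
  have "nvb_refinement \<T> \<T>'" using assms unfolding coarsest_refinement_def by blast
  then obtain t where t: "\<T>' = forest t \<T>" using nvb_refinement_iff_forest[OF mesh] by blast
  obtain t' where t': "unif \<T> = forest t' \<T>" "\<And>K. tle (t K) (t' K)"
    using nvb_forest[OF mesh le[unfolded t]] by blast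
  have "t' K = ut K" if "K \<in> \<T>" for K
    using forest_inj[OF mesh _ that, of t' ut] t'(1) unfolding unif_def by simp
  then show thesis using that[OF t _ le] t'(2) by metis
qed

text \<open>The nodes demanded by the marking are those that force every branching of
  \<open>utree\<close>. In dimension 2 they are named by the marking; in dimension 3 they have to be
  identified first.\<close>

lemma resolved_tree:
  assumes t: "\<T>' = forest t \<T>" "\<And>K. K \<in> \<T> \<Longrightarrow> tle (t K) (ut K)" "nvb_refinement \<T>' (unif \<T>)"
    and c: "conforming \<T>'" and r: "marking_resolved \<T> \<M> \<T>'"
    and K: "K \<in> \<T>" "DIM('a) = 2 \<Longrightarrow> K \<in> \<M>" "DIM('a) = 3 \<Longrightarrow> K \<in> edge_neighbourhood \<T> \<M>"
  shows "t K = ut K"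
proof -
  let ?N = "sforcing DIM('a) (snd K)"
  note mc = conforming_mesh_compatible[OF c]
  note ts = simplex[OF K(1)]
  note u = ucheck_K[OF ts dim]
  have ok: "snode_ok DIM('a) n" if "n \<in> set ?N" for n using unif_node(2)[OF dim mesh K(1) that] .
  have N: "pt K n \<in> nodes \<T>'" if n: "n \<in> set ?N" for n
    using dim
  proof
    assume d: "DIM('a) = 2"
    have l: "length (fst K) = 3" and dist: "distinct (fst K)" using ts d by (auto simp: tagged_simplex_def)
    have "n = smid (sunit 2 0) (sunit 2 1) \<or> n = smid (sunit 2 0) (sunit 2 2) \<or> n = smid (sunit 2 1) (sunit 2 2)"
      using n d by (auto simp: sforcing_def sunit_2 smid_def)
    then have "\<exists>i j. i < 3 \<and> j < 3 \<and> i \<noteq> j \<and> n = smid (sunit 2 i) (sunit 2 j)"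
    proof (elim disjE)
      assume "n = smid (sunit 2 0) (sunit 2 1)"
      then show ?thesis by (intro exI[of _ 0] exI[of _ 1]) simp
    next
      assume "n = smid (sunit 2 0) (sunit 2 2)"
      then show ?thesis by (intro exI[of _ 0] exI[of _ 2]) simp
    next
      assume "n = smid (sunit 2 1) (sunit 2 2)"
      then show ?thesis by (intro exI[of _ 1] exI[of _ 2]) simp
    qed
    then obtain i j where ij: "i < 3" "j < 3" "i \<noteq> j" "n = smid (sunit 2 i) (sunit 2 j)" by blast
    have "i = 0 \<or> i = 1 \<or> i = 2" "j = 0 \<or> j = 1 \<or> j = 2" using ij by auto
    then have "even_edge (sunit 2 i) (sunit 2 j)"
      using ij(3) by (elim disjE) (simp_all add: sunit_2 even_edge_def)
    then have "pt K n = midpoint (fst K ! i) (fst K ! j)"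
      using pt_smid[OF ts, of "sunit 2 i" "sunit 2 j"] sunit_ok[of i 2] sunit_ok[of j 2]
        pt_sunit[OF ts dim, of i] pt_sunit[OF ts dim, of j] ij d by simp
    moreover have "fst K ! i \<in> vertices K" "fst K ! j \<in> vertices K" "fst K ! i \<noteq> fst K ! j"
      using ij l dist by (auto simp: vertices_def nth_eq_iff_index_eq)
    ultimately show ?thesis using r d K(2) unfolding marking_resolved_def by auto
  next
    assume d: "DIM('a) = 3"
    obtain i where i: "i < 4" "n = sfacet_node (snd K) i" using n unfolding d sforcing_3 by blast
    have w: "fst K ! i \<in> vertices K" using i ts d by (simp add: tagged_simplex_def vertices_def)
    obtain q where q: "q \<in> nodes \<T>'" "lam K (fst K ! i) q = 0" "\<forall>v\<in>vertices K - {fst K ! i}. 0 < lam K v q"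
      using marking_resolved_facet_node[OF d r K(3)[OF d] ts w] by blast
    \<comment> \<open>The marking yields some node \<open>q\<close> inside the facet. Refining up to
      the uniform mesh keeps \<open>q\<close>, and there the interior node of a facet is unique, so
      \<open>q\<close> is the one listed in \<open>sforcing\<close>.\<close>
    have "q \<in> nodes (unif \<T>)"
    proof -
      obtain s where "unif \<T> = forest s \<T>'"
        using t(3) nvb_refinement_iff_forest[of \<T>' "unif \<T>"] mc by blast
      then show ?thesis using nodes_forest[of \<T>' s] mc q(1) by auto
    qed
    have "0 \<le> lam K z q" for z
      using q(2,3) bary_notin[OF vertex_set_vertices[OF ts], of z q]
      by (cases "z = fst K ! i"; cases "z \<in> vertices K") (auto simp: less_imp_le)
    then have "q \<in> closed_elem K" unfolding closed_elem_iff[OF ts] by blast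
    then obtain Y where Y: "Y \<in> leaves (ut K) K" "q \<in> closed_elem Y" using leaves_closed[OF ts, of "ut K"] by blast
    have "Y \<in> unif \<T>" using Y(1) K(1) unfolding unif_def forest_def by blast
    then have "q \<in> vertices Y" using node_in_closed_elem[OF unif_mesh unif_compatible _ \<open>q \<in> nodes (unif \<T>)\<close> Y(2)] by blast
    moreover obtain S where S: "S \<in> set (sleaves DIM('a) (ut K) (sroot DIM('a) (snd K)))" "Y = rl K S"
      using Y(1) unfolding leaves_ut[OF ts dim] by blast
    ultimately obtain c where c: "c \<in> set (fst S)" "q = pt K c" using vertices_rl[OF ts, of S] by auto
    have cs: "c \<in> set (snodes 3 (ut K) (sroot 3 (snd K)))" using S(1) c(1) d unfolding snodes_def by auto
    have "ssimplex_ok DIM('a) S" using sleaves_ok[OF S(1)] u unfolding ucheck_def by blast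
    then have "snode_ok 3 c" using c(1) d by (auto simp: ssimplex_ok_def list_all_iff)
    then have "c = sfacet_node (snd K) i"
      using sfacet_node_lam[OF ts d i(1) cs] q(2,3) c(2) by blast
    then show ?thesis using q(1) c(2) i(2) by simp
  qed
  show ?thesis
  proof (rule forced_tree[OF ts, of \<T>' ?N "sroot DIM('a) (snd K)"])
    show "mesh \<T>'" "compatible \<T>'" using mc by auto
    show "\<forall>n\<in>set ?N. snode_ok DIM('a) n \<and> pt K n \<in> nodes \<T>'" using N ok by blast
    show "tagged_simplex (rl K (sroot DIM('a) (snd K)))" using ts rl_root[OF ts] by simp
    show "leaves (t K) (rl K (sroot DIM('a) (snd K))) \<subseteq> \<T>'"
      unfolding rl_root[OF ts] t(1) forest_def using K(1) by blast
    show "tle (t K) (ut K)" by (rule t(2)[OF K(1)])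
  qed (use u in \<open>auto simp: ucheck_def\<close>)
qed

lemma coarsest_unique:
  assumes "coarsest_refinement \<T> \<M> \<A>" "coarsest_refinement \<T> \<M> \<B>" shows "\<A> = \<B>"
  using nvb_antisym[OF mesh] assms unfolding coarsest_refinement_def by blast

lemma coarsest_refine: "\<M> \<subseteq> \<T> \<Longrightarrow> coarsest_refinement \<T> \<M> (refine \<T> \<M>)"
  unfolding refine_def using refinable coarsest_unique by (metis theI)

lemma uniform_refinement_eq: "uniform_refinement \<T> = unif \<T>"
proof -
  have c: "coarsest_refinement \<T> \<T> (refine \<T> \<T>)" by (rule coarsest_refine) simp
  obtain t where t: "refine \<T> \<T> = forest t \<T>" "\<And>K. K \<in> \<T> \<Longrightarrow> tle (t K) (ut K)"
    "nvb_refinement (refine \<T> \<T>) (unif \<T>)"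
    by (rule coarsest_below_unif[OF c]) auto
  have "t K = ut K" if "K \<in> \<T>" for K
    by (rule resolved_tree[OF t _ _ that, of \<T>])
      (use c that in \<open>auto simp: coarsest_refinement_def edge_neighbourhood_self\<close>)
  then show ?thesis unfolding t(1) unif_def forest_def by auto
qed

end

section \<open>The energy product\<close>

text \<open>Bounds the integrand of the energy for functions with jumps at most
  \<open>min (norm (x - y) / h) 1\<close>. The quadratic term makes the singularity at 0 integrable
  for \<open>s < 1\<close>; the constant term suffices at infinity for \<open>0 < s\<close>.\<close>

definition trunc_kernel :: "real \<Rightarrow> real \<Rightarrow> 'a::euclidean_space \<Rightarrow> real" where
  "trunc_kernel s h w = min ((norm w / h)\<^sup>2) 1 / norm w powr (real DIM('a) + 2 * s)"

lemma trunc_kernel_nonneg: "0 \<le> trunc_kernel s h w"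
  by (simp add: trunc_kernel_def)

lemma trunc_kernel_measurable [measurable]: "trunc_kernel s h \<in> borel_measurable borel"
  unfolding trunc_kernel_def by measurable

lemma powr_power_swap: "0 < (x::real) \<Longrightarrow> (x ^ n) powr p = (x powr p) ^ n"
  by (simp add: powr_realpow[symmetric] powr_powr mult.commute powr_power)

lemma two_powr_Suc: "2 powr (real k + 1) = (2::real) ^ (k + 1)"
  using powr_realpow[of 2 "k + 1"] by (simp add: add.commute)

text \<open>Dyadic shells: the kernel is at most \<open>A k\<close> where 2^k <= |w| <= 2^(k+1), and
  at most \<open>B k\<close> where 2^(-k-1) <= |w| <= 2^(-k). Enlarging the shells to balls leaves
  geometric series with ratios 2^(-2s) and 2^(2s-2).\<close>

lemma trunc_kernel_finite:
  assumes s: "0 < s" "s < 1"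
  shows "(\<integral>\<^sup>+w. ennreal (trunc_kernel s 1 (w::'a::euclidean_space)) \<partial>lborel) < \<infinity>"
proof -
  let ?d = "DIM('a)"
  define p where "p = real ?d + 2 * s"
  define V where "V = unit_ball_vol (real ?d)"
  have V: "0 \<le> V" by (simp add: V_def)
  define A where "A k = 1 / (2 powr p) ^ k" for k :: nat
  define B where "B k = (1/4) ^ k * (2 powr p) ^ (k + 1)" for k :: nat
  have A0: "0 \<le> A k" and B0: "0 \<le> B k" for k by (simp_all add: A_def B_def)
  have p0: "0 < p" using s by (simp add: p_def add_nonneg_pos)
  let ?F = "\<lambda>k w. ennreal (A k) * indicator (cball (0::'a) (2 ^ (k + 1))) w + ennreal (B k) * indicator (cball (0::'a) ((1/2) ^ k)) w"
  have bound: "ennreal (trunc_kernel s 1 w) \<le> (\<Sum>k. ?F k w)" for w :: 'a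
  proof (cases "w = 0")
    case False
    then have w: "0 < norm w" by simp
    have "\<exists>k. ennreal (trunc_kernel s 1 w) \<le> ?F k w"
    proof (cases "1 \<le> norm w")
      case True
      define k where "k = nat \<lfloor>log 2 (norm w)\<rfloor>"
      have l0: "0 \<le> log 2 (norm w)" using True w by (simp add: zero_le_log_cancel_iff)
      have k1: "real k \<le> log 2 (norm w)" "log 2 (norm w) \<le> real k + 1"
        using l0 unfolding k_def by linarith+
      have lo: "2 ^ k \<le> norm w"
        using k1(1) w by (metis le_log_iff one_less_numeral_iff powr_realpow semiring_norm(76) zero_less_numeral)
      have "norm w \<le> 2 powr (real k + 1)" using k1(2) w by (simp add: log_le_iff)
      then have hi: "norm w \<le> 2 ^ (k + 1)" unfolding two_powr_Suc .
      have "trunc_kernel s 1 w \<le> 1 / norm w powr p"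
        unfolding trunc_kernel_def p_def by (intro divide_right_mono) auto
      also have "\<dots> \<le> 1 / (2 ^ k) powr p"
        using lo p0 w by (intro divide_left_mono powr_mono2 mult_pos_pos) auto
      also have "\<dots> = A k" unfolding A_def by (simp add: powr_power_swap)
      finally have "ennreal (trunc_kernel s 1 w) \<le> ennreal (A k) * indicator (cball 0 (2 ^ (k + 1))) w"
        using hi by (simp add: ennreal_leI)
      then show ?thesis by (intro exI[of _ k]) (simp add: add_increasing2)
    next
      case False
      define k where "k = nat \<lfloor>log 2 (1 / norm w)\<rfloor>"
      have l0: "0 \<le> log 2 (1 / norm w)" using False w by (simp add: log_divide)
      have k1: "real k \<le> log 2 (1 / norm w)" "log 2 (1 / norm w) \<le> real k + 1"
        using l0 unfolding k_def by linarith+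
      have "2 powr real k \<le> 1 / norm w" using k1(1) w by (subst (asm) le_log_iff) auto
      then have hi: "norm w \<le> (1/2) ^ k" using w by (simp add: powr_realpow field_simps)
      have "1 / norm w \<le> 2 powr (real k + 1)" using k1(2) w by (subst (asm) log_le_iff) auto
      then have "1 / norm w \<le> 2 ^ (k + 1)" unfolding two_powr_Suc .
      then have lo: "(1/2) ^ (k + 1) \<le> norm w" using w by (simp add: field_simps)
      have "trunc_kernel s 1 w \<le> (norm w)\<^sup>2 / norm w powr p"
        unfolding trunc_kernel_def p_def by (intro divide_right_mono) auto
      also have "\<dots> \<le> ((1/2) ^ k)\<^sup>2 / ((1/2) ^ (k + 1)) powr p"
        using lo hi p0 w by (intro frac_le powr_mono2 power_mono) auto
      also have "\<dots> = B k"
      proof -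
        have "((1/2) ^ (k + 1)) powr p = 1 / (2 powr p) ^ (k + 1)"
          by (subst powr_power_swap) (simp_all add: powr_divide power_divide)
        moreover have "((1/2::real) ^ k)\<^sup>2 = (1/4) ^ k"
          by (simp add: power2_eq_square power_mult_distrib[symmetric])
        ultimately show ?thesis unfolding B_def by simp
      qed
      finally have "ennreal (trunc_kernel s 1 w) \<le> ennreal (B k) * indicator (cball 0 ((1/2) ^ k)) w"
        using hi by (simp add: ennreal_leI)
      then show ?thesis by (intro exI[of _ k]) (simp add: add_increasing)
    qed
    then obtain k where "ennreal (trunc_kernel s 1 w) \<le> ?F k w" by blast
    also have "\<dots> = (\<Sum>i\<in>{k}. ?F i w)" by simp
    also have "\<dots> \<le> (\<Sum>i. ?F i w)" by (rule sum_le_suminf) auto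
    finally show ?thesis .
  qed (simp add: trunc_kernel_def)
  have int: "(\<integral>\<^sup>+w. ?F k w \<partial>lborel) = ennreal (A k * (V * (2 ^ (k + 1)) ^ ?d) + B k * (V * ((1/2) ^ k) ^ ?d))" for k
  proof -
    have "(\<integral>\<^sup>+w. ?F k w \<partial>lborel) = ennreal (A k) * emeasure lborel (cball (0::'a) (2 ^ (k + 1))) + ennreal (B k) * emeasure lborel (cball (0::'a) ((1/2) ^ k))"
      by (subst nn_integral_add)
        (auto simp: nn_integral_cmult_indicator intro!: borel_measurable_times_ennreal borel_measurable_indicator)
    also have "\<dots> = ennreal (A k) * ennreal (V * (2 ^ (k + 1)) ^ ?d) + ennreal (B k) * ennreal (V * ((1/2) ^ k) ^ ?d)"
      unfolding V_def by (simp add: emeasure_cball)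
    also have "\<dots> = ennreal (A k * (V * (2 ^ (k + 1)) ^ ?d) + B k * (V * ((1/2) ^ k) ^ ?d))"
      using A0 B0 V by (simp add: ennreal_mult ennreal_plus)
    finally show ?thesis .
  qed
  have sumA: "summable (\<lambda>k. A k * (V * (2 ^ (k + 1)) ^ ?d))"
  proof -
    have r: "2 ^ ?d / 2 powr p = 2 powr (- (2 * s))"
      unfolding p_def by (simp add: powr_realpow[symmetric] powr_diff[symmetric])
    have "A k * (V * (2 ^ (k + 1)) ^ ?d) = V * 2 ^ ?d * (2 powr (- (2 * s))) ^ k" for k
      unfolding r[symmetric] A_def by (simp add: power_mult_distrib power_divide power_mult[symmetric] mult.commute[of ?d])
    moreover have "\<bar>2 powr (- (2 * s))\<bar> < (1::real)" using s by (simp add: powr_less_one)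
    ultimately show ?thesis by (simp only: summable_mult summable_geometric real_norm_def)
  qed
  have sumB: "summable (\<lambda>k. B k * (V * ((1/2) ^ k) ^ ?d))"
  proof -
    have q: "1/4 = 2 powr (-2::real)" using powr_minus[of 2 "2::real"] by simp
    have d: "(1/2) ^ ?d = 2 powr (- real ?d)"
      using powr_minus[of 2 "real ?d"] powr_realpow[of 2 ?d] by (simp add: power_one_over inverse_eq_divide)
    have r: "(1/4) * (2 powr p) * (1/2) ^ ?d = 2 powr (2 * s - 2)"
      unfolding p_def q d powr_add[symmetric] by (rule arg_cong[of _ _ "\<lambda>t. 2 powr t"]) linarith
    have "B k * (V * ((1/2) ^ k) ^ ?d) = V * 2 powr p * (2 powr (2 * s - 2)) ^ k" for k
      unfolding r[symmetric] B_def by (simp add: power_mult_distrib power_divide power_mult[symmetric] mult.commute[of ?d])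
    moreover have "\<bar>2 powr (2 * s - 2)\<bar> < (1::real)" using s by (simp add: powr_less_one)
    ultimately show ?thesis by (simp only: summable_mult summable_geometric real_norm_def)
  qed
  have "(\<integral>\<^sup>+w. ennreal (trunc_kernel s 1 (w::'a)) \<partial>lborel) \<le> (\<integral>\<^sup>+w. (\<Sum>k. ?F k w) \<partial>lborel)"
    by (rule nn_integral_mono) (rule bound)
  also have "\<dots> = (\<Sum>k. \<integral>\<^sup>+w. ?F k w \<partial>lborel)"
    by (rule nn_integral_suminf) (auto intro!: borel_measurable_times_ennreal borel_measurable_indicator
        borel_measurable_add[where 'b=ennreal] simp: borel_closed)
  also have "\<dots> < \<infinity>"
  proof -
    have "(\<Sum>k. ennreal (A k * (V * (2 ^ (k + 1)) ^ ?d) + B k * (V * ((1/2) ^ k) ^ ?d))) \<noteq> top"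
      by (rule ennreal_suminf_neq_top[OF summable_add[OF sumA sumB]]) (use A0 B0 V in simp)
    then show ?thesis unfolding int by (simp only: less_top infinity_ennreal_def)
  qed
  finally show ?thesis .
qed

text \<open>Dilation by \<open>h\<close> contributes h^(-d-2s) from the kernel and h^d from the
  Jacobian.\<close>

lemma trunc_kernel_scale:
  assumes h: "0 < h"
  shows "(\<integral>\<^sup>+w. ennreal (trunc_kernel s h (w::'a::euclidean_space)) \<partial>lborel) =
    ennreal (h powr (- 2 * s)) * (\<integral>\<^sup>+w. ennreal (trunc_kernel s 1 (w::'a)) \<partial>lborel)"
proof -
  have eq: "trunc_kernel s h (h *\<^sub>R w) = h powr (- real DIM('a) - 2 * s) * trunc_kernel s 1 w" for w :: 'a
  proof -
    have "(h * norm w) powr (real DIM('a) + 2 * s) = h powr (real DIM('a) + 2 * s) * norm w powr (real DIM('a) + 2 * s)"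
      using h by (simp add: powr_mult)
    moreover have "h powr (- real DIM('a) - 2 * s) = 1 / h powr (real DIM('a) + 2 * s)"
      by (simp add: powr_minus_divide[symmetric])
    ultimately show ?thesis using h unfolding trunc_kernel_def by simp
  qed
  have "(\<integral>\<^sup>+w. ennreal (trunc_kernel s h (w::'a)) \<partial>lborel) =
     (\<integral>\<^sup>+w. ennreal (h ^ DIM('a)) * ennreal (trunc_kernel s h (h *\<^sub>R (w::'a))) \<partial>lborel)"
    using h by (subst lborel_affine[of h "0::'a"]) (simp_all add: nn_integral_density nn_integral_distr)
  also have "\<dots> = (\<integral>\<^sup>+w. ennreal (h powr (- 2 * s)) * ennreal (trunc_kernel s 1 (w::'a)) \<partial>lborel)"
  proof (rule nn_integral_cong)
    fix w :: 'a
    have "h ^ DIM('a) * h powr (- real DIM('a) - 2 * s) = h powr (- 2 * s)"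
      using h by (simp add: powr_realpow[symmetric] powr_add[symmetric])
    then show "ennreal (h ^ DIM('a)) * ennreal (trunc_kernel s h (h *\<^sub>R w)) = ennreal (h powr (- 2 * s)) * ennreal (trunc_kernel s 1 w)"
      unfolding eq using h by (simp add: ennreal_mult[symmetric] trunc_kernel_nonneg mult.assoc[symmetric])
  qed
  also have "\<dots> = ennreal (h powr (- 2 * s)) * (\<integral>\<^sup>+w. ennreal (trunc_kernel s 1 (w::'a)) \<partial>lborel)"
    by (rule nn_integral_cmult) simp
  finally show ?thesis .
qed

definition trunc_const :: "'a::euclidean_space itself \<Rightarrow> real \<Rightarrow> real" where
  "trunc_const _ s = enn2real (\<integral>\<^sup>+w. ennreal (trunc_kernel s 1 (w::'a)) \<partial>lborel)"

lemma trunc_kernel_integral: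
  assumes "0 < s" "s < 1" "0 < h"
  shows "(\<integral>\<^sup>+w. ennreal (trunc_kernel s h (w::'a::euclidean_space)) \<partial>lborel) =
    ennreal (h powr (- 2 * s) * trunc_const TYPE('a) s)"
  unfolding trunc_kernel_scale[OF assms(3)] trunc_const_def
  using trunc_kernel_finite[OF assms(1,2), where 'a='a] by (simp add: ennreal_mult)

section \<open>The energy as an integral over pairs of points\<close>

definition frac_kernel :: "real \<Rightarrow> 'a::euclidean_space \<times> 'a \<Rightarrow> real" where
  "frac_kernel s z = 1 / norm (fst z - snd z) powr (real DIM('a) + 2 * s)"

definition jump :: "('a::euclidean_space \<Rightarrow> real) \<Rightarrow> 'a \<times> 'a \<Rightarrow> real" where
  "jump v z = v (fst z) - v (snd z)"

text \<open>Integrals of functions that are not integrable are 0 by convention, so bilinearity of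
  \<open>frac_form\<close> is derived under this predicate. Integrability on the product space lets
  Fubini turn the iterated integral into a single one.\<close>

definition finite_energy :: "real \<Rightarrow> ('a::euclidean_space \<Rightarrow> real) \<Rightarrow> bool" where
  "finite_energy s v \<longleftrightarrow> v \<in> borel_measurable borel \<and>
     integrable (lborel \<Otimes>\<^sub>M lborel) (\<lambda>z. (jump v z)\<^sup>2 * frac_kernel s z)"

lemma frac_kernel_nonneg: "0 \<le> frac_kernel s z" by (simp add: frac_kernel_def)

lemma frac_kernel_measurable [measurable]: "frac_kernel s \<in> borel_measurable (lborel \<Otimes>\<^sub>M lborel)"
  unfolding frac_kernel_def by measurable

lemma jump_measurable [measurable]:
  assumes [measurable]: "v \<in> borel_measurable borel"
  shows "jump v \<in> borel_measurable (lborel \<Otimes>\<^sub>M lborel)"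
  unfolding jump_def by measurable

text \<open>A pair contributes only if one of its points lies in the ball that contains the support.
  Integrating the truncated kernel over the other point gives a constant, so either case costs the
  volume of the ball; hence the factor 2.\<close>

lemma truncated_lipschitz_energy:
  fixes v :: "'a::euclidean_space \<Rightarrow> real"
  assumes s: "0 < s" "s < 1" and h: "0 < h" and R: "0 \<le> R"
    and lip: "\<And>x y. \<bar>v x - v y\<bar> \<le> A * min (norm (x - y) / h) 1"
    and supp: "\<And>x. x \<notin> cball a R \<Longrightarrow> v x = 0"
  shows "finite_energy s v"
    "(\<integral>z. (jump v z)\<^sup>2 * frac_kernel s z \<partial>(lborel \<Otimes>\<^sub>M lborel))
       \<le> 2 * A\<^sup>2 * (unit_ball_vol (real DIM('a)) * R ^ DIM('a)) * (h powr (- 2 * s) * trunc_const TYPE('a) s)"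
proof -
  have A: "0 \<le> A"
  proof -
    obtain x :: 'a where x: "norm x = h" using vector_choose_size[OF less_imp_le[OF h]] by blast
    have "0 \<le> \<bar>v x - v 0\<bar>" by simp
    also have "\<dots> \<le> A * min (norm (x - 0) / h) 1" by (rule lip)
    also have "\<dots> = A" using x h by simp
    finally show ?thesis .
  qed
  have "\<bar>v x - v y\<bar> \<le> (A / h) * norm (x - y)" for x y
  proof -
    have "A * min (norm (x - y) / h) 1 \<le> A * (norm (x - y) / h)" using A by (intro mult_left_mono) auto
    then show ?thesis using lip[of x y] by simp
  qed
  then have "(A / h)-lipschitz_on UNIV v"
    using A h by (intro lipschitz_onI) (auto simp: dist_norm)
  then have "continuous_on UNIV v" by (rule lipschitz_on_continuous_on)
  then have vm [measurable]: "v \<in> borel_measurable borel" by (rule borel_measurable_continuous_onI)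
  let ?C = "h powr (- 2 * s) * trunc_const TYPE('a) s"
  let ?V = "unit_ball_vol (real DIM('a)) * R ^ DIM('a)"
  define G where "G w = trunc_kernel s h w" for w :: 'a
  have G [measurable]: "G \<in> borel_measurable borel" unfolding G_def by simp
  have G0: "0 \<le> G w" for w unfolding G_def by (rule trunc_kernel_nonneg)
  have sym: "G (x - y) = G (y - x)" for x y by (simp add: G_def trunc_kernel_def norm_minus_commute)
  have C0: "0 \<le> ?C" by (simp add: trunc_const_def)
  have V0: "0 \<le> ?V" using R by simp
  have intG: "(\<integral>\<^sup>+y. ennreal (G (x - y)) \<partial>lborel) = ennreal ?C" for x
  proof -
    have "ennreal ?C = (\<integral>\<^sup>+w. ennreal (G w) \<partial>lborel)"
      unfolding G_def by (rule trunc_kernel_integral[OF s h, symmetric])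
    also have "\<dots> = (\<integral>\<^sup>+y. ennreal (G (x + (-1) *\<^sub>R y)) \<partial>lborel)"
      by (subst lborel_affine[of "-1" x]) (simp_all add: nn_integral_density nn_integral_distr)
    finally show ?thesis by simp
  qed
  define B where "B = cball a R"
  have Bm [measurable]: "B \<in> sets borel" unfolding B_def by simp
  have eB: "emeasure lborel B = ennreal ?V" unfolding B_def using R by (simp add: emeasure_cball)
  have pt: "ennreal ((jump v z)\<^sup>2 * frac_kernel s z) \<le>
     ennreal (A\<^sup>2) * (indicator B (fst z) * ennreal (G (fst z - snd z))) +
     ennreal (A\<^sup>2) * (indicator B (snd z) * ennreal (G (fst z - snd z)))" for z
  proof (cases "fst z \<in> B \<or> snd z \<in> B")
    case True
    obtain x y where z: "z = (x, y)" by (cases z)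
    have "\<bar>v x - v y\<bar>\<^sup>2 \<le> (A * min (norm (x - y) / h) 1)\<^sup>2" by (rule power_mono[OF lip]) simp
    then have "(jump v z)\<^sup>2 \<le> A\<^sup>2 * (min (norm (x - y) / h) 1)\<^sup>2" by (simp add: z jump_def power_mult_distrib)
    also have "(min (norm (x - y) / h) 1)\<^sup>2 = min ((norm (x - y) / h)\<^sup>2) 1"
    proof (cases "norm (x - y) / h \<le> 1")
      case True
      moreover have "(norm (x - y) / h)\<^sup>2 \<le> 1" using True h by (intro power_le_one) auto
      ultimately show ?thesis by (simp add: min_def)
    next
      case False
      then have "1 \<le> (norm (x - y) / h)\<^sup>2" by (intro one_le_power) auto
      then have "min ((norm (x - y) / h)\<^sup>2) 1 = 1" by (rule min.absorb2)
      moreover have "min (norm (x - y) / h) 1 = 1" using False by simp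
      ultimately show ?thesis by simp
    qed
    finally have "(jump v z)\<^sup>2 * frac_kernel s z \<le> A\<^sup>2 * min ((norm (x - y) / h)\<^sup>2) 1 * frac_kernel s z"
      using frac_kernel_nonneg mult_right_mono by blast
    also have "\<dots> = A\<^sup>2 * G (x - y)" by (simp add: z G_def trunc_kernel_def frac_kernel_def)
    finally have "ennreal ((jump v z)\<^sup>2 * frac_kernel s z) \<le> ennreal (A\<^sup>2) * ennreal (G (x - y))"
      using G0 by (simp add: ennreal_mult[symmetric] ennreal_leI)
    then show ?thesis using True z by (auto simp: indicator_def add_increasing add_increasing2)
  next
    case False
    then have "jump v z = 0" using supp unfolding B_def jump_def by simp
    then show ?thesis by simp
  qed
  have m1 [measurable]: "(\<lambda>z. indicator B (fst z) * ennreal (G (fst z - snd z))) \<in> borel_measurable (lborel \<Otimes>\<^sub>M lborel)"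
    by measurable
  have m2 [measurable]: "(\<lambda>z. indicator B (snd z) * ennreal (G (fst z - snd z))) \<in> borel_measurable (lborel \<Otimes>\<^sub>M lborel)"
    by measurable
  have i1: "(\<integral>\<^sup>+z. indicator B (fst z) * ennreal (G (fst z - snd z)) \<partial>(lborel \<Otimes>\<^sub>M lborel)) = ennreal (?V * ?C)"
  proof -
    have "(\<integral>\<^sup>+z. indicator B (fst z) * ennreal (G (fst z - snd z)) \<partial>(lborel \<Otimes>\<^sub>M lborel)) =
      (\<integral>\<^sup>+x. \<integral>\<^sup>+y. indicator B x * ennreal (G (x - y)) \<partial>lborel \<partial>lborel)"
      by (subst lborel.nn_integral_fst[symmetric]) simp_all
    also have "\<dots> = (\<integral>\<^sup>+x. indicator B x * ennreal ?C \<partial>lborel)"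
      by (intro nn_integral_cong) (simp add: nn_integral_cmult intG del: ennreal_mult')
    also have "\<dots> = ennreal ?C * emeasure lborel B"
      by (simp add: mult.commute[of "indicator _ _"] nn_integral_cmult_indicator del: ennreal_mult')
    also have "\<dots> = ennreal (?V * ?C)"
      unfolding eB using C0 V0 by (simp only: ennreal_mult mult.commute)
    finally show ?thesis .
  qed
  have i2: "(\<integral>\<^sup>+z. indicator B (snd z) * ennreal (G (fst z - snd z)) \<partial>(lborel \<Otimes>\<^sub>M lborel)) = ennreal (?V * ?C)"
  proof -
    have "(\<integral>\<^sup>+z. indicator B (snd z) * ennreal (G (fst z - snd z)) \<partial>(lborel \<Otimes>\<^sub>M lborel)) =
      (\<integral>\<^sup>+y. \<integral>\<^sup>+x. indicator B y * ennreal (G (y - x)) \<partial>lborel \<partial>lborel)"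
      by (subst lborel_pair.nn_integral_snd[symmetric]) (simp_all add: sym)
    also have "\<dots> = (\<integral>\<^sup>+x. indicator B x * ennreal ?C \<partial>lborel)"
      by (intro nn_integral_cong) (simp add: nn_integral_cmult intG del: ennreal_mult')
    also have "\<dots> = ennreal ?C * emeasure lborel B"
      by (simp add: mult.commute[of "indicator _ _"] nn_integral_cmult_indicator del: ennreal_mult')
    also have "\<dots> = ennreal (?V * ?C)"
      unfolding eB using C0 V0 by (simp only: ennreal_mult mult.commute)
    finally show ?thesis .
  qed
  have "(\<integral>\<^sup>+z. ennreal ((jump v z)\<^sup>2 * frac_kernel s z) \<partial>(lborel \<Otimes>\<^sub>M lborel)) \<le>
    (\<integral>\<^sup>+z. ennreal (A\<^sup>2) * (indicator B (fst z) * ennreal (G (fst z - snd z))) +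
     ennreal (A\<^sup>2) * (indicator B (snd z) * ennreal (G (fst z - snd z))) \<partial>(lborel \<Otimes>\<^sub>M lborel))"
    by (rule nn_integral_mono) (rule pt)
  also have "\<dots> = ennreal (A\<^sup>2) * ennreal (?V * ?C) + ennreal (A\<^sup>2) * ennreal (?V * ?C)"
    by (subst nn_integral_add) (measurable, simp only: nn_integral_cmult m1 m2 i1 i2)
  also have "\<dots> = ennreal (2 * A\<^sup>2 * ?V * ?C)"
  proof -
    have "ennreal a * ennreal b + ennreal a * ennreal b = ennreal (2 * a * b)" if "0 \<le> a" "0 \<le> b" for a b
      using that by (simp add: ennreal_mult[symmetric] ennreal_plus[symmetric] del: ennreal_plus)
    from this[of "A\<^sup>2" "?V * ?C", OF zero_le_power2 mult_nonneg_nonneg[OF V0 C0]] show ?thesis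
      by (simp only: mult.assoc)
  qed
  finally have nn: "(\<integral>\<^sup>+z. ennreal ((jump v z)\<^sup>2 * frac_kernel s z) \<partial>(lborel \<Otimes>\<^sub>M lborel)) \<le> ennreal (2 * A\<^sup>2 * ?V * ?C)" .
  have int: "integrable (lborel \<Otimes>\<^sub>M lborel) (\<lambda>z. (jump v z)\<^sup>2 * frac_kernel s z)"
  proof (rule integrableI_nonneg)
    show "(\<integral>\<^sup>+z. ennreal ((jump v z)\<^sup>2 * frac_kernel s z) \<partial>(lborel \<Otimes>\<^sub>M lborel)) < \<infinity>"
      using le_less_trans[OF nn ennreal_less_top] by simp
  qed (simp_all add: frac_kernel_nonneg)
  then show "finite_energy s v" unfolding finite_energy_def using vm by blast
  have "ennreal (\<integral>z. (jump v z)\<^sup>2 * frac_kernel s z \<partial>(lborel \<Otimes>\<^sub>M lborel)) =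
     (\<integral>\<^sup>+z. ennreal ((jump v z)\<^sup>2 * frac_kernel s z) \<partial>(lborel \<Otimes>\<^sub>M lborel))"
    using int by (subst nn_integral_eq_integral) (simp_all add: frac_kernel_nonneg)
  with nn have "ennreal (\<integral>z. (jump v z)\<^sup>2 * frac_kernel s z \<partial>(lborel \<Otimes>\<^sub>M lborel)) \<le> ennreal (2 * A\<^sup>2 * ?V * ?C)" by simp
  moreover have "0 \<le> 2 * A\<^sup>2 * ?V * ?C" using V0 C0 by simp
  ultimately show "(\<integral>z. (jump v z)\<^sup>2 * frac_kernel s z \<partial>(lborel \<Otimes>\<^sub>M lborel)) \<le> 2 * A\<^sup>2 * ?V * ?C"
    by (simp add: ennreal_le_iff)
qed

lemma finite_energy_product:
  assumes "finite_energy s v" "finite_energy s w"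
  shows "integrable (lborel \<Otimes>\<^sub>M lborel) (\<lambda>z. jump v z * jump w z * frac_kernel s z)"
proof (rule Bochner_Integration.integrable_bound)
  show "integrable (lborel \<Otimes>\<^sub>M lborel) (\<lambda>z. (jump v z)\<^sup>2 * frac_kernel s z + (jump w z)\<^sup>2 * frac_kernel s z)"
    using assms unfolding finite_energy_def by (intro Bochner_Integration.integrable_add) auto
  have [measurable]: "v \<in> borel_measurable borel" "w \<in> borel_measurable borel" using assms by (auto simp: finite_energy_def)
  show "(\<lambda>z. jump v z * jump w z * frac_kernel s z) \<in> borel_measurable (lborel \<Otimes>\<^sub>M lborel)" by measurable
  show "AE z in lborel \<Otimes>\<^sub>M lborel. norm (jump v z * jump w z * frac_kernel s z) \<le>
     norm ((jump v z)\<^sup>2 * frac_kernel s z + (jump w z)\<^sup>2 * frac_kernel s z)"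
  proof (rule AE_I2)
    fix z :: "'a \<times> 'a"
    have "\<bar>jump v z * jump w z\<bar> \<le> (jump v z)\<^sup>2 + (jump w z)\<^sup>2"
    proof -
      have "2 * (\<bar>jump v z\<bar> * \<bar>jump w z\<bar>) \<le> (jump v z)\<^sup>2 + (jump w z)\<^sup>2"
        using sum_squares_bound[of "\<bar>jump v z\<bar>" "\<bar>jump w z\<bar>"] by simp
      moreover have "0 \<le> \<bar>jump v z\<bar> * \<bar>jump w z\<bar>" by simp
      ultimately show ?thesis unfolding abs_mult by linarith
    qed
    then have "\<bar>jump v z * jump w z\<bar> * frac_kernel s z \<le> ((jump v z)\<^sup>2 + (jump w z)\<^sup>2) * frac_kernel s z"
      by (rule mult_right_mono) (rule frac_kernel_nonneg)
    then show "norm (jump v z * jump w z * frac_kernel s z) \<le>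
     norm ((jump v z)\<^sup>2 * frac_kernel s z + (jump w z)\<^sup>2 * frac_kernel s z)"
      using frac_kernel_nonneg[of s z] by (simp add: abs_mult distrib_right)
  qed
qed

lemma frac_form_eq:
  fixes v w :: "'a::euclidean_space \<Rightarrow> real"
  assumes "finite_energy s v" "finite_energy s w"
  shows "frac_form s v w = frac_const DIM('a) s / 2 *
    (\<integral>z. jump v z * jump w z * frac_kernel s z \<partial>(lborel \<Otimes>\<^sub>M lborel))"
proof -
  have "(\<integral>z. jump v z * jump w z * frac_kernel s z \<partial>(lborel \<Otimes>\<^sub>M lborel)) =
    (\<integral>x. \<integral>y. jump v (x, y) * jump w (x, y) * frac_kernel s (x, y) \<partial>lborel \<partial>lborel)"
    by (rule lborel_pair.integral_fst'[symmetric]) (rule finite_energy_product[OF assms])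
  then show ?thesis unfolding frac_form_def by (simp add: jump_def frac_kernel_def)
qed

lemma finite_energy_add:
  assumes "finite_energy s v" "finite_energy s w" shows "finite_energy s (\<lambda>x. v x + w x)"
proof -
  have "integrable (lborel \<Otimes>\<^sub>M lborel) (\<lambda>z. (jump v z)\<^sup>2 * frac_kernel s z + 2 * (jump v z * jump w z * frac_kernel s z) + (jump w z)\<^sup>2 * frac_kernel s z)"
    using assms finite_energy_product[OF assms] unfolding finite_energy_def
    by (intro Bochner_Integration.integrable_add) auto
  moreover have "(jump v z)\<^sup>2 * frac_kernel s z + 2 * (jump v z * jump w z * frac_kernel s z) + (jump w z)\<^sup>2 * frac_kernel s z =
     (jump (\<lambda>x. v x + w x) z)\<^sup>2 * frac_kernel s z" for z
  proof -
    have "jump (\<lambda>x. v x + w x) z = jump v z + jump w z" by (simp add: jump_def)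
    then show ?thesis by (simp add: power2_sum algebra_simps)
  qed
  ultimately show ?thesis using assms unfolding finite_energy_def by auto
qed

lemma finite_energy_cmult:
  assumes "finite_energy s v" shows "finite_energy s (\<lambda>x. c * v x)"
proof -
  have eq: "(\<lambda>z. (jump (\<lambda>x. c * v x) z)\<^sup>2 * frac_kernel s z) = (\<lambda>z. c\<^sup>2 * ((jump v z)\<^sup>2 * frac_kernel s z))"
  proof
    fix z :: "'a \<times> 'a"
    have "jump (\<lambda>x. c * v x) z = c * jump v z" by (simp add: jump_def algebra_simps)
    then show "(jump (\<lambda>x. c * v x) z)\<^sup>2 * frac_kernel s z = c\<^sup>2 * ((jump v z)\<^sup>2 * frac_kernel s z)"
      by (simp add: power_mult_distrib)
  qed
  show ?thesis using assms unfolding finite_energy_def eq by auto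
qed

lemma finite_energy_zero: "finite_energy s (\<lambda>x. 0)"
  by (simp add: finite_energy_def jump_def)

lemma finite_energy_diff:
  "finite_energy s v \<Longrightarrow> finite_energy s w \<Longrightarrow> finite_energy s (\<lambda>x. v x - w x)"
  using finite_energy_add[of s v "\<lambda>x. (-1) * w x"] finite_energy_cmult[of s w "-1"] by simp

lemma finite_energy_sum:
  "(\<And>i. i \<in> I \<Longrightarrow> finite_energy s (f i)) \<Longrightarrow> finite_energy s (\<lambda>x. \<Sum>i\<in>I. c i * f i x)"
  by (induction I rule: infinite_finite_induct)
    (simp_all add: finite_energy_zero finite_energy_add finite_energy_cmult)

lemma frac_form_sym: "finite_energy s v \<Longrightarrow> finite_energy s w \<Longrightarrow> frac_form s v w = frac_form s w v"
  by (simp add: frac_form_eq mult.commute[of "jump v _"])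

lemma frac_form_add_right:
  assumes "finite_energy s u" "finite_energy s v" "finite_energy s w"
  shows "frac_form s u (\<lambda>x. v x + w x) = frac_form s u v + frac_form s u w"
proof -
  have "jump u z * jump (\<lambda>x. v x + w x) z * frac_kernel s z =
    jump u z * jump v z * frac_kernel s z + jump u z * jump w z * frac_kernel s z" for z
    by (simp add: jump_def algebra_simps)
  then show ?thesis using assms
    by (simp add: frac_form_eq finite_energy_add finite_energy_product distrib_left)
qed

lemma frac_form_cmult_right:
  assumes "finite_energy s u" "finite_energy s v"
  shows "frac_form s u (\<lambda>x. c * v x) = c * frac_form s u v"
proof -
  have eq: "(\<lambda>z. jump u z * jump (\<lambda>x. c * v x) z * frac_kernel s z) =
     (\<lambda>z. c * (jump u z * jump v z * frac_kernel s z))"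
    by (simp add: jump_def algebra_simps)
  show ?thesis
    unfolding frac_form_eq[OF assms] frac_form_eq[OF assms(1) finite_energy_cmult[OF assms(2)]] eq by simp
qed

lemma frac_form_zero_right: "frac_form s u (\<lambda>x. 0) = 0"
  by (simp add: frac_form_def)

lemma frac_form_sum_right:
  assumes "finite_energy s u" "\<And>i. i \<in> I \<Longrightarrow> finite_energy s (f i)"
  shows "frac_form s u (\<lambda>x. \<Sum>i\<in>I. c i * f i x) = (\<Sum>i\<in>I. c i * frac_form s u (f i))"
  using assms
proof (induction I rule: infinite_finite_induct)
  case (insert i I)
  then show ?case
    by (simp add: frac_form_add_right finite_energy_sum finite_energy_cmult frac_form_cmult_right)
qed (simp_all add: frac_form_zero_right)

lemma frac_form_diff_right:
  assumes "finite_energy s u" "finite_energy s v" "finite_energy s w"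
  shows "frac_form s u (\<lambda>x. v x - w x) = frac_form s u v - frac_form s u w"
  using frac_form_add_right[OF assms(1,2) finite_energy_cmult[OF assms(3), of "-1"]]
    frac_form_cmult_right[OF assms(1,3), of "-1"] by simp

lemma frac_form_diff_left:
  assumes "finite_energy s u" "finite_energy s v" "finite_energy s w"
  shows "frac_form s (\<lambda>x. v x - w x) u = frac_form s v u - frac_form s w u"
  using frac_form_diff_right[OF assms] assms by (simp add: frac_form_sym finite_energy_diff)

lemma frac_const_pos: "0 < s \<Longrightarrow> s < 1 \<Longrightarrow> 0 < frac_const d s"
  unfolding frac_const_def by (intro divide_pos_pos mult_pos_pos Gamma_real_pos) auto

lemma frac_form_nonneg:
  assumes "finite_energy s v" "0 < s" "s < 1" shows "0 \<le> frac_form s v v"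
  unfolding frac_form_eq[OF assms(1,1)] power2_eq_square[symmetric]
  using frac_const_pos[OF assms(2,3), of "DIM('a)"]
  by (intro mult_nonneg_nonneg Bochner_Integration.integral_nonneg) (auto simp: frac_kernel_nonneg)

lemma energy_norm_sq:
  "finite_energy s v \<Longrightarrow> 0 < s \<Longrightarrow> s < 1 \<Longrightarrow> (energy_norm s v)\<^sup>2 = frac_form s v v"
  unfolding energy_norm_def by (simp add: frac_form_nonneg)

text \<open>The jump at a pair of points involves at most \<open>N\<close> functions for each of the
  two points, so Cauchy-Schwarz with \<open>2 * N\<close> terms applies under the integral.\<close>

lemma frac_form_overlap:
  fixes \<phi> :: "'b \<Rightarrow> 'a::euclidean_space \<Rightarrow> real"
  assumes s: "0 < s" "s < 1" and fin: "finite Z" and fe: "\<And>z. z \<in> Z \<Longrightarrow> finite_energy s (\<phi> z)"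
    and ov: "\<And>x. card {z\<in>Z. \<phi> z x \<noteq> 0} \<le> N"
  shows "frac_form s (\<lambda>x. \<Sum>z\<in>Z. c z * \<phi> z x) (\<lambda>x. \<Sum>z\<in>Z. c z * \<phi> z x)
    \<le> 2 * real N * (\<Sum>z\<in>Z. (c z)\<^sup>2 * frac_form s (\<phi> z) (\<phi> z))"
proof -
  let ?w = "\<lambda>x. \<Sum>z\<in>Z. c z * \<phi> z x"
  let ?M = "lborel \<Otimes>\<^sub>M lborel :: ('a \<times> 'a) measure"
  have few: "finite_energy s ?w" by (rule finite_energy_sum[OF fe])
  have pt: "(jump ?w q)\<^sup>2 * frac_kernel s q \<le> 2 * real N * (\<Sum>z\<in>Z. (c z)\<^sup>2 * ((jump (\<phi> z) q)\<^sup>2 * frac_kernel s q))" for q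
  proof -
    let ?S = "{z\<in>Z. \<phi> z (fst q) \<noteq> 0} \<union> {z\<in>Z. \<phi> z (snd q) \<noteq> 0}"
    have cS: "card ?S \<le> 2 * N" using card_Un_le[of "{z\<in>Z. \<phi> z (fst q) \<noteq> 0}" "{z\<in>Z. \<phi> z (snd q) \<noteq> 0}"] ov[of "fst q"] ov[of "snd q"] by linarith
    have "jump ?w q = (\<Sum>z\<in>Z. c z * jump (\<phi> z) q)"
      by (simp add: jump_def sum_subtractf[symmetric] right_diff_distrib)
    also have "\<dots> = (\<Sum>z\<in>?S. c z * jump (\<phi> z) q)"
      by (rule sum.mono_neutral_right[OF fin]) (auto simp: jump_def)
    finally have "(jump ?w q)\<^sup>2 \<le> (\<Sum>z\<in>?S. (c z * jump (\<phi> z) q)\<^sup>2) * real (card ?S)"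
      using sum_squared_le_sum_of_squares[of "\<lambda>z. c z * jump (\<phi> z) q" ?S] by simp
    also have "\<dots> \<le> (\<Sum>z\<in>Z. (c z * jump (\<phi> z) q)\<^sup>2) * real (2 * N)"
      using cS fin by (intro mult_mono sum_mono2 sum_nonneg) auto
    finally have "(jump ?w q)\<^sup>2 * frac_kernel s q \<le> (\<Sum>z\<in>Z. (c z * jump (\<phi> z) q)\<^sup>2) * real (2 * N) * frac_kernel s q"
      by (rule mult_right_mono) (rule frac_kernel_nonneg)
    then show ?thesis by (simp add: sum_distrib_left sum_distrib_right power_mult_distrib mult_ac)
  qed
  have "(\<integral>q. (jump ?w q)\<^sup>2 * frac_kernel s q \<partial>?M) \<le>
     (\<integral>q. 2 * real N * (\<Sum>z\<in>Z. (c z)\<^sup>2 * ((jump (\<phi> z) q)\<^sup>2 * frac_kernel s q)) \<partial>?M)"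
  proof (rule integral_mono)
    show "integrable ?M (\<lambda>q. (jump ?w q)\<^sup>2 * frac_kernel s q)" using few by (simp add: finite_energy_def)
    show "integrable ?M (\<lambda>q. 2 * real N * (\<Sum>z\<in>Z. (c z)\<^sup>2 * ((jump (\<phi> z) q)\<^sup>2 * frac_kernel s q)))"
      using fe unfolding finite_energy_def by (intro integrable_mult_right Bochner_Integration.integrable_sum) auto
  qed (rule pt)
  also have "\<dots> = 2 * real N * (\<Sum>z\<in>Z. (c z)\<^sup>2 * (\<integral>q. (jump (\<phi> z) q)\<^sup>2 * frac_kernel s q \<partial>?M))"
    using fe by (subst integral_mult_right_zero, subst Bochner_Integration.integral_sum) (auto simp: finite_energy_def)
  finally have main: "(\<integral>q. (jump ?w q)\<^sup>2 * frac_kernel s q \<partial>?M) \<le> \<dots>" .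
  have c: "0 \<le> frac_const DIM('a) s / 2" using frac_const_pos[OF s, of "DIM('a)"] by simp
  have "frac_form s ?w ?w = frac_const DIM('a) s / 2 * (\<integral>q. (jump ?w q)\<^sup>2 * frac_kernel s q \<partial>?M)"
    unfolding frac_form_eq[OF few few] power2_eq_square ..
  also have "\<dots> \<le> frac_const DIM('a) s / 2 * (2 * real N * (\<Sum>z\<in>Z. (c z)\<^sup>2 * (\<integral>q. (jump (\<phi> z) q)\<^sup>2 * frac_kernel s q \<partial>?M)))"
    using main c by (rule mult_left_mono)
  also have "\<dots> = 2 * real N * (\<Sum>z\<in>Z. (c z)\<^sup>2 * frac_form s (\<phi> z) (\<phi> z))"
    using fe by (simp add: frac_form_eq sum_distrib_left power2_eq_square mult_ac)
  finally show ?thesis .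
qed

text \<open>The combination \<open>w\<close> with the coefficients of a projection satisfies a(e, w)
  = Q, while its energy is at most \<open>2 * N * Q\<close> by \<open>frac_form_overlap\<close>.
  Positivity of the energy of \<open>e\<close> minus a multiple of \<open>w\<close> then bounds
  Q.\<close>

lemma frac_form_bessel:
  fixes \<phi> :: "'b \<Rightarrow> 'a::euclidean_space \<Rightarrow> real"
  assumes s: "0 < s" "s < 1" and fin: "finite Z" and fe: "\<And>z. z \<in> Z \<Longrightarrow> finite_energy s (\<phi> z)"
    and ov: "\<And>x. card {z\<in>Z. \<phi> z x \<noteq> 0} \<le> N" and N: "0 < N" and e: "finite_energy s e"
  shows "(\<Sum>z\<in>Z. (frac_form s e (\<phi> z) / energy_norm s (\<phi> z))\<^sup>2) \<le> 2 * real N * frac_form s e e"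
proof -
  define c where "c z = frac_form s e (\<phi> z) / (energy_norm s (\<phi> z))\<^sup>2" for z
  define Q where "Q = (\<Sum>z\<in>Z. (frac_form s e (\<phi> z) / energy_norm s (\<phi> z))\<^sup>2)"
  let ?w = "\<lambda>x. \<Sum>z\<in>Z. c z * \<phi> z x"
  \<comment> \<open>Minimises -2 t Q + 2 N t^2 Q, the bound for the change of the energy from
    \<open>e\<close> to \<open>e - t * w\<close>.\<close>
  let ?t = "1 / (2 * real N)"
  have few: "finite_energy s ?w" by (rule finite_energy_sum[OF fe])
  have "frac_form s e ?w = (\<Sum>z\<in>Z. c z * frac_form s e (\<phi> z))" by (rule frac_form_sum_right[OF e fe])
  then have ew: "frac_form s e ?w = Q"
    unfolding Q_def by (simp add: c_def power_divide power2_eq_square)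
  have "(c z)\<^sup>2 * frac_form s (\<phi> z) (\<phi> z) = (frac_form s e (\<phi> z) / energy_norm s (\<phi> z))\<^sup>2" if "z \<in> Z" for z
  \<comment> \<open>Division by 0 gives 0, so a function without energy contributes nothing on
    either side.\<close>
  proof (cases "energy_norm s (\<phi> z) = 0")
    case True then show ?thesis by (simp add: c_def)
  next
    case False
    then show ?thesis unfolding energy_norm_sq[OF fe[OF that] s, symmetric] c_def
      by (simp add: field_simps power2_eq_square)
  qed
  then have ww: "frac_form s ?w ?w \<le> 2 * real N * Q"
    using frac_form_overlap[OF s fin fe ov, of c] unfolding Q_def by simp
  have f1: "finite_energy s (\<lambda>x. ?t * ?w x)" by (rule finite_energy_cmult[OF few])
  have "0 \<le> frac_form s (\<lambda>x. e x - ?t * ?w x) (\<lambda>x. e x - ?t * ?w x)"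
    by (rule frac_form_nonneg[OF finite_energy_diff[OF e f1] s])
  also have "\<dots> = frac_form s (\<lambda>x. e x - ?t * ?w x) e - frac_form s (\<lambda>x. e x - ?t * ?w x) (\<lambda>x. ?t * ?w x)"
    by (rule frac_form_diff_right[OF finite_energy_diff[OF e f1] e f1])
  also have "\<dots> = frac_form s e e - 2 * ?t * Q + ?t\<^sup>2 * frac_form s ?w ?w"
  proof -
    have "frac_form s (\<lambda>x. ?t * ?w x) e = ?t * Q"
      unfolding frac_form_sym[OF f1 e] frac_form_cmult_right[OF e few] ew ..
    moreover have "frac_form s e (\<lambda>x. ?t * ?w x) = ?t * Q"
      unfolding frac_form_cmult_right[OF e few] ew ..
    moreover have "frac_form s (\<lambda>x. ?t * ?w x) (\<lambda>x. ?t * ?w x) = ?t\<^sup>2 * frac_form s ?w ?w"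
      unfolding frac_form_cmult_right[OF f1 few] frac_form_sym[OF f1 few] frac_form_cmult_right[OF few few]
      by (simp add: power2_eq_square)
    ultimately show ?thesis
      unfolding frac_form_diff_left[OF e e f1] frac_form_diff_left[OF f1 e f1] by simp
  qed
  also have "\<dots> \<le> frac_form s e e - 2 * ?t * Q + ?t\<^sup>2 * (2 * real N * Q)"
    using ww by (simp add: mult_left_mono)
  also have "\<dots> = frac_form s e e - ?t * Q" using N by (simp add: power2_eq_square field_simps)
  finally show ?thesis using N unfolding Q_def[symmetric] by (simp add: field_simps)
qed

text \<open>The nonnegative integrand dominates a step function on disjoint rectangles; all pairs
  outside them are dropped.\<close>

lemma frac_form_lower:
  fixes v :: "'a::euclidean_space \<Rightarrow> real"
  assumes s: "0 < s" "s < 1" and v: "finite_energy s v" and fin: "finite I"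
    and AB: "\<And>i. i \<in> I \<Longrightarrow> A i \<in> sets lborel \<and> B i \<in> sets lborel \<and> emeasure lborel (A i) < \<infinity> \<and> emeasure lborel (B i) < \<infinity>"
    and disj: "\<And>i j. i \<in> I \<Longrightarrow> j \<in> I \<Longrightarrow> i \<noteq> j \<Longrightarrow> (A i \<times> B i) \<inter> (A j \<times> B j) = {}"
    and m: "\<And>i x y. i \<in> I \<Longrightarrow> x \<in> A i \<Longrightarrow> y \<in> B i \<Longrightarrow> m i \<le> (v x - v y)\<^sup>2 * frac_kernel s (x, y)"
  shows "frac_const DIM('a) s / 2 * (\<Sum>i\<in>I. m i * (measure lborel (A i) * measure lborel (B i))) \<le> frac_form s v v"
proof -
  let ?M = "lborel \<Otimes>\<^sub>M lborel :: ('a \<times> 'a) measure"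
  have meas: "A i \<times> B i \<in> sets ?M" "emeasure ?M (A i \<times> B i) < \<infinity>"
    "measure ?M (A i \<times> B i) = measure lborel (A i) * measure lborel (B i)" if "i \<in> I" for i
  proof -
    have ab: "A i \<in> sets lborel" "B i \<in> sets lborel" using AB[OF that] by auto
    show "A i \<times> B i \<in> sets ?M" using ab by (rule pair_measureI)
    have e: "emeasure ?M (A i \<times> B i) = emeasure lborel (A i) * emeasure lborel (B i)"
      by (rule lborel.emeasure_pair_measure_Times[OF ab])
    then show "emeasure ?M (A i \<times> B i) < \<infinity>" using AB[OF that] by (simp add: ennreal_mult_less_top)
    show "measure ?M (A i \<times> B i) = measure lborel (A i) * measure lborel (B i)"
      unfolding measure_def e by (simp add: enn2real_mult)
  qed
  have "(\<integral>q. (\<Sum>i\<in>I. m i * indicator (A i \<times> B i) q) \<partial>?M) \<le> (\<integral>q. (jump v q)\<^sup>2 * frac_kernel s q \<partial>?M)"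
  proof (rule integral_mono)
    show "integrable ?M (\<lambda>q. (jump v q)\<^sup>2 * frac_kernel s q)" using v by (simp add: finite_energy_def)
    show "integrable ?M (\<lambda>q. \<Sum>i\<in>I. m i * indicator (A i \<times> B i) q)"
      using meas by (intro Bochner_Integration.integrable_sum integrable_mult_right integrable_real_indicator) auto
    fix q :: "'a \<times> 'a"
    show "(\<Sum>i\<in>I. m i * indicator (A i \<times> B i) q) \<le> (jump v q)\<^sup>2 * frac_kernel s q"
    proof (cases "\<exists>i\<in>I. q \<in> A i \<times> B i")
      case True
      then obtain i where i: "i \<in> I" "q \<in> A i \<times> B i" by blast
      have "(\<Sum>j\<in>I. m j * indicator (A j \<times> B j) q) = (\<Sum>j\<in>I. if j = i then m i else 0)"
        using disj[OF i(1)] i(2) by (intro sum.cong) (auto simp: indicator_def)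
      also have "\<dots> = m i" using fin i(1) by simp
      also have "\<dots> \<le> (jump v q)\<^sup>2 * frac_kernel s q"
        using m[OF i(1), of "fst q" "snd q"] i(2) by (auto simp: jump_def mem_Times_iff)
      finally show ?thesis .
    next
      case False
      then have "(\<Sum>i\<in>I. m i * indicator (A i \<times> B i) q) = 0" by (intro sum.neutral) auto
      then show ?thesis by (simp add: frac_kernel_nonneg)
    qed
  qed
  moreover have "(\<integral>q. (\<Sum>i\<in>I. m i * indicator (A i \<times> B i) q) \<partial>?M) =
     (\<Sum>i\<in>I. m i * (measure lborel (A i) * measure lborel (B i)))"
    using meas by (subst Bochner_Integration.integral_sum) (auto intro!: integrable_mult_right integrable_real_indicator sum.cong)
  ultimately show ?thesis
    unfolding frac_form_eq[OF v v] power2_eq_square[symmetric]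
    using frac_const_pos[OF s, of "DIM('a)"] by (intro mult_left_mono) auto
qed

lemma L2_inner_diff_sum:
  fixes w :: "'b \<Rightarrow> 'a::euclidean_space \<Rightarrow> real"
  assumes f: "L2_on \<Omega> f" and \<Omega>: "bounded \<Omega>" "open \<Omega>"
    and w: "\<And>i. i \<in> I \<Longrightarrow> continuous_on UNIV (w i) \<and> (\<forall>x. \<bar>w i x\<bar> \<le> M i)"
  shows "L2_inner \<Omega> f (\<lambda>x. \<Sum>i\<in>I. c i * w i x) = (\<Sum>i\<in>I. c i * L2_inner \<Omega> f (w i))"
proof -
  let ?L = "lebesgue_on \<Omega>"
  have \<Omega>m: "\<Omega> \<in> sets lebesgue" using \<Omega>(2) by (simp add: borel_open)
  have "\<Omega> \<in> lmeasurable" using \<Omega>(1) \<Omega>m by (rule bounded_set_imp_lmeasurable)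
  then have fin: "emeasure lebesgue \<Omega> < \<infinity>" unfolding fmeasurable_def by blast
  have fm [measurable]: "f \<in> borel_measurable ?L" and f2: "integrable ?L (\<lambda>x. (f x)\<^sup>2)"
    using f by (auto simp: L2_on_def)
  have one: "integrable ?L (\<lambda>x. 1::real)"
  proof -
    have "finite_measure ?L"
      using fin \<Omega>m by (intro finite_measureI) (simp add: emeasure_restrict_space less_top)
    then show ?thesis by (rule finite_measure.integrable_const)
  qed
  have int: "integrable ?L (\<lambda>x. f x * w i x)" if i: "i \<in> I" for i
  proof (rule Bochner_Integration.integrable_bound)
    show "integrable ?L (\<lambda>x. \<bar>M i\<bar> * (1 + (f x)\<^sup>2))" using one f2 by simp
    have "w i \<in> borel_measurable borel" using w[OF i] by (intro borel_measurable_continuous_onI) auto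
    then have "w i \<in> borel_measurable lebesgue" by (intro measurable_completion) simp
    then have "w i \<in> borel_measurable ?L" by (rule measurable_restrict_space1)
    then show "(\<lambda>x. f x * w i x) \<in> borel_measurable ?L" using fm by (rule borel_measurable_times[rotated])
    show "AE x in ?L. norm (f x * w i x) \<le> norm (\<bar>M i\<bar> * (1 + (f x)\<^sup>2))"
    proof (rule AE_I2)
      fix x
      \<comment> \<open>On a domain of finite measure this makes a square integrable function
        integrable against any bounded one.\<close>
      have "\<bar>f x\<bar> \<le> 1 + (f x)\<^sup>2"
      proof -
        have "0 \<le> (\<bar>f x\<bar> - 1)\<^sup>2" by simp
        then show ?thesis by (simp add: power2_diff)
      qed
      moreover have "\<bar>w i x\<bar> \<le> \<bar>M i\<bar>" using w[OF i] abs_ge_self[of "M i"] order_trans by blast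
      ultimately have "\<bar>f x\<bar> * \<bar>w i x\<bar> \<le> (1 + (f x)\<^sup>2) * \<bar>M i\<bar>" by (intro mult_mono) auto
      then show "norm (f x * w i x) \<le> norm (\<bar>M i\<bar> * (1 + (f x)\<^sup>2))" by (simp add: abs_mult mult.commute)
    qed
  qed
  have "L2_inner \<Omega> f (\<lambda>x. \<Sum>i\<in>I. c i * w i x) = (\<integral>x. (\<Sum>i\<in>I. c i * (f x * w i x)) \<partial>?L)"
    unfolding L2_inner_def by (simp add: sum_distrib_left mult_ac)
  also have "\<dots> = (\<Sum>i\<in>I. c i * (\<integral>x. f x * w i x \<partial>?L))"
    using int by (subst Bochner_Integration.integral_sum) auto
  finally show ?thesis unfolding L2_inner_def .
qed

section \<open>Hat functions and finite element spaces\<close>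

text \<open>Rules out slits: below the graph there are exterior points arbitrarily close to each
  boundary point. Members of \<open>S10\<close> vanish on the boundary, so a slit would spoil the
  hat functions whose star it crosses.\<close>

lemma lipschitz_boundary_regular:
  fixes \<Omega> :: "'a::euclidean_space set"
  assumes "open \<Omega>" "lipschitz_boundary \<Omega>" shows "interior (closure \<Omega>) = \<Omega>"
proof
  show "\<Omega> \<subseteq> interior (closure \<Omega>)" using assms(1) by (simp add: closure_subset interior_maximal)
  show "interior (closure \<Omega>) \<subseteq> \<Omega>"
  proof (rule ccontr)
    assume "\<not> interior (closure \<Omega>) \<subseteq> \<Omega>"
    then obtain x where x: "x \<in> interior (closure \<Omega>)" "x \<notin> \<Omega>" by blast
    then have "x \<in> frontier \<Omega>"
      using interior_subset interior_open[OF assms(1)] unfolding frontier_def by blast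
    then obtain e r L g where e: "norm e = 1" "0 < r" "L-lipschitz_on {y. y \<bullet> e = 0} g"
      "\<Omega> \<inter> ball x r = {y \<in> ball x r. (g (y - (y \<bullet> e) *\<^sub>R e) :: real) < y \<bullet> e}"
      using assms(2) unfolding lipschitz_boundary_def by blast
    obtain \<epsilon> where \<epsilon>: "0 < \<epsilon>" "ball x \<epsilon> \<subseteq> closure \<Omega>" using x(1) unfolding mem_interior by blast
    have ee: "e \<bullet> e = 1" using e(1) by (simp add: dot_square_norm)
    define t where "t = min r \<epsilon> / 2"
    have t: "0 < t" "t < r" "t < \<epsilon>" using e(2) \<epsilon>(1) by (auto simp: t_def)
    \<comment> \<open>A point straight below \<open>x\<close>: the same base point in the hyperplane
      and a smaller height, hence strictly below the graph.\<close>
    define y where "y = x - t *\<^sub>R e"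
    have dxy: "dist x y = t" using t e(1) by (simp add: y_def dist_norm)
    then have "y \<in> ball x \<epsilon>" using t by simp
    then have yb: "y \<in> ball x r" "y \<in> closure \<Omega>" using dxy t \<epsilon>(2) by auto
    let ?h = "\<lambda>y. y \<bullet> e - g (y - (y \<bullet> e) *\<^sub>R e)"
    have ge: "\<not> g (x - (x \<bullet> e) *\<^sub>R e) < x \<bullet> e"
    proof
      assume "g (x - (x \<bullet> e) *\<^sub>R e) < x \<bullet> e"
      then have "x \<in> {y \<in> ball x r. g (y - (y \<bullet> e) *\<^sub>R e) < y \<bullet> e}" using e(2) by simp
      then show False unfolding e(4)[symmetric] using x(2) by simp
    qed
    have ye: "y \<bullet> e = x \<bullet> e - t" by (simp add: y_def inner_diff_left ee)
    have eq: "y - (y \<bullet> e) *\<^sub>R e = x - (x \<bullet> e) *\<^sub>R e" unfolding ye unfolding y_def by (simp add: algebra_simps)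
    have hy: "?h y < 0" unfolding eq using t(1) ge ye by simp
    have "continuous_on UNIV (\<lambda>y. g (y - (y \<bullet> e) *\<^sub>R e))"
    proof (rule continuous_on_compose2[OF lipschitz_on_continuous_on[OF e(3)]])
      show "continuous_on UNIV (\<lambda>y. y - (y \<bullet> e) *\<^sub>R e)" by (intro continuous_intros)
      show "(\<lambda>y. y - (y \<bullet> e) *\<^sub>R e) ` UNIV \<subseteq> {y. y \<bullet> e = 0}" by (auto simp: inner_diff_left ee)
    qed
    then have "continuous_on UNIV ?h" by (intro continuous_intros)
    then have "open {y. ?h y < 0}" by (rule open_Collect_less) (rule continuous_on_const)
    then have op: "open ({y. ?h y < 0} \<inter> ball x r)" by auto
    have "({y. ?h y < 0} \<inter> ball x r) \<inter> \<Omega> = {y. ?h y < 0} \<inter> (\<Omega> \<inter> ball x r)" by blast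
    also have "\<dots> = {}" unfolding e(4) by auto
    finally have "({y. ?h y < 0} \<inter> ball x r) \<inter> \<Omega> = {}" .
    then have "({y. ?h y < 0} \<inter> ball x r) \<inter> closure \<Omega> = {}" using open_Int_closure_eq_empty[OF op] by blast
    then show False using hy yb by blast
  qed
qed

text \<open>On a compatible mesh the chosen element is immaterial. Elements without \<open>z\<close>
  give 0 by the convention for \<open>bary\<close>.\<close>

definition hatfun :: "'a::euclidean_space tagged set \<Rightarrow> 'a \<Rightarrow> 'a \<Rightarrow> real" where
  "hatfun \<T> z x = (if \<exists>K\<in>\<T>. x \<in> closed_elem K then lam (SOME K. K \<in> \<T> \<and> x \<in> closed_elem K) z x else 0)"

section \<open>Hat functions of a conforming mesh\<close>

locale fe_mesh =
  fixes \<Omega> :: "'a::euclidean_space set" and \<T> :: "'a tagged set"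
  assumes mesh: "mesh \<T>" and compatible: "compatible \<T>"
    and cover: "(\<Union>K\<in>\<T>. closed_elem K) = closure \<Omega>" and inside: "K \<in> \<T> \<Longrightarrow> open_elem K \<subseteq> \<Omega>"
    and open_dom: "open \<Omega>" and bounded_dom: "bounded \<Omega>" and regular_dom: "interior (closure \<Omega>) = \<Omega>"
begin

lemma simplex: "K \<in> \<T> \<Longrightarrow> tagged_simplex K" using mesh by (simp add: mesh_def)

lemma finite_mesh: "finite \<T>" using mesh by (simp add: mesh_def)

lemma closed_closed_elem: "closed (closed_elem K)"
  unfolding closed_elem_def vertices_def by (simp add: compact_imp_closed finite_imp_compact_convex_hull)

lemma hatfun_eq: assumes "K \<in> \<T>" "x \<in> closed_elem K" shows "hatfun \<T> z x = lam K z x"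
proof -
  define K' where "K' = (SOME K. K \<in> \<T> \<and> x \<in> closed_elem K)"
  have K': "K' \<in> \<T> \<and> x \<in> closed_elem K'"
    unfolding K'_def by (rule someI[of _ K]) (use assms in blast)
  have "hatfun \<T> z x = lam K' z x" unfolding hatfun_def K'_def using assms by auto
  also have "\<dots> = lam K z x" by (rule compatibleD[OF compatible]) (use K' assms in auto)
  finally show ?thesis .
qed

lemma in_cover: "x \<in> closure \<Omega> \<Longrightarrow> \<exists>K\<in>\<T>. x \<in> closed_elem K" using cover by blast

lemma closed_elem_subset: "K \<in> \<T> \<Longrightarrow> closed_elem K \<subseteq> closure \<Omega>" using cover by blast

lemma hatfun_outside: "x \<notin> closure \<Omega> \<Longrightarrow> hatfun \<T> z x = 0" unfolding hatfun_def using cover by auto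

lemma hatfun_bounds: "0 \<le> hatfun \<T> z x" "hatfun \<T> z x \<le> 1"
proof -
  have "0 \<le> hatfun \<T> z x \<and> hatfun \<T> z x \<le> 1"
  proof (cases "x \<in> closure \<Omega>")
    case True
    then obtain K where K: "K \<in> \<T>" "x \<in> closed_elem K" using in_cover by blast
    have "x \<in> convex hull (vertices K)" using K(2) by (simp add: closed_elem_def)
    then show ?thesis unfolding hatfun_eq[OF K]
      using bary_nonneg bary_le_1 vertex_set_vertices[OF simplex[OF K(1)]] by blast
  qed (simp add: hatfun_outside)
  then show "0 \<le> hatfun \<T> z x" "hatfun \<T> z x \<le> 1" by auto
qed

lemma vertex_in_closed_elem: "v \<in> vertices K \<Longrightarrow> v \<in> closed_elem K"
  unfolding closed_elem_def by (rule hull_inc)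

lemma hatfun_node: "v \<in> nodes \<T> \<Longrightarrow> hatfun \<T> z v = (if v = z then 1 else 0)"
proof -
  assume "v \<in> nodes \<T>"
  then obtain K where K: "K \<in> \<T>" "v \<in> vertices K" unfolding nodes_def by blast
  show ?thesis unfolding hatfun_eq[OF K(1) vertex_in_closed_elem[OF K(2)]]
    by (rule bary_vertex[OF vertex_set_vertices[OF simplex[OF K(1)]] K(2)])
qed

lemma hatfun_continuous: "continuous_on (closure \<Omega>) (hatfun \<T> z)"
  unfolding cover[symmetric]
proof (rule continuous_on_closed_Union)
  fix K assume K: "K \<in> \<T>"
  show "closed (closed_elem K)" by (rule closed_closed_elem)
  have "continuous_on (closed_elem K) (lam K z)"
    by (rule affine_fun_continuous[OF affine_fun_bary[OF vertex_set_vertices[OF simplex[OF K]]]])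
  then show "continuous_on (closed_elem K) (hatfun \<T> z)"
    by (rule continuous_on_eq) (simp add: hatfun_eq[OF K])
qed (rule finite_mesh)

lemma interior_node: "z \<in> interior_nodes \<Omega> \<T> \<longleftrightarrow> z \<in> nodes \<T> \<and> z \<in> \<Omega>"
proof -
  have "z \<in> closure \<Omega>" if "z \<in> nodes \<T>"
    using that vertex_in_closed_elem closed_elem_subset unfolding nodes_def by blast
  then show ?thesis using interior_open[OF open_dom] unfolding interior_nodes_def frontier_def by auto
qed

text \<open>Dilations centred at \<open>z\<close> map the open star of \<open>z\<close> into a neighbourhood of \<open>z\<close> inside \<open>\<Omega>\<close>;
  hence the star is open and, \<open>\<Omega>\<close> being the interior of its closure, contained in \<open>\<Omega>\<close>.\<close>

lemma hatfun_support:
  assumes z: "z \<in> interior_nodes \<Omega> \<T>" and x: "0 < hatfun \<T> z x" shows "x \<in> \<Omega>"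
proof -
  have zn: "z \<in> nodes \<T>" "z \<in> \<Omega>" using z by (auto simp: interior_node)
  have "x \<in> closure \<Omega>" using x hatfun_outside by force
  then obtain K0 where K0: "K0 \<in> \<T>" "x \<in> closed_elem K0" using in_cover by blast
  note vs0 = vertex_set_vertices[OF simplex[OF K0(1)]]
  have l0: "0 < lam K0 z x" using x hatfun_eq[OF K0] by simp
  then have z0: "z \<in> vertices K0" using bary_notin[OF vs0, of z x] by force
  \<comment> \<open>A neighbourhood of \<open>z\<close> that is met only by elements containing
    \<open>z\<close>.\<close>
  define U where "U = \<Omega> - (\<Union>K\<in>{K\<in>\<T>. z \<notin> closed_elem K}. closed_elem K)"
  have "open U" unfolding U_def using open_dom finite_mesh closed_closed_elem
    by (intro open_Diff closed_UN) auto
  moreover have "z \<in> U" unfolding U_def using zn by blast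
  ultimately obtain r where r: "0 < r" "ball z r \<subseteq> U" by (meson open_contains_ball)
  define t where "t = min 1 (r / (2 * (norm (x - z) + 1)))"
  have t: "0 < t" "t \<le> 1" using r(1) by (auto simp: t_def add_nonneg_pos)
  have tx: "t * norm (x - z) < r"
  proof -
    have "t * norm (x - z) \<le> r / (2 * (norm (x - z) + 1)) * norm (x - z)"
      by (intro mult_right_mono) (auto simp: t_def)
    also have "\<dots> = r * (norm (x - z) / (2 * (norm (x - z) + 1)))" by simp
    also have "\<dots> < r * 1"
    proof (rule mult_strict_left_mono[OF _ r(1)])
      have "n / (2 * (n + 1)) < 1" if "0 \<le> n" for n :: real using that by (simp add: field_simps)
      from this[of "norm (x - z)"] show "norm (x - z) / (2 * (norm (x - z) + 1)) < 1" by fastforce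
    qed
    finally show ?thesis by simp
  qed
  define D where "D y = (1 - t) *\<^sub>R z + t *\<^sub>R y" for y
  have Dc: "continuous_on A D" for A unfolding D_def by (intro continuous_intros)
  have Dz: "D y - z = t *\<^sub>R (y - z)" for y unfolding D_def by (simp add: algebra_simps)
  define W where "W = D -` ball z r"
  have "open W" unfolding W_def using Dc[of UNIV] by (intro open_vimage) auto
  have Wb: "D y \<in> closure \<Omega>" if "y \<in> W" for y
    using that r(2) closure_subset unfolding W_def U_def by blast
  have xW: "x \<in> W"
    unfolding W_def using tx t by (simp add: dist_norm norm_minus_commute[of z] Dz)
  have "continuous_on W (\<lambda>y. hatfun \<T> z (D y))"
    by (rule continuous_on_compose2[OF hatfun_continuous Dc]) (use Wb in auto)
  then have opV: "open (W \<inter> (\<lambda>y. hatfun \<T> z (D y)) -` {1 - t<..})"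
    using \<open>open W\<close> by (intro continuous_open_preimage) auto
  have "D x \<in> closed_elem K0"
    unfolding D_def closed_elem_def
    using K0(2) vertex_in_closed_elem[OF z0] t unfolding closed_elem_def
    by (intro convexD_alt[OF convex_convex_hull]) auto
  then have "hatfun \<T> z (D x) = lam K0 z (D x)" by (rule hatfun_eq[OF K0(1)])
  also have "\<dots> = (1 - t) * 1 + t * lam K0 z x"
    unfolding D_def affine_fun_comb2[OF affine_fun_bary[OF vs0]] using bary_vertex[OF vs0 z0] by simp
  finally have "1 - t < hatfun \<T> z (D x)" using l0 t by simp
  then have xV: "x \<in> W \<inter> (\<lambda>y. hatfun \<T> z (D y)) -` {1 - t<..}" using xW by simp
  have "W \<inter> (\<lambda>y. hatfun \<T> z (D y)) -` {1 - t<..} \<subseteq> closure \<Omega>"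
  proof
    fix y assume y: "y \<in> W \<inter> (\<lambda>y. hatfun \<T> z (D y)) -` {1 - t<..}"
    obtain K where K: "K \<in> \<T>" "D y \<in> closed_elem K" using in_cover Wb y by blast
    note vs = vertex_set_vertices[OF simplex[OF K(1)]]
    have "z \<in> closed_elem K" using y r(2) K unfolding W_def U_def by blast
    then have zK: "z \<in> vertices K" by (rule node_in_closed_elem[OF mesh compatible K(1) zn(1)])
    have lz: "1 - t < lam K z (D y)" using y hatfun_eq[OF K] by simp
    have comb: "lam K v (D y) = (1 - t) * (if v = z then 1 else 0) + t * lam K v y" for v
      unfolding D_def affine_fun_comb2[OF affine_fun_bary[OF vs]] using bary_vertex[OF vs zK, of v] by auto
    have "0 \<le> lam K v y" for v
    \<comment> \<open>The coordinates other than that of \<open>z\<close> are scaled by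
      \<open>t\<close>, so they have the same sign at \<open>y\<close> and at \<open>D y\<close>.
      For \<open>z\<close> itself the threshold \<open>1 - t\<close> gives positivity.\<close>
    proof (cases "v = z")
      case True
      then have "0 < t * lam K v y" using comb[of v] lz by simp
      then show ?thesis using t(1) by (simp add: zero_less_mult_iff)
    next
      case False
      have "0 \<le> lam K v (D y)" using K(2) closed_elem_iff[OF simplex[OF K(1)]] by blast
      then have "0 \<le> t * lam K v y" using comb[of v] False by simp
      then show ?thesis using t(1) by (simp add: zero_le_mult_iff)
    qed
    then show "y \<in> closure \<Omega>" using closed_elem_iff[OF simplex[OF K(1)]] closed_elem_subset K(1) by blast
  qed
  then have "x \<in> interior (closure \<Omega>)" using opV xV by (meson interiorI)
  then show ?thesis using regular_dom by simp
qed

section \<open>The space of continuous piecewise affine functions\<close>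

lemma hatfun_S10: assumes "z \<in> interior_nodes \<Omega> \<T>" shows "hatfun \<T> z \<in> S10 \<Omega> \<T>"
  unfolding S10_def
proof (intro CollectI conjI ballI allI impI)
  show "continuous_on (closure \<Omega>) (hatfun \<T> z)" by (rule hatfun_continuous)
  fix x assume "x \<notin> \<Omega>"
  then show "hatfun \<T> z x = 0" using hatfun_support[OF assms] hatfun_bounds(1)[of z x] by force
next
  fix K assume K: "K \<in> \<T>"
  obtain g c where g: "\<And>x. lam K z x = g \<bullet> x + c"
    using affine_fun_bary[OF vertex_set_vertices[OF simplex[OF K]]] unfolding affine_fun_def by blast
  have "x \<in> closed_elem K" if "x \<in> open_elem K" for x using that interior_subset unfolding open_elem_def by blast
  then show "\<exists>g c. \<forall>x\<in>open_elem K. hatfun \<T> z x = g \<bullet> x + c"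
    using hatfun_eq[OF K] g by (intro exI[of _ g] exI[of _ c]) simp
qed

text \<open>\<open>S10\<close> prescribes affinity on open elements only; continuity carries it over
  to their closures.\<close>

lemma S10_affine:
  assumes v: "v \<in> S10 \<Omega> \<T>" and K: "K \<in> \<T>"
  obtains f where "affine_fun f" "\<And>x. x \<in> closed_elem K \<Longrightarrow> v x = f x"
proof -
  obtain g c where g: "\<forall>x\<in>open_elem K. v x = g \<bullet> x + c" using v K unfolding S10_def by blast
  have "closure (open_elem K) = closed_elem K"
  proof -
    have "closure (interior (closed_elem K)) = closure (closed_elem K)"
      using open_elem_nonempty[OF simplex[OF K]] unfolding open_elem_def
      by (intro convex_closure_interior) (auto simp: closed_elem_def)
    then show ?thesis unfolding open_elem_def closure_closed[OF closed_closed_elem] .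
  qed
  moreover have "continuous_on (closed_elem K) v"
    using v closed_elem_subset[OF K] continuous_on_subset unfolding S10_def by blast
  ultimately have c: "continuous_on (closure (open_elem K)) (\<lambda>x. v x - (g \<bullet> x + c))"
    by (intro continuous_intros) auto
  have "v x = g \<bullet> x + c" if "x \<in> closed_elem K" for x
    using continuous_constant_on_closure[OF c, of 0 x] g that \<open>closure (open_elem K) = closed_elem K\<close> by auto
  then show thesis by (intro that[of "\<lambda>x. g \<bullet> x + c"] affine_funI[of _ g c]) auto
qed

lemma S10_expand:
  assumes v: "v \<in> S10 \<Omega> \<T>" and K: "K \<in> \<T>" "x \<in> closed_elem K"
  shows "v x = (\<Sum>z\<in>vertices K. lam K z x * v z)"
proof -
  obtain f where f: "affine_fun f" "\<And>x. x \<in> closed_elem K \<Longrightarrow> v x = f x" using S10_affine[OF v K(1)] by blast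
  have "v x = f x" using f(2) K(2) by simp
  also have "\<dots> = (\<Sum>z\<in>vertices K. lam K z x * f z)"
    by (rule affine_fun_expand[OF vertex_set_vertices[OF simplex[OF K(1)]] f(1)])
  also have "\<dots> = (\<Sum>z\<in>vertices K. lam K z x * v z)"
    by (intro sum.cong refl) (simp add: f(2)[OF vertex_in_closed_elem])
  finally show ?thesis .
qed

lemma finite_nodes: "finite (nodes \<T>)" unfolding nodes_def vertices_def using finite_mesh by simp

lemma finite_interior_nodes: "finite (interior_nodes \<Omega> \<T>)" unfolding interior_nodes_def using finite_nodes by simp

lemma S10_sum:
  assumes v: "v \<in> S10 \<Omega> \<T>" shows "v x = (\<Sum>z\<in>interior_nodes \<Omega> \<T>. v z * hatfun \<T> z x)"
proof (cases "x \<in> closure \<Omega>")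
  case False
  then have "x \<notin> \<Omega>" using closure_subset by blast
  then show ?thesis using v False by (simp add: S10_def hatfun_outside)
next
  case True
  then obtain K where K: "K \<in> \<T>" "x \<in> closed_elem K" using in_cover by blast
  have fin: "finite (vertices K)" by (simp add: vertices_def)
  have sub: "vertices K \<subseteq> nodes \<T>" using K(1) unfolding nodes_def by blast
  have "v x = (\<Sum>z\<in>vertices K. lam K z x * v z)" by (rule S10_expand[OF v K])
  also have "\<dots> = (\<Sum>z\<in>vertices K \<inter> interior_nodes \<Omega> \<T>. lam K z x * v z)"
    using v sub fin by (intro sum.mono_neutral_right) (auto simp: interior_node S10_def)
  also have "\<dots> = (\<Sum>z\<in>interior_nodes \<Omega> \<T>. lam K z x * v z)"
    using bary_notin[OF vertex_set_vertices[OF simplex[OF K(1)]]] finite_interior_nodes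
    by (intro sum.mono_neutral_left) auto
  finally show ?thesis by (simp add: hatfun_eq[OF K] mult.commute)
qed

lemma hat_eq: assumes z: "z \<in> interior_nodes \<Omega> \<T>" shows "hat \<Omega> \<T> z = hatfun \<T> z"
  unfolding hat_def
proof (rule the_equality)
  show "hatfun \<T> z \<in> S10 \<Omega> \<T> \<and> (\<forall>z'\<in>interior_nodes \<Omega> \<T>. hatfun \<T> z z' = (if z' = z then 1 else 0))"
    using hatfun_S10[OF z] hatfun_node by (auto simp: interior_node)
next
  fix \<phi> assume \<phi>: "\<phi> \<in> S10 \<Omega> \<T> \<and> (\<forall>z'\<in>interior_nodes \<Omega> \<T>. \<phi> z' = (if z' = z then 1 else 0))"
  show "\<phi> = hatfun \<T> z"
  proof
    fix x
    have "\<phi> x = (\<Sum>z'\<in>interior_nodes \<Omega> \<T>. \<phi> z' * hatfun \<T> z' x)" using S10_sum \<phi> by blast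
    also have "\<dots> = (\<Sum>z'\<in>interior_nodes \<Omega> \<T>. if z' = z then hatfun \<T> z x else 0)"
      using \<phi> by (intro sum.cong) auto
    also have "\<dots> = hatfun \<T> z x" using z finite_interior_nodes by simp
    finally show "\<phi> x = hatfun \<T> z x" .
  qed
qed

lemma S10_zero: "(\<lambda>x. 0) \<in> S10 \<Omega> \<T>"
  unfolding S10_def by (auto intro!: exI[of _ 0])

lemma S10_add: assumes "v \<in> S10 \<Omega> \<T>" "w \<in> S10 \<Omega> \<T>" shows "(\<lambda>x. v x + w x) \<in> S10 \<Omega> \<T>"
  unfolding S10_def
proof (intro CollectI conjI ballI allI impI)
  show "continuous_on (closure \<Omega>) (\<lambda>x. v x + w x)" using assms by (intro continuous_intros) (auto simp: S10_def)
  fix K assume "K \<in> \<T>"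
  then obtain g c h d where "\<forall>x\<in>open_elem K. v x = g \<bullet> x + c" "\<forall>x\<in>open_elem K. w x = h \<bullet> x + d"
    using assms unfolding S10_def by blast
  then show "\<exists>g c. \<forall>x\<in>open_elem K. v x + w x = g \<bullet> x + c"
    by (intro exI[of _ "g + h"] exI[of _ "c + d"]) (auto simp: inner_add_left)
qed (use assms in \<open>auto simp: S10_def\<close>)

lemma S10_cmult: assumes "v \<in> S10 \<Omega> \<T>" shows "(\<lambda>x. k * v x) \<in> S10 \<Omega> \<T>"
  unfolding S10_def
proof (intro CollectI conjI ballI allI impI)
  show "continuous_on (closure \<Omega>) (\<lambda>x. k * v x)" using assms by (intro continuous_intros) (auto simp: S10_def)
  fix K assume "K \<in> \<T>"
  then obtain g c where "\<forall>x\<in>open_elem K. v x = g \<bullet> x + c" using assms unfolding S10_def by blast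
  then show "\<exists>g c. \<forall>x\<in>open_elem K. k * v x = g \<bullet> x + c"
    by (intro exI[of _ "k *\<^sub>R g"] exI[of _ "k * c"]) (auto simp: algebra_simps)
qed (use assms in \<open>auto simp: S10_def\<close>)

lemma S10_diff: "v \<in> S10 \<Omega> \<T> \<Longrightarrow> w \<in> S10 \<Omega> \<T> \<Longrightarrow> (\<lambda>x. v x - w x) \<in> S10 \<Omega> \<T>"
  using S10_add[of v "\<lambda>x. (-1) * w x"] S10_cmult[of w "-1"] by simp

lemma S10_sumI: "(\<And>i. i \<in> I \<Longrightarrow> f i \<in> S10 \<Omega> \<T>) \<Longrightarrow> (\<lambda>x. \<Sum>i\<in>I. c i * f i x) \<in> S10 \<Omega> \<T>"
  by (induction I rule: infinite_finite_induct) (auto simp: S10_zero intro!: S10_add S10_cmult)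

text \<open>The segment from \<open>x\<close> to \<open>y\<close> may leave \<Omega>. Its parameter
  interval is covered by finitely many closed pieces, one for each element and one for the
  complement of \<Omega>, where \<open>v\<close> is 0. Lipschitz bounds on closed pieces of an
  interval combine without loss in the constant.\<close>

lemma S10_lipschitz:
  assumes v: "v \<in> S10 \<Omega> \<T>" and L: "0 \<le> L" "\<And>K. K \<in> \<T> \<Longrightarrow> L-lipschitz_on (closed_elem K) v"
  shows "\<bar>v x - v y\<bar> \<le> L * norm (x - y)"
proof -
  define p where "p t = x + t *\<^sub>R (y - x)" for t :: real
  define U where "U i = (case i of None \<Rightarrow> p -` (- \<Omega>) | Some K \<Rightarrow> p -` closed_elem K)" for i
  define I where "I = insert None (Some ` \<T>)"
  have pc: "continuous_on UNIV p" unfolding p_def by (intro continuous_intros)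
  have pd: "dist (p s) (p t) = dist s t * norm (x - y)" for s t
  proof -
    have "p s - p t = (s - t) *\<^sub>R (y - x)" unfolding p_def by (simp add: algebra_simps)
    then show ?thesis by (simp add: dist_norm norm_minus_commute)
  qed
  have "(L * norm (x - y))-lipschitz_on {0..1} (\<lambda>t. v (p t))"
  proof (rule lipschitz_on_closed_Union)
    show "finite I" unfolding I_def using finite_mesh by simp
    show "0 \<le> L * norm (x - y)" using L(1) by simp
    show "{0..1} \<subseteq> (\<Union>i\<in>I. U i)"
    proof
      fix t
      show "t \<in> (\<Union>i\<in>I. U i)"
      proof (cases "p t \<in> \<Omega>")
        case True
        then obtain K where "K \<in> \<T>" "p t \<in> closed_elem K" using in_cover closure_subset by blast
        then show ?thesis unfolding I_def U_def by force
      qed (auto simp: I_def U_def)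
    qed
    fix i assume i: "i \<in> I"
    show "closed (U i)"
      using pc closed_closed_elem open_dom unfolding U_def
      by (cases i) (auto intro!: closed_vimage)
    show "(L * norm (x - y))-lipschitz_on (U i) (\<lambda>t. v (p t))"
    proof (cases i)
      case None
      then have "v (p t) = 0" if "t \<in> U i" for t using that v unfolding U_def S10_def by auto
      then show ?thesis using L(1) by (intro lipschitz_onI) auto
    next
      case (Some K)
      then have K: "K \<in> \<T>" using i unfolding I_def by auto
      show ?thesis
      proof (rule lipschitz_onI)
        fix s t assume "s \<in> U i" "t \<in> U i"
        then have "p s \<in> closed_elem K" "p t \<in> closed_elem K" unfolding U_def Some by auto
        then have "dist (v (p s)) (v (p t)) \<le> L * dist (p s) (p t)" using lipschitz_onD[OF L(2)[OF K]] by blast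
        then show "dist (v (p s)) (v (p t)) \<le> L * norm (x - y) * dist s t" unfolding pd by (simp add: mult_ac)
      qed (use L(1) in simp)
    qed
  qed
  from lipschitz_onD[OF this, of 0 1] show ?thesis by (simp add: p_def dist_norm abs_minus_commute)
qed

lemma S10_ex_lipschitz:
  assumes v: "v \<in> S10 \<Omega> \<T>" shows "\<exists>L\<ge>0. \<forall>K\<in>\<T>. L-lipschitz_on (closed_elem K) v"
proof -
  have "\<forall>K\<in>\<T>. \<exists>L\<ge>0. L-lipschitz_on (closed_elem K) v"
  proof
    fix K assume K: "K \<in> \<T>"
    obtain f where f: "affine_fun f" "\<And>x. x \<in> closed_elem K \<Longrightarrow> v x = f x" using S10_affine[OF v K] by blast
    obtain g c where g: "\<And>x. f x = g \<bullet> x + c" using f(1) unfolding affine_fun_def by blast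
    have "dist (v x) (v y) \<le> norm g * dist x y" if "x \<in> closed_elem K" "y \<in> closed_elem K" for x y
    proof -
      have "v x - v y = g \<bullet> (x - y)" using f(2) that g by (simp add: inner_diff_right)
      then show ?thesis using Cauchy_Schwarz_ineq2[of g "x - y"] by (simp add: dist_norm)
    qed
    then show "\<exists>L\<ge>0. L-lipschitz_on (closed_elem K) v" by (intro exI[of _ "norm g"]) (auto intro: lipschitz_onI)
  qed
  then obtain L where L: "\<And>K. K \<in> \<T> \<Longrightarrow> 0 \<le> L K \<and> (L K)-lipschitz_on (closed_elem K) v" by metis
  have "(\<Sum>K\<in>\<T>. L K)-lipschitz_on (closed_elem K) v" if "K \<in> \<T>" for K
    by (rule lipschitz_on_le[of "L K"]) (use L that finite_mesh in \<open>auto intro!: member_le_sum\<close>)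
  moreover have "0 \<le> (\<Sum>K\<in>\<T>. L K)" using L by (intro sum_nonneg) auto
  ultimately show ?thesis by blast
qed

lemma S10_continuous: assumes v: "v \<in> S10 \<Omega> \<T>" shows "continuous_on UNIV v"
proof -
  obtain L where L: "0 \<le> L" "\<And>K. K \<in> \<T> \<Longrightarrow> L-lipschitz_on (closed_elem K) v" using S10_ex_lipschitz[OF v] by blast
  have "L-lipschitz_on UNIV v" using S10_lipschitz[OF v L] L(1) by (intro lipschitz_onI) (auto simp: dist_norm)
  then show ?thesis by (rule lipschitz_on_continuous_on)
qed

lemma S10_bounded: assumes v: "v \<in> S10 \<Omega> \<T>" shows "\<exists>M\<ge>0. \<forall>x. \<bar>v x\<bar> \<le> M"
proof -
  have "\<bar>v x\<bar> \<le> (\<Sum>z\<in>interior_nodes \<Omega> \<T>. \<bar>v z\<bar>)" for x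
  proof -
    have "\<bar>v x\<bar> \<le> (\<Sum>z\<in>interior_nodes \<Omega> \<T>. \<bar>v z * hatfun \<T> z x\<bar>)" unfolding S10_sum[OF v, of x] by (rule sum_abs)
    also have "\<dots> \<le> (\<Sum>z\<in>interior_nodes \<Omega> \<T>. \<bar>v z\<bar>)"
      using hatfun_bounds by (intro sum_mono) (auto simp: abs_mult mult_left_le)
    finally show ?thesis .
  qed
  then show ?thesis by (intro exI[of _ "\<Sum>z\<in>interior_nodes \<Omega> \<T>. \<bar>v z\<bar>"]) (auto intro: sum_nonneg)
qed

lemma S10_finite_energy:
  assumes v: "v \<in> S10 \<Omega> \<T>" and s: "0 < s" "s < 1" shows "finite_energy s v"
proof -
  obtain L where L: "0 \<le> L" "\<And>K. K \<in> \<T> \<Longrightarrow> L-lipschitz_on (closed_elem K) v" using S10_ex_lipschitz[OF v] by blast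
  obtain M where M: "0 \<le> M" "\<And>x. \<bar>v x\<bar> \<le> M" using S10_bounded[OF v] by blast
  obtain R where "0 < R" "\<forall>x\<in>\<Omega>. norm x \<le> R" using bounded_dom unfolding bounded_pos by blast
  then have R: "0 < R" "\<Omega> \<subseteq> cball 0 R" by auto
  \<comment> \<open>\<open>?A\<close> bounds all jumps, and \<open>?A / ?h = L + 1\<close> bounds
    the slope; the added 1 avoids zero denominators.\<close>
  let ?A = "2 * M + 1" and ?h = "(2 * M + 1) / (L + 1)"
  show ?thesis
  proof (rule truncated_lipschitz_energy(1)[OF s, of ?h R v ?A 0])
    show "0 < ?h" using L(1) M(1) by simp
    show "0 \<le> R" using R(1) by simp
    show "v x = 0" if "x \<notin> cball 0 R" for x using that R(2) v unfolding S10_def by blast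
    fix x y
    have "\<bar>v x - v y\<bar> \<le> ?A" using M(2)[of x] M(2)[of y] by linarith
    moreover have "\<bar>v x - v y\<bar> \<le> ?A * (norm (x - y) / ?h)"
    proof -
      have "\<bar>v x - v y\<bar> \<le> L * norm (x - y)" by (rule S10_lipschitz[OF v L])
      also have "\<dots> \<le> (L + 1) * norm (x - y)" by (intro mult_right_mono) auto
      also have "\<dots> = ?A * (norm (x - y) / ?h)" using M(1) L(1) by (simp add: field_simps)
      finally show ?thesis .
    qed
    ultimately show "\<bar>v x - v y\<bar> \<le> ?A * min (norm (x - y) / ?h) 1" by (auto simp: min_def)
  qed
qed

section \<open>Passage to refined meshes\<close>

lemma S10_forest: assumes v: "v \<in> S10 \<Omega> \<T>" shows "v \<in> S10 \<Omega> (forest t \<T>)"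
  unfolding S10_def
proof (intro CollectI conjI ballI)
  fix X assume "X \<in> forest t \<T>"
  then obtain K where K: "K \<in> \<T>" "X \<in> leaves (t K) K" unfolding forest_def by blast
  obtain g c where "\<forall>x\<in>open_elem K. v x = g \<bullet> x + c" using v K(1) unfolding S10_def by blast
  then show "\<exists>g c. \<forall>x\<in>open_elem X. v x = g \<bullet> x + c" using leaves_open[OF simplex[OF K(1)] K(2)] by blast
qed (use v in \<open>auto simp: S10_def\<close>)

lemma fe_mesh_forest: assumes "compatible (forest t \<T>)" shows "fe_mesh \<Omega> (forest t \<T>)"
proof
  show "mesh (forest t \<T>)" by (rule mesh_forest[OF mesh])
  show "(\<Union>K\<in>forest t \<T>. closed_elem K) = closure \<Omega>"
  proof -
    have "(\<Union>K\<in>forest t \<T>. closed_elem K) = (\<Union>K\<in>\<T>. \<Union>X\<in>leaves (t K) K. closed_elem X)"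
      unfolding forest_def by blast
    also have "\<dots> = (\<Union>K\<in>\<T>. closed_elem K)" by (intro SUP_cong refl leaves_closed simplex)
    finally show ?thesis unfolding cover .
  qed
  fix X assume "X \<in> forest t \<T>"
  then obtain K where K: "K \<in> \<T>" "X \<in> leaves (t K) K" unfolding forest_def by blast
  then show "open_elem X \<subseteq> \<Omega>" using leaves_open[OF simplex[OF K(1)] K(2)] inside by blast
qed (rule assms open_dom bounded_dom regular_dom)+

lemma fe_mesh_nvb:
  assumes "nvb_refinement \<T> \<T>'" "conforming \<T>'"
  shows "fe_mesh \<Omega> \<T>'" "S10 \<Omega> \<T> \<subseteq> S10 \<Omega> \<T>'"
proof -
  obtain t where t: "\<T>' = forest t \<T>" using assms(1) nvb_refinement_iff_forest[OF mesh] by blast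
  show "fe_mesh \<Omega> \<T>'" using fe_mesh_forest conforming_mesh_compatible[OF assms(2)] unfolding t by blast
  show "S10 \<Omega> \<T> \<subseteq> S10 \<Omega> \<T>'" using S10_forest unfolding t by blast
qed

end

lemma fe_mesh_triangulation:
  assumes "polyhedral_lipschitz_domain \<Omega>" "tagged_triangulation \<Omega> \<T>" shows "fe_mesh \<Omega> \<T>"
proof
  show "mesh \<T>" "compatible \<T>"
    using assms(2) conforming_mesh_compatible unfolding tagged_triangulation_def by auto
  show "open \<Omega>" "bounded \<Omega>" using assms(1) by (auto simp: polyhedral_lipschitz_domain_def)
  then show "interior (closure \<Omega>) = \<Omega>"
    using assms(1) lipschitz_boundary_regular by (auto simp: polyhedral_lipschitz_domain_def)
qed (use assms(2) in \<open>auto simp: tagged_triangulation_def\<close>)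

lemma refinements_step: "\<A> \<in> refinements \<T> \<Longrightarrow> \<M> \<subseteq> \<A> \<Longrightarrow> refine \<A> \<M> \<in> refinements \<T>"
  unfolding refinements_def by (auto intro: rtranclp.rtrancl_into_rtrancl)

lemma refinements_trans: "\<A> \<in> refinements \<T> \<Longrightarrow> \<B> \<in> refinements \<A> \<Longrightarrow> \<B> \<in> refinements \<T>"
  unfolding refinements_def by (auto intro: rtranclp_trans)

text \<open>Each mesh on the way is refinable itself, so every application of \<open>refine\<close>
  returns a genuine coarsest refinement, and conformity is passed on.\<close>

lemma refinements_nvb:
  fixes \<T> :: "'a::euclidean_space tagged set"
  assumes d: "DIM('a) = 2 \<or> DIM('a) = 3" and c: "conforming \<T>"
    and adm: "\<And>\<A> \<M>. \<A> \<in> refinements \<T> \<Longrightarrow> \<M> \<subseteq> \<A> \<Longrightarrow> \<exists>\<T>'. coarsest_refinement \<A> \<M> \<T>'"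
    and A: "\<A> \<in> refinements \<T>"
  shows "nvb_refinement \<T> \<A> \<and> refinable_mesh \<A>"
proof -
  have "(\<lambda>\<A> \<B>. \<exists>\<M>\<subseteq>\<A>. \<B> = refine \<A> \<M>)\<^sup>*\<^sup>* \<T> \<A>" using A unfolding refinements_def by simp
  then show ?thesis
  proof (induction rule: rtranclp_induct)
    case base
    have "\<T> \<in> refinements \<T>" by (simp add: refinements_def)
    then have "refinable_mesh \<T>" using d c adm by unfold_locales auto
    then show ?case by (simp add: nvb_refinement_def)
  next
    case (step \<A> \<B>)
    obtain \<M> where M: "\<M> \<subseteq> \<A>" "\<B> = refine \<A> \<M>" using step(2) by blast
    have A: "\<A> \<in> refinements \<T>" using step(1) by (simp add: refinements_def)
    interpret refinable_mesh \<A> using step by blast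
    have cr: "coarsest_refinement \<A> \<M> \<B>" unfolding M(2) by (rule coarsest_refine[OF M(1)])
    have "\<B> \<in> refinements \<T>" unfolding M(2) by (rule refinements_step[OF A M(1)])
    then have "refinable_mesh \<B>" using d cr adm by unfold_locales (auto simp: coarsest_refinement_def)
    moreover have "nvb_refinement \<T> \<B>"
      using step cr unfolding coarsest_refinement_def nvb_refinement_def by (meson rtranclp_trans)
    ultimately show ?case by blast
  qed
qed

section \<open>Shape regularity\<close>

abbreviation vol :: "'a::euclidean_space set \<Rightarrow> real" where "vol \<equiv> measure lebesgue"

text \<open>Comparison of volumes. It serves twice: for translates of an element, which bounds
  gradients, and for the elements around a new node.\<close>

lemma packing:
  fixes A :: "'b \<Rightarrow> 'a::euclidean_space set"
  assumes fin: "finite I" and meas: "\<And>i. i \<in> I \<Longrightarrow> A i \<in> lmeasurable"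
    and disj: "\<And>i j. i \<in> I \<Longrightarrow> j \<in> I \<Longrightarrow> i \<noteq> j \<Longrightarrow> A i \<inter> A j = {}"
    and sub: "\<And>i. i \<in> I \<Longrightarrow> A i \<subseteq> cball a R" and R: "0 \<le> R" and m: "\<And>i. i \<in> I \<Longrightarrow> m \<le> vol (A i)"
  shows "real (card I) * m \<le> unit_ball_vol (real DIM('a)) * R ^ DIM('a)"
proof -
  have "real (card I) * m \<le> (\<Sum>i\<in>I. vol (A i))" using sum_mono[OF m] by simp
  also have "\<dots> = vol (\<Union>i\<in>I. A i)"
    using disj by (intro measure_negligible_finite_Union_image[symmetric] fin meas) (auto simp: pairwise_def)
  also have "\<dots> \<le> vol (cball a R)"
    using sub meas fin by (intro measure_mono_fmeasurable) (auto intro: fmeasurableD)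
  also have "\<dots> = unit_ball_vol (real DIM('a)) * R ^ DIM('a)" using R by (simp add: content_cball)
  finally show ?thesis .
qed

text \<open>Translates of \<open>X\<close> by multiples of the width of the slab \<open>0 < g \<bullet> x + c \<le> 1\<close> are disjoint.\<close>

lemma gradient_bound:
  fixes X :: "'a::euclidean_space set"
  assumes X: "X \<in> lmeasurable" "X \<subseteq> cball a D" and D: "0 < D"
    and g: "\<And>x. x \<in> X \<Longrightarrow> 0 < g \<bullet> x + c \<and> g \<bullet> x + c \<le> 1"
  shows "norm g * vol X * D \<le> unit_ball_vol (real DIM('a)) * (2 * D) ^ DIM('a)"
proof (cases "g = 0")
  case True
  then show ?thesis using D by simp
next
  case False
  define u where "u = (1 / (norm g)\<^sup>2) *\<^sub>R g"
  have gu: "g \<bullet> u = 1" using False by (simp add: u_def dot_square_norm)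
  have nu: "norm u = 1 / norm g" using False by (simp add: u_def power2_eq_square)
  \<comment> \<open>The number of steps of length \<open>1 / norm g\<close> that stay within
    distance \<open>D\<close>. The index set \<open>{..m}\<close> has \<open>m + 1\<close> members,
    which is at least \<open>D * norm g\<close>.\<close>
  define m where "m = nat \<lfloor>D * norm g\<rfloor>"
  have m: "real m \<le> D * norm g" "D * norm g \<le> real m + 1" using D unfolding m_def by (simp_all add: of_nat_floor)
  define A where "A k = (+) (real k *\<^sub>R u) ` X" for k :: nat
  have in_A: "real k < g \<bullet> y + c \<and> g \<bullet> y + c \<le> real k + 1" if y: "y \<in> A k" for k y
  proof -
    obtain x where "x \<in> X" "y = real k *\<^sub>R u + x" using y unfolding A_def by blast
    then show ?thesis using g[of x] gu by (simp add: inner_add_right)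
  qed
  have "real (card {..m}) * vol X \<le> unit_ball_vol (real DIM('a)) * (2 * D) ^ DIM('a)"
  proof (rule packing[of "{..m}" A a "2 * D"])
    fix i j assume ij: "i \<in> {..m}"
    show "A i \<in> lmeasurable" unfolding A_def by (rule measurable_translation[OF X(1)])
    show "vol X \<le> vol (A i)" unfolding A_def by (simp add: measure_translation)
    show "A i \<inter> A j = {}" if "j \<in> {..m}" "i \<noteq> j"
    proof (rule ccontr)
      assume "A i \<inter> A j \<noteq> {}"
      then obtain y where "y \<in> A i" "y \<in> A j" by blast
      then have "real i < real j + 1 \<and> real j < real i + 1" using in_A[of y i] in_A[of y j] by linarith
      then show False using that(2) by linarith
    qed
    show "A i \<subseteq> cball a (2 * D)"
    proof
      fix y assume "y \<in> A i"
      then obtain x where x: "x \<in> X" "y = real i *\<^sub>R u + x" unfolding A_def by blast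
      have "norm (real i *\<^sub>R u) \<le> D"
      proof -
        have "norm (real i *\<^sub>R u) \<le> real m * (1 / norm g)" using ij nu by (simp add: divide_right_mono)
        also have "\<dots> \<le> D" using m(1) False by (simp add: field_simps)
        finally show ?thesis .
      qed
      moreover have "dist a x \<le> D" using x(1) X(2) by auto
      moreover have "dist a y \<le> dist a x + norm (real i *\<^sub>R u)"
        unfolding x(2) dist_norm using norm_triangle_ineq4[of "a - x" "real i *\<^sub>R u"] by (simp add: algebra_simps)
      ultimately show "y \<in> cball a (2 * D)" by simp
    qed
  qed (use D in auto)
  moreover have "norm g * vol X * D \<le> real (card {..m}) * vol X"
  proof -
    have "(D * norm g) * vol X \<le> (real m + 1) * vol X" using m(2) by (intro mult_right_mono) auto
    then show ?thesis by (simp add: mult_ac add_ac)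
  qed
  ultimately show ?thesis by linarith
qed

section \<open>Diameters, volumes and gradients\<close>

definition diam :: "'a::euclidean_space tagged \<Rightarrow> real" where "diam K = diameter (open_elem K)"

lemma bounded_closed_elem: "bounded (closed_elem K)"
  unfolding closed_elem_def vertices_def by (simp add: finite_imp_bounded_convex_hull)

lemma open_open_elem: "open (open_elem K)" unfolding open_elem_def by simp

lemma open_subset_closed_elem: "open_elem K \<subseteq> closed_elem K"
  unfolding open_elem_def by (rule interior_subset)

lemma bounded_open_elem: "bounded (open_elem K)"
  using bounded_closed_elem open_subset_closed_elem bounded_subset by blast

lemma lmeasurable_open_elem: "open_elem K \<in> lmeasurable"
  by (rule lmeasurable_open[OF bounded_open_elem open_open_elem])

lemma closure_open_elem: "tagged_simplex K \<Longrightarrow> closure (open_elem K) = closed_elem K"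
proof -
  assume K: "tagged_simplex K"
  have "closed (closed_elem K)"
    unfolding closed_elem_def vertices_def by (simp add: compact_imp_closed finite_imp_compact_convex_hull)
  moreover have "closure (interior (closed_elem K)) = closure (closed_elem K)"
    using open_elem_nonempty[OF K] unfolding open_elem_def
    by (intro convex_closure_interior) (auto simp: closed_elem_def)
  ultimately show ?thesis unfolding open_elem_def by simp
qed

lemma norm_le_diam:
  assumes "tagged_simplex K" "x \<in> closed_elem K" "y \<in> closed_elem K" shows "norm (x - y) \<le> diam K"
  using diameter_bounded_bound[OF bounded_closed_elem assms(2,3)] diameter_closure[OF bounded_open_elem, of K]
  unfolding closure_open_elem[OF assms(1)] diam_def dist_norm by simp

lemma vertex_closed: "v \<in> vertices K \<Longrightarrow> v \<in> closed_elem K"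
  unfolding closed_elem_def by (rule hull_inc)

lemma diam_pos: assumes "tagged_simplex K" shows "0 < diam K"
proof -
  have "0 < norm (end1 K - end2 K)" using end_vertices(3)[OF assms] by simp
  also have "\<dots> \<le> diam K" using norm_le_diam[OF assms] end_vertices[OF assms] vertex_closed by blast
  finally show ?thesis .
qed

lemma vol_open_elem_pos: assumes "tagged_simplex K" shows "0 < vol (open_elem K)"
proof -
  obtain x r where x: "0 < r" "cball x r \<subseteq> open_elem K"
    using open_elem_nonempty[OF assms] open_open_elem by (metis ex_in_conv open_contains_cball)
  have "0 < vol (cball x r)" using x(1) by simp
  also have "\<dots> \<le> vol (open_elem K)"
    using x(2) by (intro measure_mono_fmeasurable lmeasurable_open_elem) auto
  finally show ?thesis .
qed

lemma vol_homothety: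
  fixes S :: "'a::euclidean_space set"
  shows "0 \<le> r \<Longrightarrow> vol ((\<lambda>x. d + r *\<^sub>R x) ` S) = r ^ DIM('a) * vol S"
  using measure_lebesgue_affine[of r d S] by (simp add: add.commute)

lemma homothety_open_elem:
  assumes K: "tagged_simplex K" and p: "p \<in> closed_elem K" and r: "0 < r" "r \<le> 1"
  shows "(\<lambda>x. (1 - r) *\<^sub>R p + r *\<^sub>R x) ` open_elem K \<subseteq> open_elem K"
proof (clarify)
  fix x assume x: "x \<in> open_elem K"
  show "(1 - r) *\<^sub>R p + r *\<^sub>R x \<in> open_elem K"
    unfolding open_elem_iff[OF K] affine_fun_comb2[OF affine_fun_bary[OF vertex_set_vertices[OF K]]]
    using x p r by (auto simp: open_elem_iff[OF K] closed_elem_iff[OF K] intro!: add_nonneg_pos)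
qed

text \<open>The copy of \<open>K\<close> shrunk by 1/2 towards the end that a son keeps lies in that
  son. The resulting factor is worse than the exact 1/2, but it comes without determinants, and only
  a positive bound matters.\<close>

lemma vol_sons:
  fixes K :: "'a::euclidean_space tagged"
  assumes K: "tagged_simplex K"
  shows "(1/2) ^ DIM('a) * vol (open_elem K) \<le> vol (open_elem (son1 K))"
    "(1/2) ^ DIM('a) * vol (open_elem K) \<le> vol (open_elem (son2 K))"
proof -
  note vs = vertex_set_vertices[OF K] and s = tagged_simplex_sons[OF K] and e = end_vertices[OF K]
  note mid = mid_pt_notin[OF K]
  have comb: "lam K v ((1/2) *\<^sub>R p + (1/2) *\<^sub>R x) = (lam K v p + lam K v x) / 2" for v p x
    using affine_fun_comb2[OF affine_fun_bary[OF vs], of v "1/2" p x] by (simp add: field_simps)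
  have le1: "lam K v x < 1" if x: "x \<in> open_elem K" and v: "v \<in> {end1 K, end2 K}" for v x
  proof -
    have "lam K (end1 K) x + lam K (end2 K) x \<le> 1"
      using bary_add_le_1[OF vs _ e(3), of x] x open_subset_closed_elem unfolding closed_elem_def by blast
    moreover have "0 < lam K (end1 K) x" "0 < lam K (end2 K) x" using x e open_elem_iff[OF K] by auto
    ultimately show ?thesis using v by auto
  qed
  have 1: "(\<lambda>x. (1/2) *\<^sub>R end1 K + (1/2) *\<^sub>R x) ` open_elem K \<subseteq> open_elem (son1 K)"
  proof (clarify)
    fix x assume x: "x \<in> open_elem K"
    show "(1/2) *\<^sub>R end1 K + (1/2) *\<^sub>R x \<in> open_elem (son1 K)"
      unfolding open_elem_iff[OF s(1)]
    proof
      fix z assume z: "z \<in> vertices (son1 K)"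
      consider "z = mid_pt K" | "z = end1 K" | "z \<in> vertices K" "z \<noteq> end1 K" "z \<noteq> end2 K" "z \<noteq> mid_pt K"
        using z mid unfolding vertices_sons[OF K] by blast
      then show "0 < lam (son1 K) z ((1/2) *\<^sub>R end1 K + (1/2) *\<^sub>R x)"
        using x le1[OF x, of "end2 K"] e bary_vertex[OF vs e(1)] open_elem_iff[OF K, of x]
        by cases (auto simp: lam_son1[OF K] comb add_pos_pos)
    qed
  qed
  have 2: "(\<lambda>x. (1/2) *\<^sub>R end2 K + (1/2) *\<^sub>R x) ` open_elem K \<subseteq> open_elem (son2 K)"
  proof (clarify)
    fix x assume x: "x \<in> open_elem K"
    show "(1/2) *\<^sub>R end2 K + (1/2) *\<^sub>R x \<in> open_elem (son2 K)"
      unfolding open_elem_iff[OF s(2)]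
    proof
      fix z assume z: "z \<in> vertices (son2 K)"
      consider "z = mid_pt K" | "z = end2 K" | "z \<in> vertices K" "z \<noteq> end1 K" "z \<noteq> end2 K" "z \<noteq> mid_pt K"
        using z mid unfolding vertices_sons[OF K] by blast
      then show "0 < lam (son2 K) z ((1/2) *\<^sub>R end2 K + (1/2) *\<^sub>R x)"
        using x le1[OF x, of "end1 K"] e bary_vertex[OF vs e(2)] open_elem_iff[OF K, of x]
        by cases (auto simp: lam_son2[OF K] comb add_pos_pos)
    qed
  qed
  have op: "open ((\<lambda>x. p + (1/2) *\<^sub>R x) ` open_elem K)" for p
    by (rule open_affinity[OF open_open_elem]) simp
  have "vol ((\<lambda>x. (1/2) *\<^sub>R end1 K + (1/2) *\<^sub>R x) ` open_elem K) \<le> vol (open_elem (son1 K))"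
    using 1 op by (intro measure_mono_fmeasurable lmeasurable_open_elem) (auto simp: borel_open)
  then show "(1/2) ^ DIM('a) * vol (open_elem K) \<le> vol (open_elem (son1 K))"
    using vol_homothety[of "1/2" "(1/2) *\<^sub>R end1 K" "open_elem K"] by simp
  have "vol ((\<lambda>x. (1/2) *\<^sub>R end2 K + (1/2) *\<^sub>R x) ` open_elem K) \<le> vol (open_elem (son2 K))"
    using 2 op by (intro measure_mono_fmeasurable lmeasurable_open_elem) (auto simp: borel_open)
  then show "(1/2) ^ DIM('a) * vol (open_elem K) \<le> vol (open_elem (son2 K))"
    using vol_homothety[of "1/2" "(1/2) *\<^sub>R end2 K" "open_elem K"] by simp
qed

text \<open>\<open>size t\<close> counts the branchings and so bounds the number of bisections on
  the way to any leaf.\<close>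

lemma vol_leaves:
  fixes K :: "'a::euclidean_space tagged"
  shows "tagged_simplex K \<Longrightarrow> X \<in> leaves t K \<Longrightarrow> size t \<le> n \<Longrightarrow>
    (1/2) ^ (DIM('a) * n) * vol (open_elem K) \<le> vol (open_elem X)"
proof (induction t arbitrary: K n)
  case Leaf
  have "(1/2::real) ^ (DIM('a) * n) \<le> 1" by (rule power_le_one) auto
  then show ?case using Leaf by (simp add: mult_left_le_one_le)
next
  case (Node l r)
  note s = tagged_simplex_sons[OF Node.prems(1)] and v = vol_sons[OF Node.prems(1)]
  obtain k where k: "n = Suc k" using Node.prems(3) by (cases n) auto
  have eq: "(1/2::real) ^ (DIM('a) * n) = (1/2) ^ (DIM('a) * k) * (1/2) ^ DIM('a)"
    unfolding k by (simp add: power_add)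
  have "size l \<le> k" "size r \<le> k" using Node.prems(3) k by auto
  from Node.prems(2) consider "X \<in> leaves l (son1 K)" | "X \<in> leaves r (son2 K)" by auto
  then show ?case
  proof cases
    case 1
    have "(1/2) ^ (DIM('a) * n) * vol (open_elem K) \<le> (1/2) ^ (DIM('a) * k) * vol (open_elem (son1 K))"
      unfolding eq mult.assoc using v(1) by (intro mult_left_mono) auto
    also have "\<dots> \<le> vol (open_elem X)" by (rule Node.IH(1)[OF s(1) 1 \<open>size l \<le> k\<close>])
    finally show ?thesis .
  next
    case 2
    have "(1/2) ^ (DIM('a) * n) * vol (open_elem K) \<le> (1/2) ^ (DIM('a) * k) * vol (open_elem (son2 K))"
      unfolding eq mult.assoc using v(2) by (intro mult_left_mono) auto
    also have "\<dots> \<le> vol (open_elem X)" by (rule Node.IH(2)[OF s(2) 2 \<open>size r \<le> k\<close>])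
    finally show ?thesis .
  qed
qed

lemma tle_size: "tle s t \<Longrightarrow> size s \<le> size t"
  by (induction s t rule: tle.induct) auto

lemma card_leaves: "card (leaves t K) \<le> size t + 1"
proof (induction t arbitrary: K)
  case (Node l r)
  have "card (leaves l (son1 K) \<union> leaves r (son2 K)) \<le> card (leaves l (son1 K)) + card (leaves r (son2 K))"
    by (rule card_Un_le)
  then show ?case using Node[of "son1 K"] Node(2)[of "son2 K"] by (simp; linarith)
qed simp

text \<open>A binary tree with 20 leaves has 19 branchings.\<close>

lemma size_utree: "size (utree d \<beta>) \<le> 19"
  by (auto simp: utree_def Let_def)

definition shape_elem :: "real \<Rightarrow> 'a::euclidean_space tagged \<Rightarrow> bool" where
  "shape_elem \<gamma> K \<longleftrightarrow> diam K ^ DIM('a) \<le> \<gamma> ^ DIM('a) * vol (open_elem K)"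

lemma shape_regular_elem:
  fixes \<T> :: "'a::euclidean_space tagged set"
  assumes "shape_regular \<gamma> \<T>" "0 < \<gamma>" "K \<in> \<T>" "tagged_simplex K" shows "shape_elem \<gamma> K"
proof -
  let ?V = "vol (open_elem K)"
  have V: "0 < ?V" by (rule vol_open_elem_pos[OF assms(4)])
  have "diam K / ?V powr (1 / real DIM('a)) \<le> \<gamma>" using assms(1,3) unfolding shape_regular_def diam_def by blast
  then have "diam K \<le> \<gamma> * ?V powr (1 / real DIM('a))" using V by (simp add: divide_le_eq)
  then have "diam K ^ DIM('a) \<le> (\<gamma> * ?V powr (1 / real DIM('a))) ^ DIM('a)"
    using diam_pos[OF assms(4)] by (intro power_mono) auto
  also have "\<dots> = \<gamma> ^ DIM('a) * ?V"
    using V by (simp add: power_mult_distrib powr_realpow[symmetric] powr_powr)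
  finally show ?thesis unfolding shape_elem_def .
qed

text \<open>The unit ball and 2^d come from \<open>gradient_bound\<close>, \<gamma>^d from shape
  regularity, and 2^(d n) is the loss of volume after at most \<open>n\<close> bisections.\<close>

definition grad_const :: "nat \<Rightarrow> real \<Rightarrow> nat \<Rightarrow> real" where
  "grad_const d \<gamma> n = unit_ball_vol (real d) * 2 ^ d * \<gamma> ^ d * 2 ^ (d * n)"

lemma grad_const_pos: "0 < \<gamma> \<Longrightarrow> 0 < grad_const d \<gamma> n"
  unfolding grad_const_def by (simp add: unit_ball_vol_pos)

text \<open>\<open>gradient_bound\<close> is applied to the descendant \<open>X\<close>, but in a
  ball of the size of \<open>K\<close>, so the estimate refers to the diameter of the ancestor. The
  tree \<open>Leaf\<close> with \<open>n = 0\<close> covers \<open>K\<close> itself.\<close>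

lemma lam_lipschitz:
  fixes K :: "'a::euclidean_space tagged"
  assumes K: "tagged_simplex K" and sh: "shape_elem \<gamma> K" "0 < \<gamma>" and X: "X \<in> leaves t K" "size t \<le> n"
  shows "\<bar>lam X z x - lam X z y\<bar> \<le> grad_const DIM('a) \<gamma> n / diam K * norm (x - y)"
proof (cases "z \<in> vertices X")
  case False
  then show ?thesis
    using bary_notin[OF vertex_set_vertices[OF leaves_simplex[OF K X(1)]] False] grad_const_pos[OF sh(2)] diam_pos[OF K]
    by (simp add: less_imp_le)
next
  case True
  let ?d = "DIM('a)" and ?D = "diam K"
  have tX: "tagged_simplex X" by (rule leaves_simplex[OF K X(1)])
  note vX = vertex_set_vertices[OF tX]
  have D: "0 < ?D" by (rule diam_pos[OF K])
  obtain g c where g: "\<And>x. lam X z x = g \<bullet> x + c" using affine_fun_bary[OF vX] unfolding affine_fun_def by blast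
  have cl: "x \<in> closed_elem K" if "x \<in> open_elem X" for x
    using that open_subset_closed_elem leaves_subset[OF K X(1)] by blast
  have a1: "norm g * vol (open_elem X) * ?D \<le> unit_ball_vol (real ?d) * (2 * ?D) ^ ?d"
  proof (rule gradient_bound[OF lmeasurable_open_elem _ D])
    show "open_elem X \<subseteq> cball (end1 K) ?D"
      using cl norm_le_diam[OF K vertex_closed[OF end_vertices(1)[OF K]]] by (auto simp: dist_norm)
    fix x assume x: "x \<in> open_elem X"
    then have "0 < lam X z x" using True open_elem_iff[OF tX] by blast
    moreover have "lam X z x \<le> 1" using bary_le_1[OF vX] x open_subset_closed_elem unfolding closed_elem_def by blast
    ultimately show "0 < g \<bullet> x + c \<and> g \<bullet> x + c \<le> 1" using g by simp
  qed
  have "vol (open_elem K) \<le> 2 ^ (?d * n) * vol (open_elem X)"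
    using vol_leaves[OF K X] by (simp add: power_one_over field_simps)
  then have "\<gamma> ^ ?d * vol (open_elem K) \<le> \<gamma> ^ ?d * (2 ^ (?d * n) * vol (open_elem X))"
    using sh(2) by (intro mult_left_mono) auto
  then have a2: "?D ^ ?d \<le> \<gamma> ^ ?d * (2 ^ (?d * n) * vol (open_elem X))"
    using sh(1) unfolding shape_elem_def by linarith
  have "unit_ball_vol (real ?d) * (2 * ?D) ^ ?d = unit_ball_vol (real ?d) * 2 ^ ?d * ?D ^ ?d"
    by (simp add: power_mult_distrib)
  also have "\<dots> \<le> unit_ball_vol (real ?d) * 2 ^ ?d * (\<gamma> ^ ?d * (2 ^ (?d * n) * vol (open_elem X)))"
    using a2 by (intro mult_left_mono) auto
  also have "\<dots> = grad_const ?d \<gamma> n * vol (open_elem X)" unfolding grad_const_def by (simp only: mult.assoc)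
  finally have "norm g * vol (open_elem X) * ?D \<le> grad_const ?d \<gamma> n * vol (open_elem X)" using a1 by linarith
  then have "norm g * ?D \<le> grad_const ?d \<gamma> n"
    using vol_open_elem_pos[OF tX] by (simp add: mult.commute[of _ "vol _"] mult.assoc mult.left_commute)
  then have ng: "norm g \<le> grad_const ?d \<gamma> n / ?D" using D by (simp add: field_simps)
  have "\<bar>lam X z x - lam X z y\<bar> = \<bar>g \<bullet> (x - y)\<bar>" by (simp add: g inner_diff_right)
  also have "\<dots> \<le> norm g * norm (x - y)" by (rule Cauchy_Schwarz_ineq2)
  also have "\<dots> \<le> grad_const ?d \<gamma> n / ?D * norm (x - y)" using ng by (intro mult_right_mono) auto
  finally show ?thesis .
qed

text \<open>The coordinate of \<open>p\<close> falls from 1 to 0 along the edge, which on a short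
  edge would be too steep for \<open>lam_lipschitz\<close>.\<close>

lemma edge_ge_diam:
  fixes K :: "'a::euclidean_space tagged"
  assumes K: "tagged_simplex K" "shape_elem \<gamma> K" "0 < \<gamma>" and pq: "p \<in> vertices K" "q \<in> vertices K" "p \<noteq> q"
  shows "diam K \<le> grad_const DIM('a) \<gamma> 0 * norm (p - q)"
proof -
  have "1 = \<bar>lam K p p - lam K p q\<bar>" using bary_vertex[OF vertex_set_vertices[OF K(1)]] pq by simp
  also have "\<dots> \<le> grad_const DIM('a) \<gamma> 0 / diam K * norm (p - q)"
    by (rule lam_lipschitz[OF K, of K Leaf]) auto
  finally show ?thesis using diam_pos[OF K(1)] by (simp add: field_simps)
qed

text \<open>The common face contains \<open>z\<close>, which is no vertex, so it cannot be a single
  vertex. Hence sizes of elements at a new node compare directly, without chains of neighbours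
  around a vertex.\<close>

lemma shared_edge:
  assumes m: "mesh \<T>" "compatible \<T>" and K: "K \<in> \<T>" "K' \<in> \<T>" and z: "z \<in> closed_elem K" "z \<in> closed_elem K'" "z \<notin> nodes \<T>"
  obtains p q where "p \<noteq> q" "{p, q} \<subseteq> vertices K \<inter> vertices K'"
proof -
  let ?C = "vertices K \<inter> vertices K'"
  have zC: "z \<in> convex hull ?C" using compatible_Int[OF m K] z by blast
  then have "?C \<noteq> {}" by auto
  then obtain p where p: "p \<in> ?C" by blast
  have "?C \<noteq> {p}"
  proof
    assume "?C = {p}"
    then have "z = p" using zC by simp
    then show False using p z(3) K(1) unfolding nodes_def by blast
  qed
  then obtain q where "q \<in> ?C" "q \<noteq> p" using p by blast
  then show thesis using that[of p q] p by blast
qed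

lemma neighbour_diam:
  fixes \<T> :: "'a::euclidean_space tagged set"
  assumes m: "mesh \<T>" "compatible \<T>" and sh: "shape_regular \<gamma> \<T>" "0 < \<gamma>"
    and K: "K \<in> \<T>" "K' \<in> \<T>" and z: "z \<in> closed_elem K" "z \<in> closed_elem K'" "z \<notin> nodes \<T>"
  shows "diam K \<le> grad_const DIM('a) \<gamma> 0 * diam K'"
proof -
  have ts: "tagged_simplex K" "tagged_simplex K'" using m(1) K by (auto simp: mesh_def)
  obtain p q where pq: "p \<noteq> q" "{p, q} \<subseteq> vertices K \<inter> vertices K'" by (rule shared_edge[OF m K z])
  have "diam K \<le> grad_const DIM('a) \<gamma> 0 * norm (p - q)"
    using edge_ge_diam[OF ts(1) shape_regular_elem[OF sh K(1) ts(1)] sh(2)] pq by blast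
  also have "\<dots> \<le> grad_const DIM('a) \<gamma> 0 * diam K'"
    using norm_le_diam[OF ts(2), of p q] pq vertex_closed[of p K'] vertex_closed[of q K'] grad_const_pos[OF sh(2), of "DIM('a)" 0]
    by (intro mult_left_mono) auto
  finally show ?thesis .
qed

text \<open>Packing around the node: the elements there lie in a ball of radius
  \<open>G * diam K0\<close> and have volume at least \<open>(diam K0 / (G * \<gamma>)) ^ d\<close>;
  the bound is the quotient.\<close>

lemma new_node_valence:
  fixes \<T> :: "'a::euclidean_space tagged set"
  assumes m: "mesh \<T>" "compatible \<T>" and sh: "shape_regular \<gamma> \<T>" "0 < \<gamma>" and z: "z \<notin> nodes \<T>"
  shows "real (card {K\<in>\<T>. z \<in> closed_elem K}) \<le>
    unit_ball_vol (real DIM('a)) * ((grad_const DIM('a) \<gamma> 0)\<^sup>2 * \<gamma>) ^ DIM('a)"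
proof (cases "{K\<in>\<T>. z \<in> closed_elem K} = {}")
  case True
  then show ?thesis using grad_const_pos[OF sh(2)] sh(2) by (simp only: True card.empty) simp
next
  case False
  let ?d = "DIM('a)" and ?I = "{K\<in>\<T>. z \<in> closed_elem K}"
  define G where "G = grad_const ?d \<gamma> 0"
  have G: "0 < G" unfolding G_def by (rule grad_const_pos[OF sh(2)])
  have ts: "\<And>K. K \<in> \<T> \<Longrightarrow> tagged_simplex K" and fin: "finite \<T>" using m by (auto simp: mesh_def)
  obtain K0 where K0: "K0 \<in> \<T>" "z \<in> closed_elem K0" using False by blast
  let ?D = "diam K0"
  have D: "0 < ?D" by (rule diam_pos[OF ts[OF K0(1)]])
  have "real (card ?I) * (?D / (G * \<gamma>)) ^ ?d \<le> unit_ball_vol (real ?d) * (G * ?D) ^ ?d"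
  proof (rule packing[of ?I open_elem z "G * ?D"])
    show "finite ?I" using fin by simp
    show "0 \<le> G * ?D" using G D by simp
    fix K assume K: "K \<in> ?I"
    then have KT: "K \<in> \<T>" "z \<in> closed_elem K" by auto
    show "open_elem K \<in> lmeasurable" by (rule lmeasurable_open_elem)
    have d1: "diam K \<le> G * ?D" "?D \<le> G * diam K"
      using neighbour_diam[OF m sh] KT K0 z unfolding G_def by blast+
    show "open_elem K \<subseteq> cball z (G * ?D)"
    proof
      fix x assume "x \<in> open_elem K"
      then have "norm (z - x) \<le> diam K" using norm_le_diam[OF ts[OF KT(1)] KT(2)] open_subset_closed_elem by blast
      then show "x \<in> cball z (G * ?D)" using d1 by (simp add: dist_norm)
    qed
    have "(?D / (G * \<gamma>)) ^ ?d \<le> (diam K / \<gamma>) ^ ?d"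
      using d1(2) D G sh(2) by (intro power_mono) (auto simp: field_simps)
    also have "\<dots> \<le> vol (open_elem K)"
      using shape_regular_elem[OF sh KT(1) ts[OF KT(1)]] sh(2) unfolding shape_elem_def
      by (simp add: power_divide field_simps)
    finally show "(?D / (G * \<gamma>)) ^ ?d \<le> vol (open_elem K)" .
    fix K' assume "K' \<in> ?I" "K \<noteq> K'"
    then show "open_elem K \<inter> open_elem K' = {}" using m(1) KT unfolding mesh_def by blast
  qed
  then have "real (card ?I) \<le> unit_ball_vol (real ?d) * (G * ?D) ^ ?d / (?D / (G * \<gamma>)) ^ ?d"
    using D G sh(2) by (subst pos_le_divide_eq) auto
  also have "\<dots> = unit_ball_vol (real ?d) * (G\<^sup>2 * \<gamma>) ^ ?d"
    using D G sh(2) by (simp add: power_mult_distrib power_divide power2_eq_square field_simps)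
  finally show ?thesis unfolding G_def .
qed

section \<open>Oscillation and energy\<close>

definition osc :: "('a::euclidean_space \<Rightarrow> real) \<Rightarrow> 'a tagged \<Rightarrow> real" where
  "osc v K = Max (v ` vertices K) - Min (v ` vertices K)"

text \<open>The midpoint of the refinement edge belongs to both sons, so points in different sons
  are compared through it and the oscillations of the subtrees add up.\<close>

lemma tree_oscillation:
  fixes v :: "'a::euclidean_space \<Rightarrow> real"
  assumes X: "\<And>X x y. X \<in> leaves t K \<Longrightarrow> x \<in> closed_elem X \<Longrightarrow> y \<in> closed_elem X \<Longrightarrow> \<bar>v x - v y\<bar> \<le> o_X X"
    and nn: "\<And>X. X \<in> leaves t K \<Longrightarrow> 0 \<le> o_X X"
    and K: "tagged_simplex K" and xy: "x \<in> closed_elem K" "y \<in> closed_elem K"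
  shows "\<bar>v x - v y\<bar> \<le> (\<Sum>X\<in>leaves t K. o_X X)"
  using assms
proof (induction t arbitrary: K x y)
  case Leaf
  then show ?case by simp
next
  case (Node l r)
  note K = Node.prems(3) and s = tagged_simplex_sons[OF Node.prems(3)]
  have "leaves l (son1 K) \<inter> leaves r (son2 K) = {}" using leaves_sons_disjoint(2)[OF K] by blast
  then have sum: "(\<Sum>X\<in>leaves (Node l r) K. o_X X) = (\<Sum>X\<in>leaves l (son1 K). o_X X) + (\<Sum>X\<in>leaves r (son2 K). o_X X)"
    by (simp add: sum.union_disjoint)
  have n1: "0 \<le> (\<Sum>X\<in>leaves l (son1 K). o_X X)" "0 \<le> (\<Sum>X\<in>leaves r (son2 K). o_X X)"
    using Node.prems(2) by (simp_all add: sum_nonneg)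
  have i1: "\<bar>v x - v y\<bar> \<le> (\<Sum>X\<in>leaves l (son1 K). o_X X)" if "x \<in> closed_elem (son1 K)" "y \<in> closed_elem (son1 K)" for x y
    by (rule Node.IH(1)[OF _ _ s(1) that]) (use Node.prems in auto)
  have i2: "\<bar>v x - v y\<bar> \<le> (\<Sum>X\<in>leaves r (son2 K). o_X X)" if "x \<in> closed_elem (son2 K)" "y \<in> closed_elem (son2 K)" for x y
    by (rule Node.IH(2)[OF _ _ s(2) that]) (use Node.prems in auto)
  have m: "mid_pt K \<in> closed_elem (son1 K)" "mid_pt K \<in> closed_elem (son2 K)"
    by (rule vertex_closed, simp add: vertices_sons[OF K])+
  from Node.prems(4,5) consider "x \<in> closed_elem (son1 K)" "y \<in> closed_elem (son1 K)" | "x \<in> closed_elem (son2 K)" "y \<in> closed_elem (son2 K)"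
    | "x \<in> closed_elem (son1 K)" "y \<in> closed_elem (son2 K)" | "x \<in> closed_elem (son2 K)" "y \<in> closed_elem (son1 K)"
    unfolding closed_elem_sons[OF K] by blast
  then show ?case
  proof cases
    case 1 then show ?thesis using i1[of x y] n1 unfolding sum by linarith
  next
    case 2 then show ?thesis using i2[of x y] n1 unfolding sum by linarith
  next
    case 3 then show ?thesis using i1[of x "mid_pt K"] i2[of "mid_pt K" y] m unfolding sum by linarith
  next
    case 4 then show ?thesis using i2[of x "mid_pt K"] i1[of "mid_pt K" y] m unfolding sum by linarith
  qed
qed

context fe_mesh
begin

lemma osc_bounds:
  assumes v: "v \<in> S10 \<Omega> \<T>" and K: "K \<in> \<T>" "x \<in> closed_elem K"
  shows "Min (v ` vertices K) \<le> v x" "v x \<le> Max (v ` vertices K)"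
proof -
  note vs = vertex_set_vertices[OF simplex[OF K(1)]]
  have fin: "finite (vertices K)" by (simp add: vertices_def)
  have nn: "0 \<le> lam K z x" for z using K(2) closed_elem_iff[OF simplex[OF K(1)]] by blast
  have c: "(\<Sum>z\<in>vertices K. lam K z x * k) = k" for k
    using bary_sum[OF vs, of x] by (simp add: sum_distrib_right[symmetric])
  have "v x \<le> (\<Sum>z\<in>vertices K. lam K z x * Max (v ` vertices K))"
    unfolding S10_expand[OF v K] using fin nn by (intro sum_mono mult_left_mono) auto
  then show "v x \<le> Max (v ` vertices K)" unfolding c .
  have "(\<Sum>z\<in>vertices K. lam K z x * Min (v ` vertices K)) \<le> v x"
    unfolding S10_expand[OF v K] using fin nn by (intro sum_mono mult_left_mono) auto
  then show "Min (v ` vertices K) \<le> v x" unfolding c .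
qed

lemma osc_le:
  "v \<in> S10 \<Omega> \<T> \<Longrightarrow> K \<in> \<T> \<Longrightarrow> x \<in> closed_elem K \<Longrightarrow> y \<in> closed_elem K \<Longrightarrow> \<bar>v x - v y\<bar> \<le> osc v K"
  unfolding osc_def using osc_bounds[of v K x] osc_bounds[of v K y] by linarith

lemma osc_nonneg: "v \<in> S10 \<Omega> \<T> \<Longrightarrow> K \<in> \<T> \<Longrightarrow> 0 \<le> osc v K"
  using osc_le[of v K "end1 K" "end1 K"] vertex_closed[OF end_vertices(1)[OF simplex]] by auto

text \<open>Restricts the double integral to the pairs from two copies of each element, scaled by 1/4
  towards a vertex with the largest and one with the smallest value.\<close>

lemma energy_lower:
  assumes v: "v \<in> S10 \<Omega> \<T>" and s: "0 < s" "s < 1"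
  shows "frac_const DIM('a) s / 2 * (\<Sum>K\<in>\<T>. (osc v K / 2)\<^sup>2 * diam K powr (- (real DIM('a) + 2 * s)) *
     ((1/4) ^ DIM('a) * vol (open_elem K))\<^sup>2) \<le> frac_form s v v"
proof -
  have fin: "finite (vertices K)" for K :: "'a tagged" by (simp add: vertices_def)
  have "\<exists>p q. p \<in> vertices K \<and> q \<in> vertices K \<and> v p = Max (v ` vertices K) \<and> v q = Min (v ` vertices K)"
    if "K \<in> \<T>" for K
  proof -
    have ne: "v ` vertices K \<noteq> {}" using end_vertices(1)[OF simplex[OF that]] by blast
    have "Max (v ` vertices K) \<in> v ` vertices K" "Min (v ` vertices K) \<in> v ` vertices K"
      using ne fin by (intro Max_in Min_in; simp)+
    then show ?thesis by (metis imageE)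
  qed
  then obtain P Q where PQ: "\<And>K. K \<in> \<T> \<Longrightarrow> P K \<in> vertices K \<and> Q K \<in> vertices K \<and>
      v (P K) = Max (v ` vertices K) \<and> v (Q K) = Min (v ` vertices K)" by metis
  define A where "A K = (\<lambda>x. (3/4) *\<^sub>R P K + (1/4) *\<^sub>R x) ` open_elem K" for K
  define B where "B K = (\<lambda>x. (3/4) *\<^sub>R Q K + (1/4) *\<^sub>R x) ` open_elem K" for K
  have opA: "open (A K)" "open (B K)" for K
    unfolding A_def B_def by (rule open_affinity[OF open_open_elem], simp)+
  have sub: "A K \<subseteq> open_elem K" "B K \<subseteq> open_elem K" if "K \<in> \<T>" for K
    using homothety_open_elem[OF simplex[OF that], of "P K" "1/4"] homothety_open_elem[OF simplex[OF that], of "Q K" "1/4"]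
      PQ[OF that] vertex_closed[of "P K" K] vertex_closed[of "Q K" K]
    unfolding A_def B_def by simp_all
  have vA: "vol (A K) = (1/4) ^ DIM('a) * vol (open_elem K)" "vol (B K) = (1/4) ^ DIM('a) * vol (open_elem K)" for K
    unfolding A_def B_def by (rule vol_homothety, simp)+
  have mA: "measure lborel (A K) = vol (A K)" "measure lborel (B K) = vol (B K)" for K
    using opA by (simp_all add: borel_open)
  let ?m = "\<lambda>K. (osc v K / 2)\<^sup>2 * diam K powr (- (real DIM('a) + 2 * s))"
  have "frac_const DIM('a) s / 2 * (\<Sum>K\<in>\<T>. ?m K * (measure lborel (A K) * measure lborel (B K))) \<le> frac_form s v v"
  proof (rule frac_form_lower[OF s S10_finite_energy[OF v s] finite_mesh])
    fix K assume K: "K \<in> \<T>"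
    have "bounded (A K)" "bounded (B K)" using sub[OF K] bounded_open_elem bounded_subset by blast+
    then show "A K \<in> sets lborel \<and> B K \<in> sets lborel \<and> emeasure lborel (A K) < \<infinity> \<and> emeasure lborel (B K) < \<infinity>"
      using opA emeasure_bounded_finite by (auto simp: borel_open)
    show "(A K \<times> B K) \<inter> (A K' \<times> B K') = {}" if "K' \<in> \<T>" "K \<noteq> K'" for K'
      using sub[OF K] sub[OF that(1)] mesh K that unfolding mesh_def by blast
    fix x y assume xy: "x \<in> A K" "y \<in> B K"
    obtain f where f: "affine_fun f" "\<And>x. x \<in> closed_elem K \<Longrightarrow> v x = f x" using S10_affine[OF v K] by blast
    obtain x' where x': "x' \<in> open_elem K" "x = (3/4) *\<^sub>R P K + (1/4) *\<^sub>R x'" using xy(1) unfolding A_def by blast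
    obtain y' where y': "y' \<in> open_elem K" "y = (3/4) *\<^sub>R Q K + (1/4) *\<^sub>R y'" using xy(2) unfolding B_def by blast
    have cl: "x \<in> closed_elem K" "y \<in> closed_elem K" "x' \<in> closed_elem K" "y' \<in> closed_elem K" "P K \<in> closed_elem K" "Q K \<in> closed_elem K"
      using xy sub[OF K] x' y' open_subset_closed_elem[of K] PQ[OF K] vertex_closed by blast+
    have "v x = 3/4 * v (P K) + 1/4 * v x'"
      using affine_fun_comb2[OF f(1), of "1/4" "P K" x'] f(2) cl x'(2) by simp
    have "v y = 3/4 * v (Q K) + 1/4 * v y'"
      using affine_fun_comb2[OF f(1), of "1/4" "Q K" y'] f(2) cl y'(2) by simp
    \<comment> \<open>Each copy carries 3/4 of an extreme value and 1/4 of some other value; in the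
      worst case 3/4 - 1/4 of the oscillation remains.\<close>
    have ge: "osc v K / 2 \<le> v x - v y"
    proof -
      have "v (P K) = Max (v ` vertices K)" "v (Q K) = Min (v ` vertices K)" using PQ[OF K] by auto
      with \<open>v x = _\<close> \<open>v y = _\<close> show ?thesis
        using osc_bounds(1)[OF v K cl(3)] osc_bounds(2)[OF v K cl(4)] unfolding osc_def by argo
    qed
    have o0: "0 \<le> osc v K" by (rule osc_nonneg[OF v K])
    show "?m K \<le> (v x - v y)\<^sup>2 * frac_kernel s (x, y)"
    \<comment> \<open>Without oscillation the two copies may overlap, and at \<open>x = y\<close>
      the kernel is 0 by the convention for division.\<close>
    proof (cases "osc v K = 0")
      case True
      then show ?thesis by (simp add: frac_kernel_nonneg)
    next
      case False
      then have "x \<noteq> y" using ge o0 by auto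
      then have n0: "0 < norm (x - y)" by simp
      have "norm (x - y) \<le> diam K" by (rule norm_le_diam[OF simplex[OF K] cl(1,2)])
      then have "norm (x - y) powr (real DIM('a) + 2 * s) \<le> diam K powr (real DIM('a) + 2 * s)"
        using n0 s by (intro powr_mono2) auto
      then have "diam K powr (- (real DIM('a) + 2 * s)) \<le> frac_kernel s (x, y)"
        using n0 diam_pos[OF simplex[OF K]] unfolding frac_kernel_def powr_minus_divide
        by (intro divide_left_mono mult_pos_pos) auto
      moreover have "(osc v K / 2)\<^sup>2 \<le> (v x - v y)\<^sup>2" using ge o0 by (intro power_mono) auto
      ultimately show ?thesis by (intro mult_mono) auto
    qed
  qed
  then show ?thesis unfolding mA vA by (simp add: power2_eq_square)
qed

end

section \<open>The two-level estimator\<close>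

definition valence :: "nat \<Rightarrow> real \<Rightarrow> real" where
  "valence d \<gamma> = unit_ball_vol (real d) * ((grad_const d \<gamma> 0)\<^sup>2 * \<gamma>) ^ d"

text \<open>The bound of \<open>truncated_lipschitz_energy\<close> times half of
  \<open>frac_const\<close>, for jumps at most 1, support radius \<open>G0 * D\<close> and length
  \<open>D / (G * G0)\<close>, with the powers of the diameter \<open>D\<close> taken out. Here
  \<open>G\<close> allows for 19 bisections and \<open>G0\<close> for none.\<close>

definition hat_energy_const :: "'a::euclidean_space itself \<Rightarrow> real \<Rightarrow> real \<Rightarrow> real" where
  "hat_energy_const A s \<gamma> = frac_const DIM('a) s * (unit_ball_vol (real DIM('a)) * grad_const DIM('a) \<gamma> 0 ^ DIM('a) *
     (grad_const DIM('a) \<gamma> 19 * grad_const DIM('a) \<gamma> 0) powr (2 * s) * trunc_const A s)"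

text \<open>1/4 is the square of the factor 1/2 on the oscillation in \<open>energy_lower\<close>.
  The other square is a lower bound for the volume of a copy, scaled by 1/4, of a descendant after
  at most 19 bisections, relative to the power \<open>d\<close> of the diameter of the
  ancestor.\<close>

definition elem_const :: "nat \<Rightarrow> real \<Rightarrow> real" where
  "elem_const d \<gamma> = (1/4) * ((1/4) ^ d * ((1/2) ^ (d * 19) / \<gamma> ^ d))\<^sup>2"

text \<open>At most \<open>20 * (d + 1)\<close> new nodes per element, a factor 20 from
  Cauchy-Schwarz over the descendants, the quotient of the upper and lower energy constants, and
  \<open>2 / frac_const\<close> to undo the prefactor of the form.\<close>

definition split_const :: "'a::euclidean_space itself \<Rightarrow> real \<Rightarrow> real \<Rightarrow> real" where
  "split_const A s \<gamma> =
     real (20 * (DIM('a) + 1)) * 20 * hat_energy_const A s \<gamma> / elem_const DIM('a) \<gamma> * (2 / frac_const DIM('a) s)"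

lemma valence_pos: "0 < \<gamma> \<Longrightarrow> 0 < valence d \<gamma>"
  unfolding valence_def using grad_const_pos[of \<gamma> d 0] by simp

lemma elem_const_pos: "0 < \<gamma> \<Longrightarrow> 0 < elem_const d \<gamma>"
  unfolding elem_const_def by simp

lemma trunc_const_nonneg: "0 \<le> trunc_const A s" unfolding trunc_const_def by simp

lemma hat_energy_const_nonneg: "0 < s \<Longrightarrow> s < 1 \<Longrightarrow> 0 < \<gamma> \<Longrightarrow> 0 \<le> hat_energy_const A s \<gamma>"
  for A :: "'a::euclidean_space itself"
  unfolding hat_energy_const_def
  using frac_const_pos[of s "DIM('a)"] grad_const_pos[of \<gamma> "DIM('a)" 0] trunc_const_nonneg
  by (intro mult_nonneg_nonneg) auto

lemma split_const_nonneg: "0 < s \<Longrightarrow> s < 1 \<Longrightarrow> 0 < \<gamma> \<Longrightarrow> 0 \<le> split_const A s \<gamma>"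
  for A :: "'a::euclidean_space itself"
  unfolding split_const_def
  using frac_const_pos[of s "DIM('a)"] elem_const_pos[of \<gamma>] hat_energy_const_nonneg[of s \<gamma> A]
  by (intro mult_nonneg_nonneg divide_nonneg_nonneg) (auto intro: less_imp_le)

section \<open>New nodes and their hat functions\<close>

locale estimator_mesh = fe_mesh \<Omega> \<T> + R: refinable_mesh \<T>
  for \<Omega> :: "'a::euclidean_space set" and \<T>
begin

lemma two_le_dim: "2 \<le> DIM('a)" using R.dim by auto

sublocale U: fe_mesh \<Omega> "unif \<T>"
  unfolding unif_def by (rule fe_mesh_forest[OF R.unif_compatible[unfolded unif_def]])

abbreviation \<phi> :: "'a \<Rightarrow> 'a \<Rightarrow> real" where "\<phi> \<equiv> hatfun (unif \<T>)"

definition new :: "'a set" where "new = interior_nodes \<Omega> (unif \<T>) - nodes \<T>"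

lemma finite_new: "finite new" unfolding new_def using U.finite_interior_nodes by simp

lemma newD: "z \<in> new \<Longrightarrow> z \<in> interior_nodes \<Omega> (unif \<T>)" "z \<in> new \<Longrightarrow> z \<in> nodes (unif \<T>)"
  "z \<in> new \<Longrightarrow> z \<notin> nodes \<T>" "z \<in> new \<Longrightarrow> z \<in> \<Omega>"
  unfolding new_def using U.interior_node by auto

lemma unif_leaf: "K \<in> \<T> \<Longrightarrow> Y \<in> leaves (ut K) K \<Longrightarrow> Y \<in> unif \<T>"
  unfolding unif_def forest_def by blast

lemma leaf_containing:
  assumes "K \<in> \<T>" "x \<in> closed_elem K"
  obtains Y where "Y \<in> leaves (ut K) K" "Y \<in> unif \<T>" "x \<in> closed_elem Y"
proof -
  obtain Y where "Y \<in> leaves (ut K) K" "x \<in> closed_elem Y"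
    using assms(2) leaves_closed[OF simplex[OF assms(1)], of "ut K"] by blast
  then show thesis using that unif_leaf[OF assms(1)] by blast
qed

lemma leaf_vertex_closed: "K \<in> \<T> \<Longrightarrow> Y \<in> leaves t K \<Longrightarrow> z \<in> vertices Y \<Longrightarrow> z \<in> closed_elem K"
  using leaves_subset[OF simplex] vertex_closed by blast

lemma new_in_leaf: "z \<in> new \<Longrightarrow> Y \<in> unif \<T> \<Longrightarrow> z \<in> closed_elem Y \<Longrightarrow> z \<in> vertices Y"
  using node_in_closed_elem[OF U.mesh U.compatible] newD(2) by blast

text \<open>Conformity of the uniform refinement makes every new node that lies in \<open>K\<close>
  a vertex of a son of \<open>K\<close>, so the index set of the estimator is described by position
  alone.\<close>

lemma elem_nodes:
  assumes K: "K \<in> \<T>"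
  shows "interior_nodes \<Omega> (sons_in (unif \<T>) K) - nodes \<T> = {z\<in>new. z \<in> closed_elem K}"
proof -
  have s: "sons_in (unif \<T>) K = leaves (ut K) K" unfolding unif_def by (rule sons_in_forest[OF mesh K])
  have "nodes (leaves (ut K) K) \<subseteq> nodes (unif \<T>)" unfolding nodes_def using unif_leaf[OF K] by blast
  moreover have "z \<in> closed_elem K" if "z \<in> nodes (leaves (ut K) K)" for z
    using that leaf_vertex_closed[OF K] unfolding nodes_def by blast
  moreover have "z \<in> nodes (leaves (ut K) K)" if z: "z \<in> new" "z \<in> closed_elem K" for z
  proof -
    obtain Y where "Y \<in> leaves (ut K) K" "Y \<in> unif \<T>" "z \<in> closed_elem Y" using leaf_containing[OF K z(2)] .
    then show ?thesis using new_in_leaf[OF z(1)] unfolding nodes_def by blast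
  qed
  ultimately show ?thesis unfolding s new_def interior_nodes_def by blast
qed

lemma tau_elem_sq:
  assumes K: "K \<in> \<T>"
  shows "(tau_elem \<Omega> s f \<T> u K)\<^sup>2 =
    (\<Sum>z\<in>{z\<in>new. z \<in> closed_elem K}. ((L2_inner \<Omega> f (\<phi> z) - frac_form s u (\<phi> z)) / energy_norm s (\<phi> z))\<^sup>2)"
proof -
  have "tau_node \<Omega> s f \<T> u z = \<bar>L2_inner \<Omega> f (\<phi> z) - frac_form s u (\<phi> z)\<bar> / energy_norm s (\<phi> z)" if "z \<in> new" for z
    unfolding tau_node_def R.uniform_refinement_eq U.hat_eq[OF newD(1)[OF that]] Let_def ..
  then show ?thesis
    unfolding tau_elem_def R.uniform_refinement_eq elem_nodes[OF K]
    by (subst real_sqrt_pow2) (auto intro!: sum_nonneg sum.cong simp: power_divide)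
qed

lemma hat_overlap: "Z \<subseteq> new \<Longrightarrow> card {z\<in>Z. \<phi> z x \<noteq> 0} \<le> DIM('a) + 1"
proof (cases "x \<in> closure \<Omega>")
  case True
  then obtain Y where Y: "Y \<in> unif \<T>" "x \<in> closed_elem Y" using U.in_cover by blast
  note vs = vertex_set_vertices[OF U.simplex[OF Y(1)]]
  have "{z\<in>Z. \<phi> z x \<noteq> 0} \<subseteq> vertices Y"
    using U.hatfun_eq[OF Y] bary_notin[OF vs] by auto
  then have "card {z\<in>Z. \<phi> z x \<noteq> 0} \<le> card (vertices Y)" using vs by (intro card_mono) (auto simp: vertex_set_def)
  then show ?thesis using vs by (simp add: vertex_set_def)
next
  case False
  then have "{z\<in>Z. \<phi> z x \<noteq> 0} = {}" using U.hatfun_outside by auto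
  then show ?thesis by (simp only: card.empty)
qed

lemma hat_finite_energy: "z \<in> new \<Longrightarrow> 0 < s \<Longrightarrow> s < 1 \<Longrightarrow> finite_energy s (\<phi> z)"
  using U.S10_finite_energy[OF U.hatfun_S10] newD(1) by blast

text \<open>Each node is charged to one element that contains it, and the remaining terms of the
  double sum are nonnegative.\<close>

lemma sum_elements_le:
  fixes g :: "'a tagged \<Rightarrow> 'a \<Rightarrow> real"
  assumes A: "\<A> \<subseteq> \<T>" and nn: "\<And>K z. K \<in> \<A> \<Longrightarrow> 0 \<le> g K z" and Z: "Z \<subseteq> new"
    and \<kappa>: "\<And>z. z \<in> Z \<Longrightarrow> \<kappa> z \<in> \<A> \<and> z \<in> closed_elem (\<kappa> z)"
  shows "(\<Sum>z\<in>Z. g (\<kappa> z) z) \<le> (\<Sum>K\<in>\<A>. \<Sum>z\<in>{z\<in>new. z \<in> closed_elem K}. g K z)"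
proof -
  have fA: "finite \<A>" using A finite_mesh finite_subset by blast
  have "(\<Sum>z\<in>Z. g (\<kappa> z) z) \<le> (\<Sum>z\<in>Z. \<Sum>K\<in>{K\<in>\<A>. z \<in> closed_elem K}. g K z)"
    using fA nn \<kappa> by (intro sum_mono member_le_sum) auto
  also have "\<dots> \<le> (\<Sum>z\<in>new. \<Sum>K\<in>{K\<in>\<A>. z \<in> closed_elem K}. g K z)"
    using Z finite_new nn by (intro sum_mono2 sum_nonneg) auto
  also have "\<dots> = (\<Sum>K\<in>\<A>. \<Sum>z\<in>{z\<in>new. z \<in> closed_elem K}. g K z)"
    by (rule sum.swap_restrict[OF finite_new fA])
  finally show ?thesis .
qed

text \<open>In the double sum a node occurs at most \<open>valence\<close> times, and the Bessel
  inequality bounds the sum over the nodes. Efficiency and stability differ only in why the residual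
  is an energy product with \<open>e\<close>.\<close>

lemma residual_bound:
  assumes s: "0 < s" "s < 1" and sh: "shape_regular \<gamma> \<T>" "0 < \<gamma>" and A: "\<A> \<subseteq> \<T>"
    and e: "finite_energy s e"
    and r: "\<And>K z. K \<in> \<A> \<Longrightarrow> z \<in> new \<Longrightarrow> z \<in> closed_elem K \<Longrightarrow> r z = frac_form s e (\<phi> z)"
  shows "(\<Sum>K\<in>\<A>. \<Sum>z\<in>{z\<in>new. z \<in> closed_elem K}. (r z / energy_norm s (\<phi> z))\<^sup>2)
    \<le> valence DIM('a) \<gamma> * (2 * real (DIM('a) + 1) * frac_form s e e)"
proof -
  have fA: "finite \<A>" using A finite_mesh finite_subset by blast
  let ?b = "\<lambda>z. (frac_form s e (\<phi> z) / energy_norm s (\<phi> z))\<^sup>2"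
  have "(\<Sum>K\<in>\<A>. \<Sum>z\<in>{z\<in>new. z \<in> closed_elem K}. (r z / energy_norm s (\<phi> z))\<^sup>2) =
     (\<Sum>K\<in>\<A>. \<Sum>z\<in>{z\<in>new. z \<in> closed_elem K}. ?b z)"
    using r by (intro sum.cong) auto
  also have "\<dots> = (\<Sum>z\<in>new. \<Sum>K\<in>{K\<in>\<A>. z \<in> closed_elem K}. ?b z)"
    by (rule sum.swap_restrict[OF fA finite_new])
  also have "\<dots> = (\<Sum>z\<in>new. real (card {K\<in>\<A>. z \<in> closed_elem K}) * ?b z)" by simp
  also have "\<dots> \<le> (\<Sum>z\<in>new. valence DIM('a) \<gamma> * ?b z)"
  proof (intro sum_mono mult_right_mono)
    fix z assume z: "z \<in> new"
    have "card {K\<in>\<A>. z \<in> closed_elem K} \<le> card {K\<in>\<T>. z \<in> closed_elem K}"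
      using A finite_mesh by (intro card_mono) auto
    then show "real (card {K\<in>\<A>. z \<in> closed_elem K}) \<le> valence DIM('a) \<gamma>"
      using new_node_valence[OF mesh compatible sh newD(3)[OF z]] unfolding valence_def by linarith
  qed simp
  also have "\<dots> = valence DIM('a) \<gamma> * (\<Sum>z\<in>new. ?b z)" by (simp only: sum_distrib_left)
  also have "\<dots> \<le> valence DIM('a) \<gamma> * (2 * real (DIM('a) + 1) * frac_form s e e)"
  proof (rule mult_left_mono)
    show "(\<Sum>z\<in>new. ?b z) \<le> 2 * real (DIM('a) + 1) * frac_form s e e"
      by (rule frac_form_bessel[OF s finite_new hat_finite_energy[OF _ s] hat_overlap _ e]) auto
    show "0 \<le> valence DIM('a) \<gamma>" unfolding valence_def using sh(2) by simp
  qed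
  finally show ?thesis .
qed

text \<open>The midpoint of \<open>K\<close> is no end of the refinement edge of a son, so the next
  bisection leaves its coordinate unchanged.\<close>

lemma mid_pt_final:
  fixes K :: "'a tagged"
  assumes K: "tagged_simplex K" and S: "S \<in> {son1 K, son2 K}" and W: "W \<in> {son1 S, son2 S}"
  shows "lam W (mid_pt K) x = lam S (mid_pt K) x"
proof -
  note mv = middle_vertex[OF K R.dim two_le_dim]
  have tS: "tagged_simplex S" using S tagged_simplex_sons[OF K] by auto
  have m: "mid_pt K \<notin> vertices K" by (rule mid_pt_notin[OF K])
  have "mid_pt K \<noteq> end1 S" "mid_pt K \<noteq> end2 S" using S mv m end_vertices[OF K] by auto
  moreover have "mid_pt K \<noteq> mid_pt S"
    using mid_pt_notin[OF tS] S vertices_sons[OF K] by auto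
  ultimately show ?thesis using W lam_son1(4)[OF tS] lam_son2(4)[OF tS] by auto
qed

lemma hat_zero_off:
  assumes "K \<in> \<T>" "z \<notin> closed_elem K" "x \<in> closed_elem K" shows "\<phi> z x = 0"
proof -
  obtain Y where Y: "Y \<in> leaves (ut K) K" "Y \<in> unif \<T>" "x \<in> closed_elem Y" using leaf_containing[OF assms(1,3)] .
  then show ?thesis
    using U.hatfun_eq[OF Y(2,3)] bary_notin[OF vertex_set_vertices[OF U.simplex[OF Y(2)]]]
      leaf_vertex_closed[OF assms(1) Y(1)] assms(2) by auto
qed

lemma ut_2: "DIM('a) = 2 \<Longrightarrow> ut (K::'a tagged) = Node (Node Leaf Leaf) (Node Leaf Leaf)"
  by (simp add: utree_def Let_def)

text \<open>Elements that meet at a new node share an edge. So the enlarged marked set of dimension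
  3 contains the whole star of every new node on a marked element.\<close>

lemma shared_edge_neighbourhood:
  assumes M: "\<M> \<subseteq> \<T>" "K \<in> \<M>" "K' \<in> \<T>" and z: "z \<in> new" "z \<in> closed_elem K" "z \<in> closed_elem K'"
  shows "K' \<in> edge_neighbourhood \<T> \<M>"
proof -
  have K: "K \<in> \<T>" using M by blast
  obtain p q where pq: "p \<noteq> q" "{p, q} \<subseteq> vertices K \<inter> vertices K'"
    by (rule shared_edge[OF mesh compatible K M(3) z(2,3) newD(3)[OF z(1)]])
  have "convex hull {p, q} edge_of closed_elem J" if "J \<in> \<T>" "{p, q} \<subseteq> vertices J" for J
  proof -
    have "convex hull {p, q} face_of closed_elem J"
      using that vertex_set_vertices[OF simplex[OF that(1)]] unfolding closed_elem_def vertex_set_def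
      by (subst face_of_convex_hull_affine_independent) (auto intro!: exI[of _ "{p, q}"])
    then show ?thesis unfolding edge_of_def using pq(1) by (simp add: aff_dim_convex_hull aff_dim_2)
  qed
  then show ?thesis unfolding edge_neighbourhood_def using M K pq(2) by blast
qed

text \<open>In dimension 3 the whole star of \<open>z\<close> is refined uniformly. In dimension 2 a
  neighbour may lack some cuts, but on a son that is not cut again the hat function is affine by
  \<open>mid_pt_final\<close>, or it vanishes.\<close>

lemma hat_in_refined_space:
  assumes M: "\<M> \<subseteq> \<T>" "K \<in> \<M>" and z: "z \<in> new" "z \<in> closed_elem K"
  shows "\<phi> z \<in> S10 \<Omega> (refine \<T> \<M>)"
proof -
  let ?T = "refine \<T> \<M>"
  have cr: "coarsest_refinement \<T> \<M> ?T" by (rule R.coarsest_refine[OF M(1)])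
  obtain t where t: "?T = forest t \<T>" "\<And>K. K \<in> \<T> \<Longrightarrow> tle (t K) (ut K)" "nvb_refinement ?T (unif \<T>)"
    by (rule R.coarsest_below_unif[OF cr M(1)]) (rule that; simp)
  have conf: "conforming ?T" and res: "marking_resolved \<T> \<M> ?T" using cr by (auto simp: coarsest_refinement_def)
  note mc = conforming_mesh_compatible[OF conf]
  have K: "K \<in> \<T>" using M by blast
  have aff: "\<exists>g c. \<forall>x\<in>open_elem Y. \<phi> z x = g \<bullet> x + c" if "Y \<in> unif \<T>" for Y
    using U.hatfun_S10[OF newD(1)[OF z(1)]] that unfolding S10_def by blast
  have zero: "\<exists>g c. \<forall>x\<in>open_elem Y. \<phi> z x = g \<bullet> x + c" if "\<And>x. x \<in> closed_elem Y \<Longrightarrow> \<phi> z x = 0" for Y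
    using that open_subset_closed_elem[of Y] by (intro exI[of _ 0]) auto
  have marked: "t K = ut K"
    by (rule R.resolved_tree[OF t conf res K]) (use M in \<open>auto simp: edge_neighbourhood_def\<close>)
  have affT: "\<exists>g c. \<forall>x\<in>open_elem X. \<phi> z x = g \<bullet> x + c" if X: "X \<in> ?T" for X
  proof -
    obtain K' where K': "K' \<in> \<T>" "X \<in> leaves (t K') K'" using X unfolding t(1) forest_def by blast
    note ts = simplex[OF K'(1)]
    show ?thesis
    proof (cases "z \<in> closed_elem K'")
      case False
      then show ?thesis using hat_zero_off[OF K'(1) False] leaves_subset[OF ts K'(2)] by (intro zero) blast
    next
      case True
      show ?thesis using R.dim
      proof
        assume d: "DIM('a) = 3"
        have "t K' = ut K'"
          by (rule R.resolved_tree[OF t conf res K'(1)])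
            (use d shared_edge_neighbourhood[OF M K'(1) z True] in auto)
        then show ?thesis using K' unif_leaf aff by auto
      next
        assume d: "DIM('a) = 2"
        show ?thesis
        proof (cases "X \<in> unif \<T>")
          case True then show ?thesis by (rule aff)
        next
          case nU: False
          obtain Y where Y: "Y \<in> leaves (ut K) K" "Y \<in> unif \<T>" "z \<in> closed_elem Y" using leaf_containing[OF K z(2)] .
          have zT: "z \<in> nodes ?T"
            using Y(1) K marked new_in_leaf[OF z(1) Y(2,3)] unfolding t(1) nodes_def forest_def by force
          have tl: "tle (t K') (Node (Node Leaf Leaf) (Node Leaf Leaf))" using t(2)[OF K'(1)] ut_2[OF d] by simp
          \<comment> \<open>\<open>z\<close> is a node of the refined mesh and would be hanging on a
            neighbour left unrefined.\<close>
          have "t K' \<noteq> Leaf"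
          proof
            assume "t K' = Leaf"
            then have "K' \<in> ?T" using K'(1) unfolding t(1) forest_def by force
            then have "z \<in> vertices K'" using node_in_closed_elem[OF _ _ _ zT True] mc by blast
            then show False using newD(3)[OF z(1)] K'(1) unfolding nodes_def by blast
          qed
          then obtain l r where lr: "t K' = Node l r" by (cases "t K'") auto
          \<comment> \<open>An element that is not yet in the uniform mesh has to be a son of
            \<open>K'\<close> itself.\<close>
          have leafcase: "X = S" if "X \<in> leaves q S" "tle q (Node Leaf Leaf)" "leaves (Node Leaf Leaf) S \<subseteq> unif \<T>" for q S
          proof (cases q)
            case (Node a b)
            then have "q = Node Leaf Leaf" using that(2) by (cases a; cases b) auto
            then show ?thesis using that nU by auto
          qed (use that in auto)
          have sub: "leaves (Node Leaf Leaf) (son1 K') \<subseteq> unif \<T>" "leaves (Node Leaf Leaf) (son2 K') \<subseteq> unif \<T>"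
            using unif_leaf[OF K'(1)] ut_2[OF d, of K'] by auto
          have "X \<in> leaves l (son1 K') \<or> X \<in> leaves r (son2 K')" using K'(2) lr by simp
          then have XS: "X \<in> {son1 K', son2 K'}"
          proof
            have "tle l (Node Leaf Leaf)" "tle r (Node Leaf Leaf)" using tl lr by auto
            note lf = leafcase[OF _ this(1) sub(1)] leafcase[OF _ this(2) sub(2)]
            show "X \<in> leaves l (son1 K') \<Longrightarrow> ?thesis" using lf(1) by simp
            show "X \<in> leaves r (son2 K') \<Longrightarrow> ?thesis" using lf(2) by simp
          qed
          have tX: "tagged_simplex X" using XS tagged_simplex_sons[OF ts] by auto
          have sX: "son1 X \<in> unif \<T>" "son2 X \<in> unif \<T>" using XS sub by auto
          show ?thesis
          proof (cases "z \<in> closed_elem X")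
            case zX: True
            then have "z \<in> vertices X" using node_in_closed_elem[OF _ _ X zT] mc by blast
            moreover have "z \<notin> vertices K'" using newD(3)[OF z(1)] K'(1) unfolding nodes_def by blast
            ultimately have zm: "z = mid_pt K'" using XS vertices_sons[OF ts] by auto
            have "\<phi> z x = lam X z x" if x: "x \<in> closed_elem X" for x
            proof -
              obtain W where W: "W \<in> {son1 X, son2 X}" "x \<in> closed_elem W" using x closed_elem_sons[OF tX] by blast
              then have "\<phi> z x = lam W z x" using U.hatfun_eq sX by blast
              then show ?thesis unfolding zm using mid_pt_final[OF ts XS W(1)] by simp
            qed
            moreover obtain g c where "\<And>x. lam X z x = g \<bullet> x + c"
              using affine_fun_bary[OF vertex_set_vertices[OF tX]] unfolding affine_fun_def by blast
            ultimately show ?thesis using open_subset_closed_elem[of X] by (intro exI[of _ g] exI[of _ c]) auto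
          next
            case zX: False
            show ?thesis
            proof (rule zero)
              fix x assume x: "x \<in> closed_elem X"
              obtain W where W: "W \<in> {son1 X, son2 X}" "x \<in> closed_elem W" using x closed_elem_sons[OF tX] by blast
              have WU: "W \<in> unif \<T>" using W sX by blast
              have "closed_elem W \<subseteq> closed_elem X" using W(1) closed_elem_sons[OF tX] by blast
              then have "z \<notin> vertices W" using zX vertex_closed by blast
              then show "\<phi> z x = 0"
                using U.hatfun_eq[OF WU W(2)] bary_notin[OF vertex_set_vertices[OF U.simplex[OF WU]]] by simp
            qed
          qed
        qed
      qed
    qed
  qed
  show ?thesis unfolding S10_def
    using U.hatfun_S10[OF newD(1)[OF z(1)]] affT by (auto simp: S10_def)
qed

text \<open>As \<open>K\<close> survives, \<open>z\<close> is no node of the finer mesh, so no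
  neighbour has been cut at \<open>z\<close>. If a refined neighbour has a son with midpoint
  \<open>z\<close>, this son is still an element, and uniform refinement cuts it at \<open>z\<close>
  in either mesh.\<close>

lemma hat_stable:
  assumes d: "DIM('a) = 2" and m: "estimator_mesh \<Omega> \<T>'" and t: "\<T>' = forest t \<T>"
    and K: "K \<in> \<T>" "K \<in> \<T>'" and z: "z \<in> new" "z \<in> closed_elem K"
  shows "hatfun (unif \<T>') z = \<phi> z"
proof
  interpret M: estimator_mesh \<Omega> \<T>' by (rule m)
  fix x
  have znT: "z \<notin> nodes \<T>" by (rule newD(3)[OF z(1)])
  have znT': "z \<notin> nodes \<T>'"
  proof
    assume "z \<in> nodes \<T>'"
    then have "z \<in> vertices K" using node_in_closed_elem[OF M.mesh M.compatible K(2) _ z(2)] by blast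
    then show False using znT K(1) unfolding nodes_def by blast
  qed
  show "hatfun (unif \<T>') z x = \<phi> z x"
  proof (cases "x \<in> closure \<Omega>")
    case False
    then show ?thesis using U.hatfun_outside M.U.hatfun_outside by simp
  next
    case True
    obtain X where X: "X \<in> \<T>'" "x \<in> closed_elem X" using M.in_cover[OF True] by blast
    obtain K' where K': "K' \<in> \<T>" "X \<in> leaves (t K') K'" using X(1) unfolding t forest_def by blast
    note ts = simplex[OF K'(1)]
    have xK: "x \<in> closed_elem K'" using X(2) leaves_subset[OF ts K'(2)] by blast
    have off: "hatfun (unif \<T>') z x = 0" if "z \<notin> closed_elem X" using M.hat_zero_off[OF X(1) that X(2)] .
    show ?thesis
    proof (cases "z \<in> closed_elem K'")
      case False
      then show ?thesis using off hat_zero_off[OF K'(1) False xK] leaves_subset[OF ts K'(2)] by auto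
    next
      case zK: True
      show ?thesis
      proof (cases "t K'")
        case Leaf
        then have "X = K'" using K'(2) by simp
        obtain Y where Y: "Y \<in> leaves (ut K') K'" "Y \<in> unif \<T>" "x \<in> closed_elem Y" using leaf_containing[OF K'(1) xK] .
        then have "Y \<in> unif \<T>'" using M.unif_leaf X(1) \<open>X = K'\<close> by blast
        then show ?thesis using U.hatfun_eq[OF Y(2,3)] M.U.hatfun_eq Y(3) by simp
      next
        case (Node l r)
        have zmid: "z \<noteq> mid_pt K'"
        proof -
          have "mid_pt K' \<in> vertices (son1 K')" by (simp add: vertices_sons[OF ts])
          then obtain Y where "Y \<in> leaves l (son1 K')" "mid_pt K' \<in> vertices Y"
            using leaves_vertices[OF tagged_simplex_sons(1)[OF ts]] by blast
          then have "mid_pt K' \<in> nodes \<T>'" unfolding t nodes_def forest_def using K'(1) Node by force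
          then show ?thesis using znT' by blast
        qed
        have sub: "leaves (Node Leaf Leaf) (son1 K') \<subseteq> unif \<T>" "leaves (Node Leaf Leaf) (son2 K') \<subseteq> unif \<T>"
          using unif_leaf[OF K'(1)] ut_2[OF d, of K'] by auto
        obtain S q where S: "S \<in> {son1 K', son2 K'}" "X \<in> leaves q S" "leaves q S \<subseteq> \<T>'"
        proof -
          have ls: "leaves (t K') K' = leaves l (son1 K') \<union> leaves r (son2 K')" using Node by simp
          have "leaves (t K') K' \<subseteq> \<T>'" using K'(1) unfolding t forest_def by blast
          then show thesis using that[of "son1 K'" l] that[of "son2 K'" r] K'(2) unfolding ls by blast
        qed
        have tS: "tagged_simplex S" using S(1) tagged_simplex_sons[OF ts] by auto
        have sS: "son1 S \<in> unif \<T>" "son2 S \<in> unif \<T>" using S(1) sub by auto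
        have xS: "x \<in> closed_elem S" using leaves_subset[OF tS S(2)] X(2) by blast
        have zv: "z \<notin> vertices S" using S(1) vertices_sons[OF ts] zmid znT K'(1) unfolding nodes_def by auto
        have vW: "z = mid_pt S" if "W \<in> {son1 S, son2 S}" "z \<in> vertices W" for W
          using that zv vertices_sons[OF tS] by auto
        obtain W where W: "W \<in> {son1 S, son2 S}" "x \<in> closed_elem W" using xS closed_elem_sons[OF tS] by blast
        have WU: "W \<in> unif \<T>" using W sS by blast
        have \<phi>W: "\<phi> z x = lam W z x" by (rule U.hatfun_eq[OF WU W(2)])
        show ?thesis
        proof (cases "z = mid_pt S")
          case False
          have "z \<notin> vertices W" using vW[OF W(1)] False by blast
          then have "\<phi> z x = 0" using \<phi>W bary_notin[OF vertex_set_vertices[OF U.simplex[OF WU]]] by simp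
          moreover have "z \<notin> closed_elem S"
          proof
            assume "z \<in> closed_elem S"
            then obtain W' where W': "W' \<in> {son1 S, son2 S}" "z \<in> closed_elem W'" using closed_elem_sons[OF tS] by blast
            then have "z \<in> vertices W'" using new_in_leaf[OF z(1)] sS by blast
            then show False using vW[OF W'(1)] False by blast
          qed
          ultimately show ?thesis using off leaves_subset[OF tS S(2)] by auto
        next
          case zm: True
          \<comment> \<open>A cut of \<open>S\<close> would make \<open>z\<close> a node of the
            finer mesh.\<close>
          have "q = Leaf"
          proof (cases q)
            case (Node a b)
            have "mid_pt S \<in> vertices (son1 S)" by (simp add: vertices_sons[OF tS])
            then obtain Y where "Y \<in> leaves a (son1 S)" "mid_pt S \<in> vertices Y"
              using leaves_vertices[OF tagged_simplex_sons(1)[OF tS]] by blast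
            then have "mid_pt S \<in> nodes \<T>'" using S(3) Node unfolding nodes_def by force
            then show ?thesis using znT' zm by blast
          qed
          then have ST: "S \<in> \<T>'" using S(3) by simp
          \<comment> \<open>The uniform refinement of the finer mesh goes one generation deeper
            here; by \<open>mid_pt_final\<close> this does not change the coordinate of
            \<open>z\<close>.\<close>
          have tW: "tagged_simplex W" using W(1) tagged_simplex_sons[OF tS] by auto
          obtain V where V: "V \<in> {son1 W, son2 W}" "x \<in> closed_elem V" using W(2) closed_elem_sons[OF tW] by blast
          have "V \<in> leaves (ut S) S" using V(1) W(1) unfolding ut_2[OF d] by auto
          then have "hatfun (unif \<T>') z x = lam V z x" using M.U.hatfun_eq M.unif_leaf[OF ST] V(2) by blast
          also have "\<dots> = lam W z x" unfolding zm by (rule mid_pt_final[OF tS W(1) V(1)])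
          finally show ?thesis using \<phi>W by simp
        qed
      qed
    qed
  qed
qed

section \<open>Energy of hat functions and the two-level splitting\<close>

lemma hat_energy_upper:
  assumes s: "0 < s" "s < 1" and sh: "shape_regular \<gamma> \<T>" "0 < \<gamma>"
    and z: "z \<in> new" and K: "K \<in> \<T>" "z \<in> closed_elem K"
  shows "frac_form s (\<phi> z) (\<phi> z) \<le> hat_energy_const TYPE('a) s \<gamma> * diam K powr (real DIM('a) - 2 * s)"
proof -
  let ?d = "DIM('a)" and ?D = "diam K"
  define G where "G = grad_const ?d \<gamma> 19"
  define G0 where "G0 = grad_const ?d \<gamma> 0"
  have G: "0 < G" "0 < G0" unfolding G_def G0_def using grad_const_pos[OF sh(2)] by auto
  have D: "0 < ?D" by (rule diam_pos[OF simplex[OF K(1)]])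
  let ?L = "G * G0 / ?D" and ?h = "?D / (G * G0)"
  have h: "0 < ?h" using D G by simp
  \<comment> \<open>Since \<open>z\<close> is not a node of \<T>, every element at \<open>z\<close>
    shares an edge with \<open>K\<close>; so all sizes in the star of \<open>z\<close> are
    comparable with that of \<open>K\<close>.\<close>
  have nb: "?D \<le> G0 * diam K'" "diam K' \<le> G0 * ?D" if "K' \<in> \<T>" "z \<in> closed_elem K'" for K'
    using neighbour_diam[OF mesh compatible sh K(1) that(1) K(2) that(2) newD(3)[OF z]]
      neighbour_diam[OF mesh compatible sh that(1) K(1) that(2) K(2) newD(3)[OF z]] unfolding G0_def by auto
  have lip: "\<bar>\<phi> z x - \<phi> z y\<bar> \<le> ?L * norm (x - y)" for x y
  proof (rule U.S10_lipschitz[OF U.hatfun_S10[OF newD(1)[OF z]]])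
    show "0 \<le> ?L" using G D by simp
    fix Y assume Y: "Y \<in> unif \<T>"
    then obtain K' where K': "K' \<in> \<T>" "Y \<in> leaves (ut K') K'" unfolding unif_def forest_def by blast
    note ts = simplex[OF K'(1)]
    show "?L-lipschitz_on (closed_elem Y) (\<phi> z)"
    proof (rule lipschitz_onI)
      fix x y assume xy: "x \<in> closed_elem Y" "y \<in> closed_elem Y"
      have e: "\<phi> z x - \<phi> z y = lam Y z x - lam Y z y" using U.hatfun_eq[OF Y] xy by simp
      show "dist (\<phi> z x) (\<phi> z y) \<le> ?L * dist x y"
      proof (cases "z \<in> closed_elem K'")
        case True
        have "\<bar>lam Y z x - lam Y z y\<bar> \<le> G / diam K' * norm (x - y)"
          unfolding G_def by (rule lam_lipschitz[OF ts shape_regular_elem[OF sh K'(1) ts] sh(2) K'(2) size_utree])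
        also have "\<dots> \<le> ?L * norm (x - y)"
        proof (rule mult_right_mono)
          have dK: "0 < diam K'" by (rule diam_pos[OF ts])
          show "G / diam K' \<le> ?L" using nb(1)[OF K'(1) True] G D dK by (simp add: field_simps)
        qed simp
        finally show ?thesis using e by (simp add: dist_norm)
      next
        case False
        have "x \<in> closed_elem K'" "y \<in> closed_elem K'" using xy leaves_subset[OF ts K'(2)] by auto
        then show ?thesis using hat_zero_off[OF K'(1) False] G D by simp
      qed
    qed (use G D in simp)
  qed
  have b1: "\<bar>\<phi> z x - \<phi> z y\<bar> \<le> 1" for x y
    using U.hatfun_bounds[of z x] U.hatfun_bounds[of z y] by linarith
  have b2: "\<bar>\<phi> z x - \<phi> z y\<bar> \<le> 1 * min (norm (x - y) / ?h) 1" for x y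
    using b1[of x y] lip[of x y] by (simp add: mult.commute)
  have supp: "\<phi> z x = 0" if "x \<notin> cball z (G0 * ?D)" for x
  proof (rule ccontr)
    assume ne: "\<phi> z x \<noteq> 0"
    then have "x \<in> closure \<Omega>" using U.hatfun_outside by blast
    then obtain K' where K': "K' \<in> \<T>" "x \<in> closed_elem K'" using in_cover by blast
    have zK: "z \<in> closed_elem K'" using ne hat_zero_off[OF K'(1) _ K'(2)] by blast
    have "norm (z - x) \<le> G0 * ?D" using norm_le_diam[OF simplex[OF K'(1)] zK K'(2)] nb(2)[OF K'(1) zK] by linarith
    then show False using that by (simp add: dist_norm)
  qed
  have R0: "0 \<le> G0 * ?D" using G D by simp
  note up = truncated_lipschitz_energy[OF s h R0 b2 supp]
  have fe: "finite_energy s (\<phi> z)" by (rule hat_finite_energy[OF z s])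
  have c: "0 \<le> frac_const ?d s / 2" using frac_const_pos[OF s, of ?d] by simp
  have "frac_form s (\<phi> z) (\<phi> z) \<le> frac_const ?d s / 2 *
     (2 * 1\<^sup>2 * (unit_ball_vol (real ?d) * (G0 * ?D) ^ ?d) * (?h powr (- 2 * s) * trunc_const TYPE('a) s))"
    unfolding frac_form_eq[OF fe fe] power2_eq_square[symmetric] using up(2) c by (intro mult_left_mono) auto
  also have "\<dots> = hat_energy_const TYPE('a) s \<gamma> * ?D powr (real ?d - 2 * s)"
  proof -
    have "?h powr (- 2 * s) = ?D powr (- 2 * s) * (G * G0) powr (2 * s)"
      using D G by (simp add: powr_divide powr_minus_divide)
    moreover have "?D powr (real ?d - 2 * s) = ?D ^ ?d * ?D powr (- 2 * s)"
      using D by (simp add: powr_realpow[symmetric] powr_add[symmetric])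
    ultimately show ?thesis unfolding hat_energy_const_def G_def[symmetric] G0_def[symmetric]
      by (simp add: power_mult_distrib)
  qed
  finally show ?thesis .
qed

text \<open>On an element at \<open>z\<close> the hat function falls from 1 to 0, and
  \<open>energy_lower\<close> turns this oscillation into energy. It permits the division by the
  norm in the reliability estimate.\<close>

lemma hat_energy_pos:
  assumes s: "0 < s" "s < 1" and z: "z \<in> new" shows "0 < frac_form s (\<phi> z) (\<phi> z)"
proof -
  have S: "\<phi> z \<in> S10 \<Omega> (unif \<T>)" by (rule U.hatfun_S10[OF newD(1)[OF z]])
  obtain Y where Y: "Y \<in> unif \<T>" "z \<in> vertices Y" using newD(2)[OF z] unfolding nodes_def by blast
  note ts = U.simplex[OF Y(1)]
  obtain v where v: "v \<in> vertices Y" "v \<noteq> z" using end_vertices[OF ts] by metis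
  have "\<bar>\<phi> z z - \<phi> z v\<bar> = 1"
    using U.hatfun_eq[OF Y(1) vertex_closed[OF Y(2)]] U.hatfun_eq[OF Y(1) vertex_closed[OF v(1)]]
      bary_vertex[OF vertex_set_vertices[OF ts]] Y(2) v by simp
  then have o: "0 < osc (\<phi> z) Y" using U.osc_le[OF S Y(1) vertex_closed[OF Y(2)] vertex_closed[OF v(1)]] by linarith
  let ?f = "\<lambda>K. (osc (\<phi> z) K / 2)\<^sup>2 * diam K powr (- (real DIM('a) + 2 * s)) * ((1/4) ^ DIM('a) * vol (open_elem K))\<^sup>2"
  have "0 < ?f Y"
    using o diam_pos[OF ts] vol_open_elem_pos[OF ts] by (intro mult_pos_pos) auto
  also have "?f Y \<le> (\<Sum>K\<in>unif \<T>. ?f K)" using Y(1) U.finite_mesh by (intro member_le_sum) auto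
  finally have "0 < frac_const DIM('a) s / 2 * (\<Sum>K\<in>unif \<T>. ?f K)"
    using frac_const_pos[OF s, of "DIM('a)"] by simp
  also have "\<dots> \<le> frac_form s (\<phi> z) (\<phi> z)" by (rule U.energy_lower[OF S s])
  finally show ?thesis .
qed

lemma card_new_elem:
  assumes K: "K \<in> \<T>" shows "card {z\<in>new. z \<in> closed_elem K} \<le> 20 * (DIM('a) + 1)"
proof -
  have "{z\<in>new. z \<in> closed_elem K} \<subseteq> (\<Union>Y\<in>leaves (ut K) K. vertices Y)"
  proof
    fix z assume "z \<in> {z\<in>new. z \<in> closed_elem K}"
    then have z: "z \<in> new" "z \<in> closed_elem K" by auto
    obtain Y where "Y \<in> leaves (ut K) K" "Y \<in> unif \<T>" "z \<in> closed_elem Y" using leaf_containing[OF K z(2)] .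
    then show "z \<in> (\<Union>Y\<in>leaves (ut K) K. vertices Y)" using new_in_leaf[OF z(1)] by blast
  qed
  then have "card {z\<in>new. z \<in> closed_elem K} \<le> card (\<Union>Y\<in>leaves (ut K) K. vertices Y)"
    by (intro card_mono) (auto simp: vertices_def)
  also have "\<dots> \<le> (\<Sum>Y\<in>leaves (ut K) K. card (vertices Y))" by (rule card_UN_le) simp
  also have "\<dots> = card (leaves (ut K) K) * (DIM('a) + 1)"
    using vertex_set_vertices[OF leaves_simplex[OF simplex[OF K]]] by (simp add: vertex_set_def)
  also have "\<dots> \<le> 20 * (DIM('a) + 1)"
    using card_leaves[of "ut K" K] size_utree[of "DIM('a)" "snd K"] by (intro mult_right_mono) auto
  finally show ?thesis .
qed

text \<open>Comparison with \<open>energy_lower\<close> for each descendant: its diameter is not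
  larger than that of the ancestor, which helps in the negative power, and its volume is at least a
  fixed multiple of the power \<open>d\<close> of the diameter of the ancestor.\<close>

lemma osc_sum_le:
  assumes s: "0 < s" "s < 1" and sh: "shape_regular \<gamma> \<T>" "0 < \<gamma>"
    and t: "\<And>K. K \<in> \<T> \<Longrightarrow> tle (t K) (ut K)" and c: "compatible (forest t \<T>)"
    and e: "e \<in> S10 \<Omega> (forest t \<T>)"
  shows "(\<Sum>K\<in>\<T>. diam K powr (real DIM('a) - 2 * s) * (\<Sum>X\<in>leaves (t K) K. osc e X)\<^sup>2)
    \<le> 20 / elem_const DIM('a) \<gamma> * (2 / frac_const DIM('a) s) * frac_form s e e"
proof -
  let ?d = "DIM('a)"
  interpret F: fe_mesh \<Omega> "forest t \<T>" by (rule fe_mesh_forest[OF c])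
  let ?f = "\<lambda>X. (osc e X / 2)\<^sup>2 * diam X powr (- (real ?d + 2 * s)) * ((1/4) ^ ?d * vol (open_elem X))\<^sup>2"
  have ec: "0 < elem_const DIM('a) \<gamma>" by (rule elem_const_pos[OF sh(2)])
  have fc: "0 < frac_const ?d s" by (rule frac_const_pos[OF s])
  have elem: "elem_const DIM('a) \<gamma> * (diam K powr (real ?d - 2 * s) * (osc e X)\<^sup>2) \<le> ?f X"
    if K: "K \<in> \<T>" and X: "X \<in> leaves (t K) K" for K X
  proof -
    note ts = simplex[OF K]
    have tX: "tagged_simplex X" by (rule leaves_simplex[OF ts X])
    have D: "0 < diam K" "0 < diam X" using diam_pos[OF ts] diam_pos[OF tX] by auto
    have "size (t K) \<le> 19" using tle_size[OF t[OF K]] size_utree[of ?d "snd K"] by linarith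
    then have "(1/2) ^ (?d * 19) * vol (open_elem K) \<le> vol (open_elem X)" by (rule vol_leaves[OF ts X])
    moreover have "diam K ^ ?d / \<gamma> ^ ?d \<le> vol (open_elem K)"
      using shape_regular_elem[OF sh K ts] sh(2) unfolding shape_elem_def by (simp add: field_simps)
    then have "(1/2) ^ (?d * 19) * (diam K ^ ?d / \<gamma> ^ ?d) \<le> (1/2) ^ (?d * 19) * vol (open_elem K)"
      by (intro mult_left_mono) auto
    ultimately have "(1/2) ^ (?d * 19) / \<gamma> ^ ?d * diam K ^ ?d \<le> vol (open_elem X)" by (simp add: mult.commute)
    then have "(1/4) ^ ?d * ((1/2) ^ (?d * 19) / \<gamma> ^ ?d * diam K ^ ?d) \<le> (1/4) ^ ?d * vol (open_elem X)"
      by (intro mult_left_mono) auto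
    then have v: "((1/4) ^ ?d * ((1/2) ^ (?d * 19) / \<gamma> ^ ?d * diam K ^ ?d))\<^sup>2 \<le> ((1/4) ^ ?d * vol (open_elem X))\<^sup>2"
      using D sh(2) by (intro power_mono) auto
    have "diam X \<le> diam K"
      unfolding diam_def using leaves_open[OF ts X] bounded_open_elem by (rule diameter_subset)
    then have p: "diam K powr (- (real ?d + 2 * s)) \<le> diam X powr (- (real ?d + 2 * s))"
      using D s by (intro powr_mono2') auto
    \<comment> \<open>The exponent d - 2s is -(d + 2s) + 2d: the size of the kernel on the element
      times the square of a volume.\<close>
    have pd: "diam K powr (real ?d - 2 * s) = diam K powr (- (real ?d + 2 * s)) * (diam K ^ ?d)\<^sup>2"
    proof -
      have "(diam K ^ ?d)\<^sup>2 = diam K powr (2 * real ?d)"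
        using D(1) by (simp add: powr_realpow[symmetric] power2_eq_square powr_add[symmetric])
      then show ?thesis by (simp add: powr_add[symmetric])
    qed
    have "elem_const DIM('a) \<gamma> * (diam K powr (real ?d - 2 * s) * (osc e X)\<^sup>2) =
      (osc e X / 2)\<^sup>2 * diam K powr (- (real ?d + 2 * s)) * ((1/4) ^ ?d * ((1/2) ^ (?d * 19) / \<gamma> ^ ?d * diam K ^ ?d))\<^sup>2"
      unfolding elem_const_def pd by (simp add: power_mult_distrib power_divide)
    also have "\<dots> \<le> ?f X" using p v by (intro mult_mono mult_left_mono) auto
    finally show ?thesis .
  qed
  have cs: "(\<Sum>X\<in>leaves (t K) K. osc e X)\<^sup>2 \<le> 20 * (\<Sum>X\<in>leaves (t K) K. (osc e X)\<^sup>2)" if K: "K \<in> \<T>" for K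
  proof -
    have "size (t K) \<le> 19" using tle_size[OF t[OF K]] size_utree[of ?d "snd K"] by linarith
    then have cd: "real (card (leaves (t K) K)) \<le> 20" using card_leaves[of "t K" K] by linarith
    have "(\<Sum>X\<in>leaves (t K) K. osc e X)\<^sup>2 \<le> (\<Sum>X\<in>leaves (t K) K. (osc e X)\<^sup>2) * real (card (leaves (t K) K))"
      by (rule sum_squared_le_sum_of_squares)
    also have "\<dots> \<le> (\<Sum>X\<in>leaves (t K) K. (osc e X)\<^sup>2) * 20" using cd by (intro mult_left_mono sum_nonneg) auto
    finally show ?thesis by simp
  qed
  have "(\<Sum>K\<in>\<T>. diam K powr (real ?d - 2 * s) * (\<Sum>X\<in>leaves (t K) K. osc e X)\<^sup>2)
     \<le> (\<Sum>K\<in>\<T>. 20 / elem_const DIM('a) \<gamma> * (\<Sum>X\<in>leaves (t K) K. ?f X))"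
  proof (rule sum_mono)
    fix K assume K: "K \<in> \<T>"
    have "diam K powr (real ?d - 2 * s) * (\<Sum>X\<in>leaves (t K) K. osc e X)\<^sup>2 \<le>
       diam K powr (real ?d - 2 * s) * (20 * (\<Sum>X\<in>leaves (t K) K. (osc e X)\<^sup>2))"
      using cs[OF K] by (intro mult_left_mono) auto
    also have "\<dots> = 20 / elem_const DIM('a) \<gamma> * (\<Sum>X\<in>leaves (t K) K. elem_const DIM('a) \<gamma> * (diam K powr (real ?d - 2 * s) * (osc e X)\<^sup>2))"
      using ec by (simp add: sum_distrib_left mult_ac)
    also have "\<dots> \<le> 20 / elem_const DIM('a) \<gamma> * (\<Sum>X\<in>leaves (t K) K. ?f X)"
      using elem[OF K] ec by (intro mult_left_mono sum_mono) auto
    finally show "diam K powr (real ?d - 2 * s) * (\<Sum>X\<in>leaves (t K) K. osc e X)\<^sup>2 \<le> 20 / elem_const DIM('a) \<gamma> * (\<Sum>X\<in>leaves (t K) K. ?f X)" .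
  qed
  also have "\<dots> = 20 / elem_const DIM('a) \<gamma> * (\<Sum>K\<in>\<T>. \<Sum>X\<in>leaves (t K) K. ?f X)" by (simp only: sum_distrib_left)
  also have "(\<Sum>K\<in>\<T>. \<Sum>X\<in>leaves (t K) K. ?f X) = (\<Sum>X\<in>forest t \<T>. ?f X)"
    unfolding forest_def
  proof (rule sum.UNION_disjoint[symmetric, OF finite_mesh])
    show "\<forall>K\<in>\<T>. finite (leaves (t K) K)" by simp
    show "\<forall>K\<in>\<T>. \<forall>L\<in>\<T>. K \<noteq> L \<longrightarrow> leaves (t K) K \<inter> leaves (t L) L = {}"
      using leaves_mesh_disjoint(2)[OF mesh] by blast
  qed
  also have "20 / elem_const DIM('a) \<gamma> * (\<Sum>X\<in>forest t \<T>. ?f X) \<le> 20 / elem_const DIM('a) \<gamma> * (2 / frac_const ?d s * frac_form s e e)"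
    using F.energy_lower[OF e s] ec fc by (intro mult_left_mono) (auto simp: field_simps)
  finally show ?thesis by (simp add: mult.assoc)
qed

text \<open>The difference to the nodal interpolant vanishes at all old nodes and so expands in the
  hat functions of new ones. Its value at \<open>z\<close> is \<open>e z\<close> minus a convex
  combination of vertex values of \<open>e\<close>, which the oscillation over the descendants
  bounds.\<close>

lemma two_level_splitting:
  assumes s: "0 < s" "s < 1" and sh: "shape_regular \<gamma> \<T>" "0 < \<gamma>"
    and t: "\<And>K. K \<in> \<T> \<Longrightarrow> tle (t K) (ut K)" and c: "compatible (forest t \<T>)"
    and le: "nvb_refinement (forest t \<T>) (unif \<T>)" and e: "e \<in> S10 \<Omega> (forest t \<T>)"
  obtains v w where "v \<in> S10 \<Omega> \<T>" "\<And>x. e x - v x = (\<Sum>z\<in>new. w z * \<phi> z x)"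
    "(\<Sum>z\<in>new. (w z)\<^sup>2 * frac_form s (\<phi> z) (\<phi> z)) \<le> split_const TYPE('a) s \<gamma> * frac_form s e e"
    "\<And>z. z \<in> new \<Longrightarrow> w z \<noteq> 0 \<Longrightarrow> \<exists>K\<in>\<T> - forest t \<T>. z \<in> closed_elem K"
proof -
  let ?d = "DIM('a)" and ?T = "forest t \<T>"
  interpret F: fe_mesh \<Omega> ?T by (rule fe_mesh_forest[OF c])
  define v where "v x = (\<Sum>z\<in>interior_nodes \<Omega> \<T>. e z * hatfun \<T> z x)" for x
  have v: "v \<in> S10 \<Omega> \<T>" unfolding v_def by (intro S10_sumI hatfun_S10)
  have vF: "v \<in> S10 \<Omega> ?T" by (rule S10_forest[OF v])
  define w where "w z = e z - v z" for z
  have wF: "w \<in> S10 \<Omega> ?T" unfolding w_def by (rule F.S10_diff[OF e vF])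
  obtain u where u: "unif \<T> = forest u ?T" using le nvb_refinement_iff_forest[OF F.mesh] by blast
  have wU: "w \<in> S10 \<Omega> (unif \<T>)" unfolding u by (rule F.S10_forest[OF wF])
  have node: "v y = e y" if y: "y \<in> nodes \<T>" for y
  proof (cases "y \<in> \<Omega>")
    case True
    then have yi: "y \<in> interior_nodes \<Omega> \<T>" using y by (simp add: interior_node)
    have "v y = (\<Sum>z\<in>interior_nodes \<Omega> \<T>. if z = y then e y else 0)"
      unfolding v_def using hatfun_node[OF y] by (intro sum.cong) auto
    then show ?thesis using yi finite_interior_nodes by simp
  next
    case False
    then show ?thesis using v e by (auto simp: S10_def)
  qed
  have "w x = (\<Sum>z\<in>new. w z * \<phi> z x)" for x
  proof -
    have "w x = (\<Sum>z\<in>interior_nodes \<Omega> (unif \<T>). w z * \<phi> z x)" by (rule U.S10_sum[OF wU])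
    also have "\<dots> = (\<Sum>z\<in>new. w z * \<phi> z x)"
      using U.finite_interior_nodes node unfolding new_def w_def by (intro sum.mono_neutral_right) auto
    finally show ?thesis .
  qed
  then have expand: "e x - v x = (\<Sum>z\<in>new. w z * \<phi> z x)" for x unfolding w_def .
  define Os where "Os K = (\<Sum>X\<in>leaves (t K) K. osc e X)" for K
  have leafF: "X \<in> ?T" if "K \<in> \<T>" "X \<in> leaves (t K) K" for K X using that unfolding forest_def by blast
  have Ob: "\<bar>e x - e y\<bar> \<le> Os K" if K: "K \<in> \<T>" "x \<in> closed_elem K" "y \<in> closed_elem K" for K x y
    unfolding Os_def
  proof (rule tree_oscillation[OF _ _ simplex[OF K(1)] K(2,3)])
    fix X x y assume X: "X \<in> leaves (t K) K"
    show "0 \<le> osc e X" by (rule F.osc_nonneg[OF e leafF[OF K(1) X]])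
    assume "x \<in> closed_elem X" "y \<in> closed_elem X"
    then show "\<bar>e x - e y\<bar> \<le> osc e X" by (rule F.osc_le[OF e leafF[OF K(1) X]])
  qed
  have wb: "\<bar>w z\<bar> \<le> Os K" if K: "K \<in> \<T>" "z \<in> closed_elem K" for K z
  proof -
    note vs = vertex_set_vertices[OF simplex[OF K(1)]]
    have "v z = (\<Sum>p\<in>vertices K. lam K p z * e p)"
    proof -
      have "p \<in> nodes \<T>" if "p \<in> vertices K" for p using that K(1) unfolding nodes_def by blast
      then show ?thesis unfolding S10_expand[OF v K] using node by (intro sum.cong) auto
    qed
    then have "w z = (\<Sum>p\<in>vertices K. lam K p z * (e z - e p))"
      unfolding w_def using bary_sum[OF vs, of z]
      by (simp add: right_diff_distrib sum_subtractf sum_distrib_right[symmetric])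
    then have "\<bar>w z\<bar> \<le> (\<Sum>p\<in>vertices K. \<bar>lam K p z * (e z - e p)\<bar>)" by (simp only: sum_abs)
    also have "\<dots> \<le> (\<Sum>p\<in>vertices K. lam K p z * Os K)"
    proof (rule sum_mono)
      fix p assume p: "p \<in> vertices K"
      have "0 \<le> lam K p z" using K(2) closed_elem_iff[OF simplex[OF K(1)]] by blast
      then show "\<bar>lam K p z * (e z - e p)\<bar> \<le> lam K p z * Os K"
        using Ob[OF K vertex_closed[OF p]] by (simp add: abs_mult mult_left_mono)
    qed
    also have "\<dots> = Os K" using bary_sum[OF vs, of z] by (simp add: sum_distrib_right[symmetric])
    finally show ?thesis .
  qed
  have "\<forall>z\<in>new. \<exists>K\<in>\<T>. z \<in> closed_elem K"
    using newD(4) closure_subset in_cover by blast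
  then obtain \<kappa> where \<kappa>: "\<And>z. z \<in> new \<Longrightarrow> \<kappa> z \<in> \<T> \<and> z \<in> closed_elem (\<kappa> z)" by metis
  let ?E = "hat_energy_const TYPE('a) s \<gamma>"
  have E: "0 \<le> ?E" by (rule hat_energy_const_nonneg[OF s sh(2)])
  have "(\<Sum>z\<in>new. (w z)\<^sup>2 * frac_form s (\<phi> z) (\<phi> z)) \<le>
     (\<Sum>z\<in>new. (Os (\<kappa> z))\<^sup>2 * (?E * diam (\<kappa> z) powr (real ?d - 2 * s)))"
  proof (rule sum_mono)
    fix z assume z: "z \<in> new"
    have "(w z)\<^sup>2 \<le> (Os (\<kappa> z))\<^sup>2" using wb \<kappa>[OF z] power_mono[of "\<bar>w z\<bar>" "Os (\<kappa> z)" 2] by simp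
    moreover have "frac_form s (\<phi> z) (\<phi> z) \<le> ?E * diam (\<kappa> z) powr (real ?d - 2 * s)"
      using hat_energy_upper[OF s sh z] \<kappa>[OF z] by blast
    ultimately show "(w z)\<^sup>2 * frac_form s (\<phi> z) (\<phi> z) \<le> (Os (\<kappa> z))\<^sup>2 * (?E * diam (\<kappa> z) powr (real ?d - 2 * s))"
      using hat_energy_pos[OF s z] by (intro mult_mono) auto
  qed
  also have "\<dots> \<le> (\<Sum>K\<in>\<T>. \<Sum>z\<in>{z\<in>new. z \<in> closed_elem K}. (Os K)\<^sup>2 * (?E * diam K powr (real ?d - 2 * s)))"
    by (rule sum_elements_le[where g = "\<lambda>K z. (Os K)\<^sup>2 * (?E * diam K powr (real ?d - 2 * s))"])
      (use E \<kappa> in auto)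
  also have "\<dots> = (\<Sum>K\<in>\<T>. real (card {z\<in>new. z \<in> closed_elem K}) * ((Os K)\<^sup>2 * (?E * diam K powr (real ?d - 2 * s))))"
    by simp
  also have "\<dots> \<le> (\<Sum>K\<in>\<T>. real (20 * (?d + 1)) * ((Os K)\<^sup>2 * (?E * diam K powr (real ?d - 2 * s))))"
    using card_new_elem E by (intro sum_mono mult_right_mono) (auto simp del: of_nat_mult of_nat_add)
  also have "\<dots> = real (20 * (?d + 1)) * ?E * (\<Sum>K\<in>\<T>. diam K powr (real ?d - 2 * s) * (Os K)\<^sup>2)"
    by (simp add: sum_distrib_left mult_ac)
  also have "\<dots> \<le> real (20 * (?d + 1)) * ?E * (20 / elem_const DIM('a) \<gamma> * (2 / frac_const ?d s) * frac_form s e e)"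
    using osc_sum_le[OF s sh t c e] E unfolding Os_def by (intro mult_left_mono) auto
  also have "\<dots> = split_const TYPE('a) s \<gamma> * frac_form s e e" unfolding split_const_def by simp
  finally have bound: "(\<Sum>z\<in>new. (w z)\<^sup>2 * frac_form s (\<phi> z) (\<phi> z)) \<le> split_const TYPE('a) s \<gamma> * frac_form s e e" .
  have refined: "\<exists>K\<in>\<T> - ?T. z \<in> closed_elem K" if z: "z \<in> new" "w z \<noteq> 0" for z
  proof -
    have K: "\<kappa> z \<in> \<T>" "z \<in> closed_elem (\<kappa> z)" using \<kappa>[OF z(1)] by auto
    \<comment> \<open>On an element that is not refined, \<open>e - v\<close> is affine and 0 at the
      vertices, hence 0 at \<open>z\<close>.\<close>
    have "\<kappa> z \<notin> ?T"
    proof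
      assume KF: "\<kappa> z \<in> ?T"
      have "w z = (\<Sum>p\<in>vertices (\<kappa> z). lam (\<kappa> z) p z * w p)" by (rule F.S10_expand[OF wF KF K(2)])
      also have "\<dots> = 0"
      proof (rule sum.neutral, rule ballI)
        fix p assume "p \<in> vertices (\<kappa> z)"
        then have "p \<in> nodes \<T>" using K(1) unfolding nodes_def by blast
        then show "lam (\<kappa> z) p z * w p = 0" unfolding w_def using node[of p] by simp
      qed
      finally show False using z(2) by simp
    qed
    then show ?thesis using K by blast
  qed
  show thesis by (rule that[OF v expand bound refined])
qed

section \<open>Efficiency, reliability and stability of the estimator\<close>

lemma galerkin_energy:
  assumes "galerkin_solution \<Omega> s f \<T> u" "0 < s" "s < 1" shows "finite_energy s u"
  using assms S10_finite_energy unfolding galerkin_solution_def by blast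

text \<open>For a new node of a marked element \<open>\<phi> z\<close> is a test function for
  \<open>u1\<close>, so the residual of \<open>u\<close> there is the energy product of
  \<open>u1 - u\<close> with \<open>\<phi> z\<close>.\<close>

lemma tau_efficiency:
  assumes s: "0 < s" "s < 1" and sh: "shape_regular \<gamma> \<T>" "0 < \<gamma>" and M: "\<M> \<subseteq> \<T>"
    and u: "galerkin_solution \<Omega> s f \<T> u" and u1: "galerkin_solution \<Omega> s f (refine \<T> \<M>) u1"
  shows "tau \<Omega> s f \<T> u \<M> \<le> sqrt (valence DIM('a) \<gamma> * (2 * real (DIM('a) + 1))) * energy_norm s (\<lambda>x. u1 x - u x)"
proof -
  have cr: "coarsest_refinement \<T> \<M> (refine \<T> \<M>)" by (rule R.coarsest_refine[OF M])
  interpret F: fe_mesh \<Omega> "refine \<T> \<M>"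
    using fe_mesh_nvb(1) cr unfolding coarsest_refinement_def by blast
  have fu: "finite_energy s u" by (rule galerkin_energy[OF u s])
  have fu1: "finite_energy s u1" using u1 F.S10_finite_energy s unfolding galerkin_solution_def by blast
  have fe: "finite_energy s (\<lambda>x. u1 x - u x)" by (rule finite_energy_diff[OF fu1 fu])
  let ?e = "\<lambda>x. u1 x - u x"
  have "(\<Sum>K\<in>\<M>. (tau_elem \<Omega> s f \<T> u K)\<^sup>2) =
    (\<Sum>K\<in>\<M>. \<Sum>z\<in>{z\<in>new. z \<in> closed_elem K}. ((L2_inner \<Omega> f (\<phi> z) - frac_form s u (\<phi> z)) / energy_norm s (\<phi> z))\<^sup>2)"
    using tau_elem_sq M by (intro sum.cong) auto
  also have "\<dots> \<le> valence DIM('a) \<gamma> * (2 * real (DIM('a) + 1) * frac_form s ?e ?e)"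
  proof (rule residual_bound[OF s sh M fe])
    fix K z assume K: "K \<in> \<M>" and z: "z \<in> new" "z \<in> closed_elem K"
    have "frac_form s u1 (\<phi> z) = L2_inner \<Omega> f (\<phi> z)"
      using u1 hat_in_refined_space[OF M K z] unfolding galerkin_solution_def by blast
    then show "L2_inner \<Omega> f (\<phi> z) - frac_form s u (\<phi> z) = frac_form s ?e (\<phi> z)"
      using frac_form_diff_left[OF hat_finite_energy[OF z(1) s] fu1 fu] by simp
  qed
  finally have "(\<Sum>K\<in>\<M>. (tau_elem \<Omega> s f \<T> u K)\<^sup>2) \<le> valence DIM('a) \<gamma> * (2 * real (DIM('a) + 1)) * frac_form s ?e ?e"
    by (simp add: mult.assoc)
  then have "tau \<Omega> s f \<T> u \<M> \<le> sqrt (valence DIM('a) \<gamma> * (2 * real (DIM('a) + 1)) * frac_form s ?e ?e)"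
    unfolding tau_def by simp
  then show ?thesis unfolding energy_norm_def real_sqrt_mult .
qed

text \<open>Galerkin orthogonality removes the interpolant, Cauchy-Schwarz separates the
  coefficients from the normalised residuals, and one factor of the energy norm of the error
  cancels.\<close>

lemma tau_reliability:
  assumes s: "0 < s" "s < 1" and sh: "shape_regular \<gamma> \<T>" "0 < \<gamma>" and M: "\<M> \<subseteq> \<T>" and f: "L2_on \<Omega> f"
    and u: "galerkin_solution \<Omega> s f \<T> u" and u1: "galerkin_solution \<Omega> s f (refine \<T> \<M>) u1"
  shows "energy_norm s (\<lambda>x. u1 x - u x) \<le> sqrt (split_const TYPE('a) s \<gamma>) * tau \<Omega> s f \<T> u (\<T> - refine \<T> \<M>)"
proof -
  let ?T = "refine \<T> \<M>" and ?e = "\<lambda>x. u1 x - u x"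
  have cr: "coarsest_refinement \<T> \<M> ?T" by (rule R.coarsest_refine[OF M])
  obtain t where t: "?T = forest t \<T>" "\<And>K. K \<in> \<T> \<Longrightarrow> tle (t K) (ut K)" "nvb_refinement ?T (unif \<T>)"
    by (rule R.coarsest_below_unif[OF cr M]) (rule that; simp)
  have conf: "conforming ?T" using cr by (simp add: coarsest_refinement_def)
  have comp: "compatible (forest t \<T>)" using conforming_mesh_compatible[OF conf] t(1) by simp
  interpret F: fe_mesh \<Omega> ?T unfolding t(1) by (rule fe_mesh_forest[OF comp])
  have fu: "finite_energy s u" by (rule galerkin_energy[OF u s])
  have u1S: "u1 \<in> S10 \<Omega> ?T" and uS: "u \<in> S10 \<Omega> \<T>" using u u1 by (auto simp: galerkin_solution_def)
  have sub: "S10 \<Omega> \<T> \<subseteq> S10 \<Omega> ?T" unfolding t(1) using S10_forest by blast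
  have eS: "?e \<in> S10 \<Omega> ?T" by (rule F.S10_diff[OF u1S]) (use uS sub in blast)
  have fu1: "finite_energy s u1" by (rule F.S10_finite_energy[OF u1S s])
  have fe: "finite_energy s ?e" by (rule finite_energy_diff[OF fu1 fu])
  obtain v w where v: "v \<in> S10 \<Omega> \<T>" and w: "\<And>x. ?e x - v x = (\<Sum>z\<in>new. w z * \<phi> z x)"
    and wb: "(\<Sum>z\<in>new. (w z)\<^sup>2 * frac_form s (\<phi> z) (\<phi> z)) \<le> split_const TYPE('a) s \<gamma> * frac_form s ?e ?e"
    and wr: "\<And>z. z \<in> new \<Longrightarrow> w z \<noteq> 0 \<Longrightarrow> \<exists>K\<in>\<T> - forest t \<T>. z \<in> closed_elem K"
    by (rule two_level_splitting[OF s sh t(2) comp t(3)[unfolded t(1)] eS[unfolded t(1)]]) auto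
  have fv: "finite_energy s v" by (rule S10_finite_energy[OF v s])
  let ?r = "\<lambda>z. L2_inner \<Omega> f (\<phi> z) - frac_form s u (\<phi> z)"
  have ev: "(\<lambda>x. ?e x - v x) = (\<lambda>x. \<Sum>z\<in>new. w z * \<phi> z x)" using w by (rule ext)
  have evS: "(\<lambda>x. ?e x - v x) \<in> S10 \<Omega> ?T" by (rule F.S10_diff[OF eS]) (use v sub in blast)
  have fev: "finite_energy s (\<lambda>x. ?e x - v x)" by (rule F.S10_finite_energy[OF evS s])
  have g1: "frac_form s u1 y = L2_inner \<Omega> f y" if "y \<in> S10 \<Omega> ?T" for y using u1 that unfolding galerkin_solution_def by blast
  have g0: "frac_form s u y = L2_inner \<Omega> f y" if "y \<in> S10 \<Omega> \<T>" for y using u that unfolding galerkin_solution_def by blast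
  have "frac_form s ?e v = 0"
    using frac_form_diff_left[OF fv fu1 fu] g1[of v] g0[of v] v sub by auto
  then have "frac_form s ?e ?e = frac_form s ?e (\<lambda>x. ?e x - v x)"
    using frac_form_diff_right[OF fe fe fv] by simp
  \<comment> \<open>A single \<open>\<phi> z\<close> need not belong to the refined space, but the
    combination \<open>e - v\<close> does. So the equation for \<open>u1\<close> is used before the
    sum is expanded.\<close>
  also have "\<dots> = L2_inner \<Omega> f (\<lambda>x. ?e x - v x) - frac_form s u (\<lambda>x. ?e x - v x)"
    using frac_form_diff_left[OF fev fu1 fu] g1[OF evS] by simp
  also have "\<dots> = (\<Sum>z\<in>new. w z * ?r z)"
  proof -
    have "L2_inner \<Omega> f (\<lambda>x. \<Sum>z\<in>new. w z * \<phi> z x) = (\<Sum>z\<in>new. w z * L2_inner \<Omega> f (\<phi> z))"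
      by (rule L2_inner_diff_sum[OF f bounded_dom open_dom, where M = "\<lambda>_. 1"])
        (use U.S10_continuous U.hatfun_S10 newD(1) U.hatfun_bounds in \<open>auto simp: abs_le_iff intro: order_trans[of _ 0]\<close>)
    moreover have "frac_form s u (\<lambda>x. \<Sum>z\<in>new. w z * \<phi> z x) = (\<Sum>z\<in>new. w z * frac_form s u (\<phi> z))"
      by (rule frac_form_sum_right[OF fu hat_finite_energy[OF _ s]])
    ultimately show ?thesis unfolding ev by (simp add: right_diff_distrib sum_subtractf)
  qed
  also have "\<dots> = (\<Sum>z\<in>{z\<in>new. w z \<noteq> 0}. w z * ?r z)"
    using finite_new by (intro sum.mono_neutral_right) auto
  also have "\<dots> \<le> (\<Sum>z\<in>{z\<in>new. w z \<noteq> 0}. \<bar>w z * energy_norm s (\<phi> z)\<bar> * \<bar>?r z / energy_norm s (\<phi> z)\<bar>)"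
  proof (rule sum_mono)
    fix z assume "z \<in> {z\<in>new. w z \<noteq> 0}"
    then have "0 < energy_norm s (\<phi> z)" unfolding energy_norm_def using hat_energy_pos[OF s] by simp
    then have "w z * ?r z = (w z * energy_norm s (\<phi> z)) * (?r z / energy_norm s (\<phi> z))" by simp
    also have "\<dots> \<le> \<bar>w z * energy_norm s (\<phi> z)\<bar> * \<bar>?r z / energy_norm s (\<phi> z)\<bar>"
      unfolding abs_mult[symmetric] by (rule abs_ge_self)
    finally show "w z * ?r z \<le> \<bar>w z * energy_norm s (\<phi> z)\<bar> * \<bar>?r z / energy_norm s (\<phi> z)\<bar>" .
  qed
  also have "\<dots> \<le> L2_set (\<lambda>z. w z * energy_norm s (\<phi> z)) {z\<in>new. w z \<noteq> 0} *
     L2_set (\<lambda>z. ?r z / energy_norm s (\<phi> z)) {z\<in>new. w z \<noteq> 0}"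
    by (rule L2_set_mult_ineq)
  also have "\<dots> \<le> (sqrt (split_const TYPE('a) s \<gamma>) * energy_norm s ?e) * tau \<Omega> s f \<T> u (\<T> - ?T)"
  proof (rule mult_mono)
    have "(\<Sum>z\<in>{z\<in>new. w z \<noteq> 0}. (w z * energy_norm s (\<phi> z))\<^sup>2) \<le> (\<Sum>z\<in>new. (w z * energy_norm s (\<phi> z))\<^sup>2)"
      using finite_new by (intro sum_mono2) auto
    also have "\<dots> = (\<Sum>z\<in>new. (w z)\<^sup>2 * frac_form s (\<phi> z) (\<phi> z))"
      by (intro sum.cong refl) (simp add: power_mult_distrib energy_norm_sq[OF hat_finite_energy[OF _ s] s])
    also have "\<dots> \<le> split_const TYPE('a) s \<gamma> * frac_form s ?e ?e" by (rule wb)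
    finally have "L2_set (\<lambda>z. w z * energy_norm s (\<phi> z)) {z\<in>new. w z \<noteq> 0} \<le> sqrt (split_const TYPE('a) s \<gamma> * frac_form s ?e ?e)"
      unfolding L2_set_def by (rule real_sqrt_le_mono)
    then show "L2_set (\<lambda>z. w z * energy_norm s (\<phi> z)) {z\<in>new. w z \<noteq> 0} \<le> sqrt (split_const TYPE('a) s \<gamma>) * energy_norm s ?e"
      unfolding energy_norm_def[of s ?e] real_sqrt_mult .
    have "\<forall>z\<in>{z\<in>new. w z \<noteq> 0}. \<exists>K. K \<in> \<T> - ?T \<and> z \<in> closed_elem K" using wr unfolding t(1) by blast
    then obtain \<kappa> where \<kappa>: "\<And>z. z \<in> {z\<in>new. w z \<noteq> 0} \<Longrightarrow> \<kappa> z \<in> \<T> - ?T \<and> z \<in> closed_elem (\<kappa> z)" by metis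
    have "(\<Sum>z\<in>{z\<in>new. w z \<noteq> 0}. (?r z / energy_norm s (\<phi> z))\<^sup>2) \<le>
      (\<Sum>K\<in>\<T> - ?T. \<Sum>z\<in>{z\<in>new. z \<in> closed_elem K}. (?r z / energy_norm s (\<phi> z))\<^sup>2)"
      by (rule sum_elements_le[where g = "\<lambda>K z. (?r z / energy_norm s (\<phi> z))\<^sup>2" and \<kappa> = \<kappa>]) (use \<kappa> in auto)
    also have "\<dots> = (\<Sum>K\<in>\<T> - ?T. (tau_elem \<Omega> s f \<T> u K)\<^sup>2)" using tau_elem_sq by (intro sum.cong) auto
    finally show "L2_set (\<lambda>z. ?r z / energy_norm s (\<phi> z)) {z\<in>new. w z \<noteq> 0} \<le> tau \<Omega> s f \<T> u (\<T> - ?T)"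
      unfolding L2_set_def tau_def by (rule real_sqrt_le_mono)
    show "0 \<le> sqrt (split_const TYPE('a) s \<gamma>) * energy_norm s ?e"
      unfolding energy_norm_def using split_const_nonneg[OF s sh(2), of "TYPE('a)"] frac_form_nonneg[OF fe s] by simp
  qed (simp add: L2_set_nonneg)
  finally have "(energy_norm s ?e)\<^sup>2 \<le> energy_norm s ?e * (sqrt (split_const TYPE('a) s \<gamma>) * tau \<Omega> s f \<T> u (\<T> - ?T))"
    unfolding energy_norm_sq[OF fe s] by (simp add: mult_ac)
  moreover have "0 \<le> energy_norm s ?e" unfolding energy_norm_def using frac_form_nonneg[OF fe s] by simp
  moreover have "0 \<le> sqrt (split_const TYPE('a) s \<gamma>) * tau \<Omega> s f \<T> u (\<T> - ?T)"
    unfolding tau_def using split_const_nonneg[OF s sh(2), of "TYPE('a)"] by (intro mult_nonneg_nonneg) (auto intro: sum_nonneg)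
  ultimately show ?thesis
    by (cases "energy_norm s ?e = 0") (auto simp: power2_eq_square)
qed

text \<open>On common elements both estimators run over the same nodes with the same hat functions.
  They are Euclidean norms of two residual vectors, and the reverse triangle inequality leaves the
  products with \<open>u' - u\<close>.\<close>

lemma tau_stability:
  assumes s: "0 < s" "s < 1" and sh: "shape_regular \<gamma> \<T>" "0 < \<gamma>" and d: "DIM('a) = 2"
    and m: "estimator_mesh \<Omega> \<T>'" and nvb: "nvb_refinement \<T> \<T>'"
    and u: "galerkin_solution \<Omega> s f \<T> u" and u': "galerkin_solution \<Omega> s f \<T>' u'"
  shows "\<bar>tau \<Omega> s f \<T> u (\<T>' \<inter> \<T>) - tau \<Omega> s f \<T>' u' (\<T>' \<inter> \<T>)\<bar>
    \<le> sqrt (valence DIM('a) \<gamma> * (2 * real (DIM('a) + 1))) * energy_norm s (\<lambda>x. u' x - u x)"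
proof -
  interpret M: estimator_mesh \<Omega> \<T>' by (rule m)
  obtain t where t: "\<T>' = forest t \<T>" using nvb nvb_refinement_iff_forest[OF mesh] by blast
  let ?A = "\<T>' \<inter> \<T>" and ?e = "\<lambda>x. u' x - u x"
  have fu: "finite_energy s u" by (rule galerkin_energy[OF u s])
  have fu': "finite_energy s u'" by (rule M.galerkin_energy[OF u' s])
  have fe: "finite_energy s ?e" by (rule finite_energy_diff[OF fu' fu])
  have fA: "finite ?A" using finite_mesh by simp
  have nodes_sub: "nodes \<T> \<subseteq> nodes \<T>'" unfolding t by (rule nodes_forest[OF mesh])
  \<comment> \<open>A node of the finer mesh that lies in an unrefined \<open>K\<close> is a vertex
    of \<open>K\<close>, so being new means the same for both meshes.\<close>
  have same: "{z\<in>M.new. z \<in> closed_elem K} = {z\<in>new. z \<in> closed_elem K}" if K: "K \<in> ?A" for K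
  proof -
    have KT: "K \<in> \<T>" "K \<in> \<T>'" using K by auto
    have s1: "sons_in (unif \<T>) K = leaves (ut K) K" unfolding unif_def by (rule sons_in_forest[OF mesh KT(1)])
    have s2: "sons_in (unif \<T>') K = leaves (ut K) K" unfolding unif_def by (rule sons_in_forest[OF M.mesh KT(2)])
    have "z \<in> vertices K" if "z \<in> nodes \<T>'" "z \<in> closed_elem K" for z
      using node_in_closed_elem[OF M.mesh M.compatible KT(2)] that by blast
    then have "z \<in> nodes \<T>" if "z \<in> nodes \<T>'" "z \<in> closed_elem K" for z
      using that KT(1) unfolding nodes_def by blast
    moreover have "z \<in> closed_elem K" if "z \<in> interior_nodes \<Omega> (leaves (ut K) K)" for z
      using that leaf_vertex_closed[OF KT(1)] unfolding interior_nodes_def nodes_def by blast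
    ultimately show ?thesis
      using elem_nodes[OF KT(1)] M.elem_nodes[OF KT(2)] nodes_sub unfolding s1 s2 by blast
  qed
  \<comment> \<open>Pairs, because a node counts once for every element that contains it.\<close>
  define I where "I = Sigma ?A (\<lambda>K. {z\<in>new. z \<in> closed_elem K})"
  let ?a = "\<lambda>p. (L2_inner \<Omega> f (\<phi> (snd p)) - frac_form s u (\<phi> (snd p))) / energy_norm s (\<phi> (snd p))"
  let ?b = "\<lambda>p. (L2_inner \<Omega> f (\<phi> (snd p)) - frac_form s u' (\<phi> (snd p))) / energy_norm s (\<phi> (snd p))"
  have sums: "(\<Sum>p\<in>I. g (snd p)) = (\<Sum>K\<in>?A. \<Sum>z\<in>{z\<in>new. z \<in> closed_elem K}. g z)" for g :: "'a \<Rightarrow> real"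
    unfolding I_def using finite_new by (subst sum.Sigma[OF fA]) (auto simp: case_prod_beta)
  have ta: "tau \<Omega> s f \<T> u ?A = L2_set ?a I"
    unfolding tau_def L2_set_def using tau_elem_sq by (subst sums) simp
  have tb: "tau \<Omega> s f \<T>' u' ?A = L2_set ?b I"
  proof -
    have "(tau_elem \<Omega> s f \<T>' u' K)\<^sup>2 = (\<Sum>z\<in>{z\<in>new. z \<in> closed_elem K}.
       ((L2_inner \<Omega> f (\<phi> z) - frac_form s u' (\<phi> z)) / energy_norm s (\<phi> z))\<^sup>2)" if K: "K \<in> ?A" for K
    proof -
      have "K \<in> \<T>'" "K \<in> \<T>" using K by auto
      then show ?thesis unfolding M.tau_elem_sq[OF \<open>K \<in> \<T>'\<close>] same[OF K]
        using hat_stable[OF d m t \<open>K \<in> \<T>\<close> \<open>K \<in> \<T>'\<close>] by (intro sum.cong) auto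
    qed
    then show ?thesis unfolding tau_def L2_set_def by (subst sums) simp
  qed
  have tri: "L2_set g I \<le> L2_set h I + L2_set (\<lambda>p. g p - h p) I" for g h :: "'a tagged \<times> 'a \<Rightarrow> real"
    using L2_set_triangle_ineq[of h "\<lambda>p. g p - h p" I] by simp
  have sym: "L2_set (\<lambda>p. ?b p - ?a p) I = L2_set (\<lambda>p. ?a p - ?b p) I"
    unfolding L2_set_def by (simp add: power2_commute)
  have "\<bar>tau \<Omega> s f \<T> u ?A - tau \<Omega> s f \<T>' u' ?A\<bar> \<le> L2_set (\<lambda>p. ?a p - ?b p) I"
    unfolding ta tb using tri[of ?a ?b] tri[of ?b ?a] unfolding sym by linarith
  also have "\<dots> = sqrt (\<Sum>K\<in>?A. \<Sum>z\<in>{z\<in>new. z \<in> closed_elem K}. (frac_form s ?e (\<phi> z) / energy_norm s (\<phi> z))\<^sup>2)"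
  proof -
    have "?a p - ?b p = frac_form s ?e (\<phi> (snd p)) / energy_norm s (\<phi> (snd p))" if "p \<in> I" for p
    proof -
      have "snd p \<in> new" using that unfolding I_def by auto
      then show ?thesis using frac_form_diff_left[OF hat_finite_energy[OF _ s] fu' fu]
        by (simp add: diff_divide_distrib)
    qed
    then have "(\<Sum>p\<in>I. (?a p - ?b p)\<^sup>2) = (\<Sum>p\<in>I. (frac_form s ?e (\<phi> (snd p)) / energy_norm s (\<phi> (snd p)))\<^sup>2)"
      by (intro sum.cong) auto
    then show ?thesis unfolding L2_set_def
      by (simp only: sums[of "\<lambda>z. (frac_form s ?e (\<phi> z) / energy_norm s (\<phi> z))\<^sup>2"])
  qed
  also have "\<dots> \<le> sqrt (valence DIM('a) \<gamma> * (2 * real (DIM('a) + 1) * frac_form s ?e ?e))"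
    by (rule real_sqrt_le_mono, rule residual_bound[OF s sh _ fe]) auto
  also have "\<dots> = sqrt (valence DIM('a) \<gamma> * (2 * real (DIM('a) + 1))) * energy_norm s ?e"
    unfolding energy_norm_def by (simp add: real_sqrt_mult)
  finally show ?thesis .
qed

end

theorem theorem2p7:
  fixes \<Omega> :: "(real ^ 'd::finite) set" and s \<gamma> :: real
  assumes "CARD('d) = 2 \<or> CARD('d) = 3"
    and "polyhedral_lipschitz_domain \<Omega>"
    and "0 < s" "s < 1"
    and "0 < \<gamma>"
  shows "\<exists>C_eff C_rel C_stab :: real. 0 < C_eff \<and> 0 < C_rel \<and> (CARD('d) = 2 \<longrightarrow> 0 < C_stab) \<and>
    (\<forall>(f :: real ^ 'd \<Rightarrow> real) \<T>\<^sub>0 \<T>\<^sub>l \<M> \<T>\<^sub>l\<^sub>1 \<T>\<^sub>m u\<^sub>l u\<^sub>l\<^sub>1 u\<^sub>m.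
       L2_on \<Omega> f \<and>
       tagged_triangulation \<Omega> \<T>\<^sub>0 \<and> admissibly_tagged \<T>\<^sub>0 \<and>
       \<T>\<^sub>l \<in> refinements \<T>\<^sub>0 \<and> shape_regular \<gamma> \<T>\<^sub>l \<and>
       \<M> \<subseteq> \<T>\<^sub>l \<and> \<T>\<^sub>l\<^sub>1 = refine \<T>\<^sub>l \<M> \<and>
       \<T>\<^sub>m \<in> refinements \<T>\<^sub>l \<and>
       galerkin_solution \<Omega> s f \<T>\<^sub>l u\<^sub>l \<and>
       galerkin_solution \<Omega> s f \<T>\<^sub>l\<^sub>1 u\<^sub>l\<^sub>1 \<and>
       galerkin_solution \<Omega> s f \<T>\<^sub>m u\<^sub>m
       \<longrightarrow>
         tau \<Omega> s f \<T>\<^sub>l u\<^sub>l \<M> \<le> C_eff * energy_norm s (\<lambda>x. u\<^sub>l\<^sub>1 x - u\<^sub>l x) \<and>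
         energy_norm s (\<lambda>x. u\<^sub>l\<^sub>1 x - u\<^sub>l x) \<le> C_rel * tau \<Omega> s f \<T>\<^sub>l u\<^sub>l (\<T>\<^sub>l - \<T>\<^sub>l\<^sub>1) \<and>
         (CARD('d) = 2 \<longrightarrow>
            \<bar>tau \<Omega> s f \<T>\<^sub>l u\<^sub>l (\<T>\<^sub>m \<inter> \<T>\<^sub>l) - tau \<Omega> s f \<T>\<^sub>m u\<^sub>m (\<T>\<^sub>m \<inter> \<T>\<^sub>l)\<bar>
              \<le> C_stab * energy_norm s (\<lambda>x. u\<^sub>m x - u\<^sub>l x)))"
proof -
  let ?d = "DIM(real ^ 'd)"
  define C where "C = sqrt (valence ?d \<gamma> * (2 * real (?d + 1)))"
  \<comment> \<open>Adding 1 gives positivity; \<open>split_const\<close> is only known to be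
    nonnegative.\<close>
  define C' where "C' = sqrt (split_const TYPE(real ^ 'd) s \<gamma>) + 1"
  have dim: "?d = 2 \<or> ?d = 3" using assms(1) by simp
  have C: "0 < C" unfolding C_def using valence_pos[OF assms(5), of ?d] by simp
  have C': "0 < C'" "sqrt (split_const TYPE(real ^ 'd) s \<gamma>) \<le> C'"
    unfolding C'_def using split_const_nonneg[OF assms(3,4,5), of "TYPE(real ^ 'd)"] by (auto intro: add_nonneg_pos)
  have main: "tau \<Omega> s f T u M \<le> C * energy_norm s (\<lambda>x. u1 x - u x) \<and>
      energy_norm s (\<lambda>x. u1 x - u x) \<le> C' * tau \<Omega> s f T u (T - refine T M) \<and>
      (CARD('d) = 2 \<longrightarrow> \<bar>tau \<Omega> s f T u (Tm \<inter> T) - tau \<Omega> s f Tm um (Tm \<inter> T)\<bar> \<le> C * energy_norm s (\<lambda>x. um x - u x))"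
    if f: "L2_on \<Omega> f" and T0: "tagged_triangulation \<Omega> T0" "admissibly_tagged T0"
      and T: "T \<in> refinements T0" and sh: "shape_regular \<gamma> T" and M: "M \<subseteq> T" and Tm: "Tm \<in> refinements T"
      and u: "galerkin_solution \<Omega> s f T u" and u1: "galerkin_solution \<Omega> s f (refine T M) u1"
      and um: "galerkin_solution \<Omega> s f Tm um" for f T0 T M u u1 Tm um
  proof -
    have adm: "\<exists>\<T>'. coarsest_refinement \<A> \<N> \<T>'" if "\<A> \<in> refinements T0" "\<N> \<subseteq> \<A>" for \<A> \<N>
      using that T0(2) unfolding admissibly_tagged_def by blast
    have conf0: "conforming T0" using T0(1) by (simp add: tagged_triangulation_def)
    interpret F0: fe_mesh \<Omega> T0 by (rule fe_mesh_triangulation[OF assms(2) T0(1)])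
    have est: "estimator_mesh \<Omega> \<A>" if "\<A> \<in> refinements T0" for \<A>
    proof -
      have *: "nvb_refinement T0 \<A>" "refinable_mesh \<A>" using refinements_nvb[OF dim conf0 adm that] by blast+
      then show ?thesis
        using F0.fe_mesh_nvb(1)[OF *(1) refinable_mesh.conforming[OF *(2)]] by (simp add: estimator_mesh_def)
    qed
    interpret E: estimator_mesh \<Omega> T by (rule est[OF T])
    have nvb: "nvb_refinement T Tm"
      using refinements_nvb[OF dim E.R.conforming adm[OF refinements_trans[OF T]] Tm] by blast
    have "0 \<le> tau \<Omega> s f T u (T - refine T M)" by (simp add: tau_def sum_nonneg)
    then have "sqrt (split_const TYPE(real ^ 'd) s \<gamma>) * tau \<Omega> s f T u (T - refine T M) \<le> C' * tau \<Omega> s f T u (T - refine T M)"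
      by (intro mult_right_mono C')
    then have "energy_norm s (\<lambda>x. u1 x - u x) \<le> C' * tau \<Omega> s f T u (T - refine T M)"
      using E.tau_reliability[OF assms(3,4) sh assms(5) M f u u1] by linarith
    moreover have "tau \<Omega> s f T u M \<le> C * energy_norm s (\<lambda>x. u1 x - u x)"
      unfolding C_def by (rule E.tau_efficiency[OF assms(3,4) sh assms(5) M u u1])
    moreover have "\<bar>tau \<Omega> s f T u (Tm \<inter> T) - tau \<Omega> s f Tm um (Tm \<inter> T)\<bar> \<le> C * energy_norm s (\<lambda>x. um x - u x)"
      if "CARD('d) = 2"
      unfolding C_def using that
      by (intro E.tau_stability[OF assms(3,4) sh assms(5) _ est[OF refinements_trans[OF T Tm]] nvb u um]) simp
    ultimately show ?thesis by blast
  qed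
  \<comment> \<open>\<open>C\<close> serves both for the efficiency and for the stability.\<close>
  show ?thesis
    by (rule exI[of _ C], rule exI[of _ C'], rule exI[of _ C]) (use C C'(1) main in blast)
qed

end
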